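(* There is a natural map $\mathcal{AP}\to\overline{\mathcal{AB}}$. More precisely, for every element $[\eta]\in\mathcal{AP}$ there is a sequence $(\alpha_n)$ in $\mathcal{AB}$ of (smooth, positively curved) billiard tables, obtained by the smoothing construction for $[\eta]$ described in the context, which is $d_{AB}$-Cauchy and tends to $[\eta]$ in the $C^0$-norm. In addition, all such sequences are $d_{AB}$-equivalent: if $(\alpha_n)$ and $(\beta_n)$ are two such sequences for the same $[\eta]$, then $d_{AB}(\alpha_n,\beta_n)\to0$. (Thus sending $[\eta]$ to the class of such a sequence in $\overline{\mathcal{AB}}$ is a well-defined map.)
   Context: Billiard tables. $S^1=\mathbb{R}/\mathbb{Z}$. $\mathcal{B}$ is the set of marked billiard tables: pairs $(K,S)$ with $K\subset\mathbb{R}^2$ a smooth convex body whose boundary has length $1$ and positive curvature, and $S\in\partial K$. Such a pair is identified with the counterclockwise arc-length parametrization $\gamma\colon S^1\to\mathbb{R}^2$ of $\partial K$ with $\gamma(0)=S$. For $\alpha,\beta\in\mathcal{B}$, $d_B(\alpha,\beta)$ is the infimum of $\int_0^1\max_{q\in S^1}\|\frac{\partial\gamma_s}{\partial s}(q)\|\,ds$ over all smooth homotopies $\gamma_s$, $s\in[0,1]$, from $\alpha$ to $\beta$ with $\gamma_s\in\mathcal{B}$ for all $s$. $\mathrm{SE}(2)$ is the group of orientation-preserving isometries of the plane; $\mathcal{AB}=\mathcal{B}/\mathrm{SE}(2)$ with the induced quotient metric $d_{AB}([\alpha],[\beta])=\inf_{g\in \mathrm{SE}(2)}d_B(\alpha,g\beta)$,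 and $\overline{\mathcal{AB}}$ is its metric completion. Not strictly convex tables. $\mathcal{C}$ is the set of pairs $(K,S)$ with $K\subset\mathbb{R}^2$ a smooth convex body (not necessarily strictly convex) with boundary of length $1$ and $S\in\partial K$, each pair being identified with the counterclockwise arc-length parametrization $\gamma\colon S^1\to\mathbb{R}^2$ of $\partial K$ with $\gamma(0)=S$. The metric $d_C$ is defined exactly as $d_B$ but with smooth homotopies through $\mathcal{C}$; $\mathcal{AC}=\mathcal{C}/\mathrm{SE}(2)$ carries the quotient metric $d_{AC}$. One has $\mathcal{AB}\subset\mathcal{AC}$ densely, and $d_{AC}$ restricts to $d_{AB}$ on $\mathcal{AB}$, so $\overline{\mathcal{AC}}=\overline{\mathcal{AB}}$. Polygons. $\mathcal{P}$ is the set of pairs $(P,S)$ with $P\subset\mathbb{R}^2$ a convex polygon with boundary of length $1$ and $S\in\partial P$, identified with the counterclockwise arc-length parametrization $\eta\colon S^1\to\mathbb{R}^2$ of $\partial P$ with $\eta(0)=S$. $\mathcal{AP}=\mathcal{P}/\mathrm{SE}(2)$. A sequence in $\mathcal{AB}$ tends to $[\eta]\in\mathcal{AP}$ in the $C^0$-norm if it has representatives $\alpha_n\in\mathcal{B}$ with $\max_{q\in S^1}\|\alpha_n(q)-\eta(q)\|\to0$. Smoothing family. Let $\eta\in\mathcal{P}$ with polygon $K$ be such that $S=\eta(0)$ is not a corner. Let $D_1,\dots,D_n$ be the corners, enumerated counterclockwise with $S\in[D_n,D_1]$. For each $i$ take an orthonormal coordinate system with origin $D_i$ in which $\partial K$ is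 locally the graph of $a_i|x|$, $a_i>0$, and a smooth convex function $f_i$ coinciding with $a_i|x|$ outside a small neighborhood of $0$ (small enough that the modifications at different corners are disjoint, stay in the part of $\partial K$ given by the graph of $a_i|x|$, and avoid $S$). The functions $(f_1,\dots,f_n)$ define a smooth family of positively oriented convex Jordan curves $\gamma_s\colon S^1\to\mathbb{R}^2$, $s\in(0,1]$, such that: near $D_i$, $\gamma_s$ coincides with the graph of $x\mapsto s f_i(x/s)$ in the corresponding coordinates; outside these neighborhoods $\gamma_s$ coincides with $\partial K$; $\gamma_s(0)=S$; and $\|\partial\gamma_s/\partial q\|=\mathrm{length}(\gamma_s)$. Put $\lambda(s)=1/\mathrm{length}(\gamma_s)$, choose a point $O\in\mathbb{R}^2$, and let $\widetilde\gamma_s\in\mathcal{C}$ be the image of $\gamma_s$ under the homothety with center $O$ and ratio $\lambda(s)$. Call $(\widetilde\gamma_s)_{s\in(0,1]}$ a smoothing family of $\eta$. Sequences obtained by the smoothing construction. If $\eta(0)$ is not a corner, a sequence $(\alpha_n)$ in $\mathcal{AB}$ is obtained by the smoothing construction for $[\eta]$ if there are a smoothing family $(\widetilde\gamma_s)$ of $\eta$ and $s_n\to0$, $s_n\in(0,1]$, with $d_{AC}(\alpha_n,[\widetilde\gamma_{s_n}])\to0$. If $\eta(0)$ is a corner, $(\alpha_n)$ is obtained by the smoothing construction for $[\eta]$ if there are $\tau_n\to0$ such that $\eta(\tau_n)$ is not a corner, and smoothing families $(\widetilde\gamma^{(n)}_s)_{s\in(0,1]}$ of $q\mapsto\eta(q+\tau_n)$,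 with $\limsup_{s\to0}d_{AC}(\alpha_n,[\widetilde\gamma^{(n)}_s])\to0$ as $n\to\infty$ (i.e. the element assigned to $[\eta]$ is the limit, as $\tau\to0$, of the elements assigned to $[\eta(\cdot+\tau)]$). *)

theory Defs
  imports "HOL-Complex_Analysis.Complex_Analysis"
begin

text \<open>
  The Euclidean plane is \<^typ>\<open>complex\<close>; its real inner product is \<open>\<bullet>\<close>.
  A curve parametrized by the circle \<open>\<real>/\<int>\<close> is a 1-periodic function
  \<^typ>\<open>real \<Rightarrow> complex\<close>.
\<close>

text \<open>The function \<open>D n\<close> is the derivative of order \<open>n\<close>.\<close>

definition smooth_fun :: "(real \<Rightarrow> 'a::real_normed_vector) \<Rightarrow> bool" where
  "smooth_fun f \<longleftrightarrow> (\<exists>D. D 0 = f \<and>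
     (\<forall>n q. (D n has_vector_derivative D (Suc n) q) (at q)))"

text \<open>
  Joint smoothness in \<open>(s, q)\<close> on \<open>A \<times> \<real>\<close>, where \<open>A\<close> is an interval; at an end point of \<open>A\<close>
  belonging to \<open>A\<close> the derivatives in \<open>s\<close> are one-sided. The function \<open>D i j\<close> is the partial
  derivative of order \<open>i\<close> in \<open>s\<close> and \<open>j\<close> in \<open>q\<close>.
\<close>

definition smooth_family_on :: "real set \<Rightarrow> (real \<Rightarrow> real \<Rightarrow> complex) \<Rightarrow> bool" where
  "smooth_family_on A H \<longleftrightarrow> (\<exists>D. D 0 0 = H \<and>
     (\<forall>i j. continuous_on (A \<times> UNIV) (\<lambda>(s, q). D i j s q) \<and>
       (\<forall>s\<in>A. \<forall>q.
          ((\<lambda>t. D i j t q) has_vector_derivative D (Suc i) j s q) (at s within A) \<and>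
          (D i j s has_vector_derivative D i (Suc j) s q) (at q))))"

definition convex_body :: "complex set \<Rightarrow> bool" where
  "convex_body K \<longleftrightarrow> compact K \<and> convex K \<and> interior K \<noteq> {}"

text \<open>
  Counterclockwise parametrizations by \<open>\<real>/\<int>\<close> of the boundary of \<open>K\<close>, as a Jordan curve; no
  condition on the speed. The orientation is expressed by the winding number of the closed path
  that is the restriction of \<open>\<gamma>\<close> to one period \<open>{0..1}\<close>.
\<close>

definition ccw_boundary_param :: "complex set \<Rightarrow> (real \<Rightarrow> complex) \<Rightarrow> bool" where
  "ccw_boundary_param K \<gamma> \<longleftrightarrow>
     convex_body K \<and> continuous_on UNIV \<gamma> \<and> (\<forall>q. \<gamma> (q + 1) = \<gamma> q) \<and>
     inj_on \<gamma> {0..<1} \<and> range \<gamma> = frontier K \<and>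
     (\<forall>z\<in>interior K. winding_number \<gamma> z = 1)"

definition velocity :: "(real \<Rightarrow> complex) \<Rightarrow> real \<Rightarrow> complex" where
  "velocity \<gamma> q = vector_derivative \<gamma> (at q)"

definition curvature :: "(real \<Rightarrow> complex) \<Rightarrow> real \<Rightarrow> real" where
  "curvature \<gamma> q = Im (cnj (velocity \<gamma> q) * velocity (velocity \<gamma>) q) / norm (velocity \<gamma> q) ^ 3"

definition curve_length :: "(real \<Rightarrow> complex) \<Rightarrow> real" where
  "curve_length \<gamma> = integral {0..1} (\<lambda>q. norm (velocity \<gamma> q))"

text \<open>
  A marked table \<open>(K, S)\<close> is the arc-length parametrization \<open>\<gamma>\<close> of the boundary of \<open>K\<close> with
  \<open>\<gamma> 0 = S\<close>. The boundary has length 1 because the period of \<open>\<gamma>\<close> is 1.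
\<close>

definition tables_C :: "(real \<Rightarrow> complex) set" where
  "tables_C = {\<gamma>. (\<exists>K. ccw_boundary_param K \<gamma>) \<and> smooth_fun \<gamma> \<and>
                  (\<forall>q. norm (velocity \<gamma> q) = 1)}"

definition tables_B :: "(real \<Rightarrow> complex) set" where
  "tables_B = {\<gamma> \<in> tables_C. \<forall>q. curvature \<gamma> q > 0}"

text \<open>The corners of a polygon are its extreme points; along the sides the speed is 1.\<close>

definition polygon_param :: "complex set \<Rightarrow> (real \<Rightarrow> complex) \<Rightarrow> bool" where
  "polygon_param K \<eta> \<longleftrightarrow> polytope K \<and> ccw_boundary_param K \<eta> \<and>
     (\<forall>q. \<not> \<eta> q extreme_point_of K \<longrightarrow>
        (\<exists>w. norm w = 1 \<and> (\<eta> has_vector_derivative w) (at q)))"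

definition tables_P :: "(real \<Rightarrow> complex) set" where
  "tables_P = {\<eta>. \<exists>K. polygon_param K \<eta>}"

text \<open>
  Distances take values in \<^typ>\<open>ennreal\<close>, so that the infimum over an empty set of homotopies
  is \<open>\<infinity>\<close>.
\<close>

definition smooth_homotopies ::
  "(real \<Rightarrow> complex) set \<Rightarrow> (real \<Rightarrow> complex) \<Rightarrow> (real \<Rightarrow> complex) \<Rightarrow> (real \<Rightarrow> real \<Rightarrow> complex) set" where
  "smooth_homotopies M \<alpha> \<beta> =
     {H. smooth_family_on {0..1} H \<and> (\<forall>s\<in>{0..1}. H s \<in> M) \<and> H 0 = \<alpha> \<and> H 1 = \<beta>}"

definition homotopy_length :: "(real \<Rightarrow> real \<Rightarrow> complex) \<Rightarrow> real" where
  "homotopy_length H =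
     integral {0..1} (\<lambda>s. SUP q. norm (vector_derivative (\<lambda>t. H t q) (at s within {0..1})))"

definition table_dist ::
  "(real \<Rightarrow> complex) set \<Rightarrow> (real \<Rightarrow> complex) \<Rightarrow> (real \<Rightarrow> complex) \<Rightarrow> ennreal" where
  "table_dist M \<alpha> \<beta> = (INF H\<in>smooth_homotopies M \<alpha> \<beta>. ennreal (homotopy_length H))"

abbreviation "d_B \<equiv> table_dist tables_B"
abbreviation "d_C \<equiv> table_dist tables_C"

definition SE2 :: "(complex \<Rightarrow> complex) set" where
  "SE2 = {g. \<exists>a b. norm a = 1 \<and> g = (\<lambda>z. a * z + b)}"

definition SE2_orbit :: "(real \<Rightarrow> complex) \<Rightarrow> (real \<Rightarrow> complex) set" where
  "SE2_orbit \<gamma> = {g \<circ> \<gamma> |g. g \<in> SE2}"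

definition AB :: "(real \<Rightarrow> complex) set set" where
  "AB = SE2_orbit ` tables_B"

definition AC :: "(real \<Rightarrow> complex) set set" where
  "AC = SE2_orbit ` tables_C"

definition AP :: "(real \<Rightarrow> complex) set set" where
  "AP = SE2_orbit ` tables_P"

text \<open>
  Quotient distance between orbits; the lemmas \<open>d_AB_orbit\<close> and \<open>d_AC_orbit\<close> below express it by
  representatives.
\<close>

definition orbit_dist ::
  "(real \<Rightarrow> complex) set \<Rightarrow> (real \<Rightarrow> complex) set \<Rightarrow> (real \<Rightarrow> complex) set \<Rightarrow> ennreal" where
  "orbit_dist M X Y = (INF \<alpha>\<in>X. INF \<beta>\<in>Y. table_dist M \<alpha> \<beta>)"

abbreviation "d_AB \<equiv> orbit_dist tables_B"
abbreviation "d_AC \<equiv> orbit_dist tables_C"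

definition d_AB_Cauchy :: "(nat \<Rightarrow> (real \<Rightarrow> complex) set) \<Rightarrow> bool" where
  "d_AB_Cauchy X \<longleftrightarrow> (\<forall>e>0. \<exists>N. \<forall>m\<ge>N. \<forall>n\<ge>N. d_AB (X m) (X n) < e)"

definition C0_tendsto ::
  "(nat \<Rightarrow> (real \<Rightarrow> complex) set) \<Rightarrow> (real \<Rightarrow> complex) set \<Rightarrow> bool" where
  "C0_tendsto X E \<longleftrightarrow> (\<exists>\<eta>\<in>E. \<exists>\<alpha>. (\<forall>n. \<alpha> n \<in> tables_B \<and> \<alpha> n \<in> X n) \<and>
     (\<lambda>n. SUP q. norm (\<alpha> n q - \<eta> q)) \<longlonglongrightarrow> 0)"

text \<open>
  The part over \<open>{-l..r}\<close> of the graph of \<open>h\<close> in the orthonormal coordinate system with origin \<open>D\<close>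
  and axes spanned by \<open>u\<close> and \<open>v\<close>.
\<close>

definition graph_in ::
  "complex \<Rightarrow> complex \<Rightarrow> complex \<Rightarrow> real \<Rightarrow> real \<Rightarrow> (real \<Rightarrow> real) \<Rightarrow> complex set" where
  "graph_in D u v l r h = (\<lambda>x. D + x *\<^sub>R u + h x *\<^sub>R v) ` {-l..r}"

text \<open>
  All data at the corners are indexed by the corners themselves. At the corner \<open>D\<close>, the small
  neighbourhood of 0 outside which \<open>f D\<close> agrees with \<open>a D * \<bar>x\<bar>\<close> is \<open>{- l D..r D}\<close>. For
  \<open>s \<le> 1\<close> the function \<open>s * f D (x / s)\<close> also agrees with \<open>a D * \<bar>x\<bar>\<close> outside it. Only the values of
  \<open>\<Gamma> s\<close> for \<open>0 < s \<le> 1\<close> matter.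
\<close>

definition smoothing_family ::
  "complex set \<Rightarrow> (real \<Rightarrow> complex) \<Rightarrow> (real \<Rightarrow> real \<Rightarrow> complex) \<Rightarrow> bool" where
  "smoothing_family K \<eta> \<Gamma> \<longleftrightarrow>
     polygon_param K \<eta> \<and> \<not> \<eta> 0 extreme_point_of K \<and>
     (\<exists>u v a l r f \<gamma> centre.
        (\<forall>D. D extreme_point_of K \<longrightarrow>
           norm (u D) = 1 \<and> norm (v D) = 1 \<and> u D \<bullet> v D = 0 \<and>
           a D > 0 \<and> l D > 0 \<and> r D > 0 \<and>
           graph_in D (u D) (v D) (l D) (r D) (\<lambda>x. a D * \<bar>x\<bar>) \<subseteq> frontier K \<and>
           \<eta> 0 \<notin> graph_in D (u D) (v D) (l D) (r D) (\<lambda>x. a D * \<bar>x\<bar>) \<and>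
           smooth_fun (f D) \<and> convex_on UNIV (f D) \<and>
           (\<forall>x. x \<notin> {- l D..r D} \<longrightarrow> f D x = a D * \<bar>x\<bar>)) \<and>
        disjoint_family_on (\<lambda>D. graph_in D (u D) (v D) (l D) (r D) (\<lambda>x. a D * \<bar>x\<bar>))
          {D. D extreme_point_of K} \<and>
        smooth_family_on {0<..1} \<gamma> \<and>
        (\<forall>s\<in>{0<..1}.
           (\<exists>L. ccw_boundary_param L (\<gamma> s)) \<and>
           range (\<gamma> s) =
             (frontier K -
               (\<Union>D\<in>{D. D extreme_point_of K}.
                  graph_in D (u D) (v D) (l D) (r D) (\<lambda>x. a D * \<bar>x\<bar>))) \<union>
             (\<Union>D\<in>{D. D extreme_point_of K}.
                graph_in D (u D) (v D) (l D) (r D) (\<lambda>x. s * f D (x / s))) \<and>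
           \<gamma> s 0 = \<eta> 0 \<and>
           (\<forall>q. norm (velocity (\<gamma> s) q) = curve_length (\<gamma> s)) \<and>
           (\<forall>q. \<Gamma> s q = centre + (1 / curve_length (\<gamma> s)) *\<^sub>R (\<gamma> s q - centre))))"

definition obtained_by_smoothing ::
  "(real \<Rightarrow> complex) set \<Rightarrow> (nat \<Rightarrow> (real \<Rightarrow> complex) set) \<Rightarrow> bool" where
  "obtained_by_smoothing E X \<longleftrightarrow> (\<exists>\<eta>\<in>E. \<exists>K. polygon_param K \<eta> \<and>
     (if \<not> \<eta> 0 extreme_point_of K
      then \<exists>\<Gamma> s. smoothing_family K \<eta> \<Gamma> \<and> (\<forall>n. s n \<in> {0<..1}) \<and> s \<longlonglongrightarrow> 0 \<and>
             (\<lambda>n. d_AC (X n) (SE2_orbit (\<Gamma> (s n)))) \<longlonglongrightarrow> 0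
      else \<exists>\<tau> \<Gamma>. \<tau> \<longlonglongrightarrow> 0 \<and>
             (\<forall>n. \<not> \<eta> (\<tau> n) extreme_point_of K \<and>
                  smoothing_family K (\<lambda>q. \<eta> (q + \<tau> n)) (\<Gamma> n)) \<and>
             (\<lambda>n. Limsup (at_right 0) (\<lambda>s. d_AC (X n) (SE2_orbit (\<Gamma> n s)))) \<longlonglongrightarrow> 0))"

lemma id_in_SE2: "id \<in> SE2"
proof -
  have "id = (\<lambda>z::complex. 1 * z + 0)" by auto
  then show ?thesis unfolding SE2_def by (intro CollectI exI[of _ 1] exI[of _ 0]) auto
qed

lemma SE2_comp: "g \<in> SE2 \<Longrightarrow> h \<in> SE2 \<Longrightarrow> g \<circ> h \<in> SE2"
proof -
  assume "g \<in> SE2" "h \<in> SE2"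
  then obtain a b c d where "norm a = 1" "g = (\<lambda>z. a * z + b)" "norm c = 1" "h = (\<lambda>z. c * z + d)"
    unfolding SE2_def by auto
  then show ?thesis unfolding SE2_def
    by (intro CollectI exI[of _ "a * c"] exI[of _ "a * d + b"])
       (auto simp: norm_mult algebra_simps fun_eq_iff)
qed

lemma SE2_inverse:
  assumes "g \<in> SE2"
  obtains h where "h \<in> SE2" "h \<circ> g = id" "g \<circ> h = id"
proof -
  obtain a b where a: "norm a = 1" and g: "g = (\<lambda>z. a * z + b)"
    using assms unfolding SE2_def by auto
  have "a \<noteq> 0" using a by auto
  define h where "h = (\<lambda>z. inverse a * z + (- inverse a * b))"
  have "h \<in> SE2" unfolding SE2_def h_def
    using a by (intro CollectI exI[of _ "inverse a"] exI[of _ "- inverse a * b"])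
      (auto simp: norm_inverse)
  moreover have "h \<circ> g = id" "g \<circ> h = id"
    using \<open>a \<noteq> 0\<close> by (auto simp: fun_eq_iff h_def g algebra_simps)
  ultimately show ?thesis using that by blast
qed

lemma velocity_affine:
  assumes "\<gamma> differentiable (at q)"
  shows "velocity (\<lambda>t. a * \<gamma> t + b) q = a * velocity \<gamma> q"
proof -
  have "(\<gamma> has_vector_derivative velocity \<gamma> q) (at q)"
    using assms unfolding velocity_def by (simp add: vector_derivative_works)
  then have "((\<lambda>t. a * \<gamma> t + b) has_vector_derivative a * velocity \<gamma> q) (at q)"
    by (auto intro!: derivative_eq_intros)
  then show ?thesis unfolding velocity_def by (simp add: vector_derivative_at)
qed

lemma smooth_fun_affine:
  fixes \<gamma> :: "real \<Rightarrow> complex"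
  assumes "smooth_fun \<gamma>"
  shows "smooth_fun (\<lambda>t. a * \<gamma> t + b)"
proof -
  obtain D where D: "D 0 = \<gamma>" "\<And>n q. (D n has_vector_derivative D (Suc n) q) (at q)"
    using assms unfolding smooth_fun_def by blast
  show ?thesis unfolding smooth_fun_def
  proof (intro exI[of _ "\<lambda>n t. a * D n t + (if n = 0 then b else 0)"] conjI allI)
    fix n q
    show "((\<lambda>t. a * D n t + (if n = 0 then b else 0)) has_vector_derivative
           a * D (Suc n) q + (if Suc n = 0 then b else 0)) (at q)"
      using D(2)[of n q] by (auto intro!: derivative_eq_intros)
  qed (use D in auto)
qed

lemma smooth_fun_imp_velocity:
  assumes "smooth_fun \<gamma>"
  shows "\<gamma> differentiable (at q)" "smooth_fun (velocity \<gamma>)"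
proof -
  obtain D where D: "D 0 = \<gamma>" "\<And>n q. (D n has_vector_derivative D (Suc n) q) (at q)"
    using assms unfolding smooth_fun_def by blast
  show "\<gamma> differentiable (at q)"
    using D(2)[of 0 q] D(1) by (metis differentiableI_vector)
  have v: "velocity \<gamma> = D 1"
    using D(2)[of 0] D(1) by (auto simp: velocity_def fun_eq_iff vector_derivative_at)
  show "smooth_fun (velocity \<gamma>)"
    unfolding smooth_fun_def v
    by (rule exI[of _ "\<lambda>n. D (Suc n)"]) (use D in auto)
qed

lemma winding_number_affine:
  assumes "path \<gamma>" "z \<notin> path_image \<gamma>" "a \<noteq> 0"
  shows "winding_number (\<lambda>t. a * \<gamma> t + b) (a * z + b) = winding_number \<gamma> z"
proof -
  obtain q where q: "path q"
    "pathfinish q - pathstart q = 2 * of_real pi * \<i> * winding_number \<gamma> z"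
    "\<And>t. t \<in> {0..1} \<Longrightarrow> \<gamma> t = z + exp (q t)"
    using winding_number_as_continuous_log[OF assms(1,2)] by metis
  define p where "p = (\<lambda>t. q t + Ln a)"
  have "path p" using q(1) unfolding p_def path_def by (intro continuous_intros)
  have "winding_number (\<lambda>t. a * \<gamma> t + b) (a * z + b)
        = winding_number (\<lambda>t. a * \<gamma> t + b - (a * z + b)) 0"
    by (rule winding_number_offset)
  also have "\<dots> = winding_number (exp \<circ> p) 0"
    by (rule winding_number_cong) (use q(3) assms(3) in \<open>auto simp: p_def exp_add algebra_simps\<close>)
  also have "\<dots> = (pathfinish p - pathstart p) / (2 * of_real pi * \<i>)"
    by (rule winding_number_compose_exp[OF \<open>path p\<close>])
  also have "\<dots> = winding_number \<gamma> z"
    using q(2) by (simp add: p_def pathfinish_def pathstart_def)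
  finally show ?thesis .
qed

lemma ccw_boundary_param_affine:
  assumes "ccw_boundary_param K \<gamma>" "a \<noteq> 0"
  shows "ccw_boundary_param ((\<lambda>z. a * z + b) ` K) (\<lambda>t. a * \<gamma> t + b)"
proof -
  have K: "compact K" "convex K" "interior K \<noteq> {}" and cont: "continuous_on UNIV \<gamma>"
    and per: "\<And>q. \<gamma> (q + 1) = \<gamma> q" and inj: "inj_on \<gamma> {0..<1}" and ran: "range \<gamma> = frontier K"
    and wn: "\<And>z. z \<in> interior K \<Longrightarrow> winding_number \<gamma> z = 1"
    using assms(1) unfolding ccw_boundary_param_def convex_body_def by auto
  let ?g = "\<lambda>z. a * z + b"
  have g: "?g ` T = (+) b ` (*) a ` T" for T by (auto simp: image_image add.commute)
  have lin: "linear ((*) a)"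
    using bounded_linear.linear bounded_linear_mult_right by blast
  have bij: "bij ((*) a)"
    using assms(2) by (intro bij_betw_byWitness[where f' = "\<lambda>z. z / a"]) auto
  have int: "interior (?g ` K) = ?g ` interior K"
    unfolding g by (simp add: interior_translation interior_bijective_linear_image[OF lin bij])
  have cmp: "compact (?g ` K)"
    using K(1) by (intro compact_continuous_image continuous_intros)
  have fr: "frontier (?g ` K) = ?g ` frontier K"
    using K(1) cmp assms(2)
    by (auto simp: frontier_def int closure_closed compact_imp_closed)
  show ?thesis
    unfolding ccw_boundary_param_def convex_body_def
  proof (intro conjI ballI allI)
    show "convex (?g ` K)" unfolding g
      by (intro convex_translation convex_linear_image lin K)
    show "continuous_on UNIV (\<lambda>t. a * \<gamma> t + b)" using cont by (intro continuous_intros)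
    show "inj_on (\<lambda>t. a * \<gamma> t + b) {0..<1}" using inj assms(2) by (auto simp: inj_on_def)
    show "range (\<lambda>t. a * \<gamma> t + b) = frontier (?g ` K)"
      unfolding fr ran[symmetric] by (simp add: image_image)
    fix w assume "w \<in> interior (?g ` K)"
    then obtain z where z: "z \<in> interior K" "w = a * z + b" unfolding int by auto
    have "path \<gamma>" using cont unfolding path_def by (rule continuous_on_subset) auto
    moreover have "z \<notin> path_image \<gamma>"
      using z(1) ran by (auto simp: path_image_def frontier_def)
    ultimately show "winding_number (\<lambda>t. a * \<gamma> t + b) w = 1"
      using winding_number_affine assms(2) wn z by metis
  qed (use K cmp per int in auto)
qed

lemma tables_C_SE2:
  assumes "\<gamma> \<in> tables_C" "g \<in> SE2"
  shows "g \<circ> \<gamma> \<in> tables_C"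
proof -
  obtain a b where a: "norm a = 1" and g: "g = (\<lambda>z. a * z + b)"
    using assms(2) unfolding SE2_def by auto
  have eq: "g \<circ> \<gamma> = (\<lambda>t. a * \<gamma> t + b)" by (auto simp: g)
  have \<gamma>: "smooth_fun \<gamma>" "\<And>q. norm (velocity \<gamma> q) = 1"
    using assms(1) unfolding tables_C_def by auto
  have "a \<noteq> 0" using a by auto
  then have "\<exists>K. ccw_boundary_param K (g \<circ> \<gamma>)"
    using assms(1) ccw_boundary_param_affine unfolding tables_C_def eq by blast
  moreover have "norm (velocity (g \<circ> \<gamma>) q) = 1" for q
    unfolding eq using \<gamma> a by (simp add: velocity_affine smooth_fun_imp_velocity norm_mult)
  ultimately show ?thesis
    using smooth_fun_affine[OF \<gamma>(1)] unfolding tables_C_def eq by auto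
qed

lemma tables_B_SE2:
  assumes "\<gamma> \<in> tables_B" "g \<in> SE2"
  shows "g \<circ> \<gamma> \<in> tables_B"
proof -
  obtain a b where a: "norm a = 1" and g: "g = (\<lambda>z. a * z + b)"
    using assms(2) unfolding SE2_def by auto
  have eq: "g \<circ> \<gamma> = (\<lambda>t. a * \<gamma> t + b)" by (auto simp: g)
  have sm: "smooth_fun \<gamma>" using assms(1) unfolding tables_B_def tables_C_def by auto
  note d = smooth_fun_imp_velocity[OF sm]
  have v: "velocity (g \<circ> \<gamma>) = (\<lambda>q. a * velocity \<gamma> q + 0)"
    unfolding eq using d(1) by (simp add: velocity_affine fun_eq_iff)
  have v2: "velocity (velocity (g \<circ> \<gamma>)) = (\<lambda>q. a * velocity (velocity \<gamma>) q)"
    unfolding v using smooth_fun_imp_velocity(1)[OF d(2)]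
    using velocity_affine[of "velocity \<gamma>" _ a 0] by auto
  have "cnj a * a = 1"
    using a by (metis complex_norm_square mult.commute of_real_1 one_power2)
  then have *: "cnj (a * x) * (a * y) = cnj x * y" for x y
    by (metis complex_cnj_mult mult.assoc mult.commute mult.left_neutral)
  then have "curvature (g \<circ> \<gamma>) q = curvature \<gamma> q" for q
    unfolding curvature_def v2 unfolding v add_0_right * using a by (simp add: norm_mult)
  then show ?thesis
    using assms tables_C_SE2[of \<gamma> g] unfolding tables_B_def by auto
qed

lemma smooth_homotopies_SE2:
  assumes M: "\<And>\<gamma> g. \<gamma> \<in> M \<Longrightarrow> g \<in> SE2 \<Longrightarrow> g \<circ> \<gamma> \<in> M"
    and g: "g \<in> SE2" and H: "H \<in> smooth_homotopies M \<alpha> \<beta>"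
  shows "(\<lambda>s. g \<circ> H s) \<in> smooth_homotopies M (g \<circ> \<alpha>) (g \<circ> \<beta>)"
    and "homotopy_length (\<lambda>s. g \<circ> H s) = homotopy_length H"
proof -
  obtain a b where a: "norm a = 1" and g': "g = (\<lambda>z. a * z + b)"
    using g unfolding SE2_def by auto
  have H': "smooth_family_on {0..1} H" "\<forall>s\<in>{0..1}. H s \<in> M" "H 0 = \<alpha>" "H 1 = \<beta>"
    using H unfolding smooth_homotopies_def by auto
  obtain D where D: "D 0 0 = H"
    "\<And>i j. continuous_on ({0..1} \<times> UNIV) (\<lambda>(s, q). D i j s q)"
    "\<And>i j s q. s \<in> {0..1} \<Longrightarrow>
       ((\<lambda>t. D i j t q) has_vector_derivative D (Suc i) j s q) (at s within {0..1})"
    "\<And>i j s q. s \<in> {0..1} \<Longrightarrow> (D i j s has_vector_derivative D i (Suc j) s q) (at q)"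
    using H'(1) unfolding smooth_family_on_def by metis
  define c where "c = (\<lambda>(i::nat) (j::nat). if i = 0 \<and> j = 0 then b else 0)"
  have "smooth_family_on {0..1} (\<lambda>s. g \<circ> H s)"
    unfolding smooth_family_on_def
  proof (intro exI[of _ "\<lambda>i j s q. a * D i j s q + c i j"] conjI allI ballI)
    show "(\<lambda>s q. a * D 0 0 s q + c 0 0) = (\<lambda>s. g \<circ> H s)"
      by (auto simp: c_def D(1) g' fun_eq_iff)
    fix i j
    show "continuous_on ({0..1} \<times> UNIV) (\<lambda>(s, q). a * D i j s q + c i j)"
      using D(2)[of i j] unfolding case_prod_unfold by (intro continuous_intros)
    fix s :: real and q assume s: "s \<in> {0..1}"
    show "((\<lambda>t. a * D i j t q + c i j) has_vector_derivative a * D (Suc i) j s q + c (Suc i) j)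
            (at s within {0..1})"
      using D(3)[OF s, of i j q] by (auto intro!: derivative_eq_intros simp: c_def)
    show "((\<lambda>q. a * D i j s q + c i j) has_vector_derivative a * D i (Suc j) s q + c i (Suc j))
            (at q)"
      using D(4)[OF s, of i j q] by (auto intro!: derivative_eq_intros simp: c_def)
  qed
  then show "(\<lambda>s. g \<circ> H s) \<in> smooth_homotopies M (g \<circ> \<alpha>) (g \<circ> \<beta>)"
    using H' M g unfolding smooth_homotopies_def by auto
  have "norm (vector_derivative (\<lambda>t. (g \<circ> H t) q) (at s within {0..1}))
        = norm (vector_derivative (\<lambda>t. H t q) (at s within {0..1}))" if s: "s \<in> {0..1}" for s q
  proof -
    have 1: "((\<lambda>t. H t q) has_vector_derivative D 1 0 s q) (at s within {0..1})"
      using D(3)[OF s, of 0 0 q] D(1) by simp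
    then have 2: "((\<lambda>t. (g \<circ> H t) q) has_vector_derivative a * D 1 0 s q) (at s within {0..1})"
      unfolding g' comp_def by (auto intro!: derivative_eq_intros)
    show ?thesis
      using vector_derivative_within_closed_interval[OF _ s 1]
        vector_derivative_within_closed_interval[OF _ s 2] a
      by (simp add: norm_mult)
  qed
  then show "homotopy_length (\<lambda>s. g \<circ> H s) = homotopy_length H"
    unfolding homotopy_length_def by (intro integral_cong) simp
qed

lemma table_dist_SE2:
  assumes M: "\<And>\<gamma> g. \<gamma> \<in> M \<Longrightarrow> g \<in> SE2 \<Longrightarrow> g \<circ> \<gamma> \<in> M" and g: "g \<in> SE2"
  shows "table_dist M (g \<circ> \<alpha>) (g \<circ> \<beta>) = table_dist M \<alpha> \<beta>"
proof -
  have le: "table_dist M (h \<circ> \<alpha>) (h \<circ> \<beta>) \<le> table_dist M \<alpha> \<beta>" if "h \<in> SE2" for h \<alpha> \<beta>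
    unfolding table_dist_def
  proof (rule INF_mono)
    fix H assume "H \<in> smooth_homotopies M \<alpha> \<beta>"
    then show "\<exists>H'\<in>smooth_homotopies M (h \<circ> \<alpha>) (h \<circ> \<beta>).
                 ennreal (homotopy_length H') \<le> ennreal (homotopy_length H)"
      using smooth_homotopies_SE2[of M h H \<alpha> \<beta>] M that
      by (intro bexI[of _ "\<lambda>s. h \<circ> H s"]) auto
  qed
  obtain h where h: "h \<in> SE2" "h \<circ> g = id" "g \<circ> h = id" using SE2_inverse[OF g] .
  have "table_dist M \<alpha> \<beta> = table_dist M (h \<circ> (g \<circ> \<alpha>)) (h \<circ> (g \<circ> \<beta>))"
    by (simp add: h(2) flip: comp_assoc)
  also have "\<dots> \<le> table_dist M (g \<circ> \<alpha>) (g \<circ> \<beta>)" by (rule le[OF h(1)])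
  finally show ?thesis using le[OF g] by (intro antisym) auto
qed

lemma orbit_dist_orbit:
  assumes M: "\<And>\<gamma> g. \<gamma> \<in> M \<Longrightarrow> g \<in> SE2 \<Longrightarrow> g \<circ> \<gamma> \<in> M"
  shows "orbit_dist M (SE2_orbit \<alpha>) (SE2_orbit \<beta>) = (INF g\<in>SE2. table_dist M \<alpha> (g \<circ> \<beta>))"
proof (rule antisym)
  show "orbit_dist M (SE2_orbit \<alpha>) (SE2_orbit \<beta>) \<le> (INF g\<in>SE2. table_dist M \<alpha> (g \<circ> \<beta>))"
    unfolding orbit_dist_def
  proof (rule INF_greatest)
    fix g assume g: "g \<in> SE2"
    have "\<alpha> \<in> SE2_orbit \<alpha>" unfolding SE2_orbit_def using id_in_SE2
      by (auto intro!: exI[of _ id])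
    moreover have "g \<circ> \<beta> \<in> SE2_orbit \<beta>" unfolding SE2_orbit_def using g by auto
    ultimately show "(INF \<alpha>\<in>SE2_orbit \<alpha>. INF \<beta>\<in>SE2_orbit \<beta>. table_dist M \<alpha> \<beta>)
                       \<le> table_dist M \<alpha> (g \<circ> \<beta>)"
      by (meson INF_lower2 order_refl)
  qed
  show "(INF g\<in>SE2. table_dist M \<alpha> (g \<circ> \<beta>)) \<le> orbit_dist M (SE2_orbit \<alpha>) (SE2_orbit \<beta>)"
    unfolding orbit_dist_def
  proof (intro INF_greatest)
    fix \<alpha>' \<beta>' assume "\<alpha>' \<in> SE2_orbit \<alpha>" "\<beta>' \<in> SE2_orbit \<beta>"
    then obtain h k where h: "h \<in> SE2" "\<alpha>' = h \<circ> \<alpha>" and k: "k \<in> SE2" "\<beta>' = k \<circ> \<beta>"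
      unfolding SE2_orbit_def by auto
    obtain h' where h': "h' \<in> SE2" "h' \<circ> h = id" "h \<circ> h' = id" using SE2_inverse[OF h(1)] .
    have "table_dist M \<alpha>' \<beta>' = table_dist M (h' \<circ> \<alpha>') (h' \<circ> \<beta>')"
      using table_dist_SE2[of M h'] M h'(1) by auto
    also have "\<dots> = table_dist M \<alpha> ((h' \<circ> k) \<circ> \<beta>)"
      using h k h'(2) by (simp flip: comp_assoc)
    finally show "(INF g\<in>SE2. table_dist M \<alpha> (g \<circ> \<beta>)) \<le> table_dist M \<alpha>' \<beta>'"
      using SE2_comp[OF h'(1) k(1)] by (metis INF_lower)
  qed
qed

lemma d_AB_orbit: "d_AB (SE2_orbit \<alpha>) (SE2_orbit \<beta>) = (INF g\<in>SE2. d_B \<alpha> (g \<circ> \<beta>))"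
  by (rule orbit_dist_orbit[OF tables_B_SE2])

lemma d_AC_orbit: "d_AC (SE2_orbit \<alpha>) (SE2_orbit \<beta>) = (INF g\<in>SE2. d_C \<alpha> (g \<circ> \<beta>))"
  by (rule orbit_dist_orbit[OF tables_C_SE2])

end

theory Submission
  imports Defs
begin

text \<open>
  No point moves further than the length of a homotopy, so \<open>d_B\<close> and \<open>d_C\<close> dominate the uniform
  distance. Conversely, two tables with positive curvature at uniform distance \<open>d\<close> are joined by a
  homotopy of length at most \<open>18 * d\<close>: combine the points with equal tangent angles, that is,
  interpolate by Minkowski sums. Hence \<open>d_B\<close> is equivalent to the uniform distance, and the theorem
  reduces to the uniform convergence of a smoothing family to its polygon. The smoothed curves lie
  within \<open>O(s)\<close> of the polygon, and since their tangents turn by \<open>2 * pi\<close> in total, their arc lengths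
  are within \<open>O(s)\<close> of those of the polygon as well. A smoothing family exists: replace \<open>\<bar>x\<bar>\<close> at each
  corner by a smooth convex function, and pass to constant speed.
\<close>

section \<open>Smooth families of curves\<close>

text \<open>The smoothing construction speaks of \<open>d_AC\<close>, the conclusions of
  \<open>d_AB\<close>; the uniform distance is the bridge between the two. The obstacle is that
  uniformly close convex tables may have very different curvatures, so averaging points with equal
  arc-length parameter need not keep unit speed or convexity. Matching equal tangent angles does
  keep convexity, but it needs strictly increasing angles, hence positive curvature; a weakly convex
  table is therefore bent into \<open>tables_B\<close> by an arbitrarily short homotopy. With this
  matching the velocity of the homotopy has a normal part, a difference of support functions and so
  at most d, and a tangential part whose derivative along the curve is curvature times the normal
  part. Total curvature 2 * pi bounds the oscillation of the tangential part by 2 * pi * d, and one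
  value of it is bounded separately. The sum is (2 + 4 * pi) * d, whence the constant 18.\<close>

primrec Ck :: "nat \<Rightarrow> real set \<Rightarrow> real set \<Rightarrow> (real \<Rightarrow> real \<Rightarrow> 'a::real_normed_vector) \<Rightarrow> bool" where
  "Ck 0 A J F \<longleftrightarrow> continuous_on (A \<times> J) (\<lambda>(s, q). F s q)"
| "Ck (Suc k) A J F \<longleftrightarrow> continuous_on (A \<times> J) (\<lambda>(s, q). F s q) \<and>
     (\<exists>F1 F2. Ck k A J F1 \<and> Ck k A J F2 \<and>
       (\<forall>s\<in>A. \<forall>q\<in>J. ((\<lambda>t. F t q) has_vector_derivative F1 s q) (at s within A) \<and>
                      (F s has_vector_derivative F2 s q) (at q)))"

text \<open>\<open>smooth_family_on\<close> asks for a full table of mixed partials, which is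
  awkward to write down for a product or an inverse. The recursion \<open>Ck\<close> asks only for
  some first partials of lower order, so closure properties follow by induction on the order;
  \<open>smooth2_of_smooth_family\<close> and \<open>smooth_family_onI\<close> translate between the
  two. Derivatives in \<open>s\<close> are relative to \<open>A\<close>, those in \<open>q\<close>
  are two-sided.\<close>

definition smooth2 :: "real set \<Rightarrow> real set \<Rightarrow> (real \<Rightarrow> real \<Rightarrow> 'a::real_normed_vector) \<Rightarrow> bool" where
  "smooth2 A J F \<longleftrightarrow> (\<forall>k. Ck k A J F)"

named_theorems smooth2_intros

lemma Ck_continuous: "Ck k A J F \<Longrightarrow> continuous_on (A \<times> J) (\<lambda>(s, q). F s q)"
  by (cases k) auto

lemma Ck_SucI:
  assumes "continuous_on (A \<times> J) (\<lambda>(s, q). F s q)" "Ck k A J F1" "Ck k A J F2"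
    "\<And>s q. s \<in> A \<Longrightarrow> q \<in> J \<Longrightarrow> ((\<lambda>t. F t q) has_vector_derivative F1 s q) (at s within A)"
    "\<And>s q. s \<in> A \<Longrightarrow> q \<in> J \<Longrightarrow> (F s has_vector_derivative F2 s q) (at q)"
  shows "Ck (Suc k) A J F"
  using assms unfolding Ck.simps(2) by blast

lemma Ck_SucE:
  assumes "Ck (Suc k) A J F"
  obtains F1 F2 where "continuous_on (A \<times> J) (\<lambda>(s, q). F s q)" "Ck k A J F1" "Ck k A J F2"
    "\<And>s q. s \<in> A \<Longrightarrow> q \<in> J \<Longrightarrow> ((\<lambda>t. F t q) has_vector_derivative F1 s q) (at s within A)"
    "\<And>s q. s \<in> A \<Longrightarrow> q \<in> J \<Longrightarrow> (F s has_vector_derivative F2 s q) (at q)"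
  using assms by auto

declare Ck.simps(2) [simp del]

lemma Ck_Suc_imp: "Ck (Suc k) A J F \<Longrightarrow> Ck k A J F"
proof (induction k arbitrary: F)
  case (Suc k)
  from Suc.prems show ?case
    by (rule Ck_SucE) (blast intro: Ck_SucI Suc.IH)
qed (auto dest: Ck_continuous)

lemma smooth2_continuous: "smooth2 A J F \<Longrightarrow> continuous_on (A \<times> J) (\<lambda>(s, q). F s q)"
  unfolding smooth2_def using Ck_continuous by blast

lemma continuous_on_family:
  assumes "continuous_on (A \<times> J) (\<lambda>(s, q). F s q)" "continuous_on S f" "continuous_on S g"
    "\<And>x. x \<in> S \<Longrightarrow> f x \<in> A \<and> g x \<in> J"
  shows "continuous_on S (\<lambda>x. F (f x) (g x))"
proof -
  have "continuous_on S (\<lambda>x. (f x, g x))" using assms(2,3) by (intro continuous_intros)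
  from continuous_on_compose2[OF assms(1) this] show ?thesis using assms(4) by auto
qed

section \<open>Algebraic operations on smooth families\<close>

lemma Ck_const: "Ck k A J (\<lambda>s q. c)"
proof (induction k arbitrary: c)
  case (Suc k)
  show ?case by (rule Ck_SucI[of _ _ _ _ "\<lambda>s q. 0" "\<lambda>s q. 0"]) (auto intro: Suc)
qed auto

lemma smooth2_const [smooth2_intros]: "smooth2 A J (\<lambda>s q. c)"
  by (simp add: smooth2_def Ck_const)

lemma smooth2_fst [smooth2_intros]: "smooth2 A J (\<lambda>s q. s)"
  unfolding smooth2_def
proof
  fix k show "Ck k A J (\<lambda>s q. s)"
  proof (cases k)
    case (Suc k')
    show ?thesis unfolding Suc
      by (rule Ck_SucI[of _ _ _ _ "\<lambda>s q. 1" "\<lambda>s q. 0"])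
        (auto intro!: Ck_const derivative_eq_intros continuous_intros simp: case_prod_unfold)
  qed (auto simp: case_prod_unfold intro!: continuous_intros)
qed

lemma smooth2_snd [smooth2_intros]: "smooth2 A J (\<lambda>s q. q)"
  unfolding smooth2_def
proof
  fix k show "Ck k A J (\<lambda>s q. q)"
  proof (cases k)
    case (Suc k')
    show ?thesis unfolding Suc
      by (rule Ck_SucI[of _ _ _ _ "\<lambda>s q. 0" "\<lambda>s q. 1"])
        (auto intro!: Ck_const derivative_eq_intros continuous_intros simp: case_prod_unfold)
  qed (auto simp: case_prod_unfold intro!: continuous_intros)
qed

lemma Ck_add: "Ck k A J F \<Longrightarrow> Ck k A J G \<Longrightarrow> Ck k A J (\<lambda>s q. F s q + G s q)"
proof (induction k arbitrary: F G)
  case 0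
  then show ?case by (auto simp: case_prod_unfold intro!: continuous_intros)
next
  case (Suc k)
  from Suc.prems(1) obtain F1 F2 where F: "continuous_on (A \<times> J) (\<lambda>(s, q). F s q)"
    "Ck k A J F1" "Ck k A J F2"
    "\<And>s q. s \<in> A \<Longrightarrow> q \<in> J \<Longrightarrow> ((\<lambda>t. F t q) has_vector_derivative F1 s q) (at s within A)"
    "\<And>s q. s \<in> A \<Longrightarrow> q \<in> J \<Longrightarrow> (F s has_vector_derivative F2 s q) (at q)" by (rule Ck_SucE) blast
  from Suc.prems(2) obtain G1 G2 where G: "continuous_on (A \<times> J) (\<lambda>(s, q). G s q)"
    "Ck k A J G1" "Ck k A J G2"
    "\<And>s q. s \<in> A \<Longrightarrow> q \<in> J \<Longrightarrow> ((\<lambda>t. G t q) has_vector_derivative G1 s q) (at s within A)"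
    "\<And>s q. s \<in> A \<Longrightarrow> q \<in> J \<Longrightarrow> (G s has_vector_derivative G2 s q) (at q)" by (rule Ck_SucE) blast
  show ?case
  proof (rule Ck_SucI[where ?F1.0 = "\<lambda>s q. F1 s q + G1 s q" and ?F2.0 = "\<lambda>s q. F2 s q + G2 s q"])
    show "continuous_on (A \<times> J) (\<lambda>(s, q). F s q + G s q)"
      using F(1) G(1) by (auto simp: case_prod_unfold intro!: continuous_intros)
  qed (use F G in \<open>auto intro!: Suc.IH derivative_eq_intros\<close>)
qed

lemma smooth2_add [smooth2_intros]:
  "smooth2 A J F \<Longrightarrow> smooth2 A J G \<Longrightarrow> smooth2 A J (\<lambda>s q. F s q + G s q)"
  by (simp add: smooth2_def Ck_add)

lemma Ck_bilinear:
  assumes "bounded_bilinear p"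
  shows "Ck k A J F \<Longrightarrow> Ck k A J G \<Longrightarrow> Ck k A J (\<lambda>s q. p (F s q) (G s q))"
proof (induction k arbitrary: F G)
  case 0
  then show ?case
    by (auto simp: case_prod_unfold intro!: bounded_bilinear.continuous_on[OF assms])
next
  case (Suc k)
  from Suc.prems(1) obtain F1 F2 where F: "continuous_on (A \<times> J) (\<lambda>(s, q). F s q)"
    "Ck k A J F1" "Ck k A J F2"
    "\<And>s q. s \<in> A \<Longrightarrow> q \<in> J \<Longrightarrow> ((\<lambda>t. F t q) has_vector_derivative F1 s q) (at s within A)"
    "\<And>s q. s \<in> A \<Longrightarrow> q \<in> J \<Longrightarrow> (F s has_vector_derivative F2 s q) (at q)" by (rule Ck_SucE) blast
  from Suc.prems(2) obtain G1 G2 where G: "continuous_on (A \<times> J) (\<lambda>(s, q). G s q)"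
    "Ck k A J G1" "Ck k A J G2"
    "\<And>s q. s \<in> A \<Longrightarrow> q \<in> J \<Longrightarrow> ((\<lambda>t. G t q) has_vector_derivative G1 s q) (at s within A)"
    "\<And>s q. s \<in> A \<Longrightarrow> q \<in> J \<Longrightarrow> (G s has_vector_derivative G2 s q) (at q)" by (rule Ck_SucE) blast
  note prems = Suc.prems[THEN Ck_Suc_imp]
  show ?case
  proof (rule Ck_SucI[where ?F1.0 = "\<lambda>s q. p (F s q) (G1 s q) + p (F1 s q) (G s q)"
        and ?F2.0 = "\<lambda>s q. p (F s q) (G2 s q) + p (F2 s q) (G s q)"])
    show "continuous_on (A \<times> J) (\<lambda>(s, q). p (F s q) (G s q))"
      using F(1) G(1)
      by (auto simp: case_prod_unfold intro!: bounded_bilinear.continuous_on[OF assms])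
  qed (use F G prems in
      \<open>auto intro!: Suc.IH Ck_add bounded_bilinear.has_vector_derivative[OF assms]\<close>)
qed

lemma smooth2_mult [smooth2_intros]:
  fixes F G :: "real \<Rightarrow> real \<Rightarrow> 'a::real_normed_algebra"
  shows "smooth2 A J F \<Longrightarrow> smooth2 A J G \<Longrightarrow> smooth2 A J (\<lambda>s q. F s q * G s q)"
  by (simp add: smooth2_def Ck_bilinear bounded_bilinear_mult)

lemma smooth2_scaleR [smooth2_intros]:
  "smooth2 A J F \<Longrightarrow> smooth2 A J G \<Longrightarrow> smooth2 A J (\<lambda>s q. F s q *\<^sub>R G s q)"
  by (simp add: smooth2_def Ck_bilinear bounded_bilinear_scaleR)

lemma smooth2_inner [smooth2_intros]:
  "smooth2 A J F \<Longrightarrow> smooth2 A J G \<Longrightarrow> smooth2 A J (\<lambda>s q. F s q \<bullet> G s q)"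
  by (simp add: smooth2_def Ck_bilinear bounded_bilinear_inner)

text \<open>A case of the bilinear rule: \<open>r *\<^sub>R L x\<close> is bilinear in
  \<open>r\<close> and \<open>x\<close>, and \<open>r\<close> is the constant 1.\<close>

lemma smooth2_linear:
  assumes "bounded_linear L" "smooth2 A J F"
  shows "smooth2 A J (\<lambda>s q. L (F s q))"
proof -
  interpret L: bounded_linear L by fact
  have "bounded_bilinear (\<lambda>(r::real) x. r *\<^sub>R L x)"
    using bounded_bilinear.comp[OF bounded_bilinear_scaleR bounded_linear_ident assms(1)] .
  then have "smooth2 A J (\<lambda>s q. (1::real) *\<^sub>R L (F s q))"
    using assms(2) Ck_bilinear[OF _ Ck_const[of _ A J "1::real"]] unfolding smooth2_def by blast
  then show ?thesis by simp
qed

lemmas smooth2_of_real [smooth2_intros] = smooth2_linear[OF bounded_linear_of_real]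
lemmas smooth2_minus [smooth2_intros] = smooth2_linear[OF bounded_linear_minus[OF bounded_linear_ident]]
lemmas smooth2_Re [smooth2_intros] = smooth2_linear[OF bounded_linear_Re]
lemmas smooth2_Im [smooth2_intros] = smooth2_linear[OF bounded_linear_Im]
lemmas smooth2_cnj [smooth2_intros] = smooth2_linear[OF bounded_linear_cnj]

lemma smooth2_diff [smooth2_intros]:
  "smooth2 A J F \<Longrightarrow> smooth2 A J G \<Longrightarrow> smooth2 A J (\<lambda>s q. F s q - G s q)"
  using smooth2_add[of A J F "\<lambda>s q. - G s q"] smooth2_minus by force

lemma smooth2_power [smooth2_intros]:
  fixes F :: "real \<Rightarrow> real \<Rightarrow> 'a::real_normed_algebra_1"
  shows "smooth2 A J F \<Longrightarrow> smooth2 A J (\<lambda>s q. F s q ^ n)"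
  by (induction n) (auto intro!: smooth2_intros)

text \<open>The partials of the reciprocal contain the reciprocal again, but at one order less,
  where the induction hypothesis applies to the same \<open>F\<close>. The square root below works
  in the same way.\<close>

lemma Ck_inverse:
  fixes F :: "real \<Rightarrow> real \<Rightarrow> real"
  assumes "\<And>s q. s \<in> A \<Longrightarrow> q \<in> J \<Longrightarrow> F s q \<noteq> 0"
  shows "Ck k A J F \<Longrightarrow> Ck k A J (\<lambda>s q. inverse (F s q))"
proof (induction k)
  case 0
  then show ?case using assms by (auto simp: case_prod_unfold intro!: continuous_intros)
next
  case (Suc k)
  from Suc.prems(1) obtain F1 F2 where F: "continuous_on (A \<times> J) (\<lambda>(s, q). F s q)"
    "Ck k A J F1" "Ck k A J F2"
    "\<And>s q. s \<in> A \<Longrightarrow> q \<in> J \<Longrightarrow> ((\<lambda>t. F t q) has_vector_derivative F1 s q) (at s within A)"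
    "\<And>s q. s \<in> A \<Longrightarrow> q \<in> J \<Longrightarrow> (F s has_vector_derivative F2 s q) (at q)" by (rule Ck_SucE) blast
  note IH = Suc.IH[OF Ck_Suc_imp[OF Suc.prems]]
  show ?case
  proof (rule Ck_SucI[where ?F1.0 = "\<lambda>s q. (- F1 s q) * (inverse (F s q) * inverse (F s q))"
        and ?F2.0 = "\<lambda>s q. (- F2 s q) * (inverse (F s q) * inverse (F s q))"])
    show "continuous_on (A \<times> J) (\<lambda>(s, q). inverse (F s q))"
      using F(1) assms by (auto simp: case_prod_unfold intro!: continuous_intros)
    fix s q assume sq: "s \<in> A" "q \<in> J"
    show "((\<lambda>t. inverse (F t q)) has_vector_derivative (- F1 s q) * (inverse (F s q) * inverse (F s q)))
        (at s within A)"
      using F(4)[OF sq] assms[OF sq]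
      by (auto simp flip: has_real_derivative_iff_has_vector_derivative
          intro!: derivative_eq_intros simp: field_simps)
    show "((\<lambda>t. inverse (F s t)) has_vector_derivative (- F2 s q) * (inverse (F s q) * inverse (F s q)))
        (at q)"
      using F(5)[OF sq] assms[OF sq]
      by (auto simp flip: has_real_derivative_iff_has_vector_derivative
          intro!: derivative_eq_intros simp: field_simps)
  next
    show "Ck k A J (\<lambda>s q. (- F1 s q) * (inverse (F s q) * inverse (F s q)))"
      "Ck k A J (\<lambda>s q. (- F2 s q) * (inverse (F s q) * inverse (F s q)))"
      using F(2,3) IH Ck_bilinear[OF bounded_bilinear_mult, OF Ck_const[of k A J "-1::real"]]
      by (auto intro!: Ck_bilinear[OF bounded_bilinear_mult])
  qed
qed

lemma smooth2_inverse [smooth2_intros]: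
  fixes F :: "real \<Rightarrow> real \<Rightarrow> real"
  shows "smooth2 A J F \<Longrightarrow> (\<And>s q. s \<in> A \<Longrightarrow> q \<in> J \<Longrightarrow> F s q \<noteq> 0) \<Longrightarrow>
    smooth2 A J (\<lambda>s q. inverse (F s q))"
  by (simp add: smooth2_def Ck_inverse)

lemma smooth2_divide [smooth2_intros]:
  fixes F :: "real \<Rightarrow> real \<Rightarrow> real"
  shows "smooth2 A J F \<Longrightarrow> smooth2 A J G \<Longrightarrow> (\<And>s q. s \<in> A \<Longrightarrow> q \<in> J \<Longrightarrow> G s q \<noteq> 0) \<Longrightarrow>
    smooth2 A J (\<lambda>s q. F s q / G s q)"
  unfolding divide_inverse by (intro smooth2_intros)

lemma Ck_sqrt:
  fixes F :: "real \<Rightarrow> real \<Rightarrow> real"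
  assumes "\<And>s q. s \<in> A \<Longrightarrow> q \<in> J \<Longrightarrow> F s q > 0"
  shows "Ck k A J F \<Longrightarrow> Ck k A J (\<lambda>s q. sqrt (F s q))"
proof (induction k)
  case 0
  then show ?case using assms by (auto simp: case_prod_unfold intro!: continuous_intros)
next
  case (Suc k)
  from Suc.prems(1) obtain F1 F2 where F: "continuous_on (A \<times> J) (\<lambda>(s, q). F s q)"
    "Ck k A J F1" "Ck k A J F2"
    "\<And>s q. s \<in> A \<Longrightarrow> q \<in> J \<Longrightarrow> ((\<lambda>t. F t q) has_vector_derivative F1 s q) (at s within A)"
    "\<And>s q. s \<in> A \<Longrightarrow> q \<in> J \<Longrightarrow> (F s has_vector_derivative F2 s q) (at q)" by (rule Ck_SucE) blast
  note IH = Suc.IH[OF Ck_Suc_imp[OF Suc.prems]]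
  have ne: "2 * sqrt (F s q) \<noteq> 0" if "s \<in> A" "q \<in> J" for s q using assms[OF that] by simp
  show ?case
  proof (rule Ck_SucI[where ?F1.0 = "\<lambda>s q. F1 s q * inverse (2 * sqrt (F s q))"
        and ?F2.0 = "\<lambda>s q. F2 s q * inverse (2 * sqrt (F s q))"])
    show "continuous_on (A \<times> J) (\<lambda>(s, q). sqrt (F s q))"
      using F(1) by (auto simp: case_prod_unfold intro!: continuous_intros)
    fix s q assume sq: "s \<in> A" "q \<in> J"
    show "((\<lambda>t. sqrt (F t q)) has_vector_derivative F1 s q * inverse (2 * sqrt (F s q))) (at s within A)"
      using F(4)[OF sq] assms[OF sq]
      by (auto simp flip: has_real_derivative_iff_has_vector_derivative
          intro!: derivative_eq_intros simp: field_simps)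
    show "((\<lambda>t. sqrt (F s t)) has_vector_derivative F2 s q * inverse (2 * sqrt (F s q))) (at q)"
      using F(5)[OF sq] assms[OF sq]
      by (auto simp flip: has_real_derivative_iff_has_vector_derivative
          intro!: derivative_eq_intros simp: field_simps)
  next
    have "Ck k A J (\<lambda>s q. inverse (2 * sqrt (F s q)))"
      by (intro Ck_inverse ne Ck_bilinear[OF bounded_bilinear_mult] Ck_const IH)
    then show "Ck k A J (\<lambda>s q. F1 s q * inverse (2 * sqrt (F s q)))"
      "Ck k A J (\<lambda>s q. F2 s q * inverse (2 * sqrt (F s q)))"
      using F(2,3) by - (rule Ck_bilinear[OF bounded_bilinear_mult], assumption+)+
  qed
qed

lemma smooth2_sqrt [smooth2_intros]:
  fixes F :: "real \<Rightarrow> real \<Rightarrow> real"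
  shows "smooth2 A J F \<Longrightarrow> (\<And>s q. s \<in> A \<Longrightarrow> q \<in> J \<Longrightarrow> F s q > 0) \<Longrightarrow>
    smooth2 A J (\<lambda>s q. sqrt (F s q))"
  by (simp add: smooth2_def Ck_sqrt)

text \<open>The chain rule replaces \<open>D n\<close> by \<open>D (Suc n)\<close>, so the induction
  on the order has to run over all derivatives of the outer function at once.\<close>

lemma Ck_derivs:
  fixes D :: "nat \<Rightarrow> real \<Rightarrow> 'a::real_normed_vector"
  assumes "\<And>n x. (D n has_vector_derivative D (Suc n) x) (at x)"
  shows "Ck k A J (\<phi> :: real \<Rightarrow> real \<Rightarrow> real) \<Longrightarrow> Ck k A J (\<lambda>s q. D n (\<phi> s q))"
proof (induction k arbitrary: n)
  case 0
  have "continuous_on UNIV (D n)"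
    using assms by (intro continuous_at_imp_continuous_on) (auto intro: has_vector_derivative_continuous)
  from continuous_on_compose2[OF this] 0 show ?case
    by (simp add: case_prod_unfold)
next
  case (Suc k)
  from Suc.prems(1) obtain F1 F2 where F: "continuous_on (A \<times> J) (\<lambda>(s, q). \<phi> s q)"
    "Ck k A J F1" "Ck k A J F2"
    "\<And>s q. s \<in> A \<Longrightarrow> q \<in> J \<Longrightarrow> ((\<lambda>t. \<phi> t q) has_vector_derivative F1 s q) (at s within A)"
    "\<And>s q. s \<in> A \<Longrightarrow> q \<in> J \<Longrightarrow> (\<phi> s has_vector_derivative F2 s q) (at q)" by (rule Ck_SucE) blast
  note IH = Suc.IH[OF Ck_Suc_imp[OF Suc.prems]]
  show ?case
  proof (rule Ck_SucI[where ?F1.0 = "\<lambda>s q. F1 s q *\<^sub>R D (Suc n) (\<phi> s q)"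
        and ?F2.0 = "\<lambda>s q. F2 s q *\<^sub>R D (Suc n) (\<phi> s q)"])
    show "continuous_on (A \<times> J) (\<lambda>(s, q). D n (\<phi> s q))"
      by (rule Ck_continuous[OF IH])
    fix s q assume sq: "s \<in> A" "q \<in> J"
    show "((\<lambda>t. D n (\<phi> t q)) has_vector_derivative F1 s q *\<^sub>R D (Suc n) (\<phi> s q)) (at s within A)"
      using vector_diff_chain_within[OF F(4)[OF sq] has_vector_derivative_at_within[OF assms]]
      by (simp add: comp_def)
    show "((\<lambda>t. D n (\<phi> s t)) has_vector_derivative F2 s q *\<^sub>R D (Suc n) (\<phi> s q)) (at q)"
      using vector_diff_chain_within[OF F(5)[OF sq] has_vector_derivative_at_within[OF assms]]
      by (simp add: comp_def)
  qed (use F(2,3) IH in \<open>auto intro!: Ck_bilinear[OF bounded_bilinear_scaleR]\<close>)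
qed

lemma smooth2_compose1:
  assumes "smooth_fun g" "smooth2 A J \<phi>"
  shows "smooth2 A J (\<lambda>s q. g (\<phi> s q))"
  using assms Ck_derivs unfolding smooth2_def smooth_fun_def by metis

lemma smooth_fun_cis: "smooth_fun cis"
  unfolding smooth_fun_def
proof (intro exI[of _ "\<lambda>n t. \<i> ^ n * cis t"] conjI allI)
  fix n q
  have "((\<lambda>t. exp (\<i> * of_real t)) has_vector_derivative \<i> * exp (\<i> * of_real q)) (at q)"
    by (rule has_vector_derivative_real_field) (auto intro!: derivative_eq_intros)
  from has_vector_derivative_mult_right[OF this, of "\<i> ^ n"]
  show "((\<lambda>t. \<i> ^ n * cis t) has_vector_derivative \<i> ^ Suc n * cis q) (at q)"
    by (simp add: cis_conv_exp mult_ac)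
qed auto

lemmas smooth2_cis [smooth2_intros] = smooth2_compose1[OF smooth_fun_cis]

text \<open>A partial in \<open>s\<close> at the point together with a jointly continuous partial in
  \<open>q\<close> gives a total derivative relative to \<open>A \<times> UNIV\<close>, also at an
  end point of \<open>A\<close>. It is then composed with the curve that sends t to (t, \<phi>
  t).\<close>

lemma chain_rule_family:
  fixes F :: "real \<Rightarrow> real \<Rightarrow> 'a::real_normed_vector"
  assumes F1: "((\<lambda>t. F t (\<phi> s)) has_vector_derivative F1) (at s within A)"
    and F2: "\<And>t x. t \<in> A \<Longrightarrow> (F t has_vector_derivative F2 t x) (at x)"
    and cont: "continuous_on (A \<times> UNIV) (\<lambda>(s, q). F2 s q)"
    and \<phi>: "(\<phi> has_vector_derivative \<phi>') (at s within A)" and s: "s \<in> A"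
  shows "((\<lambda>t. F t (\<phi> t)) has_vector_derivative F1 + \<phi>' *\<^sub>R F2 s (\<phi> s)) (at s within A)"
proof -
  have c: "continuous_on (A \<times> UNIV) (\<lambda>(s, q). blinfun_scaleR_left (F2 s q))"
    using bounded_linear.continuous_on[OF bounded_linear_blinfun_scaleR_left cont]
    by (simp add: case_prod_unfold)
  have "((\<lambda>(x, y). F x y) has_derivative
      (\<lambda>(tx, ty). (\<lambda>h. h *\<^sub>R F1) tx + blinfun_scaleR_left (F2 s (\<phi> s)) ty))
      (at (s, \<phi> s) within A \<times> UNIV)"
  proof (rule has_derivative_partialsI)
    show "((\<lambda>x. F x (\<phi> s)) has_derivative (\<lambda>h. h *\<^sub>R F1)) (at s within A)"
      using F1 by (simp add: has_vector_derivative_def)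
    show "(F x has_derivative blinfun_apply (blinfun_scaleR_left (F2 x y))) (at y)" if "x \<in> A" for x y
      using F2[OF that, of y] unfolding has_vector_derivative_def
      by (simp add: blinfun_scaleR_left.rep_eq)
    show "continuous (at (s, \<phi> s) within A \<times> UNIV) (\<lambda>(x, y). blinfun_scaleR_left (F2 x y))"
      using c s by (auto simp: continuous_on_eq_continuous_within)
  qed auto
  then have d: "((\<lambda>(x, y). F x y) has_derivative
      (\<lambda>(tx, ty). tx *\<^sub>R F1 + ty *\<^sub>R F2 s (\<phi> s))) (at (s, \<phi> s) within (\<lambda>t. (t, \<phi> t)) ` A)"
    unfolding blinfun_scaleR_left.rep_eq by (rule has_derivative_subset) (use s in auto)
  have "((\<lambda>t. (t, \<phi> t)) has_derivative (\<lambda>h. (h, h *\<^sub>R \<phi>'))) (at s within A)"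
    using \<phi> unfolding has_vector_derivative_def by (auto intro!: derivative_eq_intros)
  from diff_chain_within[OF this d]
  show ?thesis
    by (simp add: has_vector_derivative_def comp_def algebra_simps)
qed

lemma Ck_compose:
  fixes F :: "real \<Rightarrow> real \<Rightarrow> 'a::real_normed_vector"
  shows "Ck k A UNIV F \<Longrightarrow> Ck k A J \<phi> \<Longrightarrow> Ck k A J (\<lambda>s q. F s (\<phi> s q))"
proof (induction k arbitrary: F)
  case 0
  then show ?case
    unfolding Ck.simps(1) case_prod_unfold
    by (intro continuous_on_family[of A UNIV F]) (auto intro!: continuous_intros simp: case_prod_unfold)
next
  case (Suc k)
  from Suc.prems(1) obtain F1 F2 where F: "continuous_on (A \<times> UNIV) (\<lambda>(s, q). F s q)"
    "Ck k A UNIV F1" "Ck k A UNIV F2"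
    "\<And>s q. s \<in> A \<Longrightarrow> ((\<lambda>t. F t q) has_vector_derivative F1 s q) (at s within A)"
    "\<And>s q. s \<in> A \<Longrightarrow> (F s has_vector_derivative F2 s q) (at q)"
    by (rule Ck_SucE) blast
  from Suc.prems(2) obtain P1 P2 where P: "continuous_on (A \<times> J) (\<lambda>(s, q). \<phi> s q)"
    "Ck k A J P1" "Ck k A J P2"
    "\<And>s q. s \<in> A \<Longrightarrow> q \<in> J \<Longrightarrow> ((\<lambda>t. \<phi> t q) has_vector_derivative P1 s q) (at s within A)"
    "\<And>s q. s \<in> A \<Longrightarrow> q \<in> J \<Longrightarrow> (\<phi> s has_vector_derivative P2 s q) (at q)" by (rule Ck_SucE) blast
  note \<phi> = Ck_Suc_imp[OF Suc.prems(2)]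
  show ?case
  proof (rule Ck_SucI[where ?F1.0 = "\<lambda>s q. F1 s (\<phi> s q) + P1 s q *\<^sub>R F2 s (\<phi> s q)"
        and ?F2.0 = "\<lambda>s q. P2 s q *\<^sub>R F2 s (\<phi> s q)"])
    show "continuous_on (A \<times> J) (\<lambda>(s, q). F s (\<phi> s q))"
      by (rule Ck_continuous[OF Suc.IH[OF Ck_Suc_imp[OF Suc.prems(1)] \<phi>]])
    fix s q assume sq: "s \<in> A" "q \<in> J"
    show "((\<lambda>t. F t (\<phi> t q)) has_vector_derivative F1 s (\<phi> s q) + P1 s q *\<^sub>R F2 s (\<phi> s q))
        (at s within A)"
      by (rule chain_rule_family) (use F P sq Ck_continuous[OF F(3)] in auto)
    show "((\<lambda>q. F s (\<phi> s q)) has_vector_derivative P2 s q *\<^sub>R F2 s (\<phi> s q)) (at q)"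
      using vector_diff_chain_within[OF P(5)[OF sq]
          has_vector_derivative_at_within[OF F(5)[OF sq(1), of "\<phi> s q"]]]
      by (simp add: comp_def)
  qed (use F P \<phi> in \<open>auto intro!: Suc.IH Ck_add Ck_bilinear[OF bounded_bilinear_scaleR]\<close>)
qed

lemma smooth2_compose:
  "smooth2 A UNIV F \<Longrightarrow> smooth2 A J \<phi> \<Longrightarrow> smooth2 A J (\<lambda>s q. F s (\<phi> s q))"
  by (simp add: smooth2_def Ck_compose)

text \<open>A change of the time variable alone. The derivatives of the time change are taken within
  \<open>B\<close>, so that \<open>A\<close> and \<open>B\<close> may be closed intervals with
  one-sided derivatives at their ends.\<close>

lemma Ck_reparam:
  fixes F :: "real \<Rightarrow> real \<Rightarrow> 'a::real_normed_vector"
  assumes \<tau>: "\<And>n. \<And>s. s \<in> B \<Longrightarrow> (T n has_vector_derivative T (Suc n) s) (at s within B)"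
    "T 0 ` B \<subseteq> A"
  shows "Ck k A J F \<Longrightarrow> Ck k B J (\<lambda>s q. F (T 0 s) q)"
proof (induction k arbitrary: F)
  case 0
  have "continuous_on B (T 0)"
    using \<tau>(1)[of _ 0] by (auto simp: continuous_on_eq_continuous_within
        intro: has_vector_derivative_continuous)
  then have "continuous_on (B \<times> J) (\<lambda>x. T 0 (fst x))"
    by (rule continuous_on_compose2) (auto intro!: continuous_intros)
  then show ?case using 0 \<tau>(2)
    unfolding Ck.simps(1) case_prod_unfold
    by (intro continuous_on_family[of A J F]) (auto intro!: continuous_intros simp: case_prod_unfold)
next
  case (Suc k)
  have T1: "Ck k B J (\<lambda>s q. T n s)" for k n
  proof (induction k arbitrary: n)
    case 0
    have "continuous_on B (T n)"
      using \<tau>(1)[of _ n] by (auto simp: continuous_on_eq_continuous_within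
          intro: has_vector_derivative_continuous)
    then show ?case by (auto simp: case_prod_unfold intro!: continuous_on_compose2[where f = fst] continuous_intros)
  next
    case (Suc k)
    have "continuous_on B (T n)"
      using \<tau>(1)[of _ n] by (auto simp: continuous_on_eq_continuous_within
          intro: has_vector_derivative_continuous)
    then show ?case
      by (intro Ck_SucI[of _ _ _ _ "\<lambda>s q. T (Suc n) s" "\<lambda>s q. 0"])
         (auto simp: case_prod_unfold intro!: Suc Ck_const \<tau> continuous_on_compose2[where f = fst] continuous_intros)
  qed
  from Suc.prems(1) obtain F1 F2 where F: "continuous_on (A \<times> J) (\<lambda>(s, q). F s q)"
    "Ck k A J F1" "Ck k A J F2"
    "\<And>s q. s \<in> A \<Longrightarrow> q \<in> J \<Longrightarrow> ((\<lambda>t. F t q) has_vector_derivative F1 s q) (at s within A)"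
    "\<And>s q. s \<in> A \<Longrightarrow> q \<in> J \<Longrightarrow> (F s has_vector_derivative F2 s q) (at q)"
    by (rule Ck_SucE) blast
  show ?case
  proof (rule Ck_SucI[where ?F1.0 = "\<lambda>s q. T 1 s *\<^sub>R F1 (T 0 s) q" and ?F2.0 = "\<lambda>s q. F2 (T 0 s) q"])
    show "continuous_on (B \<times> J) (\<lambda>(s, q). F (T 0 s) q)"
      by (rule Ck_continuous[OF Suc.IH[OF Ck_Suc_imp[OF Suc.prems(1)]]])
    fix s q assume sq: "s \<in> B" "q \<in> J"
    then have A: "T 0 s \<in> A" using \<tau>(2) by auto
    have "((\<lambda>t. F t q) has_vector_derivative F1 (T 0 s) q) (at (T 0 s) within T 0 ` B)"
      using has_vector_derivative_within_subset[OF F(4)[OF A sq(2)] \<tau>(2)] .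
    from vector_diff_chain_within[OF \<tau>(1)[OF sq(1), of 0] this]
    show "((\<lambda>t. F (T 0 t) q) has_vector_derivative T 1 s *\<^sub>R F1 (T 0 s) q) (at s within B)"
      by (simp add: comp_def)
    show "(F (T 0 s) has_vector_derivative F2 (T 0 s) q) (at q)" using F(5)[OF A sq(2)] .
  qed (use F T1 in \<open>auto intro!: Suc.IH Ck_bilinear[OF bounded_bilinear_scaleR]\<close>)
qed

lemma smooth2_reparam:
  assumes "smooth2 A J F" "smooth_fun \<tau>" "\<tau> ` B \<subseteq> A"
  shows "smooth2 B J (\<lambda>s q. F (\<tau> s) q)"
proof -
  obtain T where "T 0 = \<tau>" "\<And>n q. (T n has_vector_derivative T (Suc n) q) (at q)"
    using assms(2) unfolding smooth_fun_def by blast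
  then show ?thesis using assms(1,3) Ck_reparam[of B T A]
    unfolding smooth2_def by (metis has_vector_derivative_at_within)
qed

section \<open>Canonical partial derivatives and gluing\<close>

definition dt :: "real set \<Rightarrow> (real \<Rightarrow> real \<Rightarrow> 'a::real_normed_vector) \<Rightarrow> real \<Rightarrow> real \<Rightarrow> 'a" where
  "dt A F s q = vector_derivative (\<lambda>t. F t q) (at s within A)"

definition dq :: "(real \<Rightarrow> real \<Rightarrow> 'a::real_normed_vector) \<Rightarrow> real \<Rightarrow> real \<Rightarrow> 'a" where
  "dq F s q = vector_derivative (F s) (at q)"

text \<open>\<open>J\<close> is open because a two-sided derivative in \<open>q\<close> depends on
  values in a whole neighbourhood; the derivative in \<open>s\<close> is already relative to
  \<open>A\<close>.\<close>

lemma Ck_cong: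
  assumes "open J" "\<And>s q. s \<in> A \<Longrightarrow> q \<in> J \<Longrightarrow> F s q = G s q" "Ck k A J F"
  shows "Ck k A J G"
proof (cases k)
  case 0
  have "continuous_on (A \<times> J) (\<lambda>(s, q). G s q) = continuous_on (A \<times> J) (\<lambda>(s, q). F s q)"
    by (rule continuous_on_cong) (use assms(2) in auto)
  then show ?thesis using assms(3) 0 by simp
next
  case (Suc k')
  have c: "continuous_on (A \<times> J) (\<lambda>(s, q). G s q) = continuous_on (A \<times> J) (\<lambda>(s, q). F s q)"
    by (rule continuous_on_cong) (use assms(2) in auto)
  from assms(3)[unfolded Suc] obtain F1 F2 where F: "continuous_on (A \<times> J) (\<lambda>(s, q). F s q)"
    "Ck k' A J F1" "Ck k' A J F2"
    "\<And>s q. s \<in> A \<Longrightarrow> q \<in> J \<Longrightarrow> ((\<lambda>t. F t q) has_vector_derivative F1 s q) (at s within A)"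
    "\<And>s q. s \<in> A \<Longrightarrow> q \<in> J \<Longrightarrow> (F s has_vector_derivative F2 s q) (at q)" by (rule Ck_SucE) blast
  show ?thesis unfolding Suc
  proof (rule Ck_SucI[OF _ F(2,3)])
    fix s q assume sq: "s \<in> A" "q \<in> J"
    show "((\<lambda>t. G t q) has_vector_derivative F1 s q) (at s within A)"
      by (rule has_vector_derivative_transform[OF sq(1) _ F(4)[OF sq]]) (use assms(2) sq in auto)
    show "(G s has_vector_derivative F2 s q) (at q)"
      by (rule has_vector_derivative_transform_within_open[OF F(5)[OF sq] assms(1) sq(2)])
        (use assms(2) sq in auto)
  qed (use c F in simp)
qed

context
  fixes A J :: "real set"
  assumes nt: "\<And>s. s \<in> A \<Longrightarrow> at s within A \<noteq> bot" and J: "open J"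
begin

text \<open>The partials in \<open>Ck\<close> are only asserted to exist. Where no point of
  \<open>A\<close> is isolated, one-sided derivatives are unique, so these partials agree with
  \<open>dt\<close> and \<open>dq\<close> on \<open>A \<times> J\<close>, and smoothness passes to
  those.\<close>

lemma Ck_SucD:
  assumes "Ck (Suc k) A J F"
  shows "Ck k A J (dt A F)" "Ck k A J (dq F)"
    "\<And>s q. s \<in> A \<Longrightarrow> q \<in> J \<Longrightarrow> ((\<lambda>t. F t q) has_vector_derivative dt A F s q) (at s within A)"
    "\<And>s q. s \<in> A \<Longrightarrow> q \<in> J \<Longrightarrow> (F s has_vector_derivative dq F s q) (at q)"
proof -
  from assms obtain F1 F2 where F: "continuous_on (A \<times> J) (\<lambda>(s, q). F s q)"
    "Ck k A J F1" "Ck k A J F2"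
    "\<And>s q. s \<in> A \<Longrightarrow> q \<in> J \<Longrightarrow> ((\<lambda>t. F t q) has_vector_derivative F1 s q) (at s within A)"
    "\<And>s q. s \<in> A \<Longrightarrow> q \<in> J \<Longrightarrow> (F s has_vector_derivative F2 s q) (at q)" by (rule Ck_SucE) blast
  have 1: "F1 s q = dt A F s q" if "s \<in> A" "q \<in> J" for s q
    unfolding dt_def using vector_derivative_within[OF nt F(4)] that by auto
  have 2: "F2 s q = dq F s q" if "s \<in> A" "q \<in> J" for s q
    unfolding dq_def using vector_derivative_at[OF F(5)] that by auto
  show "Ck k A J (dt A F)" by (rule Ck_cong[OF J 1 F(2)])
  show "Ck k A J (dq F)" by (rule Ck_cong[OF J 2 F(3)])
  show "((\<lambda>t. F t q) has_vector_derivative dt A F s q) (at s within A)" if "s \<in> A" "q \<in> J" for s q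
    using F(4) 1 that by metis
  show "(F s has_vector_derivative dq F s q) (at q)" if "s \<in> A" "q \<in> J" for s q
    using F(5) 2 that by metis
qed

lemma smooth2D:
  assumes "smooth2 A J F"
  shows "smooth2 A J (dt A F)" "smooth2 A J (dq F)"
    "\<And>s q. s \<in> A \<Longrightarrow> q \<in> J \<Longrightarrow> ((\<lambda>t. F t q) has_vector_derivative dt A F s q) (at s within A)"
    "\<And>s q. s \<in> A \<Longrightarrow> q \<in> J \<Longrightarrow> (F s has_vector_derivative dq F s q) (at q)"
  using assms Ck_SucD unfolding smooth2_def by blast+

text \<open>The witnesses for the partials may change from one neighbourhood to the next; replacing
  them by \<open>dt A F\<close> and \<open>dq F\<close> provides global witnesses, to which the
  induction hypothesis applies.\<close>

lemma Ck_local: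
  assumes "\<And>s q. s \<in> A \<Longrightarrow> q \<in> J \<Longrightarrow>
    \<exists>U V. open U \<and> open V \<and> s \<in> U \<and> q \<in> V \<and> Ck k (A \<inter> U) V F"
  shows "Ck k A J F"
  using assms
proof (induction k arbitrary: F)
  case 0
  show ?case unfolding Ck.simps continuous_on_eq_continuous_within
  proof safe
    fix s q assume sq: "s \<in> A" "q \<in> J"
    with 0 obtain U V where UV: "open U" "open V" "s \<in> U" "q \<in> V" "Ck 0 (A \<inter> U) V F" by meson
    have "continuous (at (s, q) within (A \<inter> U) \<times> V) (\<lambda>(s, q). F s q)"
      using UV sq by (auto simp: continuous_on_eq_continuous_within)
    then have "continuous (at (s, q) within (A \<inter> U) \<times> (V \<inter> J)) (\<lambda>(s, q). F s q)"
      by (rule continuous_within_subset) auto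
    moreover have "at (s, q) within (A \<inter> U) \<times> (V \<inter> J) = at (s, q) within A \<times> J"
      by (rule at_within_nhd[of _ "U \<times> V"]) (use UV in \<open>auto intro: open_Times\<close>)
    ultimately show "continuous (at (s, q) within A \<times> J) (\<lambda>(s, q). F s q)" by metis
  qed
next
  case (Suc k)
  have loc: "\<exists>U V. open U \<and> open V \<and> s \<in> U \<and> q \<in> V \<and> Ck k (A \<inter> U) V F \<and> Ck k (A \<inter> U) V (dt A F)
      \<and> Ck k (A \<inter> U) V (dq F) \<and> ((\<lambda>t. F t q) has_vector_derivative dt A F s q) (at s within A)
      \<and> (F s has_vector_derivative dq F s q) (at q)" if sq: "s \<in> A" "q \<in> J" for s q
  proof -
    from Suc.prems[OF sq] obtain U V
      where UV: "open U" "open V" "s \<in> U" "q \<in> V" "Ck (Suc k) (A \<inter> U) V F" by meson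
    have w: "at s within (A \<inter> U) = at s within A" if "s \<in> U" for s
      by (rule at_within_nhd[of _ U]) (use UV that in auto)
    from UV(5) obtain F1 F2 where F: "continuous_on ((A \<inter> U) \<times> V) (\<lambda>(s, q). F s q)"
      "Ck k (A \<inter> U) V F1" "Ck k (A \<inter> U) V F2"
      "\<And>s q. s \<in> A \<inter> U \<Longrightarrow> q \<in> V \<Longrightarrow>
         ((\<lambda>t. F t q) has_vector_derivative F1 s q) (at s within (A \<inter> U))"
      "\<And>s q. s \<in> A \<inter> U \<Longrightarrow> q \<in> V \<Longrightarrow> (F s has_vector_derivative F2 s q) (at q)"
      by (rule Ck_SucE) blast
    have 1: "F1 s q = dt A F s q" if sq: "s \<in> A \<inter> U" "q \<in> V" for s q
    proof -
      have "at s within (A \<inter> U) = at s within A" "at s within A \<noteq> bot" using w nt sq by auto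
      then show ?thesis
        unfolding dt_def using vector_derivative_within F(4)[OF sq] by metis
    qed
    have 2: "F2 s q = dq F s q" if "s \<in> A \<inter> U" "q \<in> V" for s q
      unfolding dq_def using vector_derivative_at[OF F(5)] that by auto
    have "Ck k (A \<inter> U) V (dt A F)" by (rule Ck_cong[OF UV(2) 1 F(2)])
    moreover have "Ck k (A \<inter> U) V (dq F)" by (rule Ck_cong[OF UV(2) 2 F(3)])
    moreover have "((\<lambda>t. F t q) has_vector_derivative dt A F s q) (at s within A)"
      using F(4) 1 sq UV w by (metis IntI)
    moreover have "(F s has_vector_derivative dq F s q) (at q)"
      using F(5) 2 sq UV by (metis IntI)
    ultimately show ?thesis using UV Ck_Suc_imp by blast
  qed
  show ?case
  proof (rule Ck_SucI[where ?F1.0 = "dt A F" and ?F2.0 = "dq F"])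
    have "Ck k A J F" by (rule Suc.IH) (use loc in meson)
    then show "continuous_on (A \<times> J) (\<lambda>(s, q). F s q)" by (rule Ck_continuous)
    show "Ck k A J (dt A F)" by (rule Suc.IH) (use loc in meson)
    show "Ck k A J (dq F)" by (rule Suc.IH) (use loc in meson)
  qed (use loc in meson)+
qed

lemma smooth2_local:
  assumes "\<And>s q. s \<in> A \<Longrightarrow> q \<in> J \<Longrightarrow>
    \<exists>U V. open U \<and> open V \<and> s \<in> U \<and> q \<in> V \<and> smooth2 (A \<inter> U) V F"
  shows "smooth2 A J F"
  unfolding smooth2_def
proof
  fix k
  show "Ck k A J F"
    by (rule Ck_local) (use assms in \<open>unfold smooth2_def, meson\<close>)
qed

end

lemma smooth2_cong:
  assumes "open J" "\<And>s q. s \<in> A \<Longrightarrow> q \<in> J \<Longrightarrow> F s q = G s q" "smooth2 A J F"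
  shows "smooth2 A J G"
  using assms Ck_cong unfolding smooth2_def by blast

lemma smooth2_subset:
  assumes "smooth2 A J F" "B \<subseteq> A" "V \<subseteq> J"
  shows "smooth2 B V F"
proof -
  have "Ck k A J F \<Longrightarrow> Ck k B V F" for k
  proof (induction k arbitrary: F)
    case 0
    have "B \<times> V \<subseteq> A \<times> J" using assms by auto
    with 0 show ?case using continuous_on_subset by auto
  next
    case (Suc k)
    from Suc.prems obtain F1 F2 where F: "continuous_on (A \<times> J) (\<lambda>(s, q). F s q)"
      "Ck k A J F1" "Ck k A J F2"
      "\<And>s q. s \<in> A \<Longrightarrow> q \<in> J \<Longrightarrow> ((\<lambda>t. F t q) has_vector_derivative F1 s q) (at s within A)"
      "\<And>s q. s \<in> A \<Longrightarrow> q \<in> J \<Longrightarrow> (F s has_vector_derivative F2 s q) (at q)"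
      by (rule Ck_SucE) blast
    have s: "B \<times> V \<subseteq> A \<times> J" using assms by auto
    show ?case
    proof (rule Ck_SucI[OF _ Suc.IH[OF F(2)] Suc.IH[OF F(3)]])
      show "continuous_on (B \<times> V) (\<lambda>(s, q). F s q)" by (rule continuous_on_subset[OF F(1) s])
      fix s q assume "s \<in> B" "q \<in> V"
      then have sq: "s \<in> A" "q \<in> J" using assms by auto
      show "((\<lambda>t. F t q) has_vector_derivative F1 s q) (at s within B)"
        by (rule has_vector_derivative_within_subset[OF F(4)[OF sq] assms(2)])
      show "(F s has_vector_derivative F2 s q) (at q)" by (rule F(5)[OF sq])
    qed
  qed
  then show ?thesis using assms(1) unfolding smooth2_def by blast
qed

section \<open>Integrals with a parameter and mixed partial derivatives\<close>

context
  fixes A :: "real set"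
  assumes nt: "\<And>s. s \<in> A \<Longrightarrow> at s within A \<noteq> bot" and A: "convex A"
begin

lemma smooth2_integral_param:
  fixes F :: "real \<Rightarrow> real \<Rightarrow> 'a::banach"
  assumes "smooth2 A UNIV F" "s \<in> A"
  shows "((\<lambda>s. integral {a..b} (F s)) has_vector_derivative integral {a..b} (dt A F s)) (at s within A)"
proof -
  have c: "continuous_on (A \<times> {a..b}) (\<lambda>(s, q). dt A F s q)"
    by (rule continuous_on_subset[OF smooth2_continuous[OF smooth2D(1)[OF nt open_UNIV assms(1)]]])
      auto
  have i: "F s integrable_on {a..b}" if "s \<in> A" for s
    using smooth2D(4)[OF nt open_UNIV assms(1) that]
    by (intro integrable_continuous_real continuous_at_imp_continuous_on ballI)
       (auto intro: has_vector_derivative_continuous)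
  show ?thesis
    using leibniz_rule_vector_derivative[of A a b F "dt A F" s] c i A assms(2)
      smooth2D(3)[OF nt open_UNIV assms(1)]
    by (simp add: cbox_interval)
qed

lemma smooth2_FTC:
  fixes F :: "real \<Rightarrow> real \<Rightarrow> 'a::banach"
  assumes "smooth2 A UNIV F" "s \<in> A" "a < x"
  shows "((\<lambda>x. integral {a..x} (F s)) has_vector_derivative F s x) (at x)"
proof -
  have c: "continuous_on {a..x + 1} (F s)"
    using smooth2D(4)[OF nt open_UNIV assms(1,2)]
    by (intro continuous_at_imp_continuous_on ballI) (auto intro: has_vector_derivative_continuous)
  have "((\<lambda>x. integral {a..x} (F s)) has_vector_derivative F s x) (at x within {a..x + 1})"
    by (rule integral_has_vector_derivative[OF c]) (use assms in auto)
  then show ?thesis using at_within_Icc_at[of a x "x + 1"] assms(3) by simp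
qed

text \<open>Symmetry of mixed partials: write F s x - F s a as the integral of
  \<open>dq F s\<close>, differentiate in \<open>s\<close> under the integral, and recover the
  integrand by differentiating in the upper limit.\<close>

lemma smooth2_deriv_commute:
  fixes F :: "real \<Rightarrow> real \<Rightarrow> 'a::banach"
  assumes F: "smooth2 A UNIV F" and s: "s \<in> A"
  shows "dq (dt A F) s q = dt A (dq F) s q"
proof -
  note D = smooth2D[OF nt open_UNIV F, simplified]
  \<comment> \<open>The base point lies strictly left of \<open>q\<close>, so that \<open>q\<close>
    is interior to the range of the upper limit and the resulting derivative is two-sided.\<close>
  define a where "a = q - 1"
  have e: "integral {a..x} (dq F s) = F s x - F s a" if "x \<ge> a" "s \<in> A" for x s
    by (rule integral_unique, rule fundamental_theorem_of_calculus)
      (use that D(4) in \<open>auto intro: has_vector_derivative_at_within\<close>)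
  have e1: "dt A F s x = dt A F s a + integral {a..x} (dt A (dq F) s)" if "x \<ge> a" for x
  proof -
    have "((\<lambda>s. F s x - F s a) has_vector_derivative dt A F s x - dt A F s a) (at s within A)"
      using D(3)[OF s] by (auto intro!: derivative_eq_intros)
    moreover have "((\<lambda>s. F s x - F s a) has_vector_derivative integral {a..x} (dt A (dq F) s))
        (at s within A)"
      by (rule has_vector_derivative_transform[OF s _ smooth2_integral_param[OF D(2) s, of a x]])
        (use e that in auto)
    ultimately have "dt A F s x - dt A F s a = integral {a..x} (dt A (dq F) s)"
      using vector_derivative_unique_within nt s by blast
    then show ?thesis by (simp add: algebra_simps)
  qed
  have e2: "dt A F s a + integral {a..x} (dt A (dq F) s) = dt A F s x" if "x \<in> {a<..}" for x
    using e1[of x] that by simp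
  have "((\<lambda>x. integral {a..x} (dt A (dq F) s)) has_vector_derivative dt A (dq F) s q) (at q)"
    using smooth2_FTC[OF smooth2D(1)[OF nt open_UNIV D(2)] s, of a q] by (simp add: a_def)
  from has_vector_derivative_add[OF has_vector_derivative_const this, of "dt A F s a"]
  have "((\<lambda>x. dt A F s a + integral {a..x} (dt A (dq F) s)) has_vector_derivative dt A (dq F) s q) (at q)"
    by simp
  from has_vector_derivative_transform_within_open[OF this open_greaterThan[of a] _ e2]
  have "(dt A F s has_vector_derivative dt A (dq F) s q) (at q)" by (simp add: a_def)
  then show ?thesis unfolding dq_def by (rule vector_derivative_at)
qed

text \<open>The table of partials is obtained by iterating \<open>dq\<close> and then
  \<open>dt\<close>. Its derivative in \<open>q\<close> has to be moved past all the
  \<open>dt\<close>, which is where the symmetry of mixed partials enters.\<close>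

lemma smooth_family_onI:
  assumes F: "smooth2 A UNIV F"
  shows "smooth_family_on A F"
proof -
  define D where "D i j = (dt A ^^ i) ((dq ^^ j) F)" for i j :: nat
  have sq: "smooth2 A UNIV ((dq ^^ j) F)" for j
    by (induction j) (auto intro: F smooth2D(2)[OF nt open_UNIV])
  have sm: "smooth2 A UNIV (D i j)" for i j
    unfolding D_def by (induction i) (auto intro: sq smooth2D(1)[OF nt open_UNIV])
  have "dq (D i j) s q = D i (Suc j) s q" if "s \<in> A" for i j s q
    using that
  proof (induction i arbitrary: s q)
    case 0
    show ?case unfolding D_def by simp
  next
    case (Suc i)
    have "dq (D (Suc i) j) s q = dt A (dq (D i j)) s q"
      using smooth2_deriv_commute[OF sm Suc.prems] by (simp add: D_def)
    also have "\<dots> = dt A (D i (Suc j)) s q"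
      unfolding dt_def
      by (rule vector_derivative_cong_eq) (use Suc.IH Suc.prems in \<open>auto simp: eventually_at_filter\<close>)
    also have "\<dots> = D (Suc i) (Suc j) s q" unfolding D_def by simp
    finally show ?case .
  qed
  note comm = this
  have c: "continuous_on (A \<times> UNIV) (\<lambda>(s, q). D i j s q)" for i j
    by (rule smooth2_continuous[OF sm])
  have d1: "((\<lambda>t. D i j t q) has_vector_derivative D (Suc i) j s q) (at s within A)"
    if "s \<in> A" for i j s q
  proof -
    have "D (Suc i) j s q = dt A (D i j) s q" unfolding D_def by simp
    then show ?thesis using smooth2D(3)[OF nt open_UNIV sm that UNIV_I] by metis
  qed
  have d2: "(D i j s has_vector_derivative D i (Suc j) s q) (at q)" if "s \<in> A" for i j s q
    using smooth2D(4)[OF nt open_UNIV sm that UNIV_I] comm[OF that] by metis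
  have "D 0 0 = F" unfolding D_def by simp
  then show ?thesis unfolding smooth_family_on_def using c d1 d2 by blast
qed

end

lemma smooth2_of_smooth_family:
  assumes "smooth_family_on A F"
  shows "smooth2 A UNIV F"
proof -
  obtain D where D: "D 0 0 = F" "\<And>i j. continuous_on (A \<times> UNIV) (\<lambda>(s, q). D i j s q)"
    "\<And>i j s q. s \<in> A \<Longrightarrow> ((\<lambda>t. D i j t q) has_vector_derivative D (Suc i) j s q) (at s within A)"
    "\<And>i j s q. s \<in> A \<Longrightarrow> (D i j s has_vector_derivative D i (Suc j) s q) (at q)"
    using assms unfolding smooth_family_on_def by metis
  have "Ck k A UNIV (D i j)" for k i j
  proof (induction k arbitrary: i j)
    case (Suc k)
    show ?case by (rule Ck_SucI[OF _ Suc[of "Suc i" j] Suc[of i "Suc j"]]) (use D in auto)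
  qed (use D in auto)
  then show ?thesis unfolding smooth2_def D(1)[symmetric] by blast
qed

lemma smooth2_of_smooth_fun:
  assumes "smooth_fun g" shows "smooth2 A J (\<lambda>s q. g q)"
  using smooth2_compose1[OF assms smooth2_snd] .

lemma smooth_fun_of_smooth2:
  assumes "smooth2 A UNIV F" "s \<in> A" "\<And>s. s \<in> A \<Longrightarrow> at s within A \<noteq> bot"
  shows "smooth_fun (F s)"
proof -
  have sq: "smooth2 A UNIV ((dq ^^ j) F)" for j
    by (induction j) (auto intro: assms(1) smooth2D(2)[OF assms(3) open_UNIV])
  show ?thesis unfolding smooth_fun_def
    by (intro exI[of _ "\<lambda>j. (dq ^^ j) F s"])
      (use smooth2D(4)[OF assms(3) open_UNIV sq] assms(2) in auto)
qed

lemma smooth_funI: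
  assumes "smooth2 UNIV UNIV (\<lambda>s. F)" shows "smooth_fun F"
  using smooth_fun_of_smooth2[OF assms, of 0] by simp

section \<open>Primitives and inverse functions depending on a parameter\<close>

context
  fixes A :: "real set"
  assumes nt: "\<And>s. s \<in> A \<Longrightarrow> at s within A \<noteq> bot" and A: "convex A"
begin

text \<open>As in the chain rule above, one continuous partial yields total differentiability, and
  this yields joint continuity.\<close>

lemma continuous_on_of_partials:
  fixes F :: "real \<Rightarrow> real \<Rightarrow> 'a::real_normed_vector"
  assumes "\<And>s q. s \<in> A \<Longrightarrow> ((\<lambda>t. F t q) has_vector_derivative F1 s q) (at s within A)"
    and F2: "\<And>s q. s \<in> A \<Longrightarrow> (F s has_vector_derivative F2 s q) (at q)"
    and cont: "continuous_on (A \<times> UNIV) (\<lambda>(s, q). F2 s q)"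
  shows "continuous_on (A \<times> UNIV) (\<lambda>(s, q). F s q)"
  unfolding continuous_on_eq_continuous_within
proof safe
  fix s q assume s: "s \<in> A"
  have c: "continuous_on (A \<times> UNIV) (\<lambda>(s, q). blinfun_scaleR_left (F2 s q))"
    using bounded_linear.continuous_on[OF bounded_linear_blinfun_scaleR_left cont]
    by (simp add: case_prod_unfold)
  have "((\<lambda>(x, y). F x y) has_derivative
      (\<lambda>(tx, ty). (\<lambda>h. h *\<^sub>R F1 s q) tx + blinfun_scaleR_left (F2 s q) ty))
      (at (s, q) within A \<times> UNIV)"
  proof (rule has_derivative_partialsI)
    show "((\<lambda>x. F x q) has_derivative (\<lambda>h. h *\<^sub>R F1 s q)) (at s within A)"
      using assms(1)[OF s] by (simp add: has_vector_derivative_def)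
    show "(F x has_derivative blinfun_apply (blinfun_scaleR_left (F2 x y))) (at y)" if "x \<in> A" for x y
      using F2[OF that, of y] unfolding has_vector_derivative_def
      by (simp add: blinfun_scaleR_left.rep_eq)
    show "continuous (at (s, q) within A \<times> UNIV) (\<lambda>(x, y). blinfun_scaleR_left (F2 x y))"
      using c s by (auto simp: continuous_on_eq_continuous_within)
  qed auto
  then show "continuous (at (s, q) within A \<times> UNIV) (\<lambda>(x, y). F x y)"
    by (rule has_derivative_continuous)
qed

text \<open>The difference of two integrals is the signed integral from 0 to \<open>q\<close>, one
  of the two intervals being empty or a point. The partial in \<open>s\<close> is the primitive of
  \<open>dt A F\<close> and the partial in \<open>q\<close> is \<open>F\<close>, so the induction on
  the order closes up.\<close>

lemma smooth2_primitive:
  fixes F :: "real \<Rightarrow> real \<Rightarrow> 'a::banach"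
  assumes F: "smooth2 A UNIV F"
  defines "P \<equiv> \<lambda>s q. integral {0..q} (F s) - integral {q..0} (F s)"
  shows "smooth2 A UNIV P"
    and "\<And>s q. s \<in> A \<Longrightarrow> (P s has_vector_derivative F s q) (at q)"
    and "\<And>s. P s 0 = 0"
proof -
  define I where "I F s q = integral {0..q} (F s) - integral {q..0} (F s)"
    for F :: "real \<Rightarrow> real \<Rightarrow> 'a" and s q
  have cont: "continuous_on S (F s)" if "smooth2 A UNIV F" "s \<in> A" for F :: "real \<Rightarrow> real \<Rightarrow> 'a" and s S
    using smooth2D(4)[OF nt open_UNIV that]
    by (intro continuous_at_imp_continuous_on ballI) (auto intro: has_vector_derivative_continuous)
  have I2: "(I F s has_vector_derivative F s q) (at q)"
    if F: "smooth2 A UNIV F" and s: "s \<in> A" for F s q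
  proof -
    \<comment> \<open>Near \<open>q\<close> the signed integral is rewritten with one base point
      \<open>-b\<close>, left of both 0 and \<open>q\<close>, to which the fundamental theorem
      applies.\<close>
    define b where "b = \<bar>q\<bar> + 1"
    have b: "- b < q" "b > 0" by (auto simp: b_def)
    have e: "integral {-b..x} (F s) - integral {-b..0} (F s) = I F s x" if "x \<in> {-b<..}" for x
    proof (cases "x \<ge> 0")
      case True
      have "integral {-b..0} (F s) + integral {0..x} (F s) = integral {-b..x} (F s)"
        by (rule Henstock_Kurzweil_Integration.integral_combine)
          (use that b True in \<open>auto intro!: integrable_continuous_real cont[OF F s]\<close>)
      moreover have "integral {x..0} (F s) = 0"
        using True by (cases "x = 0") auto
      ultimately show ?thesis by (simp add: I_def algebra_simps)
    next
      case False
      have "integral {-b..x} (F s) + integral {x..0} (F s) = integral {-b..0} (F s)"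
        by (rule Henstock_Kurzweil_Integration.integral_combine)
          (use that b False in \<open>auto intro!: integrable_continuous_real cont[OF F s]\<close>)
      then have "integral {-b..x} (F s) - integral {-b..0} (F s) = - integral {x..0} (F s)"
        by (simp add: algebra_simps)
      then show ?thesis using False by (simp add: I_def)
    qed
    have "((\<lambda>x. integral {-b..x} (F s)) has_vector_derivative F s q) (at q)"
      by (rule smooth2_FTC[OF nt A F s b(1)])
    from has_vector_derivative_diff[OF this has_vector_derivative_const]
    have "((\<lambda>x. integral {-b..x} (F s) - integral {-b..0} (F s)) has_vector_derivative F s q) (at q)"
      by simp
    from has_vector_derivative_transform_within_open[OF this open_greaterThan[of "-b"] _ e]
    show ?thesis using b by simp
  qed
  have I1: "((\<lambda>s. I F s q) has_vector_derivative I (dt A F) s q) (at s within A)"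
    if "smooth2 A UNIV F" "s \<in> A" for F s q
    unfolding I_def
    by (intro has_vector_derivative_diff smooth2_integral_param[OF nt A that])
  have "smooth2 A UNIV F \<Longrightarrow> Ck k A UNIV (I F)" for k F
  proof (induction k arbitrary: F)
    case 0
    show ?case unfolding Ck.simps
      by (rule continuous_on_of_partials[of _ "I (dt A F)" F])
         (use 0 I1 I2 smooth2_continuous in auto)
  next
    case (Suc k)
    note F = Suc.prems
    show ?case
    proof (rule Ck_SucI[where ?F1.0 = "I (dt A F)" and ?F2.0 = F])
      show "continuous_on (A \<times> UNIV) (\<lambda>(s, q). I F s q)"
        by (rule continuous_on_of_partials[of _ "I (dt A F)" F])
           (use F I1 I2 smooth2_continuous in auto)
      show "Ck k A UNIV (I (dt A F))" by (rule Suc.IH[OF smooth2D(1)[OF nt open_UNIV F]])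
      show "Ck k A UNIV F" using F unfolding smooth2_def by blast
    qed (use I1[OF F] I2[OF F] in auto)
  qed
  then have "smooth2 A UNIV (I F)" using F unfolding smooth2_def by blast
  moreover have "I F = P" by (simp add: I_def P_def fun_eq_iff)
  ultimately show "smooth2 A UNIV P" by simp
  show "(P s has_vector_derivative F s q) (at q)" if "s \<in> A" for s q
    using I2[OF F that] \<open>I F = P\<close> by simp
  show "P s 0 = 0" for s by (simp add: P_def)
qed

text \<open>The inverse function theorem fibre by fibre, with smooth dependence on the parameter.
  Since each \<sigma> s is strictly increasing, the inverse is global and its continuity is
  elementary; the usual formulas for the partials of \<open>U\<close> then raise the order step by
  step.\<close>

lemma smooth2_inverse_family:
  fixes \<sigma> U :: "real \<Rightarrow> real \<Rightarrow> real"
  assumes \<sigma>: "smooth2 A UNIV \<sigma>" and pos: "\<And>s q. s \<in> A \<Longrightarrow> dq \<sigma> s q > 0"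
    and U: "\<And>s q. s \<in> A \<Longrightarrow> \<sigma> s (U s q) = q"
  shows "smooth2 A UNIV U"
    and "\<And>s q. s \<in> A \<Longrightarrow> U s (\<sigma> s q) = q"
    and "\<And>s q. s \<in> A \<Longrightarrow> (U s has_real_derivative inverse (dq \<sigma> s (U s q))) (at q)"
proof -
  note D = smooth2D[OF nt open_UNIV \<sigma>, simplified]
  have d2: "(\<sigma> s has_real_derivative dq \<sigma> s q) (at q)" if "s \<in> A" for s q
    using D(4)[OF that] by (simp add: has_real_derivative_iff_has_vector_derivative)
  have mono: "\<sigma> s x < \<sigma> s y" if "s \<in> A" "x < y" for s x y
    using DERIV_pos_imp_increasing[OF that(2)] d2 pos that(1) by meson
  have mono': "\<sigma> s x < \<sigma> s y \<longleftrightarrow> x < y" if "s \<in> A" for s x y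
    using mono[OF that, of x y] mono[OF that, of y x] by (metis less_asym linorder_neqE_linordered_idom order_less_irrefl)
  show inv: "U s (\<sigma> s q) = q" if "s \<in> A" for s q
    using U[OF that, of "\<sigma> s q"] mono'[OF that] by (metis linorder_neqE_linordered_idom order_less_irrefl)
  have cont: "continuous_on (A \<times> UNIV) (\<lambda>(s, q). U s q)"
    unfolding continuous_on_def
  proof safe
    fix s q assume s: "s \<in> A"
    show "((\<lambda>(s, q). U s q) \<longlongrightarrow> U s q) (at (s, q) within A \<times> UNIV)"
    proof (rule tendstoI)
      fix e :: real assume e: "e > 0"
      have c: "((\<lambda>(t, x). \<sigma> t a - x) \<longlongrightarrow> \<sigma> s a - q) (at (s, q) within A \<times> UNIV)" for a
      proof -
        have "continuous_on (A \<times> UNIV) (\<lambda>x. \<sigma> (fst x) a - snd x)"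
          by (intro continuous_intros continuous_on_family[OF smooth2_continuous[OF \<sigma>]]) auto
        then show ?thesis using s by (auto simp: continuous_on_def case_prod_unfold)
      qed
      \<comment> \<open>These strict inequalities persist for nearby (t, y), and monotonicity then
        traps U t y between U s q - e and U s q + e.\<close>
      have l: "\<sigma> s (U s q - e) - q < 0" "\<sigma> s (U s q + e) - q > 0"
        using mono[OF s, of "U s q - e" "U s q"] mono[OF s, of "U s q" "U s q + e"] U[OF s] e by auto
      have "\<forall>\<^sub>F x in at (s, q) within A \<times> UNIV. x \<in> A \<times> UNIV"
        by (simp add: eventually_at_filter)
      then show "\<forall>\<^sub>F x in at (s, q) within A \<times> UNIV. dist (case x of (s, q) \<Rightarrow> U s q) (U s q) < e"
        using order_tendstoD(2)[OF c l(1)] order_tendstoD(1)[OF c l(2)]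
      proof eventually_elim
        case (elim x)
        obtain t y where x: "x = (t, y)" by (cases x)
        have t: "t \<in> A" using elim x by auto
        have "\<sigma> t (U s q - e) < \<sigma> t (U t y)" "\<sigma> t (U t y) < \<sigma> t (U s q + e)"
          using elim x U[OF t] by auto
        then show ?case using mono'[OF t] x by (auto simp: dist_real_def)
      qed
    qed
  qed
  show d_q: "(U s has_real_derivative inverse (dq \<sigma> s (U s q))) (at q)" if s: "s \<in> A" for s q
  proof (rule DERIV_inverse_function[where a = "q - 1" and b = "q + 1"])
    show "DERIV (\<sigma> s) (U s q) :> dq \<sigma> s (U s q)" using d2[OF s] .
    have "continuous_on UNIV (U s)"
      using continuous_on_family[OF cont, of UNIV "\<lambda>_. s" "\<lambda>x. x"] s by auto
    then show "isCont (U s) q" by (simp add: continuous_on_eq_continuous_at)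
  qed (use pos[OF s, of "U s q"] U[OF s] in auto)
  have d_s: "((\<lambda>t. U t q) has_real_derivative - dt A \<sigma> s (U s q) * inverse (dq \<sigma> s (U s q))) (at s within A)"
    if s: "s \<in> A" for s q
  proof -
    \<comment> \<open>The mean value theorem expresses the increment of \<open>U\<close> in
      \<open>t\<close> exactly through the increment of \<sigma>; the intermediate point tends to
      \<open>U s q\<close> because \<open>U\<close> is continuous.\<close>
    have "\<exists>\<xi>. \<bar>\<xi> - U s q\<bar> \<le> \<bar>U t q - U s q\<bar> \<and> q - \<sigma> t (U s q) = dq \<sigma> t \<xi> * (U t q - U s q)"
      if t: "t \<in> A" for t
    proof (cases "U t q" "U s q" rule: linorder_cases)
      case less
      from MVT2[OF less, of "\<sigma> t" "dq \<sigma> t"] d2[OF t] obtain \<xi> where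
        "U t q < \<xi>" "\<xi> < U s q" "\<sigma> t (U s q) - \<sigma> t (U t q) = (U s q - U t q) * dq \<sigma> t \<xi>" by blast
      then show ?thesis using U[OF t] by (intro exI[of _ \<xi>]) (auto simp: algebra_simps)
    next
      case equal
      then show ?thesis using U[OF t, of q] by auto
    next
      case greater
      from MVT2[OF greater, of "\<sigma> t" "dq \<sigma> t"] d2[OF t] obtain \<xi> where
        "U s q < \<xi>" "\<xi> < U t q" "\<sigma> t (U t q) - \<sigma> t (U s q) = (U t q - U s q) * dq \<sigma> t \<xi>" by blast
      then show ?thesis using U[OF t] by (intro exI[of _ \<xi>]) (auto simp: algebra_simps)
    qed
    then obtain \<xi> where \<xi>: "\<And>t. t \<in> A \<Longrightarrow> \<bar>\<xi> t - U s q\<bar> \<le> \<bar>U t q - U s q\<bar>"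
      "\<And>t. t \<in> A \<Longrightarrow> q - \<sigma> t (U s q) = dq \<sigma> t (\<xi> t) * (U t q - U s q)" by metis
    have "continuous_on A (\<lambda>t. U t q)"
      by (rule continuous_on_family[OF cont]) (auto intro!: continuous_intros)
    then have Ul: "((\<lambda>t. U t q) \<longlongrightarrow> U s q) (at s within A)" using s by (simp add: continuous_on_def)
    have ev: "\<forall>\<^sub>F t in at s within A. t \<in> A" by (simp add: eventually_at_filter)
    have "((\<lambda>t. \<xi> t - U s q) \<longlongrightarrow> 0) (at s within A)"
    proof (rule Lim_null_comparison)
      show "\<forall>\<^sub>F t in at s within A. norm (\<xi> t - U s q) \<le> \<bar>U t q - U s q\<bar>"
        using ev by eventually_elim (use \<xi>(1) in auto)
      show "((\<lambda>t. \<bar>U t q - U s q\<bar>) \<longlongrightarrow> 0) (at s within A)"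
        using tendsto_rabs[OF tendsto_diff[OF Ul tendsto_const[of "U s q"]]] by simp
    qed
    then have \<xi>l: "(\<xi> \<longlongrightarrow> U s q) (at s within A)" by (simp add: LIM_zero_iff)
    have dl: "((\<lambda>t. dq \<sigma> t (\<xi> t)) \<longlongrightarrow> dq \<sigma> s (U s q)) (at s within A)"
    proof -
      have "((\<lambda>x. dq \<sigma> (fst x) (snd x)) \<longlongrightarrow> dq \<sigma> s (U s q)) (at (s, U s q) within A \<times> UNIV)"
        using smooth2_continuous[OF D(2)] s by (auto simp: continuous_on_def case_prod_unfold)
      moreover have "filterlim (\<lambda>t. (t, \<xi> t)) (at (s, U s q) within A \<times> UNIV) (at s within A)"
        unfolding filterlim_at
      proof
        show "((\<lambda>t. (t, \<xi> t)) \<longlongrightarrow> (s, U s q)) (at s within A)"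
          by (intro tendsto_Pair \<xi>l tendsto_ident_at)
        show "\<forall>\<^sub>F x in at s within A. (x, \<xi> x) \<in> A \<times> UNIV \<and> (x, \<xi> x) \<noteq> (s, U s q)"
          by (auto simp: eventually_at_filter)
      qed
      ultimately show ?thesis by (auto dest: filterlim_compose)
    qed
    have "((\<lambda>t. (\<sigma> t (U s q) - \<sigma> s (U s q)) / (t - s)) \<longlongrightarrow> dt A \<sigma> s (U s q)) (at s within A)"
      using D(3)[OF s, of "U s q"]
      by (simp add: has_real_derivative_iff_has_vector_derivative[symmetric] has_field_derivative_iff)
    then have "((\<lambda>t. - ((\<sigma> t (U s q) - \<sigma> s (U s q)) / (t - s)) * inverse (dq \<sigma> t (\<xi> t))) \<longlongrightarrow>
        - dt A \<sigma> s (U s q) * inverse (dq \<sigma> s (U s q))) (at s within A)"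
      by (intro tendsto_intros dl) (use pos[OF s, of "U s q"] in auto)
    moreover have "\<forall>\<^sub>F t in at s within A. - ((\<sigma> t (U s q) - \<sigma> s (U s q)) / (t - s)) * inverse (dq \<sigma> t (\<xi> t))
        = (U t q - U s q) / (t - s)"
      using ev
    proof eventually_elim
      case (elim t)
      have p: "dq \<sigma> t (\<xi> t) \<noteq> 0" using pos[OF elim, of "\<xi> t"] by simp
      have "(\<sigma> s (U s q) - \<sigma> t (U s q)) * inverse (dq \<sigma> t (\<xi> t)) = U t q - U s q"
        unfolding U[OF s] \<xi>(2)[OF elim] using p by simp
      then have e: "U t q - U s q = (\<sigma> s (U s q) - \<sigma> t (U s q)) * inverse (dq \<sigma> t (\<xi> t))" by (rule sym)
      show ?case unfolding e by (simp only: minus_divide_left minus_diff_eq times_divide_eq_left)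
    qed
    ultimately show ?thesis unfolding has_field_derivative_iff
      by (rule Lim_transform_eventually)
  qed
  \<comment> \<open>Bootstrapping: both partials of \<open>U\<close> are expressions in
    \<open>U\<close> and the smooth partials of \<sigma>, so order \<open>k\<close> for
    \<open>U\<close> gives order \<open>Suc k\<close>.\<close>
  have "Ck k A UNIV U" for k
  proof (induction k)
    case (Suc k)
    have c: "Ck k A UNIV (\<lambda>s q. dq \<sigma> s (U s q))" "Ck k A UNIV (\<lambda>s q. dt A \<sigma> s (U s q))"
      using D(1,2) Suc by (auto simp: smooth2_def intro: Ck_compose)
    have i: "Ck k A UNIV (\<lambda>s q. inverse (dq \<sigma> s (U s q)))"
      by (rule Ck_inverse[OF _ c(1)]) (use pos in \<open>auto simp: less_imp_neq[symmetric]\<close>)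
    show ?case
    proof (rule Ck_SucI)
      show "Ck k A UNIV (\<lambda>s q. (- 1) * (dt A \<sigma> s (U s q) * inverse (dq \<sigma> s (U s q))))"
        by (intro Ck_bilinear[OF bounded_bilinear_mult] c i Ck_const)
      show "Ck k A UNIV (\<lambda>s q. inverse (dq \<sigma> s (U s q)))" by (rule i)
    qed (use cont d_q d_s in \<open>auto simp: has_real_derivative_iff_has_vector_derivative[symmetric]\<close>)
  qed (use cont in auto)
  then show "smooth2 A UNIV U" unfolding smooth2_def by blast
qed

end

section \<open>Tangent angles of convex curves\<close>

text \<open>If c < 1, then x lies strictly between the interior point z and the point y of the
  closure, hence is itself interior; c > 1 is the same with x and y exchanged.\<close>

lemma frontier_ray_unique:
  fixes K :: "complex set"
  assumes K: "convex K" "z \<in> interior K" and xy: "x \<in> frontier K" "y \<in> frontier K"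
    and c: "x - z = c *\<^sub>R (y - z)" "c > 0"
  shows "x = y"
proof -
  have *: False if "x \<in> frontier K" "y \<in> frontier K" "x - z = c *\<^sub>R (y - z)" "0 < c" "c < 1" for x y c
  proof -
    have "y \<noteq> z" using that(2) K by (auto simp: frontier_def)
    have "x = (1 - c) *\<^sub>R z + c *\<^sub>R y" using that(3) by (simp add: algebra_simps)
    then have "x \<in> open_segment z y" using that(4,5) \<open>y \<noteq> z\<close> by (auto simp: in_segment)
    then have "x \<in> interior K"
      using in_interior_closure_convex_segment[OF K] that(2) by (auto simp: frontier_def)
    then show False using that(1) by (auto simp: frontier_def)
  qed
  consider "c < 1" | "c = 1" | "c > 1" by linarith
  then show ?thesis
  proof cases
    case 3
    have "y - z = (1 / c) *\<^sub>R (x - z)" using c by simp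
    from *[OF xy(2,1) this] 3 show ?thesis by simp
  qed (use *[OF xy c] c(1) in auto)
qed

lemma exists_angle_lift:
  fixes \<gamma> :: "real \<Rightarrow> complex"
  assumes "continuous_on UNIV \<gamma>" "\<And>q. \<gamma> q \<noteq> z"
  obtains a where "continuous_on UNIV a" "\<And>q. \<gamma> q - z = norm (\<gamma> q - z) * cis (a q)"
proof -
  have "continuous_on UNIV (\<lambda>q. \<gamma> q - z)" using assms(1) by (intro continuous_intros)
  then obtain g where g: "continuous_on UNIV g" "\<And>q. \<gamma> q - z = exp (g q)"
    using continuous_logarithm_on_contractible[of UNIV "\<lambda>q. \<gamma> q - z"] assms(2) contractible_UNIV by auto
  show ?thesis
  proof (rule that)
    show "continuous_on UNIV (\<lambda>q. Im (g q))" using g(1) by (intro continuous_intros)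
    show "\<gamma> q - z = norm (\<gamma> q - z) * cis (Im (g q))" for q
      unfolding g(2) by (simp add: exp_eq_polar[of "g q"] norm_mult)
  qed
qed

lemma cis_eq_cisD: "cis x = cis y \<Longrightarrow> \<exists>k::int. x = y + 2 * pi * k"
  using sin_cos_eq_iff[of x y] by (auto simp: cis.code complex_eq_iff mult_ac)

text \<open>The increment over a period is continuous with values in the integer multiples of 2 *
  pi, hence constant.\<close>

lemma angle_lift_period:
  fixes \<theta> :: "real \<Rightarrow> real"
  assumes "continuous_on UNIV \<theta>" "\<And>q. cis (\<theta> (q + 1)) = cis (\<theta> q)"
  obtains k :: int where "\<And>q. \<theta> (q + 1) = \<theta> q + 2 * pi * k"
proof -
  define f where "f q = \<theta> (q + 1) - \<theta> q" for q
  have f: "\<exists>k::int. f q = 2 * pi * k" for q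
    using cis_eq_cisD[OF assms(2)[of q]] by (auto simp: f_def)
  have "continuous_on UNIV (\<lambda>q. \<theta> (q + 1))"
    by (rule continuous_on_compose2[OF assms(1)]) (auto intro!: continuous_intros)
  then have "continuous_on UNIV f" unfolding f_def using assms(1) by (intro continuous_intros)
  then have "f constant_on UNIV"
  proof (rule continuous_discrete_range_constant[OF connected_UNIV])
    fix x
    have "2 * pi \<le> norm (f y - f x)" if "f y \<noteq> f x" for y
    proof -
      obtain k l :: int where kl: "f x = 2 * pi * k" "f y = 2 * pi * l" using f by metis
      with that have "l \<noteq> k" by auto
      then have "1 \<le> \<bar>real_of_int (l - k)\<bar>" by linarith
      moreover have "f y - f x = 2 * pi * real_of_int (l - k)" using kl by (simp add: algebra_simps)
      ultimately show ?thesis by (simp add: abs_mult)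
    qed
    then show "\<exists>e>0. \<forall>y. y \<in> UNIV \<and> f y \<noteq> f x \<longrightarrow> e \<le> norm (f y - f x)"
      by (intro exI[of _ "2 * pi"]) auto
  qed
  then obtain c where c: "\<And>q. f q = c" unfolding constant_on_def by blast
  obtain k :: int where "c = 2 * pi * k" using f[of 0] c by auto
  with c that[of k] show ?thesis by (auto simp: f_def algebra_simps)
qed

text \<open>The function ln |\<gamma> - z| + i * a is a continuous logarithm of \<gamma> - z, and
  its real part takes the same value at both ends.\<close>

lemma winding_number_angle_lift:
  assumes cont: "continuous_on UNIV \<gamma>" "continuous_on UNIV a" and nz: "\<And>q. \<gamma> q \<noteq> z"
    and a: "\<And>q. \<gamma> q - z = norm (\<gamma> q - z) * cis (a q)" and per: "\<gamma> 1 = \<gamma> 0"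
  shows "winding_number \<gamma> z = of_real ((a 1 - a 0) / (2 * pi))"
proof -
  define p where "p t = of_real (ln (norm (\<gamma> t - z))) + \<i> * of_real (a t)" for t
  have "continuous_on {0..1} \<gamma>" "continuous_on {0..1} a"
    using cont continuous_on_subset by blast+
  then have p: "path p" unfolding p_def path_def using nz
    by (intro continuous_intros) auto
  have "exp (p t) = \<gamma> t - z" for t
  proof -
    have "exp (p t) = of_real (exp (ln (norm (\<gamma> t - z)))) * exp (\<i> * of_real (a t))"
      unfolding p_def exp_add by (simp add: exp_of_real)
    also have "\<dots> = norm (\<gamma> t - z) * cis (a t)"
      using nz[of t] by (simp add: cis_conv_exp)
    finally show ?thesis using a[of t] by simp
  qed
  then have "winding_number \<gamma> z = winding_number (exp \<circ> p) 0"
    by (subst winding_number_offset) (simp add: comp_def)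
  also have "\<dots> = (pathfinish p - pathstart p) / (2 * of_real pi * \<i>)"
    by (rule winding_number_compose_exp[OF p])
  also have "pathfinish p - pathstart p = \<i> * of_real (a 1 - a 0)"
    using per by (simp add: p_def pathfinish_def pathstart_def algebra_simps)
  also have "\<i> * of_real (a 1 - a 0) / (2 * of_real pi * \<i>) = of_real ((a 1 - a 0) / (2 * pi))"
    by simp
  finally show ?thesis .
qed

lemma periodic_add_int:
  fixes f :: "real \<Rightarrow> 'a"
  assumes "\<And>q. f (q + 1) = f q"
  shows "f (q + real_of_int k) = f q"
proof (induction k rule: int_induct[of _ 0])
  case (step1 i)
  then show ?case using assms[of "q + real_of_int i"] by (simp add: algebra_simps)
next
  case (step2 i)
  then show ?case using assms[of "q + real_of_int (i - 1)"] by (simp add: algebra_simps)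
qed simp

lemma quasiperiodic_add_int:
  fixes f :: "real \<Rightarrow> real"
  assumes "\<And>q. f (q + 1) = f q + c"
  shows "f (q + real_of_int k) = f q + c * k"
  using periodic_add_int[of "\<lambda>q. f q - c * q" q k] assms by (simp add: algebra_simps)

text \<open>Seen from an interior point, every ray meets the boundary once, so the polar angle is
  injective and therefore monotone. Winding number 1 makes it gain 2 * pi in a period, which decides
  that it increases.\<close>

lemma ccw_boundary_angle:
  assumes \<gamma>: "ccw_boundary_param K \<gamma>" and z: "z \<in> interior K"
  obtains a where "continuous_on UNIV a" "strict_mono a" "\<And>q. a (q + 1) = a q + 2 * pi"
    "\<And>q. \<gamma> q - z = norm (\<gamma> q - z) * cis (a q)" "\<And>q. \<gamma> q \<noteq> z"
proof -
  have K: "convex K" and cont: "continuous_on UNIV \<gamma>"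
    and per: "\<And>q. \<gamma> (q + 1) = \<gamma> q" and inj: "inj_on \<gamma> {0..<1}" and ran: "range \<gamma> = frontier K"
    and wn: "winding_number \<gamma> z = 1"
    using \<gamma> z unfolding ccw_boundary_param_def convex_body_def by auto
  have fr: "\<gamma> q \<in> frontier K" for q using ran by auto
  have nz: "\<gamma> q \<noteq> z" for q using fr[of q] z by (auto simp: frontier_def)
  obtain a where a: "continuous_on UNIV a" "\<And>q. \<gamma> q - z = norm (\<gamma> q - z) * cis (a q)"
    using exists_angle_lift[OF cont nz] by metis
  have "cis (a (q + 1)) = cis (a q)" for q
    using a(2)[of "q + 1"] a(2)[of q] per[of q] nz[of q] by (metis mult_left_cancel norm_eq_zero of_real_eq_0_iff right_minus_eq)
  then obtain k :: int where k: "\<And>q. a (q + 1) = a q + 2 * pi * k"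
    using angle_lift_period[OF a(1)] by metis
  have "of_real ((a 1 - a 0) / (2 * pi)) = (1::complex)"
    using winding_number_angle_lift[OF cont a(1) nz a(2)] per[of 0] wn by simp
  then have "(a 1 - a 0) / (2 * pi) = 1" by (metis of_real_eq_1_iff)
  then have per_a: "a (q + 1) = a q + 2 * pi" for q using k[of 0] k[of q] by (simp add: field_simps)
  have inj_a: "inj a"
  proof (rule injI)
    fix p q assume pq: "a p = a q"
    have "\<gamma> p - z = (norm (\<gamma> p - z) / norm (\<gamma> q - z)) *\<^sub>R (\<gamma> q - z)"
    proof -
      have "norm (\<gamma> q - z) \<noteq> 0" using nz by simp
      then have "(norm (\<gamma> p - z) / norm (\<gamma> q - z)) *\<^sub>R (norm (\<gamma> q - z) * cis (a q)) = norm (\<gamma> p - z) * cis (a q)"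
        by (simp add: scaleR_conv_of_real)
      then show ?thesis using a(2)[of p] a(2)[of q] pq by metis
    qed
    then have "\<gamma> p = \<gamma> q"
      by (rule frontier_ray_unique[OF K z fr fr]) (use nz in auto)
    moreover have "\<gamma> x = \<gamma> (frac x)" for x
      using periodic_add_int[of \<gamma> "frac x" "\<lfloor>x\<rfloor>"] per by (simp add: frac_def)
    ultimately have "\<gamma> (frac p) = \<gamma> (frac q)" by metis
    then have "frac p = frac q"
      using inj frac_ge_0 frac_lt_1 by (metis atLeastLessThan_iff inj_onD)
    then have "p = q + real_of_int (\<lfloor>p\<rfloor> - \<lfloor>q\<rfloor>)" by (simp add: frac_def algebra_simps)
    moreover from this have "a p = a q + 2 * pi * (\<lfloor>p\<rfloor> - \<lfloor>q\<rfloor>)"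
      using quasiperiodic_add_int[of a "2 * pi" q "\<lfloor>p\<rfloor> - \<lfloor>q\<rfloor>"] per_a by metis
    ultimately show "p = q" using pq by simp
  qed
  have "strict_mono a"
  proof (rule strict_monoI)
    fix p q :: real assume "p < q"
    \<comment> \<open>The interval contains \<open>p\<close> and \<open>q\<close>, and also 0 and 1,
      where the gain over a period rules out the decreasing case.\<close>
    define M where "M = \<bar>p\<bar> + \<bar>q\<bar> + 1"
    have M: "p \<in> {-M..M}" "q \<in> {-M..M}" "0 \<in> {-M..M}" "1 \<in> {-M..M}" by (auto simp: M_def)
    have "continuous_on {-M..M} a" using a(1) continuous_on_subset by blast
    then have "strict_mono_on {-M..M} a \<or> strict_antimono_on {-M..M} a"
      using injective_eq_monotone_map[of "{-M..M}" a] inj_a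
      by (meson inj_on_subset is_interval_cc subset_UNIV)
    then show "a p < a q"
    proof
      assume "strict_mono_on {-M..M} a"
      then show ?thesis using M \<open>p < q\<close> by (auto simp: strict_mono_on_def monotone_on_def)
    next
      assume "strict_antimono_on {-M..M} a"
      then have "a 1 < a 0" using M by (auto simp: monotone_on_def)
      then show ?thesis using per_a[of 0] by simp
    qed
  qed
  with that a nz per_a show ?thesis by blast
qed

section \<open>Supporting lines and the turning of the tangent\<close>

lemma cross_eq: "Im (cnj a * b) = (\<i> * a) \<bullet> b"
  by (simp add: inner_complex_def)

text \<open>Any supporting linear form at \<gamma> q has a minimum along \<gamma> there, so its
  normal is orthogonal to v and thus a multiple of i * v. The sign of the multiple follows from the
  increasing polar angle around an interior point.\<close>

lemma ccw_boundary_support: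
  assumes \<gamma>: "ccw_boundary_param K \<gamma>" and d: "(\<gamma> has_vector_derivative v) (at q)" "v \<noteq> 0"
  shows "x \<in> K \<Longrightarrow> Im (cnj v * (x - \<gamma> q)) \<ge> 0"
    and "z \<in> interior K \<Longrightarrow> Im (cnj (\<gamma> q - z) * v) > 0"
proof -
  have K: "convex K" "compact K" "interior K \<noteq> {}" and ran: "range \<gamma> = frontier K"
    using \<gamma> unfolding ccw_boundary_param_def convex_body_def by auto
  have clK: "closed K" using K by (simp add: compact_imp_closed)
  have fr: "\<gamma> q \<in> frontier K" for q using ran by auto
  then have inK: "\<gamma> q \<in> K" for q using clK frontier_subset_closed by blast
  have ri: "rel_interior K = interior K" using K by (simp add: rel_interior_nonempty_interior)
  have "\<gamma> q \<notin> rel_interior K" using fr ri by (auto simp: frontier_def)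
  then obtain n where n: "n \<noteq> 0" "\<And>y. y \<in> K \<Longrightarrow> n \<bullet> \<gamma> q \<le> n \<bullet> y"
    "\<And>y. y \<in> interior K \<Longrightarrow> n \<bullet> \<gamma> q < n \<bullet> y"
    using supporting_hyperplane_rel_boundary[OF K(1) inK] ri by metis
  have nv: "n \<bullet> v = 0"
  proof (rule DERIV_local_min[where d = 1])
    show "((\<lambda>t. n \<bullet> \<gamma> t) has_real_derivative n \<bullet> v) (at q)"
      using bounded_linear.has_vector_derivative[OF bounded_linear_inner_right d(1)]
      by (simp add: has_real_derivative_iff_has_vector_derivative)
    show "\<forall>y. \<bar>q - y\<bar> < 1 \<longrightarrow> n \<bullet> \<gamma> q \<le> n \<bullet> \<gamma> y"
      using n(2) ran clK frontier_subset_closed by blast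
  qed simp
  define c where "c = (\<i> * v) \<bullet> n / (norm v)\<^sup>2"
  have nc: "n = c *\<^sub>R (\<i> * v)"
  proof -
    have "Re n * Re v + Im n * Im v = 0" using nv by (simp add: inner_complex_def)
    then have "Re v * (Re n * Re v + Im n * Im v) = 0" "Im v * (Re n * Re v + Im n * Im v) = 0"
      by simp_all
    then have e: "(norm v)\<^sup>2 *\<^sub>R n = ((\<i> * v) \<bullet> n) *\<^sub>R (\<i> * v)"
      unfolding complex_eq_iff inner_complex_def cmod_power2 by (simp add: algebra_simps power2_eq_square)
    have "(norm v)\<^sup>2 \<noteq> 0" using d(2) by simp
    then have "n = (1 / (norm v)\<^sup>2) *\<^sub>R ((norm v)\<^sup>2 *\<^sub>R n)" by simp
    then show ?thesis unfolding e c_def by simp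
  qed
  show pos: "Im (cnj (\<gamma> q - z) * v) > 0" if z: "z \<in> interior K" for z
  proof -
    obtain a where a: "continuous_on UNIV a" "strict_mono a"
      "\<And>q. \<gamma> q - z = norm (\<gamma> q - z) * cis (a q)" "\<And>q. \<gamma> q \<noteq> z"
      using ccw_boundary_angle[OF \<gamma> z] by metis
    \<comment> \<open>Up to positive factors, \<open>g t\<close> is the sine of the polar angle
      gained since \<open>q\<close>; it is positive just after \<open>q\<close>, so its derivative
      at \<open>q\<close> is not negative.\<close>
    define g where "g t = Im (cnj (\<gamma> q - z) * (\<gamma> t - z))" for t
    have g: "g t = norm (\<gamma> q - z) * norm (\<gamma> t - z) * sin (a t - a q)" for t
      unfolding g_def by (subst (1) a(3), subst (2) a(3)) (simp add: sin_diff algebra_simps)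
    have dg: "(g has_real_derivative Im (cnj (\<gamma> q - z) * v)) (at q)"
    proof -
      have "((\<lambda>t. cnj (\<gamma> q - z) * (\<gamma> t - z)) has_vector_derivative cnj (\<gamma> q - z) * v) (at q)"
        using d(1) by (auto intro!: derivative_eq_intros)
      from bounded_linear.has_vector_derivative[OF bounded_linear_Im this]
      show ?thesis by (simp add: g_def[abs_def] has_real_derivative_iff_has_vector_derivative)
    qed
    have "\<not> Im (cnj (\<gamma> q - z) * v) < 0"
    proof
      assume "Im (cnj (\<gamma> q - z) * v) < 0"
      from DERIV_neg_dec_right[OF dg this] obtain e where e: "e > 0" "\<And>h. 0 < h \<Longrightarrow> h < e \<Longrightarrow> g (q + h) < g q"
        by blast
      have "isCont a q" using a(1) by (simp add: continuous_on_eq_continuous_at)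
      then obtain e' where e': "e' > 0" "\<And>t. \<bar>t - q\<bar> < e' \<Longrightarrow> \<bar>a t - a q\<bar> < pi"
        using pi_gt_zero unfolding continuous_at_eps_delta dist_real_def real_norm_def by blast
      define h where "h = min e e' / 2"
      have h: "0 < h" "h < e" "h < e'" using e(1) e'(1) by (auto simp: h_def min_def)
      have "a (q + h) > a q" using a(2) h(1) by (simp add: strict_mono_less)
      moreover have "\<bar>a (q + h) - a q\<bar> < pi" by (rule e'(2)) (use h in auto)
      ultimately have "sin (a (q + h) - a q) > 0" by (intro sin_gt_zero) auto
      then have "g (q + h) > 0" unfolding g using a(4) by simp
      moreover have "g q = 0" unfolding g by simp
      ultimately show False using e(2)[OF h(1,2)] by simp
    qed
    moreover have "Im (cnj (\<gamma> q - z) * v) \<noteq> 0"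
    proof
      assume "Im (cnj (\<gamma> q - z) * v) = 0"
      then have "(\<i> * v) \<bullet> (z - \<gamma> q) = 0" by (simp add: inner_complex_def algebra_simps)
      then have "n \<bullet> (z - \<gamma> q) = 0" unfolding nc by simp
      then show False using n(3)[OF z] by (simp add: inner_diff_right)
    qed
    ultimately show ?thesis by linarith
  qed
  show "Im (cnj v * (x - \<gamma> q)) \<ge> 0" if x: "x \<in> K" for x
  proof -
    obtain z where z: "z \<in> interior K" using K by auto
    have "0 < n \<bullet> (z - \<gamma> q)" using n(3)[OF z] by (simp add: inner_diff_right)
    also have "\<dots> = c * Im (cnj (\<gamma> q - z) * v)" unfolding nc by (simp add: inner_complex_def algebra_simps)
    finally have "c > 0" using pos[OF z] zero_less_mult_pos2 by blast
    have "0 \<le> n \<bullet> (x - \<gamma> q)" using n(2)[OF x] by (simp add: inner_diff_right)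
    also have "\<dots> = c * Im (cnj v * (x - \<gamma> q))" unfolding nc by (simp add: inner_complex_def algebra_simps)
    finally show ?thesis using \<open>c > 0\<close> zero_le_mult_iff by (metis less_le_not_le)
  qed
qed

text \<open>\<open>f\<close> never meets an integer multiple of pi, so by the intermediate value
  theorem it stays in one open interval of length pi.\<close>

lemma abs_diff_less_pi:
  fixes f :: "real \<Rightarrow> real"
  assumes f: "continuous_on UNIV f" and pos: "\<And>q. sin (f q) > 0"
  shows "\<bar>f x - f y\<bar> < pi"
proof -
  have *: "f y - f x < pi" for x y
  proof (rule ccontr)
    assume "\<not> f y - f x < pi"
    then have ge: "f x + pi \<le> f y" by simp
    define k where "k = \<lceil>f x / pi\<rceil>"
    have "f x / pi \<le> k" "k < f x / pi + 1" unfolding k_def using ceiling_correct[of "f x / pi"] by linarith+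
    then have "pi * (f x / pi) \<le> pi * k" "pi * k < pi * (f x / pi + 1)"
      by (intro mult_left_mono mult_strict_left_mono; simp)+
    then have "f x \<le> pi * k" "pi * k < f x + pi" by (simp_all add: algebra_simps)
    then have "pi * k \<in> {f x..f y}" using ge by auto
    moreover have "connected (range f)" using connected_continuous_image[OF f connected_UNIV] .
    ultimately obtain q where "f q = pi * k"
      using connected_contains_Icc[of "range f" "f x" "f y"] by auto
    then have "sin (f q) = 0" by (simp add: sin_zero_iff_int2 mult.commute)
    then show False using pos[of q] by simp
  qed
  show ?thesis using *[of x y] *[of y x] by linarith
qed

text \<open>The theorem of turning tangents in the convex case: the tangent stays strictly to the
  left of the radial direction, so the two angles differ by less than pi from a constant, and their
  gains over a period, both multiples of 2 * pi, must agree.\<close>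

lemma turning_eq_2pi:
  fixes \<theta> a :: "real \<Rightarrow> real"
  assumes "continuous_on UNIV \<theta>" "continuous_on UNIV a" "\<And>q. sin (\<theta> q - a q) > 0"
    "\<And>q. a (q + 1) = a q + 2 * pi" "\<And>q. cis (\<theta> (q + 1)) = cis (\<theta> q)"
  shows "\<theta> (q + 1) = \<theta> q + 2 * pi"
proof -
  obtain k :: int where k: "\<And>q. \<theta> (q + 1) = \<theta> q + 2 * pi * k"
    using angle_lift_period[OF assms(1,5)] by metis
  have "continuous_on UNIV (\<lambda>q. \<theta> q - a q)" using assms(1,2) by (intro continuous_intros)
  from abs_diff_less_pi[OF this assms(3), of "q + 1" q]
  have "\<bar>2 * pi * (real_of_int k - 1)\<bar> < pi" using k[of q] assms(4)[of q] by (simp add: algebra_simps)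
  then have lt: "2 * pi * \<bar>real_of_int k - 1\<bar> < pi" by (simp add: abs_mult)
  have "k = 1"
  proof (rule ccontr)
    assume "k \<noteq> 1"
    then have "1 \<le> \<bar>real_of_int (k - 1)\<bar>" by linarith
    then have "2 * pi * 1 \<le> 2 * pi * \<bar>real_of_int k - 1\<bar>" by (intro mult_left_mono) auto
    then show False using lt pi_gt_zero by linarith
  qed
  then show ?thesis using k by simp
qed

section \<open>Tangent angles of unit-speed curves\<close>

lemma has_vector_derivative_cis:
  assumes "(\<theta> has_real_derivative d) (at q within S)"
  shows "((\<lambda>q. cis (\<theta> q)) has_vector_derivative \<i> * d * cis (\<theta> q)) (at q within S)"
proof -
  have "((\<lambda>t. cis (\<theta> t)) has_vector_derivative d *\<^sub>R (\<i> * cis (\<theta> q))) (at q within S)"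
  proof -
    have "((\<lambda>t. exp (\<i> * of_real t)) has_vector_derivative \<i> * exp (\<i> * of_real (\<theta> q))) (at (\<theta> q))"
      by (rule has_vector_derivative_real_field) (auto intro!: derivative_eq_intros)
    then have "(cis has_vector_derivative \<i> * cis (\<theta> q)) (at (\<theta> q))"
      by (simp add: cis_conv_exp[abs_def])
    then have "(cis has_vector_derivative \<i> * cis (\<theta> q)) (at (\<theta> q) within \<theta> ` S)"
      by (rule has_vector_derivative_at_within)
    from vector_diff_chain_within[OF _ this, of d]
    show ?thesis using assms by (simp add: comp_def has_real_derivative_iff_has_vector_derivative)
  qed
  then show ?thesis by (simp add: scaleR_conv_of_real mult_ac)
qed

lemma smooth_fun_has_velocity:
  "smooth_fun \<gamma> \<Longrightarrow> (\<gamma> has_vector_derivative velocity \<gamma> q) (at q)"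
  using smooth_fun_imp_velocity(1) unfolding velocity_def by (simp add: vector_derivative_works)

lemma velocity_eq: "(\<gamma> has_vector_derivative v) (at q) \<Longrightarrow> velocity \<gamma> q = v"
  unfolding velocity_def by (rule vector_derivative_at)

lemma smooth_fun_continuous: "smooth_fun f \<Longrightarrow> continuous_on S f"
  unfolding smooth_fun_def
  by (intro continuous_at_imp_continuous_on ballI) (metis has_vector_derivative_continuous)

lemma smooth_fun_has_real_derivative:
  fixes f :: "real \<Rightarrow> real"
  assumes "smooth_fun f" obtains f' where "smooth_fun f'" "\<And>x. (f has_real_derivative f' x) (at x)"
proof -
  obtain D where D: "D 0 = f" "\<And>n q. (D n has_vector_derivative D (Suc n) q) (at q)"
    using assms unfolding smooth_fun_def by blast
  show ?thesis
  proof (rule that[of "D 1"])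
    show "smooth_fun (D 1)" unfolding smooth_fun_def by (rule exI[of _ "\<lambda>n. D (Suc n)"]) (use D in auto)
    show "(f has_real_derivative D 1 x) (at x)" for x
      using D(2)[of 0 x] D(1) by (simp add: has_real_derivative_iff_has_vector_derivative)
  qed
qed

text \<open>The angle is defined as the primitive of the curvature that starts at the argument of
  the initial velocity. Unit speed forces v' = i * \<kappa> * v, so v * cis (- \<theta>) has
  derivative 0 and keeps its initial value 1.\<close>

lemma unit_speed_angle:
  assumes \<gamma>: "smooth_fun \<gamma>" and unit: "\<And>q. norm (velocity \<gamma> q) = 1"
  obtains \<theta> where "smooth_fun \<theta>" "\<And>q. (\<gamma> has_vector_derivative cis (\<theta> q)) (at q)"
    "\<And>q. (\<theta> has_real_derivative curvature \<gamma> q) (at q)"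
proof -
  define v where "v = velocity \<gamma>"
  have v: "smooth_fun v" unfolding v_def by (rule smooth_fun_imp_velocity(2)[OF \<gamma>])
  define w where "w = velocity v"
  have w: "smooth_fun w" unfolding w_def by (rule smooth_fun_imp_velocity(2)[OF v])
  have dv: "(v has_vector_derivative w q) (at q)" for q
    unfolding w_def by (rule smooth_fun_has_velocity[OF v])
  define \<kappa> where "\<kappa> q = Im (cnj (v q) * w q)" for q
  have curv: "curvature \<gamma> q = \<kappa> q" for q
    unfolding curvature_def \<kappa>_def w_def v_def by (simp add: unit)
  have "smooth2 UNIV UNIV (\<lambda>s. \<kappa>)" unfolding \<kappa>_def
    by (intro smooth2_intros smooth2_of_smooth_fun v w)
  note sk = this
  have nt: "at s within UNIV \<noteq> bot" if "s \<in> UNIV" for s :: real by simp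
  note P = smooth2_primitive[OF nt convex_UNIV sk]
  define \<theta> where "\<theta> q = Arg (v 0) + (integral {0..q} \<kappa> - integral {q..0} \<kappa>)" for q
  have sm: "smooth_fun \<theta>"
    by (rule smooth_funI, unfold \<theta>_def) (intro smooth2_add smooth2_const P(1) UNIV_I)
  have d\<theta>: "(\<theta> has_real_derivative \<kappa> q) (at q)" for q
    unfolding \<theta>_def has_real_derivative_iff_has_vector_derivative
    using has_vector_derivative_add[OF has_vector_derivative_const P(2)[OF UNIV_I, of 0 q]] by simp
  have \<theta>0: "\<theta> 0 = Arg (v 0)" by (simp add: \<theta>_def)
  have n1: "cnj (v q) * v q = 1" for q
    using unit[of q] unfolding v_def by (metis complex_norm_square mult.commute of_real_1 one_power2)
  have wk: "w q = \<i> * \<kappa> q * v q" for q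
  proof -
    have "((\<lambda>q. cnj (v q) * v q) has_vector_derivative (cnj (v q) * w q + cnj (w q) * v q)) (at q)"
      by (rule has_vector_derivative_mult[OF has_vector_derivative_cnj[OF dv] dv])
    moreover have "((\<lambda>q. cnj (v q) * v q) has_vector_derivative 0) (at q)" unfolding n1 by simp
    ultimately have "cnj (v q) * w q + cnj (w q) * v q = 0" by (rule vector_derivative_unique_at)
    then have "Re (cnj (v q) * w q) = 0" by (simp add: complex_eq_iff)
    then have "cnj (v q) * w q = \<i> * \<kappa> q" unfolding \<kappa>_def by (simp add: complex_eq_iff)
    then have "(cnj (v q) * v q) * w q = \<i> * \<kappa> q * v q" by (metis mult.assoc mult.commute)
    then show ?thesis using n1 by simp
  qed
  have "((\<lambda>q. cis (- \<theta> q) * v q) has_vector_derivative 0) (at q)" for q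
  proof -
    have "((\<lambda>q. - \<theta> q) has_real_derivative - \<kappa> q) (at q)" by (rule DERIV_minus[OF d\<theta>])
    from has_vector_derivative_mult[OF has_vector_derivative_cis[OF this] dv]
    show ?thesis unfolding wk by (simp add: mult_ac)
  qed
  then obtain c0 where "cis (- \<theta> q) * v q = c0" for q
    using has_vector_derivative_zero_constant[OF convex_UNIV, of "\<lambda>q. cis (- \<theta> q) * v q"] by auto
  then have c: "cis (- \<theta> q) * v q = cis (- \<theta> 0) * v 0" for q by simp
  have "cis (- \<theta> 0) * v 0 = 1"
  proof -
    have "v 0 = cis (Arg (v 0))" using rcis_cmod_Arg[of "v 0"] unit[of 0] by (simp add: v_def rcis_def)
    then show ?thesis unfolding \<theta>0 by (metis cis_mult add.left_inverse cis_zero)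
  qed
  then have "v q = cis (\<theta> q)" for q
    using c[of q] by (metis cis_mult add.right_inverse cis_zero mult.assoc mult.right_neutral mult_1)
  then have "(\<gamma> has_vector_derivative cis (\<theta> q)) (at q)" for q
    using smooth_fun_has_velocity[OF \<gamma>] by (metis v_def)
  with that sm d\<theta> curv show ?thesis by metis
qed

lemma ccw_boundary_paramD:
  assumes "ccw_boundary_param K \<gamma>"
  shows "convex K" "compact K" "closed K" "interior K \<noteq> {}" "continuous_on UNIV \<gamma>"
    "\<gamma> (q + 1) = \<gamma> q" "range \<gamma> = frontier K" "\<gamma> q \<in> frontier K" "\<gamma> q \<in> K"
proof -
  show *: "convex K" "compact K" "closed K" "interior K \<noteq> {}" "continuous_on UNIV \<gamma>"
    "\<gamma> (q + 1) = \<gamma> q" "range \<gamma> = frontier K"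
    using assms compact_imp_closed unfolding ccw_boundary_param_def convex_body_def by auto
  show fr: "\<gamma> q \<in> frontier K" using *(7) by auto
  show "\<gamma> q \<in> K" using fr frontier_subset_closed[OF *(3)] by auto
qed

text \<open>The total turn comes from comparing the tangent with the radial direction. Negative
  curvature at \<open>q\<close> would turn the curve clockwise right after \<open>q\<close> and push
  it below its own tangent line at \<open>q\<close>, against the supporting property.\<close>

lemma tables_C_angle:
  assumes \<gamma>: "\<gamma> \<in> tables_C"
  obtains \<theta> where "smooth_fun \<theta>" "\<And>q. (\<gamma> has_vector_derivative cis (\<theta> q)) (at q)"
    "\<And>q. (\<theta> has_real_derivative curvature \<gamma> q) (at q)" "\<And>q. curvature \<gamma> q \<ge> 0"
    "\<And>q. \<theta> (q + 1) = \<theta> q + 2 * pi"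
proof -
  obtain K where K: "ccw_boundary_param K \<gamma>" and sm: "smooth_fun \<gamma>"
    and unit: "\<And>q. norm (velocity \<gamma> q) = 1" using \<gamma> unfolding tables_C_def by auto
  have per: "\<gamma> (q + 1) = \<gamma> q" for q using K unfolding ccw_boundary_param_def by auto
  obtain \<theta> where \<theta>: "smooth_fun \<theta>" "\<And>q. (\<gamma> has_vector_derivative cis (\<theta> q)) (at q)"
    "\<And>q. (\<theta> has_real_derivative curvature \<gamma> q) (at q)" using unit_speed_angle[OF sm unit] by metis
  obtain z where z: "z \<in> interior K" using K unfolding ccw_boundary_param_def convex_body_def by auto
  obtain a where a: "continuous_on UNIV a" "strict_mono a" "\<And>q. a (q + 1) = a q + 2 * pi"
    "\<And>q. \<gamma> q - z = norm (\<gamma> q - z) * cis (a q)" "\<And>q. \<gamma> q \<noteq> z"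
    using ccw_boundary_angle[OF K z] by metis
  have pos: "sin (\<theta> q - a q) > 0" for q
  proof -
    have "0 < Im (cnj (\<gamma> q - z) * cis (\<theta> q))"
      by (rule ccw_boundary_support(2)[OF K \<theta>(2) _ z]) simp
    also have "\<dots> = norm (\<gamma> q - z) * sin (\<theta> q - a q)"
      by (subst a(4)) (simp add: sin_diff algebra_simps)
    finally show ?thesis using a(5)[of q] by (simp add: zero_less_mult_iff)
  qed
  have cper: "cis (\<theta> (q + 1)) = cis (\<theta> q)" for q
  proof -
    have "((\<lambda>t. t + 1) has_vector_derivative 1) (at q)" by (auto intro!: derivative_eq_intros)
    from vector_diff_chain_at[OF this \<theta>(2)[of "q + 1"]]
    have "((\<lambda>t. \<gamma> (t + 1)) has_vector_derivative cis (\<theta> (q + 1))) (at q)" by (simp add: comp_def)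
    moreover have "(\<lambda>t. \<gamma> (t + 1)) = \<gamma>" using per by auto
    ultimately show ?thesis using vector_derivative_unique_at \<theta>(2)[of q] by metis
  qed
  have "\<theta> (q + 1) = \<theta> q + 2 * pi" for q
    by (rule turning_eq_2pi[OF smooth_fun_continuous[OF \<theta>(1)] a(1) pos a(3) cper])
  moreover have "curvature \<gamma> q \<ge> 0" for q
  proof (rule ccontr)
    assume neg: "\<not> 0 \<le> curvature \<gamma> q"
    then obtain e where e: "e > 0" "\<And>h. 0 < h \<Longrightarrow> h < e \<Longrightarrow> \<theta> (q + h) < \<theta> q"
      using DERIV_neg_dec_right[OF \<theta>(3)[of q]] by auto
    have "isCont \<theta> q" using \<theta>(3) DERIV_isCont by blast
    then obtain e' where e': "e' > 0" "\<And>t. \<bar>t - q\<bar> < e' \<Longrightarrow> \<bar>\<theta> t - \<theta> q\<bar> < pi"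
      using pi_gt_zero unfolding continuous_at_eps_delta dist_real_def real_norm_def by blast
    define h where "h = min e e' / 2"
    have h: "0 < h" "h < e" "h < e'" using e(1) e'(1) by (auto simp: h_def min_def)
    define g where "g t = Im (cnj (cis (\<theta> q)) * (\<gamma> t - \<gamma> q))" for t
    have dg: "(g has_real_derivative sin (\<theta> t - \<theta> q)) (at t)" for t
    proof -
      have "((\<lambda>t. cnj (cis (\<theta> q)) * (\<gamma> t - \<gamma> q)) has_vector_derivative cnj (cis (\<theta> q)) * cis (\<theta> t)) (at t)"
        using \<theta>(2)[of t] by (auto intro!: derivative_eq_intros)
      from bounded_linear.has_vector_derivative[OF bounded_linear_Im this]
      show ?thesis by (simp add: g_def[abs_def] has_real_derivative_iff_has_vector_derivative sin_diff algebra_simps)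
    qed
    obtain t where t: "q < t" "t < q + h" "g (q + h) - g q = (q + h - q) * sin (\<theta> t - \<theta> q)"
      using MVT2[of q "q + h" g "\<lambda>t. sin (\<theta> t - \<theta> q)"] dg h by auto
    have "\<theta> t < \<theta> q" using e(2)[of "t - q"] t h by auto
    moreover have "\<bar>\<theta> t - \<theta> q\<bar> < pi" using e'(2)[of t] t h by auto
    ultimately have "sin (\<theta> q - \<theta> t) > 0" by (intro sin_gt_zero) auto
    then have "sin (\<theta> t - \<theta> q) < 0" using sin_minus[of "\<theta> q - \<theta> t"] by simp
    then have "g (q + h) < 0" using t(3) h(1) by (simp add: g_def mult_less_0_iff)
    moreover have "g (q + h) \<ge> 0"
      unfolding g_def by (rule ccw_boundary_support(1)[OF K \<theta>(2) _ ccw_boundary_paramD(9)[OF K]]) simp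
    ultimately show False by simp
  qed
  ultimately show ?thesis using that \<theta> by blast
qed

text \<open>The converse: a closed curve with monotone tangent angle and total turn 2 * pi is the
  positively oriented boundary of its hull. This is how all tables below are recognized. The angle
  need only be continuous, because the rounded polygons use it in that generality.\<close>

lemma ccw_boundary_param_hull:
  fixes \<theta> :: "real \<Rightarrow> real" and l :: real
  assumes d: "\<And>q. (\<gamma> has_vector_derivative l * cis (\<theta> q)) (at q)" and l: "l > 0"
    and cont: "continuous_on UNIV \<theta>" and mono: "mono \<theta>"
    and \<theta>per: "\<And>q. \<theta> (q + 1) = \<theta> q + 2 * pi" and per: "\<And>q. \<gamma> (q + 1) = \<gamma> q"
  shows "ccw_boundary_param (convex hull (range \<gamma>)) \<gamma>"
proof -
  define K where "K = convex hull (range \<gamma>)"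
  have cont\<gamma>: "continuous_on S \<gamma>" for S
    using d by (intro continuous_at_imp_continuous_on ballI) (rule has_vector_derivative_continuous)
  have dg: "((\<lambda>t. c \<bullet> (\<gamma> t - z)) has_real_derivative l * (c \<bullet> cis (\<theta> t))) (at t)" for c z t
  proof -
    have "((\<lambda>t. \<gamma> t - z) has_vector_derivative l *\<^sub>R cis (\<theta> t)) (at t)"
      using has_vector_derivative_diff[OF d has_vector_derivative_const] by (simp add: scaleR_conv_of_real)
    from bounded_linear.has_vector_derivative[OF bounded_linear_inner_right this]
    show ?thesis by (simp add: has_real_derivative_iff_has_vector_derivative)
  qed
  have ivt: "\<exists>u. x \<le> u \<and> u \<le> y \<and> \<theta> u = m" if "x \<le> y" "\<theta> x \<le> m" "m \<le> \<theta> y" for x y m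
    using IVT'[of \<theta> x m y] that continuous_on_subset[OF cont] by auto
  have inner_cis: "cis x \<bullet> cis y = cos (y - x)" for x y
    by (simp add: inner_complex_def cos_diff algebra_simps)
  have inner_icis: "(\<i> * cis x) \<bullet> cis y = sin (y - x)" for x y
    by (simp add: inner_complex_def sin_diff algebra_simps)
  have left0: "(\<i> * cis (\<theta> q)) \<bullet> (\<gamma> t - \<gamma> q) \<ge> 0" if t: "q \<le> t" "t \<le> q + 1" for q t
  proof -
    define g where "g t = (\<i> * cis (\<theta> q)) \<bullet> (\<gamma> t - \<gamma> q)" for t
    have dg': "(g has_real_derivative l * sin (\<theta> t - \<theta> q)) (at t)" for t
      unfolding g_def using dg[of "\<i> * cis (\<theta> q)"] by (simp add: inner_icis)
    \<comment> \<open>Where the tangent has turned by pi. The height over the tangent line at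
      \<open>q\<close> rises up to \<open>m\<close> and falls afterwards, and it is 0 at both ends
      of the period.\<close>
    obtain m where m: "q \<le> m" "m \<le> q + 1" "\<theta> m = \<theta> q + pi"
      using ivt[of q "q + 1" "\<theta> q + pi"] \<theta>per[of q] by auto
    have "g q = 0" "g (q + 1) = 0" using per by (auto simp: g_def)
    show ?thesis
    proof (cases "t \<le> m")
      case True
      have "g q \<le> g t"
      proof (rule DERIV_nonneg_imp_nondecreasing[OF t(1)])
        fix x assume x: "q \<le> x" "x \<le> t"
        have "0 \<le> \<theta> x - \<theta> q" "\<theta> x - \<theta> q \<le> pi"
          using monoD[OF mono x(1)] monoD[OF mono, of x m] x True m by auto
        then show "\<exists>y. (g has_real_derivative y) (at x) \<and> 0 \<le> y"
          using dg'[of x] l sin_ge_zero by (meson mult_nonneg_nonneg less_imp_le)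
      qed
      then show ?thesis using \<open>g q = 0\<close> by (simp add: g_def)
    next
      case False
      have "g (q + 1) \<le> g t"
      proof (rule DERIV_nonpos_imp_nonincreasing[OF t(2)])
        fix x assume x: "t \<le> x" "x \<le> q + 1"
        have "0 \<le> \<theta> x - \<theta> q - pi" "\<theta> x - \<theta> q - pi \<le> pi"
          using monoD[OF mono x(2)] monoD[OF mono, of m x] x False m \<theta>per[of q] by auto
        then have "0 \<le> sin (\<theta> x - \<theta> q - pi)" by (rule sin_ge_zero)
        then have "sin (\<theta> x - \<theta> q) \<le> 0" by (simp add: sin_diff)
        then show "\<exists>y. (g has_real_derivative y) (at x) \<and> y \<le> 0"
          using dg'[of x] l by (meson mult_nonneg_nonpos less_imp_le)
      qed
      then show ?thesis using \<open>g (q + 1) = 0\<close> by (simp add: g_def)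
    qed
  qed
  have left: "(\<i> * cis (\<theta> q)) \<bullet> (\<gamma> t - \<gamma> q) \<ge> 0" for q t
  proof -
    define k where "k = \<lfloor>t - q\<rfloor>"
    have "q \<le> t - k" "t - k \<le> q + 1" unfolding k_def by linarith+
    from left0[OF this] show ?thesis
      using periodic_add_int[of \<gamma> "t - k" k] per by simp
  qed
  have distinct: "\<gamma> x \<noteq> \<gamma> y" if xy: "x < y" "\<theta> y - \<theta> x \<le> pi" for x y
  proof
    assume eq: "\<gamma> x = \<gamma> y"
    \<comment> \<open>On an arc that turns by at most pi, the projection to the middle direction is
      nondecreasing, hence constant if the end points coincide; but its derivative is
      \<open>l\<close> where the tangent has that direction.\<close>
    define m where "m = (\<theta> x + \<theta> y) / 2"
    have xm: "\<theta> x \<le> m" "m \<le> \<theta> y" using monoD[OF mono, of x y] xy by (auto simp: m_def)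
    obtain u where u: "x \<le> u" "u \<le> y" "\<theta> u = m" using ivt[OF _ xm] xy by auto
    define f where "f t = cis m \<bullet> (\<gamma> t - \<gamma> x)" for t
    have df: "(f has_real_derivative l * cos (\<theta> t - m)) (at t)" for t
      unfolding f_def using dg[of "cis m"] by (simp add: inner_cis)
    have inc: "f s \<le> f t" if "x \<le> s" "s \<le> t" "t \<le> y" for s t
    proof (rule DERIV_nonneg_imp_nondecreasing[OF that(2)])
      fix r assume r: "s \<le> r" "r \<le> t"
      have "\<theta> x \<le> \<theta> r" "\<theta> r \<le> \<theta> y" using mono r that by (auto simp: mono_def)
      then have "- (pi / 2) \<le> \<theta> r - m" "\<theta> r - m \<le> pi / 2"
        using xy unfolding m_def by (auto simp: field_simps)
      then have "0 \<le> cos (\<theta> r - m)" by (intro cos_ge_zero) auto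
      then show "\<exists>y. (f has_real_derivative y) (at r) \<and> 0 \<le> y"
        using df[of r] l by (meson mult_nonneg_nonneg less_imp_le)
    qed
    have "f t = 0" if "t \<in> {x..y}" for t
      using inc[of x t] inc[of t y] that eq by (auto simp: f_def)
    then have "(f has_vector_derivative 0) (at u within {x..y})"
      using u by (intro has_vector_derivative_transform[of u "{x..y}" f "\<lambda>_. 0" 0]) auto
    moreover have "(f has_vector_derivative l) (at u within {x..y})"
      using df[of u] u(3)
      by (auto simp: has_real_derivative_iff_has_vector_derivative intro: has_vector_derivative_at_within)
    ultimately have "0 = l"
      using vector_derivative_unique_within_closed_interval[of x y u f 0 l] xy u
      by (auto simp: cbox_interval)
    then show False using l by simp
  qed
  have inj: "inj_on \<gamma> {0..<1}"
  proof -
    \<comment> \<open>Of the two arcs between \<open>x\<close> and \<open>y\<close> modulo the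
      period, at least one turns by at most pi.\<close>
    have ne: "\<gamma> x \<noteq> \<gamma> y" if "x < y" "y < x + 1" for x y
    proof (cases "\<theta> y - \<theta> x \<le> pi")
      case False
      then have "\<theta> (x + 1) - \<theta> y \<le> pi" using \<theta>per[of x] by simp
      from distinct[OF _ this] show ?thesis using that per[of x] by auto
    qed (use distinct that in auto)
    show ?thesis
    proof (rule inj_onI, rule ccontr)
      fix x y :: real assume "x \<in> {0..<1}" "y \<in> {0..<1}" "\<gamma> x = \<gamma> y" "x \<noteq> y"
      then show False using ne[of x y] ne[of y x] by (cases "x < y") auto
    qed
  qed
  have ran: "range \<gamma> = \<gamma> ` {0..1}"
  proof -
    have "\<gamma> x = \<gamma> (frac x)" for x
      using periodic_add_int[of \<gamma> "frac x" "\<lfloor>x\<rfloor>"] per by (simp add: frac_def)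
    then show ?thesis using frac_ge_0 frac_lt_1 by (force intro: less_imp_le)
  qed
  have cran: "compact (range \<gamma>)" unfolding ran by (intro compact_continuous_image cont\<gamma> compact_Icc)
  have K: "compact K" "convex K" unfolding K_def using cran by (auto intro: compact_convex_hull)
  have clK: "closed K" using K by (simp add: compact_imp_closed)
  have inK: "\<gamma> q \<in> K" for q unfolding K_def by (auto intro: hull_inc)
  have half: "K \<subseteq> {x. (\<i> * cis (\<theta> q)) \<bullet> x \<ge> (\<i> * cis (\<theta> q)) \<bullet> \<gamma> q}" for q
    unfolding K_def
    by (rule hull_minimal) (use left[of q] in \<open>auto simp: inner_diff_right convex_halfspace_ge\<close>)
  have strict: "(\<i> * cis (\<theta> q)) \<bullet> (z - \<gamma> q) > 0" if "z \<in> interior K" for q z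
  proof -
    have "z \<in> interior {x. (\<i> * cis (\<theta> q)) \<bullet> x \<ge> (\<i> * cis (\<theta> q)) \<bullet> \<gamma> q}"
      using interior_mono[OF half] that by blast
    then show ?thesis by (simp add: inner_diff_right)
  qed
  have intK: "interior K \<noteq> {}"
  proof
    assume "interior K = {}"
    then obtain a b where ab: "a \<noteq> 0" "K \<subseteq> {x. a \<bullet> x = b}"
      using empty_interior_subset_hyperplane[OF K(2)] by metis
    have zero: "a \<bullet> cis (\<theta> q) = 0" for q
    proof -
      have "a \<bullet> (\<gamma> t - 0) = b" for t using ab(2) inK by auto
      then have "((\<lambda>t. a \<bullet> (\<gamma> t - 0)) has_real_derivative 0) (at q)" by simp
      from DERIV_unique[OF this dg] l show ?thesis by simp
    qed
    \<comment> \<open>If the hull were flat, its normal would be orthogonal to all tangents, in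
      particular to two perpendicular ones.\<close>
    obtain u where u: "\<theta> u = \<theta> 0 + pi / 2" using ivt[of 0 1 "\<theta> 0 + pi / 2"] \<theta>per[of 0] by auto
    have "cis (\<theta> u) = \<i> * cis (\<theta> 0)" unfolding u by (simp add: cis_conv_exp exp_add algebra_simps complex_eq_iff cos_add sin_add flip: cis_conv_exp)
    then have "Re a * cos (\<theta> 0) + Im a * sin (\<theta> 0) = 0" "- Re a * sin (\<theta> 0) + Im a * cos (\<theta> 0) = 0"
      using zero[of 0] zero[of u] by (auto simp: inner_complex_def)
    then have "(Re a * cos (\<theta> 0) + Im a * sin (\<theta> 0))\<^sup>2 + (- Re a * sin (\<theta> 0) + Im a * cos (\<theta> 0))\<^sup>2 = 0"
      by simp
    moreover have "(x * c + y * d)\<^sup>2 + (- x * d + y * c)\<^sup>2 = (x\<^sup>2 + y\<^sup>2) * (d\<^sup>2 + c\<^sup>2)"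
      for x y c d :: real by (simp add: power2_eq_square algebra_simps)
    ultimately have "((Re a)\<^sup>2 + (Im a)\<^sup>2) * ((sin (\<theta> 0))\<^sup>2 + (cos (\<theta> 0))\<^sup>2) = 0" by metis
    then have "(Re a)\<^sup>2 + (Im a)\<^sup>2 = 0" by simp
    then show False using ab(1) by (simp add: complex_eq_iff sum_power2_eq_zero_iff)
  qed
  have sub: "range \<gamma> \<subseteq> frontier K"
  proof safe
    fix q
    have "\<gamma> q \<notin> interior K" using strict[of "\<gamma> q" q] by auto
    then show "\<gamma> q \<in> frontier K" using inK clK by (simp add: frontier_def)
  qed
  have path: "path \<gamma>" "path_image \<gamma> = range \<gamma>" "pathfinish \<gamma> = pathstart \<gamma>"
    using cont\<gamma> per[of 0] ran by (auto simp: path_def path_image_def pathfinish_def pathstart_def)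
  have wn: "winding_number \<gamma> z = 1" if z: "z \<in> interior K" for z
  proof -
    have nz: "\<gamma> q \<noteq> z" for q using sub z by (auto simp: frontier_def)
    \<comment> \<open>The quotient lies in the open upper half plane, where \<open>Arg\<close> is
      continuous. Hence \<theta> - Arg w is a continuous polar angle around \<open>z\<close>, with
      the same gain over a period as \<theta>.\<close>
    define w where "w q = cis (\<theta> q) / (\<gamma> q - z)" for q
    have Imw: "Im (w q) > 0" for q
    proof -
      have "w q * (norm (\<gamma> q - z))\<^sup>2 = cis (\<theta> q) * cnj (\<gamma> q - z)"
        using nz[of q] unfolding w_def complex_norm_square by simp
      then have "Im (w q) * (norm (\<gamma> q - z))\<^sup>2 = (\<i> * cis (\<theta> q)) \<bullet> (z - \<gamma> q)"
        by (simp add: complex_eq_iff inner_complex_def algebra_simps)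
      then show ?thesis using strict[OF z, of q] nz[of q] by (metis zero_less_mult_pos2 zero_less_power2 norm_eq_zero right_minus_eq)
    qed
    define a where "a q = \<theta> q - Arg (w q)" for q
    have contw: "continuous_on UNIV w"
      unfolding w_def by (intro continuous_intros cont\<gamma> continuous_on_compose2[OF _ cont, of UNIV cis])
        (use nz in \<open>auto intro!: continuous_intros\<close>)
    have conta: "continuous_on UNIV a"
      unfolding a_def
    proof (rule continuous_on_diff[OF cont])
      show "continuous_on UNIV (\<lambda>q. Arg (w q))"
      proof (intro continuous_at_imp_continuous_on ballI)
        fix q
        have "isCont w q" using contw by (simp add: continuous_on_eq_continuous_at)
        moreover have "isCont Arg (w q)"
          by (rule continuous_at_Arg) (use Imw[of q] in \<open>auto simp: complex_nonpos_Reals_iff\<close>)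
        ultimately show "isCont (\<lambda>q. Arg (w q)) q" by (rule isCont_o2)
      qed
    qed
    have a: "\<gamma> q - z = norm (\<gamma> q - z) * cis (a q)" for q
    proof -
      have nw: "w q = norm (w q) * cis (Arg (w q))" using rcis_cmod_Arg[of "w q"] by (simp add: rcis_def)
      have n: "norm (w q) = 1 / norm (\<gamma> q - z)" unfolding w_def by (simp add: norm_divide)
      have "norm (\<gamma> q - z) * cis (a q) * w q = cis (\<theta> q)"
      proof -
        have "cis (a q) * cis (Arg (w q)) = cis (\<theta> q)" unfolding a_def by (simp add: cis_mult)
        then show ?thesis using nz[of q] by (subst nw) (simp add: n)
      qed
      also have "\<dots> = (\<gamma> q - z) * w q" unfolding w_def using nz[of q] by simp
      finally show ?thesis using Imw[of q] by (metis mult_right_cancel zero_complex.sel(2) less_irrefl)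
    qed
    have "w (0 + 1) = w 0"
      unfolding w_def per \<theta>per by (simp add: cis_mult[symmetric])
    then have "a 1 = a 0 + 2 * pi" using \<theta>per[of 0] by (simp add: a_def)
    then show ?thesis
      using winding_number_angle_lift[OF cont\<gamma> conta nz a] per[of 0] by simp
  qed
  have sup: "frontier K \<subseteq> range \<gamma>"
  proof
    fix x assume x: "x \<in> frontier K"
    show "x \<in> range \<gamma>"
    proof (rule ccontr)
      assume nr: "x \<notin> range \<gamma>"
      \<comment> \<open>A frontier point off the curve would have a ball missing the curve, on which
        the winding number is constant; yet the ball contains interior points of \<open>K\<close>,
        with winding number 1, and points outside \<open>K\<close>, with winding number 0.\<close>
      have "open (- range \<gamma>)" using compact_imp_closed[OF cran] by (simp add: open_Compl)
      then obtain e where e: "e > 0" "ball x e \<subseteq> - range \<gamma>" using nr open_contains_ball by blast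
      have "x \<in> closure (interior K)"
        using x convex_closure_interior[OF K(2) intK] by (simp add: frontier_def)
      then obtain z1 where z1: "z1 \<in> interior K" "dist z1 x < e"
        using e(1) closure_approachable by blast
      have "x \<in> closure (- K)" using x by (simp add: frontier_closures)
      then obtain z2 where z2: "z2 \<in> - K" "dist z2 x < e"
        using e(1) closure_approachable by blast
      have "winding_number \<gamma> constant_on ball x e"
        by (rule winding_number_constant) (use path e in auto)
      then have "winding_number \<gamma> z1 = winding_number \<gamma> z2"
        using z1(2) z2(2) unfolding constant_on_def by (metis dist_commute mem_ball)
      moreover have "winding_number \<gamma> z2 = 0"
        by (rule winding_number_zero_outside[OF path(1) K(2) path(3)]) (use z2 inK path in auto)
      ultimately show False using wn[OF z1(1)] by simp
    qed
  qed
  show ?thesis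
    unfolding ccw_boundary_param_def convex_body_def K_def[symmetric]
    using K intK cont\<gamma> per inj sub sup wn by auto
qed

section \<open>The distance is controlled by the supremum norm\<close>

lemma at_within_Icc_nontrivial: "s \<in> {a..b} \<Longrightarrow> a < b \<Longrightarrow> at s within {a..b} \<noteq> bot"
  for a b :: real
  by (simp add: trivial_limit_within islimpt_Icc)

lemma quasiperiodic_surj:
  fixes f :: "real \<Rightarrow> real"
  assumes "continuous_on UNIV f" "\<And>q. f (q + 1) = f q + c" "c > 0"
  shows "\<exists>x. f x = y"
proof -
  define k where "k = \<lfloor>(y - f 0) / c\<rfloor>"
  have "k \<le> (y - f 0) / c" "(y - f 0) / c \<le> k + 1" unfolding k_def by linarith+
  then have "c * k \<le> y - f 0" "y - f 0 \<le> c * (k + 1)"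
    using assms(3) by (simp_all add: field_simps)
  moreover have "f (0 + k) = f 0 + c * k" "f (k + 1) = f 0 + c * (k + 1)"
    using quasiperiodic_add_int[of f c 0 k] assms(2)[of k] assms(2) by (simp_all add: algebra_simps)
  ultimately have "f k \<le> y" "y \<le> f (k + 1)" by simp_all
  then show ?thesis
    using IVT'[of f k y "k + 1"] continuous_on_subset[OF assms(1)] by auto
qed

section \<open>Recognizing tables by their tangent angles\<close>

lemma tables_C_I:
  fixes \<psi> :: "real \<Rightarrow> real"
  assumes "smooth_fun \<gamma>" "\<And>q. (\<gamma> has_vector_derivative cis (\<psi> q)) (at q)"
    "continuous_on UNIV \<psi>" "mono \<psi>" "\<And>q. \<psi> (q + 1) = \<psi> q + 2 * pi" "\<And>q. \<gamma> (q + 1) = \<gamma> q"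
  shows "\<gamma> \<in> tables_C"
  using ccw_boundary_param_hull[of \<gamma> 1 \<psi>] assms velocity_eq[OF assms(2)]
  unfolding tables_C_def by auto

lemma curvature_eq:
  assumes "\<And>q. (\<gamma> has_vector_derivative cis (\<psi> q)) (at q)" "(\<psi> has_real_derivative k) (at q)"
  shows "curvature \<gamma> q = k"
proof -
  have v: "velocity \<gamma> = (\<lambda>q. cis (\<psi> q))" using velocity_eq[OF assms(1)] by auto
  have "velocity (velocity \<gamma>) q = \<i> * k * cis (\<psi> q)"
    unfolding v by (rule velocity_eq[OF has_vector_derivative_cis[OF assms(2)]])
  moreover have "cnj (cis x) * cis x = 1" for x by (simp add: cis_cnj cis_mult)
  ultimately show ?thesis unfolding curvature_def v
    by (simp add: algebra_simps)
qed

lemma tables_B_I: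
  assumes "smooth_fun \<gamma>" "\<And>q. (\<gamma> has_vector_derivative cis (\<psi> q)) (at q)"
    "\<And>q. (\<psi> has_real_derivative k q) (at q)" "\<And>q. k q > 0"
    "\<And>q. \<psi> (q + 1) = \<psi> q + 2 * pi" "\<And>q. \<gamma> (q + 1) = \<gamma> q"
  shows "\<gamma> \<in> tables_B"
proof -
  have "continuous_on UNIV \<psi>" using assms(3) by (meson DERIV_continuous_on has_field_derivative_at_within)
  moreover have "mono \<psi>"
  proof (rule monoI)
    fix x y :: real assume "x \<le> y"
    then show "\<psi> x \<le> \<psi> y"
    proof (rule DERIV_nonneg_imp_nondecreasing)
      fix u show "\<exists>d. (\<psi> has_real_derivative d) (at u) \<and> 0 \<le> d"
        using assms(3)[of u] assms(4)[of u] by (intro exI[of _ "k u"]) simp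
    qed
  qed
  ultimately have "\<gamma> \<in> tables_C" using tables_C_I assms by blast
  then show ?thesis unfolding tables_B_def using curvature_eq[OF assms(2,3)] assms(4) by auto
qed

lemma tables_C_support:
  assumes "\<gamma> \<in> tables_C" "(\<gamma> has_vector_derivative cis c) (at q)"
  shows "(\<i> * cis c) \<bullet> \<gamma> q \<le> (\<i> * cis c) \<bullet> \<gamma> u"
proof -
  obtain K where K: "ccw_boundary_param K \<gamma>" using assms unfolding tables_C_def by auto
  have "0 \<le> Im (cnj (cis c) * (\<gamma> u - \<gamma> q))"
    by (rule ccw_boundary_support(1)[OF K assms(2) _ ccw_boundary_paramD(9)[OF K]]) simp
  then show ?thesis unfolding cross_eq by (simp add: inner_diff_right)
qed

lemma tables_C_periodic: "\<gamma> \<in> tables_C \<Longrightarrow> \<gamma> (q + 1) = \<gamma> q"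
  unfolding tables_C_def ccw_boundary_param_def by auto

lemma homotopy_length_le:
  assumes "\<And>s q. s \<in> {0..1} \<Longrightarrow> norm (dt {0..1} H s q) \<le> M"
  shows "homotopy_length H \<le> M"
proof -
  define f where "f s = (SUP q. norm (vector_derivative (\<lambda>t. H t q) (at s within {0..1})))" for s
  have f: "f s \<le> M" if "s \<in> {0..1}" for s
    unfolding f_def using assms[OF that] by (intro cSUP_least) (auto simp: dt_def)
  have M: "M \<ge> 0" using assms[of 0] norm_ge_zero order_trans by (metis atLeastAtMost_iff order_refl zero_le_one)
  have "integral {0..1} f \<le> M"
  proof (cases "f integrable_on {0..1}")
    case True
    have "integral {0..1} f \<le> integral {0..1} (\<lambda>_::real. M)"
      by (rule Henstock_Kurzweil_Integration.integral_le) (use f True in auto)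
    then show ?thesis by simp
  \<comment> \<open>Without integrability the integral is 0 by convention, which still respects the
    nonnegative bound.\<close>
  next
    case False
    then show ?thesis using M by (simp add: not_integrable_integral)
  qed
  then show ?thesis unfolding homotopy_length_def f_def by simp
qed

text \<open>A bound on the speed at every point and time in place of the integral of suprema; it
  carries no integrability condition and behaves well under reversal and concatenation.\<close>

definition bounded_homotopy ::
  "(real \<Rightarrow> complex) set \<Rightarrow> (real \<Rightarrow> complex) \<Rightarrow> (real \<Rightarrow> complex) \<Rightarrow> real \<Rightarrow> bool" where
  "bounded_homotopy M \<alpha> \<beta> B \<longleftrightarrow> (\<exists>H. smooth2 {0..1} UNIV H \<and> (\<forall>s\<in>{0..1}. H s \<in> M) \<and> H 0 = \<alpha> \<and> H 1 = \<beta> \<and>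
     (\<forall>s\<in>{0..1}. \<forall>q. norm (dt {0..1} H s q) \<le> B))"

lemma table_dist_le:
  assumes "bounded_homotopy M \<alpha> \<beta> B"
  shows "table_dist M \<alpha> \<beta> \<le> ennreal B"
proof -
  obtain H where H: "smooth2 {0..1} UNIV H" "\<And>s. s \<in> {0..1} \<Longrightarrow> H s \<in> M" "H 0 = \<alpha>" "H 1 = \<beta>"
    "\<And>s q. s \<in> {0..1} \<Longrightarrow> norm (dt {0..1} H s q) \<le> B"
    using assms unfolding bounded_homotopy_def by blast
  have "smooth_family_on {0..1} H"
    by (rule smooth_family_onI[OF at_within_Icc_nontrivial convex_real_interval(5) H(1)]) auto
  then have "H \<in> smooth_homotopies M \<alpha> \<beta>" using H unfolding smooth_homotopies_def by auto
  then have "table_dist M \<alpha> \<beta> \<le> ennreal (homotopy_length H)"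
    unfolding table_dist_def by (rule INF_lower)
  also have "\<dots> \<le> ennreal B" using homotopy_length_le[OF H(5)] by (simp add: ennreal_leI)
  finally show ?thesis .
qed

text \<open>
  Interpolation by Minkowski sums: points of \<open>\<alpha>\<close> and \<open>\<beta>\<close> with equal tangent angles are combined,
  and the arc lengths of the sums are the combined arc lengths.
\<close>

lemma minkowski_homotopy:
  fixes \<theta> \<phi> Y :: "real \<Rightarrow> real"
  assumes \<alpha>: "\<alpha> \<in> tables_B" and \<beta>: "\<beta> \<in> tables_B"
    and \<theta>: "smooth_fun \<theta>" "\<And>q. (\<alpha> has_vector_derivative cis (\<theta> q)) (at q)"
      "\<And>q. (\<theta> has_real_derivative k q) (at q)" "\<And>q. k q > 0" "\<And>q. \<theta> (q + 1) = \<theta> q + 2 * pi"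
    and \<phi>: "smooth_fun \<phi>" "\<And>q. (\<beta> has_vector_derivative cis (\<phi> q)) (at q)"
    and Y: "smooth_fun Y" "\<And>q. (Y has_real_derivative Y' q) (at q)" "\<And>q. Y' q > 0"
      "\<And>q. Y (q + 1) = Y q + 1" "\<And>q. \<phi> (Y q) = \<theta> q"
    and M: "\<And>x. norm (\<beta> (Y x) - \<alpha> x - (Y x - x) *\<^sub>R cis (\<theta> x)) \<le> M"
  shows "bounded_homotopy tables_B \<alpha> \<beta> M"
proof -
  let ?A = "{0..1::real}"
  note nt = at_within_Icc_nontrivial[of _ 0 "1::real", OF _ zero_less_one]
  note cv = convex_real_interval(5)[of 0 "1::real"]
  have sm: "smooth_fun \<alpha>" "smooth_fun \<beta>" using \<alpha> \<beta> unfolding tables_B_def tables_C_def by auto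
  \<comment> \<open>The parameter \<open>x\<close> labels a common tangent angle: \<alpha> x and
    \<beta> (Y x) have the same tangent direction. \<sigma> t is the arc length of the combined
    curve in this parameter, and its inverse \<open>U\<close> restores unit speed.\<close>
  define b where "b t x = (1 - t) *\<^sub>R \<alpha> x + t *\<^sub>R \<beta> (Y x)" for t x
  define \<sigma> where "\<sigma> t x = (1 - t) * x + t * Y x" for t x :: real
  have sY: "smooth2 A J (\<lambda>s. Y)" for A J by (rule smooth2_of_smooth_fun[OF Y(1)])
  have sb: "smooth2 ?A UNIV b"
    unfolding b_def by (intro smooth2_intros smooth2_compose1[OF sm(2)] sY smooth2_of_smooth_fun[OF sm(1)])
  have s\<sigma>: "smooth2 ?A UNIV \<sigma>"
    unfolding \<sigma>_def by (intro smooth2_intros sY)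
  have d\<sigma>: "(\<sigma> t has_real_derivative (1 - t) + t * Y' x) (at x)" for t x
    unfolding \<sigma>_def using Y(2)[of x] by (auto intro!: derivative_eq_intros)
  have dq\<sigma>: "dq \<sigma> t x = (1 - t) + t * Y' x" for t x
    using d\<sigma>[of t x] unfolding dq_def has_real_derivative_iff_has_vector_derivative
    by (rule vector_derivative_at)
  have pos: "dq \<sigma> t x > 0" if "t \<in> ?A" for t x
  proof (cases "t = 0")
    case False
    then have "t * Y' x > 0" using that Y(3)[of x] by simp
    then show ?thesis using that unfolding dq\<sigma> by simp
  qed (simp add: dq\<sigma>)
  have \<sigma>per: "\<sigma> t (x + 1) = \<sigma> t x + 1" for t x unfolding \<sigma>_def Y(4) by (simp add: algebra_simps)
  have "\<exists>x. \<sigma> t x = q" for t q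
  proof (rule quasiperiodic_surj[where f = "\<sigma> t" and c = 1, OF _ \<sigma>per])
    show "continuous_on UNIV (\<sigma> t)"
      using d\<sigma> by (meson DERIV_continuous_on has_field_derivative_at_within)
  qed simp
  then obtain U where U: "\<And>t q. \<sigma> t (U t q) = q" by metis
  have inv: "smooth2 ?A UNIV U" "\<And>t q. t \<in> ?A \<Longrightarrow> U t (\<sigma> t q) = q"
    "\<And>t q. t \<in> ?A \<Longrightarrow> (U t has_real_derivative inverse (dq \<sigma> t (U t q))) (at q)"
    by (rule smooth2_inverse_family[OF nt cv s\<sigma> pos U]; simp)+
  define H where "H t q = b t (U t q)" for t q
  have sH: "smooth2 ?A UNIV H" unfolding H_def by (rule smooth2_compose[OF sb inv(1)])
  have Uper: "U t (q + 1) = U t q + 1" if "t \<in> ?A" for t q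
    using inv(2)[OF that, of "U t q + 1"] \<sigma>per U by metis
  \<comment> \<open>Both summands have velocities along cis (\<theta> x), so the velocity of the sum
    has that direction and length dq \<sigma>.\<close>
  have dbx: "(b t has_vector_derivative dq \<sigma> t x *\<^sub>R cis (\<theta> x)) (at x)" for t x
  proof -
    have "((\<lambda>x. \<beta> (Y x)) has_vector_derivative Y' x *\<^sub>R cis (\<phi> (Y x))) (at x)"
      using vector_diff_chain_at[OF _ \<phi>(2), of Y "Y' x" x] Y(2)[of x]
      by (simp add: comp_def has_real_derivative_iff_has_vector_derivative)
    then show ?thesis unfolding b_def dq\<sigma> using \<theta>(2)[of x] Y(5)[of x]
      by (auto intro!: derivative_eq_intros simp: algebra_simps)
  qed
  have dHq: "(H t has_vector_derivative cis (\<theta> (U t q))) (at q)" if t: "t \<in> ?A" for t q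
  proof -
    have "(U t has_vector_derivative inverse (dq \<sigma> t (U t q))) (at q)"
      using inv(3)[OF t, of q] by (simp add: has_real_derivative_iff_has_vector_derivative)
    from vector_diff_chain_at[OF this dbx[of t]]
    show ?thesis using pos[OF t, of "U t q"] by (simp add: comp_def H_def[abs_def])
  qed
  show ?thesis
    unfolding bounded_homotopy_def
  proof (intro exI[of _ H] conjI ballI allI sH)
    fix t assume t: "t \<in> ?A"
    show "H t \<in> tables_B"
    proof (rule tables_B_I[OF smooth_fun_of_smooth2[OF sH t nt] dHq[OF t]])
      fix q
      show "((\<lambda>q. \<theta> (U t q)) has_real_derivative k (U t q) * inverse (dq \<sigma> t (U t q))) (at q)"
        by (rule DERIV_chain2[OF \<theta>(3) inv(3)[OF t]])
      show "k (U t q) * inverse (dq \<sigma> t (U t q)) > 0" using \<theta>(4) pos[OF t] by simp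
      show "\<theta> (U t (q + 1)) = \<theta> (U t q) + 2 * pi" using Uper[OF t] \<theta>(5) by simp
      show "H t (q + 1) = H t q"
        using \<alpha> \<beta> unfolding H_def b_def Uper[OF t] Y(4) tables_B_def by (simp add: tables_C_periodic)
    qed
    fix q
    define x where "x = U t q"
    have x: "\<sigma> t x = q" by (simp add: x_def U)
    have Hs: "H s (\<sigma> s x) = b s x" if "s \<in> ?A" for s unfolding H_def using inv(2)[OF that] by simp
    \<comment> \<open>The distance is measured at fixed arc length, whereas the combination is
      explicit at fixed \<open>x\<close>. The chain rule between the two subtracts the tangential
      drift (Y x - x) * cis (\<theta> x), which accounts for the quantity bounded by
      \<open>M\<close>.\<close>
    have "((\<lambda>s. H s (\<sigma> s x)) has_vector_derivative dt ?A H t (\<sigma> t x) + (Y x - x) *\<^sub>R dq H t (\<sigma> t x))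
        (at t within ?A)"
    proof (rule chain_rule_family[OF _ _ _ _ t])
      show "((\<lambda>s. H s (\<sigma> t x)) has_vector_derivative dt ?A H t (\<sigma> t x)) (at t within ?A)"
        using smooth2D(3)[OF nt open_UNIV sH t] by simp
      show "(H s has_vector_derivative dq H s y) (at y)" if "s \<in> ?A" for s y
        using smooth2D(4)[OF nt open_UNIV sH that] by simp
      show "continuous_on (?A \<times> UNIV) (\<lambda>(s, q). dq H s q)"
        by (rule smooth2_continuous[OF smooth2D(2)[OF nt open_UNIV sH]])
      show "((\<lambda>s. \<sigma> s x) has_vector_derivative Y x - x) (at t within ?A)"
        unfolding \<sigma>_def by (auto intro!: derivative_eq_intros)
    qed
    moreover have "((\<lambda>s. H s (\<sigma> s x)) has_vector_derivative \<beta> (Y x) - \<alpha> x) (at t within ?A)"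
    proof (rule has_vector_derivative_transform[OF t Hs])
      show "((\<lambda>s. b s x) has_vector_derivative \<beta> (Y x) - \<alpha> x) (at t within ?A)"
        unfolding b_def by (auto intro!: derivative_eq_intros)
    qed
    ultimately have "dt ?A H t (\<sigma> t x) + (Y x - x) *\<^sub>R dq H t (\<sigma> t x) = \<beta> (Y x) - \<alpha> x"
      using vector_derivative_unique_within nt[OF t] by blast
    moreover have "dq H t q = cis (\<theta> x)"
      unfolding dq_def x_def by (rule vector_derivative_at[OF dHq[OF t]])
    ultimately have "dt ?A H t q = \<beta> (Y x) - \<alpha> x - (Y x - x) *\<^sub>R cis (\<theta> x)"
      unfolding x by (simp add: algebra_simps)
    then show "norm (dt ?A H t q) \<le> M" using M[of x] by simp
  next
    show "H 0 = \<alpha>" using U[of 0] by (auto simp: H_def b_def \<sigma>_def)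
    show "H 1 = \<beta>" using U[of 1] by (auto simp: H_def b_def \<sigma>_def)
  qed
qed

section \<open>From the uniform distance to a short homotopy\<close>

lemma cis_add_2pi: "cis (x + 2 * pi) = cis x"
  by (simp add: complex_eq_iff)

lemma norm_le_components:
  "norm w \<le> \<bar>cis x \<bullet> w\<bar> + \<bar>(\<i> * cis x) \<bullet> w\<bar>"
proof -
  have "norm w = norm (cnj (cis x) * w)" by (simp add: norm_mult)
  also have "\<dots> \<le> \<bar>Re (cnj (cis x) * w)\<bar> + \<bar>Im (cnj (cis x) * w)\<bar>" by (rule cmod_le)
  finally show ?thesis by (simp add: inner_complex_def algebra_simps)
qed

lemma abs_inner_unit_le: "norm e = 1 \<Longrightarrow> \<bar>e \<bullet> w\<bar> \<le> norm w" for e w :: complex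
  using Cauchy_Schwarz_ineq2[of e w] by simp

text \<open>The velocity of the homotopy has normal component \<open>N\<close>, at most
  \<open>d\<close> by comparing supporting lines, and tangential component \<open>T\<close> with
  derivative curvature * N. So \<open>T\<close> varies by at most 2 * pi * d over a period, and at
  \<open>x0\<close> it is at most d + 2 * pi * d. Together this is (2 + 4 * pi) * d, and pi <
  4.\<close>

theorem bounded_homotopy_tables_B:
  assumes \<alpha>: "\<alpha> \<in> tables_B" and \<beta>: "\<beta> \<in> tables_B" and d: "\<And>q. norm (\<alpha> q - \<beta> q) \<le> d"
  shows "bounded_homotopy tables_B \<alpha> \<beta> (18 * d)"
proof -
  have C: "\<alpha> \<in> tables_C" "\<beta> \<in> tables_C" using \<alpha> \<beta> unfolding tables_B_def by auto
  obtain \<theta> where \<theta>: "smooth_fun \<theta>" "\<And>q. (\<alpha> has_vector_derivative cis (\<theta> q)) (at q)"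
    "\<And>q. (\<theta> has_real_derivative curvature \<alpha> q) (at q)" "\<And>q. \<theta> (q + 1) = \<theta> q + 2 * pi"
    using tables_C_angle[OF C(1)] by metis
  obtain \<phi>' where \<phi>': "smooth_fun \<phi>'" "\<And>q. (\<beta> has_vector_derivative cis (\<phi>' q)) (at q)"
    "\<And>q. (\<phi>' has_real_derivative curvature \<beta> q) (at q)" "\<And>q. \<phi>' (q + 1) = \<phi>' q + 2 * pi"
    using tables_C_angle[OF C(2)] by metis
  have kpos: "curvature \<alpha> q > 0" "curvature \<beta> q > 0" for q using \<alpha> \<beta> unfolding tables_B_def by auto
  have d0: "d \<ge> 0" using d[of 0] norm_ge_zero order_trans by blast
  have inner_cis: "cis x \<bullet> cis y = cos (y - x)" for x y
    by (simp add: inner_complex_def cos_diff algebra_simps)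
  text \<open>
    Integrating \<open>\<bar>\<alpha>' - \<beta>'\<bar>\<^sup>2\<close> by parts over a period bounds it by \<open>4 * pi * d\<close>, because the second
    derivatives have total mass \<open>2 * pi\<close> each. So the tangents almost agree at some \<open>x0\<close>.
  \<close>
  obtain x0 where x0: "1 - cos (\<phi>' x0 - \<theta> x0) \<le> 2 * pi * d"
  proof -
    define D where "D q = \<alpha> q - \<beta> q" for q
    define D1 where "D1 q = cis (\<theta> q) - cis (\<phi>' q)" for q
    define D2 where "D2 q = \<i> * curvature \<alpha> q * cis (\<theta> q) - \<i> * curvature \<beta> q * cis (\<phi>' q)" for q
    have dD: "(D has_vector_derivative D1 q) (at q)" for q
      unfolding D_def D1_def by (intro has_vector_derivative_diff \<theta> \<phi>')
    have dD1: "(D1 has_vector_derivative D2 q) (at q)" for q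
      unfolding D1_def D2_def by (intro has_vector_derivative_diff has_vector_derivative_cis \<theta> \<phi>')
    \<comment> \<open>The integration by parts in mean-value form: the added angle term has a
      derivative that outweighs the second-derivative term, so F' is at least |D1|^2, while the
      periodicity of \<open>D\<close> and \<open>D1\<close> leaves F 1 - F 0 = 4 * pi * d.\<close>
    define F where "F q = D q \<bullet> D1 q + d * (\<theta> q + \<phi>' q)" for q
    have dF: "(F has_real_derivative (D q \<bullet> D2 q + D1 q \<bullet> D1 q + d * (curvature \<alpha> q + curvature \<beta> q))) (at q)" for q
    proof -
      have "((\<lambda>q. D q \<bullet> D1 q) has_real_derivative (D q \<bullet> D2 q + D1 q \<bullet> D1 q)) (at q)"
        using bounded_bilinear.has_vector_derivative[OF bounded_bilinear_inner dD dD1]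
        by (simp add: has_real_derivative_iff_has_vector_derivative)
      then show ?thesis unfolding F_def
        by (intro DERIV_add DERIV_cmult \<theta> \<phi>')
    qed
    obtain x0 where "F 1 - F 0 = D x0 \<bullet> D2 x0 + D1 x0 \<bullet> D1 x0 + d * (curvature \<alpha> x0 + curvature \<beta> x0)"
      using MVT2[OF zero_less_one dF] by auto
    moreover have "F 1 - F 0 = 4 * pi * d"
      using tables_C_periodic[OF C(1), of 0] tables_C_periodic[OF C(2), of 0] \<theta>(4)[of 0] \<phi>'(4)[of 0]
        cis_add_2pi[of "\<theta> 0"] cis_add_2pi[of "\<phi>' 0"]
      unfolding F_def D_def D1_def by (simp add: algebra_simps)
    moreover have "\<bar>D x0 \<bullet> D2 x0\<bar> \<le> d * (curvature \<alpha> x0 + curvature \<beta> x0)"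
    proof -
      have "norm (D2 x0) \<le> curvature \<alpha> x0 + curvature \<beta> x0"
        unfolding D2_def using norm_triangle_ineq4[of "\<i> * curvature \<alpha> x0 * cis (\<theta> x0)" "\<i> * curvature \<beta> x0 * cis (\<phi>' x0)"] kpos[of x0]
        by (simp add: norm_mult)
      then have "norm (D x0) * norm (D2 x0) \<le> d * (curvature \<alpha> x0 + curvature \<beta> x0)"
        using d[of x0] d0 by (intro mult_mono) (auto simp: D_def)
      then show ?thesis using Cauchy_Schwarz_ineq2[of "D x0" "D2 x0"] by linarith
    qed
    ultimately have "D1 x0 \<bullet> D1 x0 \<le> 4 * pi * d" by linarith
    moreover have "D1 x0 \<bullet> D1 x0 = 2 - 2 * cos (\<phi>' x0 - \<theta> x0)"
      unfolding D1_def inner_diff_left inner_diff_right inner_cis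
      using cos_minus[of "\<phi>' x0 - \<theta> x0"] by simp
    ultimately show ?thesis using that[of x0] by simp
  qed
  \<comment> \<open>The cosine sees angles only modulo 2 * pi; this shift brings the angle of
    \<beta> at \<open>x0\<close> within pi of that of \<alpha>, so that \<open>Y x0\<close> belongs
    to the same turn as \<open>x0\<close>.\<close>
  define m where "m = round ((\<theta> x0 - \<phi>' x0) / (2 * pi))"
  define \<phi> where "\<phi> q = \<phi>' q + 2 * pi * m" for q
  have cis\<phi>: "cis (\<phi> q) = cis (\<phi>' q)" for q
    unfolding \<phi>_def cis_mult[symmetric] using cis_multiple_2pi[of "of_int m"] by simp
  have \<phi>: "smooth_fun \<phi>" "\<And>q. (\<beta> has_vector_derivative cis (\<phi> q)) (at q)"
    "\<And>q. (\<phi> has_real_derivative curvature \<beta> q) (at q)" "\<And>q. \<phi> (q + 1) = \<phi> q + 2 * pi"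
  proof -
    show "smooth_fun \<phi>"
      by (rule smooth_funI, unfold \<phi>_def) (intro smooth2_intros smooth2_of_smooth_fun \<phi>')
    show "(\<beta> has_vector_derivative cis (\<phi> q)) (at q)" for q unfolding cis\<phi> by (rule \<phi>'(2))
    show "(\<phi> has_real_derivative curvature \<beta> q) (at q)" for q
      unfolding \<phi>_def using DERIV_add[OF \<phi>'(3) DERIV_const] by simp
    show "\<phi> (q + 1) = \<phi> q + 2 * pi" for q unfolding \<phi>_def using \<phi>'(4) by simp
  qed
  have near: "\<bar>\<phi> x0 - \<theta> x0\<bar> \<le> pi"
  proof -
    have "\<bar>of_int m - (\<theta> x0 - \<phi>' x0) / (2 * pi)\<bar> \<le> 1 / 2" unfolding m_def by (rule of_int_round_abs_le)
    then have "2 * pi * \<bar>of_int m - (\<theta> x0 - \<phi>' x0) / (2 * pi)\<bar> \<le> 2 * pi * (1 / 2)"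
      by (intro mult_left_mono) auto
    moreover have "2 * pi * \<bar>of_int m - (\<theta> x0 - \<phi>' x0) / (2 * pi)\<bar> = \<bar>2 * pi * (of_int m - (\<theta> x0 - \<phi>' x0) / (2 * pi))\<bar>"
      by (simp add: abs_mult)
    moreover have "2 * pi * (of_int m - (\<theta> x0 - \<phi>' x0) / (2 * pi)) = \<phi> x0 - \<theta> x0"
      by (simp add: \<phi>_def field_simps)
    ultimately show ?thesis by simp
  qed
  have near': "1 - cos (\<phi> x0 - \<theta> x0) \<le> 2 * pi * d"
    using x0 inner_cis[of "\<theta> x0" "\<phi> x0"] inner_cis[of "\<theta> x0" "\<phi>' x0"] cis\<phi>[of x0] by simp
  have \<phi>mono: "strict_mono \<phi>"
    by (intro strict_monoI) (metis DERIV_pos_imp_increasing \<phi>(3) kpos(2))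
  have "\<exists>y. \<phi> y = x" for x
    by (rule quasiperiodic_surj[where c = "2 * pi"]) (use \<phi>(4) smooth_fun_continuous[OF \<phi>(1)] in auto)
  then obtain S where S: "\<And>x. \<phi> (S x) = x" by metis
  have dq\<phi>: "dq (\<lambda>_::real. \<phi>) s x = curvature \<beta> x" for s x
    using \<phi>(3)[of x] unfolding dq_def has_real_derivative_iff_has_vector_derivative
    by (rule vector_derivative_at)
  have ntU: "at s within UNIV \<noteq> bot" for s :: real by simp
  \<comment> \<open>The theorem on families of inverses, applied to the constant family
    \<phi>.\<close>
  note inv = smooth2_inverse_family[OF ntU convex_UNIV smooth2_of_smooth_fun[OF \<phi>(1)], of "\<lambda>_. S", unfolded dq\<phi>, OF kpos(2) S]
  define Y where "Y x = S (\<theta> x)" for x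
  define Y' where "Y' x = inverse (curvature \<beta> (Y x)) * curvature \<alpha> x" for x
  have Y: "smooth_fun Y" "\<And>q. (Y has_real_derivative Y' q) (at q)" "\<And>q. Y' q > 0"
      "\<And>q. Y (q + 1) = Y q + 1" "\<And>q. \<phi> (Y q) = \<theta> q"
  proof -
    have "smooth2 UNIV UNIV (\<lambda>s q. S (\<theta> q))"
      by (rule smooth2_compose[OF inv(1) smooth2_of_smooth_fun[OF \<theta>(1)]])
    then show "smooth_fun Y" unfolding Y_def by (rule smooth_funI)
    show "(Y has_real_derivative Y' q) (at q)" for q
      unfolding Y_def Y'_def by (rule DERIV_chain2[OF _ \<theta>(3)]) (use inv(3)[of 0 "\<theta> q"] in simp)
    show "Y' q > 0" for q using kpos by (simp add: Y'_def)
    show "\<phi> (Y q) = \<theta> q" for q by (simp add: Y_def S)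
    then have "\<phi> (Y (q + 1)) = \<phi> (Y q + 1)" for q using \<theta>(4) \<phi>(4) by simp
    then show "Y (q + 1) = Y q + 1" for q using \<phi>mono by (simp add: strict_mono_eq)
  qed
  define N where "N x = (\<i> * cis (\<theta> x)) \<bullet> (\<beta> (Y x) - \<alpha> x)" for x
  define T where "T x = cis (\<theta> x) \<bullet> (\<beta> (Y x) - \<alpha> x) - (Y x - x)" for x
  \<comment> \<open>In the direction normal to the common tangent, \<alpha> is lowest at
    \<open>x\<close> and \<beta> at \<open>Y x\<close>. Comparing the two minima at the common
    parameter \<open>x\<close> gives the upper bound, at \<open>Y x\<close> the lower one.\<close>
  have N: "\<bar>N x\<bar> \<le> d" for x
  proof -
    let ?n = "\<i> * cis (\<theta> x)"
    have n: "\<bar>?n \<bullet> (\<alpha> q - \<beta> q)\<bar> \<le> d" for q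
      using abs_inner_unit_le[of ?n "\<alpha> q - \<beta> q"] d[of q] by (simp add: norm_mult)
    have "?n \<bullet> \<alpha> x \<le> ?n \<bullet> \<alpha> (Y x)" by (rule tables_C_support[OF C(1) \<theta>(2)])
    moreover have "?n \<bullet> \<beta> (Y x) \<le> ?n \<bullet> \<beta> x"
      using tables_C_support[OF C(2) \<phi>(2), of "Y x" x] Y(5) by simp
    ultimately show ?thesis using n[of x] n[of "Y x"] unfolding N_def inner_diff_right by linarith
  qed
  \<comment> \<open>The tangential part of the derivative is Y' x - 1 and cancels against that of Y
    x - x; only the rotation of the frame remains.\<close>
  have dT: "(T has_real_derivative curvature \<alpha> x * N x) (at x)" for x
  proof -
    have "((\<lambda>x. \<beta> (Y x)) has_vector_derivative Y' x *\<^sub>R cis (\<theta> x)) (at x)"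
      using vector_diff_chain_at[OF _ \<phi>(2), of Y "Y' x" x] Y(2)[of x] Y(5)
      by (simp add: comp_def has_real_derivative_iff_has_vector_derivative)
    from bounded_bilinear.has_vector_derivative[OF bounded_bilinear_inner
        has_vector_derivative_cis[OF \<theta>(3)] has_vector_derivative_diff[OF this \<theta>(2)]]
    have "((\<lambda>x. cis (\<theta> x) \<bullet> (\<beta> (Y x) - \<alpha> x)) has_real_derivative
        (cis (\<theta> x) \<bullet> (Y' x *\<^sub>R cis (\<theta> x) - cis (\<theta> x)) + (\<i> * curvature \<alpha> x * cis (\<theta> x)) \<bullet> (\<beta> (Y x) - \<alpha> x))) (at x)"
      by (simp add: has_real_derivative_iff_has_vector_derivative)
    moreover have "cis (\<theta> x) \<bullet> (Y' x *\<^sub>R cis (\<theta> x) - cis (\<theta> x)) = Y' x - 1"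
      by (simp add: inner_diff_right inner_cis)
    moreover have "(\<i> * curvature \<alpha> x * cis (\<theta> x)) \<bullet> (\<beta> (Y x) - \<alpha> x) = curvature \<alpha> x * N x"
    proof -
      have "\<i> * curvature \<alpha> x * cis (\<theta> x) = curvature \<alpha> x *\<^sub>R (\<i> * cis (\<theta> x))"
        by (simp add: scaleR_conv_of_real mult_ac)
      then show ?thesis unfolding N_def by simp
    qed
    ultimately show ?thesis
      unfolding T_def using Y(2)[of x] by (auto intro!: derivative_eq_intros)
  qed
  have Tper: "T (x + 1) = T x" for x
    unfolding T_def Y(4) \<theta>(4) tables_C_periodic[OF C(1)] tables_C_periodic[OF C(2)]
    by (simp add: cis_add_2pi)
  have T0: "\<bar>T x0\<bar> \<le> d + 2 * pi * d"
  proof -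
    define y0 where "y0 = Y x0"
    have \<phi>y0: "\<phi> y0 = \<theta> x0" by (simp add: y0_def Y)
    \<comment> \<open>\<open>G\<close> measures how much the projection of \<beta> to the tangent at
      \<open>x0\<close> falls short of arc length. Its derivative is small between \<open>x0\<close>
      and \<open>y0\<close>, since there the tangent of \<beta> is no farther from \<theta> x0 than
      at \<open>x0\<close>.\<close>
    define G where "G u = cis (\<theta> x0) \<bullet> \<beta> u - u" for u
    have dG: "(G has_real_derivative cos (\<phi> u - \<theta> x0) - 1) (at u)" for u
    proof -
      have "((\<lambda>u. cis (\<theta> x0) \<bullet> \<beta> u) has_real_derivative cis (\<theta> x0) \<bullet> cis (\<phi> u)) (at u)"
        using bounded_linear.has_vector_derivative[OF bounded_linear_inner_right \<phi>(2)]
        by (simp add: has_real_derivative_iff_has_vector_derivative)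
      then show ?thesis unfolding G_def inner_cis by (auto intro!: derivative_eq_intros)
    qed
    \<comment> \<open>Between \<open>x0\<close> and \<open>y0\<close> the tangent of \<beta> turns
      by at most pi, which is less than a full period.\<close>
    have "y0 < x0 + 1" "x0 < y0 + 1"
      using near \<phi>(4)[of x0] \<phi>(4)[of y0] \<phi>y0 pi_gt_zero strict_mono_less[OF \<phi>mono]
      by (smt (verit))+
    then have le1: "\<bar>y0 - x0\<bar> \<le> 1" by linarith
    have bound: "\<bar>cos (\<phi> u - \<theta> x0) - 1\<bar> \<le> 2 * pi * d"
      if "u \<in> {min x0 y0..max x0 y0}" for u
    proof -
      have "\<bar>\<phi> u - \<theta> x0\<bar> \<le> \<bar>\<phi> x0 - \<theta> x0\<bar>"
        using that strict_mono_less_eq[OF \<phi>mono] \<phi>y0 by (smt (verit) atLeastAtMost_iff)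
      then have "cos \<bar>\<phi> x0 - \<theta> x0\<bar> \<le> cos \<bar>\<phi> u - \<theta> x0\<bar>"
        by (intro cos_monotone_0_pi_le) (use near in auto)
      then show ?thesis using near' cos_le_one[of "\<phi> u - \<theta> x0"] by simp
    qed
    have "\<bar>G y0 - G x0\<bar> \<le> 2 * pi * d * \<bar>y0 - x0\<bar>"
    proof -
      have "norm (G y0 - G x0) \<le> (2 * pi * d) * norm (y0 - x0)"
        by (rule field_differentiable_bound[of "{min x0 y0..max x0 y0}" G "\<lambda>u. cos (\<phi> u - \<theta> x0) - 1"])
          (use bound dG in \<open>auto intro: has_field_derivative_at_within\<close>)
      then show ?thesis by simp
    qed
    also have "\<dots> \<le> 2 * pi * d * 1" using le1 d0 by (intro mult_left_mono) auto
    finally have "\<bar>G y0 - G x0\<bar> \<le> 2 * pi * d" by simp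
    moreover have "\<bar>cis (\<theta> x0) \<bullet> (\<alpha> x0 - \<beta> x0)\<bar> \<le> d"
      using abs_inner_unit_le[of "cis (\<theta> x0)" "\<alpha> x0 - \<beta> x0"] d[of x0] by simp
    moreover have "T x0 = G y0 - G x0 - cis (\<theta> x0) \<bullet> (\<alpha> x0 - \<beta> x0)"
      unfolding T_def G_def y0_def by (simp add: inner_diff_right)
    ultimately show ?thesis by linarith
  qed
  \<comment> \<open>Since |T'| is at most d * \<theta>', the functions T - d * \<theta> and T + d *
    \<theta> are monotone, and \<theta> gains 2 * pi in a period.\<close>
  have Tosc: "\<bar>T x - T x0\<bar> \<le> 2 * pi * d" for x
  proof -
    define k where "k = \<lfloor>x - x0\<rfloor>"
    define y where "y = x - k"
    have y: "x0 \<le> y" "y \<le> x0 + 1" unfolding y_def k_def by linarith+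
    have Ty: "T x = T y" using periodic_add_int[of T y k] Tper by (simp add: y_def)
    have \<theta>mono: "\<theta> y \<le> \<theta> (x0 + 1)"
      by (rule DERIV_nonneg_imp_nondecreasing[OF y(2)]) (use \<theta>(3) kpos(1) less_imp_le in meson)
    have "T y - d * \<theta> y \<le> T x0 - d * \<theta> x0"
    proof (rule DERIV_nonpos_imp_nonincreasing[OF y(1)])
      fix u
      have "((\<lambda>x. T x - d * \<theta> x) has_real_derivative curvature \<alpha> u * N u - d * curvature \<alpha> u) (at u)"
        by (intro DERIV_diff dT DERIV_cmult \<theta>(3))
      moreover have "curvature \<alpha> u * N u \<le> curvature \<alpha> u * d" using N[of u] kpos(1)[of u] by (intro mult_left_mono) auto
      ultimately show "\<exists>v. ((\<lambda>x. T x - d * \<theta> x) has_real_derivative v) (at u) \<and> v \<le> 0"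
        by (intro exI conjI) (assumption, simp add: mult.commute)
    qed
    moreover have "T x0 + d * \<theta> x0 \<le> T y + d * \<theta> y"
    proof (rule DERIV_nonneg_imp_nondecreasing[OF y(1)])
      fix u
      have "((\<lambda>x. T x + d * \<theta> x) has_real_derivative curvature \<alpha> u * N u + d * curvature \<alpha> u) (at u)"
        by (intro DERIV_add dT DERIV_cmult \<theta>(3))
      moreover have "curvature \<alpha> u * (- d) \<le> curvature \<alpha> u * N u" using N[of u] kpos(1)[of u] by (intro mult_left_mono) auto
      ultimately show "\<exists>v. ((\<lambda>x. T x + d * \<theta> x) has_real_derivative v) (at u) \<and> 0 \<le> v"
        by (intro exI conjI) (assumption, simp add: mult.commute)
    qed
    moreover have "d * \<theta> y \<le> d * (\<theta> x0 + 2 * pi)" using \<theta>mono \<theta>(4) d0 by (intro mult_left_mono) auto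
    ultimately show ?thesis unfolding Ty by (simp add: algebra_simps)
  qed
  have "norm (\<beta> (Y x) - \<alpha> x - (Y x - x) *\<^sub>R cis (\<theta> x)) \<le> 18 * d" for x
  proof -
    let ?V = "\<beta> (Y x) - \<alpha> x - (Y x - x) *\<^sub>R cis (\<theta> x)"
    have "cis (\<theta> x) \<bullet> ?V = T x" unfolding T_def by (simp add: inner_diff_right inner_cis)
    moreover have "(\<i> * cis (\<theta> x)) \<bullet> ?V = N x" unfolding N_def
      by (simp add: inner_diff_right inner_complex_def algebra_simps)
    ultimately have "norm ?V \<le> \<bar>T x\<bar> + \<bar>N x\<bar>" using norm_le_components[of ?V "\<theta> x"] by simp
    also have "\<dots> \<le> (d + 2 * pi * d + 2 * pi * d) + d" using Tosc[of x] T0 N[of x] by linarith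
    also have "\<dots> \<le> 18 * d" using mult_right_mono[of pi 4 d] pi_less_4 d0 by simp
    finally show ?thesis .
  qed
  then show ?thesis
    by (rule minkowski_homotopy[OF \<alpha> \<beta> \<theta>(1,2,3) kpos(1) \<theta>(4) \<phi>(1,2) Y])
qed

section \<open>Smooth steps and concatenation of homotopies\<close>

text \<open>The functions p(1/x) * exp(-1/x), extended by 0, form a class closed under
  differentiation: on the polynomials, differentiation acts as p to X^2 * (p - p').\<close>

definition bump_poly :: "real poly \<Rightarrow> real \<Rightarrow> real" where
  "bump_poly p x = (if x > 0 then poly p (1 / x) * exp (- (1 / x)) else 0)"

lemma poly_exp_tendsto_0: "((\<lambda>y. poly p y * exp (- y)) \<longlongrightarrow> 0) at_top" for p :: "real poly"
proof -
  have "((\<lambda>y. \<Sum>i\<le>degree p. coeff p i * (y ^ i / exp y)) \<longlongrightarrow> (\<Sum>i\<le>degree p. coeff p i * 0)) at_top"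
    by (intro tendsto_intros tendsto_power_div_exp_0)
  then show ?thesis
    by (simp add: poly_altdef exp_minus sum_distrib_right sum_divide_distrib field_simps)
qed

lemma bump_poly_deriv:
  "(bump_poly p has_real_derivative bump_poly ([:0, 0, 1:] * (p - pderiv p)) x) (at x)"
proof (cases x "0::real" rule: linorder_cases)
  case less
  have "(bump_poly p has_real_derivative 0) (at x)"
    by (rule has_field_derivative_transform_within_open[of "\<lambda>_. 0" 0 x "{..<0}"])
      (use less in \<open>auto simp: bump_poly_def\<close>)
  then show ?thesis using less by (simp add: bump_poly_def)
next
  case greater
  have "((\<lambda>x. poly p (1 / x) * exp (- (1 / x))) has_real_derivative
      bump_poly ([:0, 0, 1:] * (p - pderiv p)) x) (at x)"
  proof -
    have 1: "((\<lambda>x. 1 / x) has_real_derivative - (1 / x\<^sup>2)) (at x)"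
      using greater by (auto intro!: derivative_eq_intros simp: power2_eq_square)
    have 2: "((\<lambda>x. poly p (1 / x)) has_real_derivative poly (pderiv p) (1 / x) * (- (1 / x\<^sup>2))) (at x)"
      by (rule DERIV_chain2[OF poly_DERIV 1])
    have 3: "((\<lambda>x. exp (- (1 / x))) has_real_derivative exp (- (1 / x)) * (1 / x\<^sup>2)) (at x)"
      using DERIV_chain2[OF DERIV_exp DERIV_minus[OF 1]] by simp
    show ?thesis
      using DERIV_mult[OF 2 3] greater by (simp add: bump_poly_def algebra_simps power2_eq_square)
  qed
  then show ?thesis
    by (rule has_field_derivative_transform_within_open[where S = "{0<..}"])
      (use greater in \<open>auto simp: bump_poly_def\<close>)
next
  case equal
  \<comment> \<open>At 0 the difference quotient from the right is again of this form, with
    polynomial X * p, and the exponential beats every polynomial.\<close>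
  have "((\<lambda>h. bump_poly p h / h) \<longlongrightarrow> 0) (at 0)"
  proof (rule filterlim_split_at)
    show "((\<lambda>h. bump_poly p h / h) \<longlongrightarrow> 0) (at_left 0)"
      by (rule tendsto_eventually) (auto simp: eventually_at_left_field bump_poly_def intro: exI[of _ "-1"])
    have "filterlim (\<lambda>h::real. inverse h) at_top (at_right 0)" by (rule filterlim_inverse_at_top_right)
    from filterlim_compose[OF poly_exp_tendsto_0[of "[:0, 1:] * p"] this]
    have "((\<lambda>h. poly ([:0, 1:] * p) (inverse h) * exp (- inverse h)) \<longlongrightarrow> 0) (at_right 0)" .
    then show "((\<lambda>h. bump_poly p h / h) \<longlongrightarrow> 0) (at_right 0)"
      by (rule Lim_transform_eventually)
        (auto simp: eventually_at_right_field bump_poly_def field_simps intro: exI[of _ 1])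
  qed
  then show ?thesis
    using equal by (simp add: has_field_derivative_iff bump_poly_def)
qed

definition smooth_exp :: "real \<Rightarrow> real" where
  "smooth_exp x = (if x > 0 then exp (- (1 / x)) else 0)"

lemma smooth_fun_smooth_exp: "smooth_fun smooth_exp"
proof -
  define P where "P n = ((\<lambda>p. [:0, 0, 1:] * (p - pderiv p)) ^^ n) (1 :: real poly)" for n
  have "bump_poly (P 0) = smooth_exp" by (auto simp: P_def bump_poly_def smooth_exp_def)
  moreover have "(bump_poly (P n) has_vector_derivative bump_poly (P (Suc n)) q) (at q)" for n q
    using bump_poly_deriv[of "P n" q]
    by (simp add: P_def has_real_derivative_iff_has_vector_derivative)
  ultimately show ?thesis unfolding smooth_fun_def by (intro exI[of _ "\<lambda>n. bump_poly (P n)"]) auto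
qed

lemma smooth_exp_simps: "smooth_exp x \<ge> 0" "x > 0 \<Longrightarrow> smooth_exp x > 0" "x \<le> 0 \<Longrightarrow> smooth_exp x = 0"
  by (auto simp: smooth_exp_def)

lemma smooth_exp_mono: "x \<le> y \<Longrightarrow> smooth_exp x \<le> smooth_exp y"
  by (auto simp: smooth_exp_def frac_le)

text \<open>The usual smooth transition from 0 to 1. The symmetry of the denominator under x to 1 -
  x later makes \<open>soft_sign\<close> odd.\<close>

definition smooth_step :: "real \<Rightarrow> real" where
  "smooth_step x = smooth_exp x / (smooth_exp x + smooth_exp (1 - x))"

lemma smooth_step_denominator: "smooth_exp x + smooth_exp (1 - x) > 0"
  using smooth_exp_simps(1,2)[of x] smooth_exp_simps(1,2)[of "1 - x"]
  by (cases "x > 0") (auto intro: add_pos_nonneg add_nonneg_pos)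

lemma smooth_fun_smooth_step: "smooth_fun smooth_step"
proof (rule smooth_funI)
  have "smooth2 UNIV UNIV (\<lambda>s q. smooth_exp q / (smooth_exp q + smooth_exp (1 - q)))"
    by (intro smooth2_intros smooth2_compose1[OF smooth_fun_smooth_exp])
      (use smooth_step_denominator in \<open>auto simp: less_imp_neq[symmetric]\<close>)
  then show "smooth2 UNIV UNIV (\<lambda>s. smooth_step)" by (simp add: smooth_step_def[abs_def])
qed

lemma smooth_step_simps: "x \<le> 0 \<Longrightarrow> smooth_step x = 0" "x \<ge> 1 \<Longrightarrow> smooth_step x = 1"
  "0 \<le> smooth_step x" "smooth_step x \<le> 1" "smooth_step (1 - x) = 1 - smooth_step x"
  using smooth_step_denominator[of x] smooth_exp_simps(1)[of x] smooth_exp_simps(1)[of "1 - x"]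
    smooth_exp_simps(3)[of x] smooth_exp_simps(3)[of "1 - x"]
  by (auto simp: smooth_step_def field_simps)

lemma smooth_step_mono: "x \<le> y \<Longrightarrow> smooth_step x \<le> smooth_step y"
proof -
  assume xy: "x \<le> y"
  have "smooth_exp x * smooth_exp (1 - y) \<le> smooth_exp y * smooth_exp (1 - x)"
    using smooth_exp_mono[OF xy] smooth_exp_mono[of "1 - y" "1 - x"] xy smooth_exp_simps(1)
    by (intro mult_mono) auto
  then show ?thesis
    using smooth_step_denominator[of x] smooth_step_denominator[of y]
    by (simp add: smooth_step_def frac_le_eq divide_simps) (simp add: algebra_simps)
qed

lemma dt_eqI:
  assumes "s \<in> {a..b}" "a < b" "((\<lambda>t. F t q) has_vector_derivative v) (at s within {a..b})"
  shows "dt {a..b} F s q = v"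
  unfolding dt_def by (rule vector_derivative_within[OF at_within_Icc_nontrivial assms(3)]) (use assms in auto)

section \<open>Reparametrization, reversal and concatenation of homotopies\<close>

lemma bounded_homotopy_reparam:
  fixes H :: "real \<Rightarrow> real \<Rightarrow> complex"
  assumes H: "smooth2 {0..1} UNIV H" and \<tau>: "smooth_fun \<tau>" "\<tau> ` {a..b} \<subseteq> {0..1}" "a < b"
    "(\<tau> has_real_derivative \<tau>') (at s)" "s \<in> {a..b}"
  shows "dt {a..b} (\<lambda>s. H (\<tau> s)) s q = \<tau>' *\<^sub>R dt {0..1} H (\<tau> s) q"
proof (rule dt_eqI[OF \<tau>(5,3)])
  have "\<tau> s \<in> {0..1}" using \<tau>(2,5) by blast
  then have "((\<lambda>t. H t q) has_vector_derivative dt {0..1} H (\<tau> s) q) (at (\<tau> s) within {0..1})"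
    using smooth2D(3)[OF at_within_Icc_nontrivial open_UNIV H _ UNIV_I] by simp
  then have "((\<lambda>t. H t q) has_vector_derivative dt {0..1} H (\<tau> s) q) (at (\<tau> s) within \<tau> ` {a..b})"
    by (rule has_vector_derivative_within_subset) (use \<tau> in auto)
  from vector_diff_chain_within[OF _ this, of \<tau>'] \<tau>(4)
  show "((\<lambda>t. H (\<tau> t) q) has_vector_derivative \<tau>' *\<^sub>R dt {0..1} H (\<tau> s) q) (at s within {a..b})"
    by (simp add: comp_def has_real_derivative_iff_has_vector_derivative has_vector_derivative_at_within)
qed

lemma bounded_homotopy_sym:
  assumes "bounded_homotopy M \<alpha> \<beta> B" shows "bounded_homotopy M \<beta> \<alpha> B"
proof -
  obtain H where H: "smooth2 {0..1} UNIV H" "\<And>s. s \<in> {0..1} \<Longrightarrow> H s \<in> M" "H 0 = \<alpha>" "H 1 = \<beta>"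
    "\<And>s q. s \<in> {0..1} \<Longrightarrow> norm (dt {0..1} H s q) \<le> B"
    using assms unfolding bounded_homotopy_def by blast
  have sm: "smooth_fun (\<lambda>s::real. 1 - s)" by (rule smooth_funI) (intro smooth2_intros)
  have im: "(\<lambda>s::real. 1 - s) ` {0..1} \<subseteq> {0..1}" by auto
  have "norm (dt {0..1} (\<lambda>s. H (1 - s)) s q) \<le> B" if "s \<in> {0..1}" for s q
  proof -
    have "((\<lambda>s. 1 - s) has_real_derivative -1) (at s)" by (auto intro!: derivative_eq_intros)
    from bounded_homotopy_reparam[OF H(1) sm im zero_less_one this that, of q] H(5)[of "1 - s" q] that
    show ?thesis by simp
  qed
  then show ?thesis unfolding bounded_homotopy_def
    by (intro exI[of _ "\<lambda>s. H (1 - s)"]) (use H smooth2_reparam[OF H(1) sm im] in auto)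
qed

lemma bounded_homotopy_mono:
  assumes "bounded_homotopy M \<alpha> \<beta> B" "M \<subseteq> M'" "B \<le> B'"
  shows "bounded_homotopy M' \<alpha> \<beta> B'"
proof -
  obtain H where H: "smooth2 {0..1} UNIV H" "\<And>s. s \<in> {0..1} \<Longrightarrow> H s \<in> M" "H 0 = \<alpha>" "H 1 = \<beta>"
    "\<And>s q. s \<in> {0..1} \<Longrightarrow> norm (dt {0..1} H s q) \<le> B"
    using assms(1) unfolding bounded_homotopy_def by blast
  show ?thesis unfolding bounded_homotopy_def
  proof (intro exI[of _ H] conjI ballI allI)
    fix s q :: real assume "s \<in> {0..1}"
    then show "H s \<in> M'" "norm (dt {0..1} H s q) \<le> B'"
      using H(2)[of s] H(5)[of s q] assms by auto
  qed (use H in auto)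
qed

text \<open>Running one homotopy in the first third and the other in the last, with a rest at the
  common table in between, makes the concatenation smooth. The price is three times a bound on the
  derivative of the step, a constant that depends on nothing else.\<close>

lemma bounded_homotopy_trans:
  obtains c where "c > 0" "\<And>M \<alpha> \<beta> \<gamma> B. bounded_homotopy M \<alpha> \<beta> B \<Longrightarrow> bounded_homotopy M \<beta> \<gamma> B \<Longrightarrow>
    bounded_homotopy M \<alpha> \<gamma> (c * B)"
proof -
  obtain d where d: "smooth_fun d" "\<And>x. (smooth_step has_real_derivative d x) (at x)"
    using smooth_fun_has_real_derivative[OF smooth_fun_smooth_step] by metis
  have "compact (d ` {-2..3})"
    \<comment> \<open>For s in [0, 1] the arguments 3 * s and 3 * s - 2 of the step both lie in
      [-2, 3].\<close>
    by (intro compact_continuous_image smooth_fun_continuous d compact_Icc)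
  then obtain c where c: "c > 0" "\<And>x. x \<in> {-2..3} \<Longrightarrow> \<bar>d x\<bar> \<le> c"
    using compact_imp_bounded bounded_pos by (metis (no_types, lifting) image_eqI real_norm_def)
  show ?thesis
  proof (rule that[of "3 * c"])
    fix M \<alpha> \<beta> \<gamma> B assume 1: "bounded_homotopy M \<alpha> \<beta> B" and 2: "bounded_homotopy M \<beta> \<gamma> B"
    obtain F where F: "smooth2 {0..1} UNIV F" "\<And>s. s \<in> {0..1} \<Longrightarrow> F s \<in> M" "F 0 = \<alpha>" "F 1 = \<beta>"
      "\<And>s q. s \<in> {0..1} \<Longrightarrow> norm (dt {0..1} F s q) \<le> B"
      using 1 unfolding bounded_homotopy_def by blast
    obtain G where G: "smooth2 {0..1} UNIV G" "\<And>s. s \<in> {0..1} \<Longrightarrow> G s \<in> M" "G 0 = \<beta>" "G 1 = \<gamma>"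
      "\<And>s q. s \<in> {0..1} \<Longrightarrow> norm (dt {0..1} G s q) \<le> B"
      using 2 unfolding bounded_homotopy_def by blast
    define f g where "f s = smooth_step (3 * s)" and "g s = smooth_step (3 * s - 2)" for s
    have sm: "smooth_fun f" "smooth_fun g"
      unfolding f_def g_def by (rule smooth_funI, intro smooth2_intros smooth2_compose1[OF smooth_fun_smooth_step])+
    have im: "f ` {0..1} \<subseteq> {0..1}" "g ` {0..1} \<subseteq> {0..1}" unfolding f_def g_def using smooth_step_simps by auto
    have f01: "f s \<in> {0..1}" "g s \<in> {0..1}" for s unfolding f_def g_def using smooth_step_simps by auto
    have df: "(f has_real_derivative 3 * d (3 * s)) (at s)" "(g has_real_derivative 3 * d (3 * s - 2)) (at s)" for s
      unfolding f_def g_def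
    proof -
      have "((\<lambda>s. 3 * s) has_real_derivative 3) (at s)" "((\<lambda>s. 3 * s - 2) has_real_derivative 3) (at s)"
        by (auto intro!: derivative_eq_intros)
      from DERIV_chain2[OF d(2) this(1)] DERIV_chain2[OF d(2) this(2)]
      show "((\<lambda>s. smooth_step (3 * s)) has_real_derivative 3 * d (3 * s)) (at s)"
        "((\<lambda>s. smooth_step (3 * s - 2)) has_real_derivative 3 * d (3 * s - 2)) (at s)"
        by (simp_all add: mult.commute)
    qed
    \<comment> \<open>On the middle third both branches equal the common table, so \<open>H\<close>
      agrees with either branch on an open set and these two sets overlap.\<close>
    define H where "H s = (if s \<le> 1 / 2 then F (f s) else G (g s))" for s
    have HF: "H s = F (f s)" if "s < 2 / 3" for s
      using that smooth_step_simps(2)[of "3 * s"] smooth_step_simps(1)[of "3 * s - 2"] F(4) G(3)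
      by (auto simp: H_def f_def g_def)
    have HG: "H s = G (g s)" if "s > 1 / 3" for s
      using that smooth_step_simps(2)[of "3 * s"] smooth_step_simps(1)[of "3 * s - 2"] F(4) G(3)
      by (auto simp: H_def f_def g_def)
    have sF: "smooth2 {0..1} UNIV (\<lambda>s. F (f s))" and sG: "smooth2 {0..1} UNIV (\<lambda>s. G (g s))"
      by (rule smooth2_reparam[OF F(1) sm(1) im(1)], rule smooth2_reparam[OF G(1) sm(2) im(2)])
    have B0: "B \<ge> 0" using F(5)[of 0 0] norm_ge_zero order_trans by (metis atLeastAtMost_iff order_refl zero_le_one)
    have sH: "smooth2 {0..1} UNIV H"
    proof (rule smooth2_local)
      fix s q :: real assume s: "s \<in> {0..1}"
      show "\<exists>U V. open U \<and> open V \<and> s \<in> U \<and> q \<in> V \<and> smooth2 ({0..1} \<inter> U) V H"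
      proof (cases "s < 2 / 3")
        case True
        have "smooth2 ({0..1} \<inter> {..<2/3}) UNIV H"
          by (rule smooth2_cong[OF open_UNIV _ smooth2_subset[OF sF]]) (use HF in auto)
        then show ?thesis using True by (intro exI[of _ "{..<2/3}"] exI[of _ UNIV]) auto
      next
        case False
        have "smooth2 ({0..1} \<inter> {1/3<..}) UNIV H"
          by (rule smooth2_cong[OF open_UNIV _ smooth2_subset[OF sG]]) (use HG in auto)
        then show ?thesis using False by (intro exI[of _ "{1/3<..}"] exI[of _ UNIV]) auto
      qed
    qed (use at_within_Icc_nontrivial[of _ 0 "1::real"] in auto)
    have bound: "norm (dt {0..1} H s q) \<le> 3 * c * B" if s: "s \<in> {0..1}" for s q
    proof -
      have 1: "norm ((3 * d x) *\<^sub>R v) \<le> 3 * c * B" if "x \<in> {-2..3}" "norm v \<le> B" for x and v :: complex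
        using mult_mono[OF c(2)[OF that(1)] that(2)] c(1) by (simp add: abs_mult)
      show ?thesis
      proof (cases "s < 2 / 3")
        case True
        have "dt {0..1} H s q = dt {0..1} (\<lambda>s. F (f s)) s q"
          unfolding dt_def
          by (rule vector_derivative_cong_eq[OF _ refl refl s])
            (rule eventually_mono[OF eventually_nhds_in_open[of "{..<2/3}" s]], use True HF in auto)
        also have "\<dots> = (3 * d (3 * s)) *\<^sub>R dt {0..1} F (f s) q"
          by (rule bounded_homotopy_reparam[OF F(1) sm(1) im(1) zero_less_one df(1) s])
        also have "norm \<dots> \<le> 3 * c * B" by (rule 1[OF _ F(5)[OF f01(1)]]) (use s in auto)
        finally show ?thesis .
      next
        case False
        have "dt {0..1} H s q = dt {0..1} (\<lambda>s. G (g s)) s q"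
          unfolding dt_def
          by (rule vector_derivative_cong_eq[OF _ refl refl s])
            (rule eventually_mono[OF eventually_nhds_in_open[of "{1/3<..}" s]], use False HG in auto)
        also have "\<dots> = (3 * d (3 * s - 2)) *\<^sub>R dt {0..1} G (g s) q"
          by (rule bounded_homotopy_reparam[OF G(1) sm(2) im(2) zero_less_one df(2) s])
        also have "norm \<dots> \<le> 3 * c * B" by (rule 1[OF _ G(5)[OF f01(2)]]) (use s in auto)
        finally show ?thesis .
      qed
    qed
    have "H s \<in> M" if "s \<in> {0..1}" for s
      using F(2)[OF f01(1)] G(2)[OF f01(2)] unfolding H_def by auto
    moreover have "H 0 = \<alpha>" "H 1 = \<gamma>" unfolding H_def f_def g_def by (simp_all add: smooth_step_simps F G)
    ultimately show "bounded_homotopy M \<alpha> \<gamma> (3 * c * B)"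
      unfolding bounded_homotopy_def using sH bound by blast
  qed (use c in auto)
qed

section \<open>The distance dominates the supremum norm\<close>

text \<open>All curves have period 1 in \<open>q\<close>, so the time derivative has it too, and a
  continuous function on the compact square controls it everywhere.\<close>

lemma dt_homotopy_bounded:
  assumes sm: "smooth2 {0..1} UNIV H" and C: "\<And>s. s \<in> {0..1} \<Longrightarrow> H s \<in> tables_C"
  obtains B where "\<And>s q. s \<in> {0..1} \<Longrightarrow> dt {0..1} H s q = dt {0..1} H s (frac q)"
    "\<And>s q. s \<in> {0..1} \<Longrightarrow> norm (dt {0..1} H s q) \<le> B" "B > 0"
proof -
  let ?A = "{0..1::real}"
  note nt = at_within_Icc_nontrivial[of _ 0 "1::real", OF _ zero_less_one]
  define G where "G = dt ?A H"
  have dG: "((\<lambda>t. H t q) has_vector_derivative G s q) (at s within ?A)" if "s \<in> ?A" for s q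
    unfolding G_def using smooth2D(3)[OF nt open_UNIV sm that UNIV_I] by simp
  have cG: "continuous_on (?A \<times> UNIV) (\<lambda>(s, q). G s q)"
    unfolding G_def by (rule smooth2_continuous[OF smooth2D(1)[OF nt open_UNIV sm]])
  have per: "G s (q + 1) = G s q" if s: "s \<in> ?A" for s q
  proof -
    have "((\<lambda>t. H t q) has_vector_derivative G s (q + 1)) (at s within ?A)"
      by (rule has_vector_derivative_transform[OF s _ dG[OF s]]) (use tables_C_periodic[OF C] in simp)
    then show ?thesis using dG[OF s] vector_derivative_unique_within nt[OF s] by blast
  qed
  have frac: "G s q = G s (frac q)" if s: "s \<in> ?A" for s q
    using periodic_add_int[of "G s" "frac q" "\<lfloor>q\<rfloor>"] per[OF s] by (simp add: frac_def)
  have frac01: "frac q \<in> ?A" for q :: real using frac_ge_0[of q] frac_lt_1[of q] by auto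
  have cG': "continuous_on (?A \<times> ?A) (\<lambda>(s, q). G s q)"
    by (rule continuous_on_subset[OF cG]) auto
  have "bounded ((\<lambda>(s, q). G s q) ` (?A \<times> ?A))"
    by (intro compact_imp_bounded compact_continuous_image[OF cG'] compact_Times compact_Icc)
  then obtain B where B: "B > 0" "\<And>x. x \<in> ?A \<times> ?A \<Longrightarrow> norm (case x of (s, q) \<Rightarrow> G s q) \<le> B"
    unfolding bounded_pos by blast
  have "norm (G s q) \<le> B" if "s \<in> ?A" for s q
    using B(2)[of "(s, frac q)"] frac[OF that, of q] frac01[of q] that by simp
  then show ?thesis using that frac B(1) unfolding G_def by blast
qed

text \<open>A point travels the integral of its time derivative. The work is to show that the
  supremum of the speeds is continuous in \<open>s\<close>, by uniform continuity on the compact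
  square; otherwise \<open>homotopy_length\<close> could be the default value 0.\<close>

lemma homotopy_dominates:
  assumes H: "H \<in> smooth_homotopies tables_C \<alpha> \<beta>"
  shows "norm (\<alpha> q - \<beta> q) \<le> homotopy_length H"
proof -
  let ?A = "{0..1::real}"
  have sm: "smooth2 ?A UNIV H" and C: "\<And>s. s \<in> ?A \<Longrightarrow> H s \<in> tables_C" and ends: "H 0 = \<alpha>" "H 1 = \<beta>"
    using H smooth2_of_smooth_family unfolding smooth_homotopies_def by auto
  note nt = at_within_Icc_nontrivial[of _ 0 "1::real", OF _ zero_less_one]
  define G where "G = dt ?A H"
  have dG: "((\<lambda>t. H t q) has_vector_derivative G s q) (at s within ?A)" if "s \<in> ?A" for s q
    unfolding G_def using smooth2D(3)[OF nt open_UNIV sm that UNIV_I] by simp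
  obtain B where frac: "\<And>s q. s \<in> ?A \<Longrightarrow> G s q = G s (frac q)" and B: "\<And>s q. s \<in> ?A \<Longrightarrow> norm (G s q) \<le> B"
    using dt_homotopy_bounded[OF sm C] unfolding G_def by metis
  have frac01: "frac q \<in> ?A" for q :: real using frac_ge_0[of q] frac_lt_1[of q] by auto
  have cG': "continuous_on (?A \<times> ?A) (\<lambda>(s, q). G s q)"
    unfolding G_def
    by (rule continuous_on_subset[OF smooth2_continuous[OF smooth2D(1)[OF nt open_UNIV sm]]]) auto
  have comp: "compact (?A \<times> ?A)" by (intro compact_Times compact_Icc)
  define f where "f s = (SUP q. norm (G s q))" for s
  have bdd: "bdd_above (range (\<lambda>q. norm (G s q)))" if "s \<in> ?A" for s
    using B[OF that] by (intro bdd_aboveI[of _ B]) auto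
  have up: "norm (G s q) \<le> f s" if "s \<in> ?A" for s q
    unfolding f_def by (rule cSUP_upper[OF UNIV_I bdd[OF that]])
  have cf: "continuous_on ?A f"
    unfolding continuous_on_iff
  proof safe
    fix s e :: real assume s: "s \<in> {0..1}" and e: "e > 0"
    have "uniformly_continuous_on (?A \<times> ?A) (\<lambda>(s, q). G s q)"
      by (rule compact_uniformly_continuous[OF cG' comp])
    then obtain d where d: "d > 0" "\<And>x y. x \<in> ?A \<times> ?A \<Longrightarrow> y \<in> ?A \<times> ?A \<Longrightarrow> dist y x < d \<Longrightarrow>
        dist (case y of (s, q) \<Rightarrow> G s q) (case x of (s, q) \<Rightarrow> G s q) < e / 2"
      using e unfolding uniformly_continuous_on_def by (meson half_gt_zero)
    have le: "f s \<le> f t + e / 2" if st: "s \<in> ?A" "t \<in> ?A" "dist t s < d" for s t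
      unfolding f_def[of s]
    proof (rule cSUP_least)
      fix q
      have "dist (G t (frac q)) (G s (frac q)) < e / 2"
        using d(2)[of "(s, frac q)" "(t, frac q)"] st frac01 by (simp add: dist_Pair_Pair)
      then have "norm (G s q) \<le> norm (G t q) + e / 2"
        using frac[OF st(1), of q] frac[OF st(2), of q] norm_triangle_ineq2[of "G s q" "G t q"]
        by (simp add: dist_norm norm_minus_commute)
      also have "\<dots> \<le> f t + e / 2" using up[OF st(2)] by simp
      finally show "norm (G s q) \<le> f t + e / 2" .
    qed simp
    have "dist (f t) (f s) < e" if "t \<in> ?A" "dist t s < d" for t
      using le[OF s that] le[OF that(1) s] that e by (simp add: dist_real_def abs_if dist_commute) argo
    then show "\<exists>d>0. \<forall>t\<in>{0..1}. dist t s < d \<longrightarrow> dist (f t) (f s) < e"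
      using d(1) by auto
  qed
  have "((\<lambda>s. G s q) has_integral (H 1 q - H 0 q)) ?A"
    by (rule fundamental_theorem_of_calculus) (use dG in auto)
  then have int: "(\<lambda>s. G s q) integrable_on ?A" "integral ?A (\<lambda>s. G s q) = \<beta> q - \<alpha> q"
    unfolding ends by (auto simp: integral_unique)
  have "norm (integral ?A (\<lambda>s. G s q)) \<le> integral ?A f"
    by (rule integral_norm_bound_integral[OF int(1) integrable_continuous_real[OF cf]]) (use up in auto)
  also have "integral ?A f = homotopy_length H"
    unfolding homotopy_length_def f_def G_def dt_def by simp
  finally show ?thesis unfolding int(2) by (simp add: norm_minus_commute)
qed

lemma d_C_dominates:
  assumes "d_C \<alpha> \<beta> < ennreal e"
  shows "norm (\<alpha> q - \<beta> q) \<le> e"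
proof -
  obtain H where H: "H \<in> smooth_homotopies tables_C \<alpha> \<beta>" "ennreal (homotopy_length H) < ennreal e"
    using assms unfolding table_dist_def INF_less_iff by blast
  have le: "norm (\<alpha> q - \<beta> q) \<le> homotopy_length H" by (rule homotopy_dominates[OF H(1)])
  then have "0 \<le> homotopy_length H" using norm_ge_zero order_trans by blast
  then show ?thesis using H(2) le by (simp add: ennreal_less_iff)
qed

section \<open>Passing to orbits under rigid motions\<close>

lemma SE2_isometry: "g \<in> SE2 \<Longrightarrow> norm (g x - g y) = norm (x - y)"
  unfolding SE2_def by (auto simp: norm_mult simp flip: right_diff_distrib)

lemma SE2_orbit_comp: "g \<in> SE2 \<Longrightarrow> \<xi> \<in> SE2_orbit \<gamma> \<Longrightarrow> g \<circ> \<xi> \<in> SE2_orbit \<gamma>"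
  unfolding SE2_orbit_def using SE2_comp by (auto simp flip: comp_assoc)

lemma AB_subset_tables_B: "X \<in> AB \<Longrightarrow> \<xi> \<in> X \<Longrightarrow> \<xi> \<in> tables_B"
  unfolding AB_def SE2_orbit_def using tables_B_SE2 by auto

text \<open>The near pair of representatives is moved by the rigid motion that brings the second one
  back to \<gamma>; the first remains in its orbit.\<close>

lemma d_AC_dominates:
  assumes X: "X \<in> AB" and less: "d_AC X (SE2_orbit \<gamma>) < ennreal e"
  obtains \<alpha> where "\<alpha> \<in> X" "\<alpha> \<in> tables_B" "\<And>q. norm (\<alpha> q - \<gamma> q) \<le> e"
proof -
  obtain \<xi> \<eta> where \<xi>: "\<xi> \<in> X" and \<eta>: "\<eta> \<in> SE2_orbit \<gamma>" and d: "d_C \<xi> \<eta> < ennreal e"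
    using less unfolding orbit_dist_def INF_less_iff by blast
  obtain g where g: "g \<in> SE2" "\<eta> = g \<circ> \<gamma>" using \<eta> unfolding SE2_orbit_def by auto
  obtain h where h: "h \<in> SE2" "h \<circ> g = id" "g \<circ> h = id" using SE2_inverse[OF g(1)] .
  have X': "h \<circ> \<xi> \<in> X" using X \<xi> SE2_orbit_comp[OF h(1)] unfolding AB_def by auto
  have "norm ((h \<circ> \<xi>) q - \<gamma> q) \<le> e" for q
  proof -
    have "\<gamma> q = h (\<eta> q)" using h(2) g(2) by (metis comp_apply id_apply)
    then show ?thesis using d_C_dominates[OF d, of q] SE2_isometry[OF h(1)] by simp
  qed
  then show ?thesis using that[OF X'] AB_subset_tables_B[OF X X'] by blast
qed

lemma periodic_bounded:
  fixes f :: "real \<Rightarrow> real"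
  assumes "continuous_on {0..1} f" "\<And>u. f (u + 1) = f u"
  shows "\<exists>R>0. \<forall>u. \<bar>f u\<bar> \<le> R"
proof -
  have "bounded (f ` {0..1})" by (intro compact_imp_bounded compact_continuous_image assms compact_Icc)
  then obtain R where R: "R > 0" "\<And>x. x \<in> f ` {0..1} \<Longrightarrow> norm x \<le> R" unfolding bounded_pos by blast
  have "\<bar>f u\<bar> \<le> R" for u
  proof -
    have "f u = f (frac u)"
      using periodic_add_int[of f "frac u" "\<lfloor>u\<rfloor>"] assms(2) by (simp add: frac_def)
    then show ?thesis using R(2)[of "f (frac u)"] frac_ge_0[of u] frac_lt_1[of u] by auto
  qed
  then show ?thesis using R(1) by blast
qed

section \<open>Approximation by tables of positive curvature\<close>

text \<open>
  For a point \<open>z\<close> inside the table, the maps that send \<open>z + w\<close> to \<open>z + (1 - \<tau> * \<bar>w\<bar>\<^sup>2) * w\<close> bend every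
  supporting line inwards. The formula for \<open>cross\<close> below quantifies this.
\<close>

lemma radial_homotopy:
  assumes \<alpha>: "\<alpha> \<in> tables_C"
  obtains H where "smooth2 {0..1} UNIV H" "H 0 = \<alpha>" "\<And>t. t \<in> {0..1} \<Longrightarrow> H t \<in> tables_C"
    "\<And>t. t \<in> {0<..1} \<Longrightarrow> H t \<in> tables_B"
proof -
  let ?A = "{0..1::real}"
  note nt = at_within_Icc_nontrivial[of _ 0 "1::real", OF _ zero_less_one]
  note cv = convex_real_interval(5)[of 0 "1::real"]
  obtain K where K: "ccw_boundary_param K \<alpha>" and sm: "smooth_fun \<alpha>"
    using \<alpha> unfolding tables_C_def by auto
  obtain \<theta> where \<theta>: "smooth_fun \<theta>" "\<And>q. (\<alpha> has_vector_derivative cis (\<theta> q)) (at q)"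
    "\<And>q. (\<theta> has_real_derivative curvature \<alpha> q) (at q)" "\<And>q. curvature \<alpha> q \<ge> 0"
    "\<And>q. \<theta> (q + 1) = \<theta> q + 2 * pi" using tables_C_angle[OF \<alpha>] by metis
  obtain z where z: "z \<in> interior K" using ccw_boundary_paramD(4)[OF K] by auto
  obtain a where a: "continuous_on UNIV a" "\<And>q. a (q + 1) = a q + 2 * pi"
    "\<And>q. \<alpha> q - z = norm (\<alpha> q - z) * cis (a q)" "\<And>q. \<alpha> q \<noteq> z"
    using ccw_boundary_angle[OF K z] by metis
  define w where "w u = \<alpha> u - z" for u
  define \<kappa> where "\<kappa> u = curvature \<alpha> u" for u
  \<comment> \<open>In the moving frame, \<open>p\<close> is the tangential component of the vector
    from \<open>z\<close>, \<open>h\<close> the distance of the tangent line from \<open>z\<close>,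
    and \<open>r\<close> the squared distance of the point from \<open>z\<close>.\<close>
  define p where "p u = w u \<bullet> cis (\<theta> u)" for u
  define h where "h u = Im (cnj (w u) * cis (\<theta> u))" for u
  define r where "r u = w u \<bullet> w u" for u
  have h: "h u > 0" for u unfolding h_def w_def by (rule ccw_boundary_support(2)[OF K \<theta>(2) _ z]) simp
  have \<kappa>: "\<kappa> u \<ge> 0" for u unfolding \<kappa>_def by (rule \<theta>(4))
  have E1: "cis x * cnj (cis x) = 1" for x by (simp add: cis_cnj cis_mult)
  have w_eq: "w u = cis (\<theta> u) * Complex (p u) (- h u)" for u
  proof -
    have "cnj (cis (\<theta> u)) * w u = Complex (p u) (- h u)"
      by (simp add: complex_eq_iff p_def h_def inner_complex_def algebra_simps)
    then have "(cis (\<theta> u) * cnj (cis (\<theta> u))) * w u = cis (\<theta> u) * Complex (p u) (- h u)"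
      by (simp add: mult.assoc)
    then show ?thesis unfolding E1 by simp
  qed
  have r_eq: "r u = (p u)\<^sup>2 + (h u)\<^sup>2" for u
  proof -
    have "r u = (norm (w u))\<^sup>2" by (simp add: r_def power2_norm_eq_inner)
    also have "\<dots> = (norm (Complex (p u) (- h u)))\<^sup>2" by (subst w_eq) (simp add: norm_mult)
    finally show ?thesis by (simp add: cmod_power2)
  qed
  have per: "w (u + 1) = w u" "r (u + 1) = r u" "p (u + 1) = p u" for u
    by (simp_all add: w_def r_def p_def tables_C_periodic[OF \<alpha>] \<theta>(5) cis_add_2pi)
  have "continuous_on {0..1} r" unfolding r_def w_def
    by (intro continuous_intros smooth_fun_continuous[OF sm])
  from periodic_bounded[OF this per(2)] obtain R where R: "R > 0" "\<And>u. r u \<le> R"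
    using abs_ge_self order_trans by metis
  \<comment> \<open>This makes x = t * c * r u at most 1/4, so that both the radial factor P = 1 - x
    and P - 2 * x are positive; the latter multiplies the old curvature below.\<close>
  define c where "c = 1 / (4 * R)"
  have c: "c > 0" "c * r u \<le> 1 / 4" for u using R(1) R(2)[of u] by (auto simp: c_def field_simps)
  define P where "P t u = 1 - t * c * r u" for t u
  have tcr: "0 \<le> t * c * r u" "t * c * r u \<le> 1 / 4" if "t \<in> ?A" for t u
  proof -
    have "r u \<ge> 0" by (simp add: r_def)
    then show "0 \<le> t * c * r u" using that c(1) by simp
    have "t * (c * r u) \<le> 1 * (1 / 4)" using that c \<open>r u \<ge> 0\<close> by (intro mult_mono) auto
    then show "t * c * r u \<le> 1 / 4" by (simp add: mult.assoc)
  qed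
  have Ppos: "P t u > 0" if "t \<in> ?A" for t u using tcr[OF that, of u] by (simp add: P_def)
  define b where "b t u = P t u *\<^sub>R w u" for t u
  \<comment> \<open>\<open>bu\<close> and \<open>buu\<close> are the first and second derivatives of
    \<open>b\<close> in \<open>u\<close>.\<close>
  define bu where "bu t u = P t u *\<^sub>R cis (\<theta> u) - (2 * t * c * p u) *\<^sub>R w u" for t u
  define buu where "buu t u = (- 4 * t * c * p u) *\<^sub>R cis (\<theta> u) + P t u *\<^sub>R (\<i> * \<kappa> u * cis (\<theta> u))
    - (2 * t * c * (1 - \<kappa> u * h u)) *\<^sub>R w u" for t u
  have dw: "(w has_vector_derivative cis (\<theta> u)) (at u)" for u
    unfolding w_def using has_vector_derivative_diff[OF \<theta>(2) has_vector_derivative_const] by simp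
  have dE: "((\<lambda>u. cis (\<theta> u)) has_vector_derivative \<i> * \<kappa> u * cis (\<theta> u)) (at u)" for u
    unfolding \<kappa>_def by (rule has_vector_derivative_cis[OF \<theta>(3)])
  have dr: "(r has_real_derivative 2 * p u) (at u)" for u
    using bounded_bilinear.has_vector_derivative[OF bounded_bilinear_inner dw dw]
    unfolding r_def p_def by (simp add: has_real_derivative_iff_has_vector_derivative inner_commute)
  have dp: "(p has_real_derivative 1 - \<kappa> u * h u) (at u)" for u
  proof -
    have "w u \<bullet> (\<i> * \<kappa> u * cis (\<theta> u)) = - \<kappa> u * h u"
      by (simp add: h_def inner_complex_def algebra_simps)
    moreover have "cis (\<theta> u) \<bullet> cis (\<theta> u) = 1"
      by (simp add: inner_complex_def flip: power2_eq_square)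
    ultimately show ?thesis
      using bounded_bilinear.has_vector_derivative[OF bounded_bilinear_inner dw[of u] dE[of u]]
      unfolding p_def by (simp add: has_real_derivative_iff_has_vector_derivative add.commute)
  qed
  have dP: "(P t has_real_derivative - (2 * t * c * p u)) (at u)" for t u
    unfolding P_def using dr[of u] by (auto intro!: derivative_eq_intros)
  have db: "(b t has_vector_derivative bu t u) (at u)" for t u
    unfolding b_def bu_def using has_vector_derivative_scaleR[OF dP dw, of t u] by simp
  have dbu: "(bu t has_vector_derivative buu t u) (at u)" for t u
  proof -
    have "((\<lambda>u. 2 * t * c * p u) has_real_derivative 2 * t * c * (1 - \<kappa> u * h u)) (at u)"
      by (rule DERIV_cmult[OF dp])
    from has_vector_derivative_diff[OF has_vector_derivative_scaleR[OF dP dE] has_vector_derivative_scaleR[OF this dw], of t]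
    show ?thesis unfolding bu_def buu_def by (simp add: algebra_simps scaleR_conv_of_real)
  qed
  have cross_w: "Im (cnj (w u) * bu t u) = P t u * h u" for t u
    unfolding bu_def h_def by (simp add: algebra_simps)
  have cross: "Im (cnj (bu t u) * buu t u) > 0" if t: "t \<in> {0<..1}" for t u
  proof -
    define \<tau> where "\<tau> = t * c"
    have bu': "bu t u = cis (\<theta> u) * Complex (P t u - 2 * \<tau> * (p u)\<^sup>2) (2 * \<tau> * p u * h u)"
      unfolding bu_def \<tau>_def by (subst w_eq) (simp add: complex_eq_iff algebra_simps power2_eq_square)
    have buu': "buu t u = cis (\<theta> u) * Complex (- 4 * \<tau> * p u - 2 * \<tau> * (1 - \<kappa> u * h u) * p u)
        (P t u * \<kappa> u + 2 * \<tau> * (1 - \<kappa> u * h u) * h u)"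
      unfolding buu_def \<tau>_def by (subst w_eq) (simp add: complex_eq_iff algebra_simps)
    have E2: "cnj (cis x * y) * (cis x * v) = cnj y * v" for x y v
      using E1[of x] by (metis complex_cnj_mult mult.assoc mult.commute mult.left_neutral)
    have "Im (cnj (bu t u) * buu t u) = (P t u - 2 * \<tau> * (p u)\<^sup>2) * (P t u * \<kappa> u + 2 * \<tau> * (1 - \<kappa> u * h u) * h u)
        + 2 * \<tau> * p u * h u * (4 * \<tau> * p u + 2 * \<tau> * (1 - \<kappa> u * h u) * p u)"
      unfolding bu' buu' E2 by (simp add: algebra_simps)
    \<comment> \<open>The first term inherits the sign of the old curvature; the second is strictly
      positive even where the curvature vanishes, because every tangent line misses
      \<open>z\<close>.\<close>
    also have "\<dots> = P t u * \<kappa> u * (P t u - 2 * \<tau> * ((p u)\<^sup>2 + (h u)\<^sup>2)) + 2 * \<tau> * h u * P t u + 8 * \<tau>\<^sup>2 * (p u)\<^sup>2 * h u"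
      by algebra
    also have "\<dots> = P t u * \<kappa> u * (P t u - 2 * (t * c * r u)) + 2 * \<tau> * h u * P t u + 8 * \<tau>\<^sup>2 * (p u)\<^sup>2 * h u"
      by (simp add: r_eq \<tau>_def mult.assoc)
    also have "\<dots> > 0"
    proof -
      have tA: "t \<in> ?A" using t by auto
      have "P t u - 2 * (t * c * r u) \<ge> 0" using tcr[OF tA, of u] unfolding P_def by linarith
      then have "P t u * \<kappa> u * (P t u - 2 * (t * c * r u)) \<ge> 0" using Ppos[OF tA, of u] \<kappa>[of u] by simp
      moreover have "2 * \<tau> * h u * P t u > 0" using t c h[of u] Ppos[OF tA, of u] by (simp add: \<tau>_def)
      moreover have "8 * \<tau>\<^sup>2 * (p u)\<^sup>2 * h u \<ge> 0" using h[of u] by simp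
      ultimately show ?thesis by linarith
    qed
    finally show ?thesis .
  qed
  have bu0: "bu t u \<noteq> 0" if "t \<in> ?A" for t u
    using cross_w[of u t] Ppos[OF that, of u] h[of u] by auto
  have s\<alpha>: "smooth2 S J (\<lambda>s. w)" "smooth2 S J (\<lambda>s u. cis (\<theta> u))" "smooth2 S J (\<lambda>s. p)" "smooth2 S J (\<lambda>s. r)" for S J
    unfolding w_def p_def r_def by (intro smooth2_intros smooth2_of_smooth_fun sm \<theta>)+
  have sb: "smooth2 ?A UNIV b" "smooth2 ?A UNIV bu"
    unfolding b_def bu_def P_def by (intro smooth2_intros s\<alpha>)+
  define \<rho> where "\<rho> t u = norm (bu t u)" for t u
  have \<rho>pos: "\<rho> t u > 0" if "t \<in> ?A" for t u using bu0[OF that] by (simp add: \<rho>_def)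
  have s\<rho>: "smooth2 ?A UNIV \<rho>"
    unfolding \<rho>_def norm_eq_sqrt_inner by (intro smooth2_intros sb) (use bu0 in simp)
  have \<rho>per: "\<rho> t (u + 1) = \<rho> t u" for t u
    unfolding \<rho>_def bu_def P_def per \<theta>(5) cis_add_2pi ..
  define S where "S t u = integral {0..u} (\<rho> t) - integral {u..0} (\<rho> t)" for t u
  have S: "smooth2 ?A UNIV S" "\<And>t u. t \<in> ?A \<Longrightarrow> (S t has_vector_derivative \<rho> t u) (at u)" "\<And>t. S t 0 = 0"
    unfolding S_def by (rule smooth2_primitive[OF nt cv s\<rho>]; simp)+
  have dS: "(S t has_real_derivative \<rho> t u) (at u)" if "t \<in> ?A" for t u
    using S(2)[OF that] by (simp add: has_real_derivative_iff_has_vector_derivative)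
  define L where "L t = S t 1" for t
  have L: "L t > 0" if t: "t \<in> ?A" for t
    using DERIV_pos_imp_increasing[of 0 1 "S t"] dS[OF t] \<rho>pos[OF t] S(3)[of t] unfolding L_def
    by (metis zero_less_one)
  have Sper: "S t (u + 1) = S t u + L t" if t: "t \<in> ?A" for t u
  proof -
    have "((\<lambda>u. S t (u + 1) - S t u) has_real_derivative 0) (at u)" for u
      using DERIV_diff[OF DERIV_shift[THEN iffD1, OF dS[OF t, of "u + 1"]] dS[OF t, of u]] \<rho>per by simp
    then have "(S t (u + 1) - S t u) = (S t (0 + 1) - S t 0)"
      using DERIV_isconst_all by blast
    then show ?thesis using S(3) by (simp add: L_def)
  qed
  define \<sigma> where "\<sigma> t u = S t u / L t" for t u
  have sL: "smooth2 ?A UNIV (\<lambda>t u. L t)"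
    unfolding L_def by (rule smooth2_compose[OF S(1) smooth2_const])
  have s\<sigma>: "smooth2 ?A UNIV \<sigma>"
    unfolding \<sigma>_def by (intro smooth2_intros S(1) sL) (use L in \<open>auto simp: less_imp_neq[symmetric]\<close>)
  have d\<sigma>: "(\<sigma> t has_real_derivative \<rho> t u / L t) (at u)" if "t \<in> ?A" for t u
    unfolding \<sigma>_def by (rule DERIV_cdivide[OF dS[OF that]])
  have dq\<sigma>: "dq \<sigma> t u = \<rho> t u / L t" if "t \<in> ?A" for t u
    using d\<sigma>[OF that, of u] unfolding dq_def has_real_derivative_iff_has_vector_derivative
    by (rule vector_derivative_at)
  have pos: "dq \<sigma> t u > 0" if "t \<in> ?A" for t u using \<rho>pos[OF that] L[OF that] by (simp add: dq\<sigma>[OF that])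
  have \<sigma>per: "\<sigma> t (u + 1) = \<sigma> t u + 1" if "t \<in> ?A" for t u
    unfolding \<sigma>_def Sper[OF that] using L[OF that] by (simp add: field_simps)
  have "\<exists>x. \<sigma> t x = q" if t: "t \<in> ?A" for t q
  proof (rule quasiperiodic_surj[where f = "\<sigma> t" and c = 1, OF _ \<sigma>per[OF t]])
    show "continuous_on UNIV (\<sigma> t)"
      using d\<sigma>[OF t] by (meson DERIV_continuous_on has_field_derivative_at_within)
  qed simp
  then obtain U where U: "\<And>t q. t \<in> ?A \<Longrightarrow> \<sigma> t (U t q) = q" by metis
  have inv: "smooth2 ?A UNIV U" "\<And>t q. t \<in> ?A \<Longrightarrow> U t (\<sigma> t q) = q"
    "\<And>t q. t \<in> ?A \<Longrightarrow> (U t has_real_derivative inverse (dq \<sigma> t (U t q))) (at q)"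
    by (rule smooth2_inverse_family[OF nt cv s\<sigma> pos U]; simp)+
  have Uper: "U t (q + 1) = U t q + 1" if "t \<in> ?A" for t q
    using inv(2)[OF that, of "U t q + 1"] \<sigma>per[OF that] U[OF that] by metis
  \<comment> \<open>\<open>U\<close> makes the speed proportional to arc length, and dividing by the
    length about \<open>z\<close> gives length 1 and unit speed. At t = 0 nothing changes.\<close>
  define H where "H t q = z + (1 / L t) *\<^sub>R b t (U t q)" for t q
  have sH: "smooth2 ?A UNIV H"
    unfolding H_def by (intro smooth2_intros sL smooth2_compose[OF sb(1) inv(1)])
      (use L in \<open>auto simp: less_imp_neq[symmetric]\<close>)
  have H0: "H 0 = \<alpha>"
  proof -
    have 0: "0 \<in> ?A" by simp
    have \<rho>0: "\<rho> 0 u = 1" for u by (simp add: \<rho>_def bu_def P_def)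
    have "((\<lambda>u. S 0 u - u) has_real_derivative 0) (at u)" for u
      using DERIV_diff[OF dS[OF 0, of u] DERIV_ident] by (simp add: \<rho>0)
    then have "S 0 u - u = S 0 0 - 0" for u using DERIV_isconst_all by blast
    then have S0: "S 0 u = u" for u using S(3) by simp
    then have "U 0 q = q" for q using U[OF 0, of q] by (simp add: \<sigma>_def L_def)
    then show ?thesis by (auto simp: H_def L_def S0 b_def P_def w_def)
  qed
  have HB: "H t \<in> tables_B" if t0: "t \<in> {0<..1}" for t
  proof -
    have t: "t \<in> ?A" using t0 by auto
    have smH: "smooth_fun (H t)" by (rule smooth_fun_of_smooth2[OF sH t nt])
    have dH: "(H t has_vector_derivative (1 / \<rho> t (U t q)) *\<^sub>R bu t (U t q)) (at q)" for q
    proof -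
      have "(U t has_vector_derivative inverse (\<rho> t (U t q) / L t)) (at q)"
        using inv(3)[OF t, of q] dq\<sigma>[OF t] by (simp add: has_real_derivative_iff_has_vector_derivative)
      from vector_diff_chain_at[OF this db[of t]]
      have "((\<lambda>q. b t (U t q)) has_vector_derivative inverse (\<rho> t (U t q) / L t) *\<^sub>R bu t (U t q)) (at q)"
        by (simp add: comp_def)
      from has_vector_derivative_add[OF has_vector_derivative_const has_vector_derivative_scaleR[OF DERIV_const this], of z "1 / L t"]
      show ?thesis unfolding H_def[abs_def] using L[OF t] by (simp add: field_simps)
    qed
    have "norm (velocity (H t) q) = 1" for q
      unfolding velocity_eq[OF dH] using \<rho>pos[OF t, of "U t q"] by (simp add: \<rho>_def[symmetric])
    from unit_speed_angle[OF smH this] obtain \<psi> where \<psi>: "smooth_fun \<psi>"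
      "\<And>q. (H t has_vector_derivative cis (\<psi> q)) (at q)"
      "\<And>q. (\<psi> has_real_derivative curvature (H t) q) (at q)" by metis
    have cis\<psi>: "bu t (U t q) = \<rho> t (U t q) *\<^sub>R cis (\<psi> q)" for q
    proof -
      have "cis (\<psi> q) = (1 / \<rho> t (U t q)) *\<^sub>R bu t (U t q)"
        using \<psi>(2) dH vector_derivative_unique_at by blast
      then show ?thesis using \<rho>pos[OF t, of "U t q"] by simp
    qed
    have Hper: "H t (q + 1) = H t q" for q
      unfolding H_def Uper[OF t] b_def P_def per ..
    \<comment> \<open>The deformation is radial, so the polar angle around \<open>z\<close> is that
      of \<alpha>, reparametrized by \<open>U\<close>; the new tangent still points strictly to its
      left.\<close>
    have turn: "\<psi> (q + 1) = \<psi> q + 2 * pi" for q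
    proof (rule turning_eq_2pi[of \<psi> "\<lambda>q. a (U t q)"])
      show "continuous_on UNIV \<psi>" by (rule smooth_fun_continuous[OF \<psi>(1)])
      have "continuous_on UNIV (U t)"
        using inv(3)[OF t] by (meson DERIV_continuous_on has_field_derivative_at_within)
      then show "continuous_on UNIV (\<lambda>q. a (U t q))"
        by (rule continuous_on_compose2[OF a(1)]) auto
      fix q
      show "a (U t (q + 1)) = a (U t q) + 2 * pi" unfolding Uper[OF t] by (rule a(2))
      have "0 < Im (cnj (w (U t q)) * bu t (U t q))"
        unfolding cross_w using Ppos[OF t] h by simp
      also have "\<dots> = norm (w (U t q)) * \<rho> t (U t q) * sin (\<psi> q - a (U t q))"
        unfolding cis\<psi> w_def by (subst a(3)) (simp add: sin_diff algebra_simps)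
      finally have "0 < norm (w (U t q)) * \<rho> t (U t q) * sin (\<psi> q - a (U t q))" .
      moreover have "0 < norm (w (U t q)) * \<rho> t (U t q)"
        using \<rho>pos[OF t, of "U t q"] a(4)[of "U t q"] by (simp add: w_def)
      ultimately show "sin (\<psi> q - a (U t q)) > 0" by (rule zero_less_mult_pos)
      have "cis (\<psi> (q + 1)) = (1 / \<rho> t (U t q)) *\<^sub>R bu t (U t q)"
        using cis\<psi>[of "q + 1"] \<rho>pos[OF t, of "U t q"]
        unfolding Uper[OF t] \<rho>per by (simp add: bu_def P_def per \<theta>(5) cis_add_2pi)
      then show "cis (\<psi> (q + 1)) = cis (\<psi> q)" using cis\<psi>[of q] \<rho>pos[OF t, of "U t q"] by simp
    qed
    have "curvature (H t) q > 0" for q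
    proof -
      define u where "u = U t q"
      define k where "k = curvature (H t) q"
      have q: "\<sigma> t u = q" unfolding u_def by (rule U[OF t])
      obtain \<rho>' where \<rho>': "(\<rho> t has_real_derivative \<rho>') (at u)"
        using smooth2D(4)[OF nt open_UNIV s\<rho> t UNIV_I, of u]
        by (auto simp: has_real_derivative_iff_has_vector_derivative)
      have "((\<lambda>u. \<psi> (\<sigma> t u)) has_real_derivative k * (\<rho> t u / L t)) (at u)"
        by (rule DERIV_chain2[OF _ d\<sigma>[OF t]]) (use \<psi>(3)[of q] q k_def in simp)
      \<comment> \<open>Differentiating bu = \<rho> * cis (\<psi> (\<sigma> t u)) expresses the
        cross product of \<open>bu\<close> and \<open>buu\<close> as \<rho>^2 * k * \<rho> / L, so
        \<open>k\<close> has its sign.\<close>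
      from has_vector_derivative_scaleR[OF \<rho>' has_vector_derivative_cis[OF this]]
      have "((\<lambda>u. \<rho> t u *\<^sub>R cis (\<psi> (\<sigma> t u))) has_vector_derivative
          (\<rho> t u *\<^sub>R (\<i> * (k * (\<rho> t u / L t)) * cis (\<psi> q)) + \<rho>' *\<^sub>R cis (\<psi> q))) (at u)"
        unfolding q by simp
      moreover have "(\<lambda>u. \<rho> t u *\<^sub>R cis (\<psi> (\<sigma> t u))) = bu t"
        using cis\<psi>[of "\<sigma> t u" for u] inv(2)[OF t] by auto
      ultimately have "buu t u = \<rho> t u *\<^sub>R (\<i> * (k * (\<rho> t u / L t)) * cis (\<psi> q)) + \<rho>' *\<^sub>R cis (\<psi> q)"
        using dbu vector_derivative_unique_at by metis
      moreover have "bu t u = \<rho> t u *\<^sub>R cis (\<psi> q)" using cis\<psi>[of q] by (simp add: u_def)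
      moreover have "Im (cnj (x *\<^sub>R cis s) * (x *\<^sub>R (\<i> * of_real m * cis s) + y *\<^sub>R cis s)) = x * (x * m)"
        for x y m s :: real
      proof -
        have "cnj (x *\<^sub>R cis s) * (x *\<^sub>R (\<i> * of_real m * cis s) + y *\<^sub>R cis s)
            = (cis s * cnj (cis s)) * (of_real x * (of_real x * \<i> * of_real m) + of_real (x * y))"
          by (simp add: scaleR_conv_of_real algebra_simps)
        then show ?thesis unfolding E1 by simp
      qed
      ultimately have "Im (cnj (bu t u) * buu t u) = \<rho> t u * (\<rho> t u * (k * (\<rho> t u / L t)))" by metis
      then have "0 < \<rho> t u * (\<rho> t u * (k * (\<rho> t u / L t)))" using cross[OF t0, of u] by simp
      then show ?thesis using \<rho>pos[OF t, of u] L[OF t] by (simp add: zero_less_mult_iff zero_less_divide_iff k_def)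
    qed
    then show ?thesis by (rule tables_B_I[OF smH \<psi>(2,3) _ turn Hper])
  qed
  show ?thesis
  proof (rule that[OF sH H0 _ HB])
    show "H t \<in> tables_C" if "t \<in> ?A" for t
      using HB[of t] H0 \<alpha> that unfolding tables_B_def by (cases "t = 0") auto
  qed
qed

text \<open>The radial homotopy enters \<open>tables_B\<close> immediately, so it may be stopped as
  early as its bounded speed requires.\<close>

lemma tables_B_approx:
  assumes \<alpha>: "\<alpha> \<in> tables_C" and e: "e > 0"
  obtains \<beta> where "\<beta> \<in> tables_B" "bounded_homotopy tables_C \<alpha> \<beta> e"
proof -
  obtain H where H: "smooth2 {0..1} UNIV H" "H 0 = \<alpha>" "\<And>t. t \<in> {0..1} \<Longrightarrow> H t \<in> tables_C"
    "\<And>t. t \<in> {0<..1} \<Longrightarrow> H t \<in> tables_B" using radial_homotopy[OF \<alpha>] by metis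
  obtain B where B: "\<And>s q. s \<in> {0..1} \<Longrightarrow> norm (dt {0..1} H s q) \<le> B" "B > 0"
    using dt_homotopy_bounded[OF H(1,3)] by metis
  define d where "d = min 1 (e / B)"
  have d: "0 < d" "d \<le> 1" "d * B \<le> e" using e B(2) by (auto simp: d_def min_def field_simps)
  have sm: "smooth_fun (\<lambda>s. d * s)" by (rule smooth_funI) (intro smooth2_intros)
  have ds: "d * s \<in> {0..1}" if "s \<in> {0..1}" for s using that d mult_mono[of d 1 s 1] by auto
  then have im: "(\<lambda>s. d * s) ` {0..1} \<subseteq> {0..1}" by auto
  have "norm (dt {0..1} (\<lambda>s. H (d * s)) s q) \<le> e" if s: "s \<in> {0..1}" for s q
  proof -
    have "((\<lambda>s. d * s) has_real_derivative d) (at s)" by (auto intro!: derivative_eq_intros)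
    from bounded_homotopy_reparam[OF H(1) sm im zero_less_one this s]
    have "norm (dt {0..1} (\<lambda>s. H (d * s)) s q) = d * norm (dt {0..1} H (d * s) q)" using d by simp
    also have "\<dots> \<le> d * B" using B(1)[OF ds[OF s]] d by (intro mult_left_mono) auto
    finally show ?thesis using d(3) by simp
  qed
  then have "bounded_homotopy tables_C \<alpha> (H d) e"
    unfolding bounded_homotopy_def
    by (intro exI[of _ "\<lambda>s. H (d * s)"]) (use H smooth2_reparam[OF H(1) sm im] ds in auto)
  then show ?thesis using that[of "H d"] H(4)[of d] d by auto
qed

lemma bounded_homotopy_dominates:
  assumes "bounded_homotopy tables_C \<alpha> \<beta> B"
  shows "norm (\<alpha> q - \<beta> q) \<le> B"
proof -
  obtain H where H: "smooth2 {0..1} UNIV H" "\<And>s. s \<in> {0..1} \<Longrightarrow> H s \<in> tables_C" "H 0 = \<alpha>" "H 1 = \<beta>"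
    "\<And>s q. s \<in> {0..1} \<Longrightarrow> norm (dt {0..1} H s q) \<le> B"
    using assms unfolding bounded_homotopy_def by blast
  have "smooth_family_on {0..1} H"
    by (rule smooth_family_onI[OF at_within_Icc_nontrivial convex_real_interval(5) H(1)]) auto
  then have "H \<in> smooth_homotopies tables_C \<alpha> \<beta>" using H unfolding smooth_homotopies_def by auto
  from homotopy_dominates[OF this, of q] homotopy_length_le[OF H(5)] show ?thesis by linarith
qed

text \<open>Matching tangent angles requires positive curvature on both sides, so \<gamma> is
  replaced by a nearby \<beta> in \<open>tables_B\<close>, at distance at most 2 * d from \<alpha>;
  hence 36 = 18 * 2, times the constant for concatenation. It serves the case of a marked corner,
  where uniform closeness must bound \<open>d_AC\<close>.\<close>

theorem bounded_homotopy_tables_C: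
  obtains c where "c > 0" "\<And>\<alpha> \<gamma> d. \<alpha> \<in> tables_B \<Longrightarrow> \<gamma> \<in> tables_C \<Longrightarrow> d > 0 \<Longrightarrow>
    (\<And>q. norm (\<alpha> q - \<gamma> q) \<le> d) \<Longrightarrow> bounded_homotopy tables_C \<alpha> \<gamma> (c * d)"
proof -
  obtain c where c: "c > 0" "\<And>M \<alpha> \<beta> \<gamma> B. bounded_homotopy M \<alpha> \<beta> B \<Longrightarrow> bounded_homotopy M \<beta> \<gamma> B \<Longrightarrow>
    bounded_homotopy M \<alpha> \<gamma> (c * B)" using bounded_homotopy_trans by blast
  show ?thesis
  proof (rule that[of "c * 36"])
    fix \<alpha> \<gamma> d assume \<alpha>: "\<alpha> \<in> tables_B" and \<gamma>: "\<gamma> \<in> tables_C" and d: "(d::real) > 0"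
      and le: "\<And>q. norm (\<alpha> q - \<gamma> q) \<le> d"
    obtain \<beta> where \<beta>: "\<beta> \<in> tables_B" "bounded_homotopy tables_C \<gamma> \<beta> d"
      using tables_B_approx[OF \<gamma> d] by blast
    have "norm (\<alpha> q - \<beta> q) \<le> 2 * d" for q
      using le[of q] bounded_homotopy_dominates[OF \<beta>(2), of q] norm_triangle_ineq[of "\<alpha> q - \<gamma> q" "\<gamma> q - \<beta> q"] by simp
    from bounded_homotopy_tables_B[OF \<alpha> \<beta>(1) this]
    have "bounded_homotopy tables_C \<alpha> \<beta> (36 * d)"
      by (rule bounded_homotopy_mono) (auto simp: tables_B_def)
    moreover have "bounded_homotopy tables_C \<beta> \<gamma> (36 * d)"
      by (rule bounded_homotopy_mono[OF bounded_homotopy_sym[OF \<beta>(2)]]) (use d in auto)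
    ultimately show "bounded_homotopy tables_C \<alpha> \<gamma> (c * 36 * d)" using c(2) by (simp add: mult.assoc)
  qed (use c in auto)
qed

section \<open>The sides and corners of a polygon\<close>

lemma unit_cnj_mult: "norm w = 1 \<Longrightarrow> cnj w * w = 1"
  by (metis complex_norm_square mult.commute of_real_1 one_power2)

lemma Im_zero_parallel:
  assumes "norm w = 1" "Im (cnj w * x) = 0"
  shows "x = Re (cnj w * x) *\<^sub>R w"
proof -
  have "cnj w * x = of_real (Re (cnj w * x))" using assms(2) by (simp add: complex_eq_iff)
  then have "(cnj w * w) * x = of_real (Re (cnj w * x)) * w" by (metis mult.assoc mult.commute)
  then show ?thesis unfolding unit_cnj_mult[OF assms(1)] by (simp add: scaleR_conv_of_real)
qed

lemma stays_in_0_pi: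
  fixes f :: "real \<Rightarrow> real"
  assumes f: "continuous_on {x..y} f" "x \<le> y" and 0: "0 < f x" "f x < pi"
    and pos: "\<And>u. u \<in> {x..y} \<Longrightarrow> sin (f u) > 0"
  shows "0 < f y" "f y < pi"
proof -
  show "0 < f y"
  proof (rule ccontr)
    assume "\<not> 0 < f y"
    then obtain u where "x \<le> u" "u \<le> y" "f u = 0" using IVT2'[of f y 0 x] f 0 by auto
    then show False using pos[of u] by simp
  qed
  show "f y < pi"
  proof (rule ccontr)
    assume "\<not> f y < pi"
    then obtain u where "x \<le> u" "u \<le> y" "f u = pi" using IVT'[of f x pi y] f 0 by auto
    then show False using pos[of u] by simp
  qed
qed

lemma affine_has_vector_derivative:
  fixes f :: "real \<Rightarrow> complex"
  assumes "open S" "x \<in> S" "\<And>u. u \<in> S \<Longrightarrow> f u = p + (u - c) *\<^sub>R w"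
  shows "(f has_vector_derivative w) (at x)"
proof -
  have "((\<lambda>u. p + (u - c) *\<^sub>R w) has_vector_derivative w) (at x)"
    by (auto intro!: derivative_eq_intros)
  then show ?thesis
    by (rule has_vector_derivative_transform_within_open[OF _ assms(1,2)]) (rule assms(3)[symmetric])
qed

locale polygon =
  fixes K :: "complex set" and \<eta> :: "real \<Rightarrow> complex"
  assumes poly: "polygon_param K \<eta>"
begin

definition corner :: "real \<Rightarrow> bool" where
  "corner y \<longleftrightarrow> \<eta> y extreme_point_of K"

lemma ccw: "ccw_boundary_param K \<eta>" and polytope: "polytope K"
  and deriv: "\<not> corner y \<Longrightarrow> \<exists>w. norm w = 1 \<and> (\<eta> has_vector_derivative w) (at y)"
  using poly unfolding polygon_param_def corner_def by auto

lemmas K = ccw_boundary_paramD[OF ccw]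

lemma finite_extreme: "finite {v. v extreme_point_of K}"
  using finite_polyhedron_extreme_points[OF polytope_imp_polyhedron[OF polytope]] .

lemma extreme_in_range: "v extreme_point_of K \<Longrightarrow> v \<in> range \<eta>"
  using K(7) K(3) extreme_point_not_in_interior[of v K]
  by (auto simp: frontier_def extreme_point_of_def)

text \<open>The polar angle around an interior point is strictly increasing and determines the
  parameter; equal points differ by whole turns.\<close>

lemma eq_imp_int_diff:
  assumes "\<eta> u = \<eta> v" shows "\<exists>k::int. u = v + k"
proof -
  obtain z where z: "z \<in> interior K" using K(4) by auto
  obtain a where a: "strict_mono a" "\<And>q. a (q + 1) = a q + 2 * pi"
    "\<And>q. \<eta> q - z = norm (\<eta> q - z) * cis (a q)" "\<And>q. \<eta> q \<noteq> z"
    using ccw_boundary_angle[OF ccw z] by metis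
  have "cis (a u) = cis (a v)"
    using a(3)[of u] a(3)[of v] a(4)[of v] assms
    by (metis mult_left_cancel norm_eq_zero of_real_eq_0_iff right_minus_eq)
  then obtain k :: int where "a u = a v + 2 * pi * k" using cis_eq_cisD by blast
  then have "a u = a (v + k)" using quasiperiodic_add_int[of a "2 * pi" v k] a(2) by simp
  then have "u = v + k" using strict_mono_eq[OF a(1)] by simp
  then show ?thesis by blast
qed

lemma on_line:
  assumes "x \<in> K" "x + m *\<^sub>R v \<in> K" "0 \<le> t" "t \<le> m"
  shows "x + t *\<^sub>R v \<in> K"
proof (cases "m = 0")
  case False
  then have "m > 0" using assms by simp
  have "(1 - t / m) *\<^sub>R x + (t / m) *\<^sub>R (x + m *\<^sub>R v) \<in> K"
    by (rule convexD[OF K(1) assms(1,2)]) (use assms \<open>m > 0\<close> in auto)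
  moreover have "(1 - t / m) *\<^sub>R x + (t / m) *\<^sub>R (x + m *\<^sub>R v) = x + t *\<^sub>R v"
    using \<open>m > 0\<close> by (simp add: algebra_simps)
  ultimately show ?thesis by simp
qed (use assms in auto)

text \<open>A boundary point that is not extreme lies inside a segment of \<open>K\<close>. The
  tangent line supports \<open>K\<close>, so the segment runs along it. Nearby boundary points are
  determined by their rays from an interior point and thus lie on the same line; unit speed and
  orientation make the parametrization affine.\<close>

lemma side_local:
  assumes "\<not> corner y"
  shows "\<exists>w e. norm w = 1 \<and> e > 0 \<and> (\<forall>u. \<bar>u - y\<bar> < e \<longrightarrow> \<eta> u = \<eta> y + (u - y) *\<^sub>R w)"
proof -
  obtain w where w: "norm w = 1" "(\<eta> has_vector_derivative w) (at y)" using deriv[OF assms] by auto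
  have w0: "w \<noteq> 0" using w(1) by auto
  define x0 where "x0 = \<eta> y"
  have x0K: "x0 \<in> K" unfolding x0_def by (rule K(9))
  obtain z where z: "z \<in> interior K" using K(4) by auto
  have sup: "0 \<le> Im (cnj w * (x - x0))" if "x \<in> K" for x
    using ccw_boundary_support(1)[OF ccw w(2) w0 that] by (simp add: x0_def)
  have strict: "0 < Im (cnj w * (x - x0))" if "x \<in> interior K" for x
    using ccw_boundary_support(2)[OF ccw w(2) w0 that] by (simp add: x0_def algebra_simps)
  obtain p p' where p: "p \<in> K" "p' \<in> K" "x0 \<in> open_segment p p'"
    using assms x0K unfolding corner_def extreme_point_of_def x0_def by blast
  then obtain s where s: "0 < s" "s < 1" "x0 = (1 - s) *\<^sub>R p + s *\<^sub>R p'" "p \<noteq> p'"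
    by (auto simp: in_segment)
  have comb: "(1 - s) *\<^sub>R (p - x0) + s *\<^sub>R (p' - x0) = 0"
    using s(3) by (simp add: algebra_simps)
  \<comment> \<open>Coordinates of the end points of the segment with the tangent as real axis.
    Their imaginary parts are nonnegative and have weighted sum 0, so both vanish.\<close>
  define A B where "A = cnj w * (p - x0)" and "B = cnj w * (p' - x0)"
  have AB: "(1 - s) *\<^sub>R A + s *\<^sub>R B = 0"
    using arg_cong[OF comb, of "\<lambda>x. cnj w * x"] by (simp add: A_def B_def algebra_simps)
  have "(1 - s) * Im A + s * Im B = 0" using arg_cong[OF AB, of Im] by simp
  moreover have "Im A \<ge> 0" "Im B \<ge> 0" using sup p unfolding A_def B_def by auto
  ultimately have "Im A = 0" "Im B = 0" using s(1,2)
    by (smt (verit) mult_pos_pos mult_nonneg_nonneg)+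
  then have pA: "p = x0 + Re A *\<^sub>R w" "p' = x0 + Re B *\<^sub>R w"
    using Im_zero_parallel[OF w(1), of "p - x0"] Im_zero_parallel[OF w(1), of "p' - x0"]
    by (auto simp: A_def B_def algebra_simps)
  have sRe: "(1 - s) * Re A + s * Re B = 0" using arg_cong[OF AB, of Re] by simp
  have "Re A \<noteq> Re B" using pA s(4) by auto
  obtain m1 m2 where m: "m1 > 0" "m2 > 0" "x0 + m1 *\<^sub>R w \<in> K" "x0 + m2 *\<^sub>R (- w) \<in> K"
  proof (cases "Re A > 0")
    case True
    then have "s * Re B < 0" using sRe s mult_pos_pos[of "1 - s" "Re A"] by linarith
    then have "Re B < 0" using s by (simp add: mult_less_0_iff)
    then show ?thesis using that[of "Re A" "- Re B"] True p pA by auto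
  next
    case False
    have "Re A \<noteq> 0" using sRe s \<open>Re A \<noteq> Re B\<close> by auto
    with False have "Re A < 0" by simp
    then have "s * Re B > 0" using sRe s mult_pos_neg[of "1 - s" "Re A"] by linarith
    then have "Re B > 0" using s by (simp add: zero_less_mult_iff)
    then show ?thesis using that[of "Re B" "- Re A"] \<open>Re A < 0\<close> p pA by auto
  qed
  define c where "c = min m1 m2"
  have c: "c > 0" using m by (simp add: c_def)
  have lineK: "x0 + t *\<^sub>R w \<in> K" if "\<bar>t\<bar> \<le> c" for t
  proof (cases "t \<ge> 0")
    case True
    then show ?thesis using on_line[OF x0K m(3), of t] that by (auto simp: c_def)
  next
    case False
    then show ?thesis using on_line[OF x0K m(4), of "- t"] that by (auto simp: c_def)
  qed
  have lineF: "x0 + t *\<^sub>R w \<in> frontier K" if "\<bar>t\<bar> \<le> c" for t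
  proof -
    have "Im (cnj w * (x0 + t *\<^sub>R w - x0)) = 0" by (simp add: algebra_simps)
    then have "x0 + t *\<^sub>R w \<notin> interior K" using strict[of "x0 + t *\<^sub>R w"] by auto
    then show ?thesis using lineK[OF that] K(3) by (simp add: frontier_def)
  qed
  have nonext: "\<not> (x0 + t *\<^sub>R w) extreme_point_of K" if "\<bar>t\<bar> < c" for t
  proof
    assume ext: "(x0 + t *\<^sub>R w) extreme_point_of K"
    define d where "d = c - \<bar>t\<bar>"
    have d: "d > 0" using that by (simp add: d_def)
    have "x0 + t *\<^sub>R w = midpoint (x0 + (t - d) *\<^sub>R w) (x0 + (t + d) *\<^sub>R w)"
      by (simp add: midpoint_def algebra_simps scaleR_conv_of_real)
    moreover have "x0 + (t - d) *\<^sub>R w \<noteq> x0 + (t + d) *\<^sub>R w" using d w0 by (simp add: algebra_simps)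
    ultimately have "x0 + t *\<^sub>R w \<in> open_segment (x0 + (t - d) *\<^sub>R w) (x0 + (t + d) *\<^sub>R w)"
      by (metis midpoint_in_open_segment)
    moreover have "x0 + (t - d) *\<^sub>R w \<in> K" "x0 + (t + d) *\<^sub>R w \<in> K"
    proof -
      have "\<bar>t - d\<bar> \<le> \<bar>t\<bar> + d" "\<bar>t + d\<bar> \<le> \<bar>t\<bar> + d"
        using abs_triangle_ineq4[of t d] abs_triangle_ineq[of t d] abs_of_pos[OF d] by simp_all
      moreover have "\<bar>t\<bar> + d = c" by (simp add: d_def)
      ultimately show "x0 + (t - d) *\<^sub>R w \<in> K" "x0 + (t + d) *\<^sub>R w \<in> K" by (auto intro: lineK)
    qed
    ultimately show False using ext unfolding extreme_point_of_def by blast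
  qed
  define v where "v u = \<eta> u - z" for u
  define den where "den u = Im (cnj (v u) * w)" for u
  \<comment> \<open>The line through \<open>x0\<close> with direction \<open>w\<close> meets the
    line through \<open>z\<close> and \<eta> u at parameter \<open>tt u\<close>; positivity of
    \<open>lam u\<close> says that the meeting point and \<eta> u lie on the same ray from
    \<open>z\<close>.\<close>
  define tt where "tt u = - Im (cnj (v u) * (x0 - z)) / den u" for u
  define lam where "lam u = Re (cnj (v u) * (x0 + tt u *\<^sub>R w - z))" for u
  have "isCont \<eta> y" using K(5) by (simp add: continuous_on_eq_continuous_at)
  then have "(\<eta> \<longlongrightarrow> \<eta> y) (nhds y)" unfolding isCont_def tendsto_at_iff_tendsto_nhds .
  then have lv: "(v \<longlongrightarrow> v y) (nhds y)" unfolding v_def by (intro tendsto_intros)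
  have vy: "v y = x0 - z" by (simp add: v_def x0_def)
  have deny: "den y > 0" using strict[OF z] unfolding den_def vy by (simp add: algebra_simps)
  have lden: "(den \<longlongrightarrow> den y) (nhds y)" unfolding den_def by (intro tendsto_intros lv)
  have tty: "tt y = 0" by (simp add: tt_def vy algebra_simps)
  have ltt: "(tt \<longlongrightarrow> tt y) (nhds y)" unfolding tt_def by (intro tendsto_intros lv lden) (use deny in simp)
  have llam: "(lam \<longlongrightarrow> lam y) (nhds y)" unfolding lam_def by (intro tendsto_intros lv ltt)
  have lamy: "lam y > 0"
  proof -
    have "x0 \<noteq> z" using deny by (auto simp: den_def vy)
    have e: "cnj (x0 - z) * (x0 - z) = of_real ((norm (x0 - z))\<^sup>2)"
      by (metis complex_norm_square mult.commute)
    have "x0 + tt y *\<^sub>R w - z = x0 - z" by (simp add: tty)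
    then have "lam y = (norm (x0 - z))\<^sup>2" unfolding lam_def vy by (simp only: e Re_complex_of_real)
    then show ?thesis using \<open>x0 \<noteq> z\<close> by simp
  qed
  have "\<bar>tt y\<bar> < c" using c tty by simp
  from order_tendstoD(1)[OF lden deny] order_tendstoD(2)[OF tendsto_rabs[OF ltt] this] order_tendstoD(1)[OF llam lamy]
  have "\<forall>\<^sub>F u in nhds y. den u > 0 \<and> \<bar>tt u\<bar> < c \<and> lam u > 0" by (intro eventually_conj)
  then obtain e where e: "e > 0" "\<And>u. \<bar>u - y\<bar> < e \<Longrightarrow> den u > 0 \<and> \<bar>tt u\<bar> < c \<and> lam u > 0"
    unfolding eventually_nhds_metric dist_real_def by blast
  have line: "\<eta> u = x0 + tt u *\<^sub>R w" if u: "\<bar>u - y\<bar> < e" for u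
  proof -
    define X where "X = x0 + tt u *\<^sub>R w - z"
    have "Im (cnj (v u) * X) = Im (cnj (v u) * (x0 - z)) + tt u * den u"
      by (simp add: X_def den_def algebra_simps)
    also have "\<dots> = 0" using e(2)[OF u] by (simp add: tt_def)
    finally have Im0: "Im (cnj (v u) * X) = 0" .
    have v0: "v u \<noteq> 0" using e(2)[OF u] by (auto simp: den_def)
    have "cnj (v u) * X = of_real (lam u)" using Im0 by (simp add: complex_eq_iff lam_def X_def)
    then have "(v u * cnj (v u)) * X = of_real (lam u) * v u" by (metis mult.assoc mult.commute)
    then have "X = (lam u / (norm (v u))\<^sup>2) *\<^sub>R v u"
      using v0 unfolding complex_norm_square[symmetric] by (simp add: scaleR_conv_of_real field_simps)
    then have "x0 + tt u *\<^sub>R w = \<eta> u"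
      using frontier_ray_unique[OF K(1) z lineF[of "tt u"] K(8), of "lam u / (norm (v u))\<^sup>2" u] e(2)[OF u] v0
      by (simp add: X_def v_def)
    then show ?thesis by simp
  qed
  define \<tau> where "\<tau> x = Re (cnj w * (\<eta> x - x0))" for x
  have \<tau>: "\<eta> u = x0 + \<tau> u *\<^sub>R w" if "\<bar>u - y\<bar> < e" for u
  proof -
    have "\<tau> u = tt u" unfolding \<tau>_def line[OF that] using unit_cnj_mult[OF w(1)] by (simp add: algebra_simps)
    then show ?thesis using line[OF that] by simp
  qed
  \<comment> \<open>As |tt u| < c, the point is not a corner, so the speed is 1 and the derivative
    of \<tau> is 1 or -1; the counterclockwise orientation excludes -1.\<close>
  have d\<tau>: "(\<tau> has_real_derivative 1) (at u)" if u: "\<bar>u - y\<bar> < e" for u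
  proof -
    have "\<not> corner u" unfolding corner_def line[OF u] by (rule nonext) (use e(2)[OF u] in auto)
    then obtain w' where w': "norm w' = 1" "(\<eta> has_vector_derivative w') (at u)" using deriv by blast
    define d where "d = Re (cnj w * w')"
    have dt: "(\<tau> has_real_derivative d) (at u)"
    proof -
      have "((\<lambda>x. cnj w * (\<eta> x - x0)) has_vector_derivative cnj w * w') (at u)"
        using has_vector_derivative_mult_right[OF has_vector_derivative_diff[OF w'(2) has_vector_derivative_const]] by simp
      from bounded_linear.has_vector_derivative[OF bounded_linear_Re this]
      show ?thesis by (simp add: \<tau>_def[abs_def] d_def has_real_derivative_iff_has_vector_derivative)
    qed
    have "((\<lambda>x. x0 + \<tau> x *\<^sub>R w) has_vector_derivative d *\<^sub>R w) (at u)"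
      using has_vector_derivative_add[OF has_vector_derivative_const has_vector_derivative_scaleR[OF dt has_vector_derivative_const]] by simp
    then have "(\<eta> has_vector_derivative d *\<^sub>R w) (at u)"
      by (rule has_vector_derivative_transform_within_open[of _ _ _ "ball y e"])
        (use \<tau> u in \<open>auto simp: dist_real_def abs_minus_commute\<close>)
    then have w'd: "w' = d *\<^sub>R w" using w'(2) vector_derivative_unique_at by blast
    then have "\<bar>d\<bar> = 1" using w'(1) w(1) by simp
    have "w' \<noteq> 0" using w'(1) by auto
    then have "0 < Im (cnj (v u) * w')" unfolding v_def by (rule ccw_boundary_support(2)[OF ccw w'(2) _ z])
    then have "0 < d * den u" by (simp add: w'd den_def algebra_simps)
    then have "d > 0" using e(2)[OF u] by (simp add: zero_less_mult_iff)
    then show ?thesis using \<open>\<bar>d\<bar> = 1\<close> dt by simp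
  qed
  have \<tau>_eq: "\<tau> u = u - y" if u: "\<bar>u - y\<bar> < e" for u
  proof -
    have "\<exists>k. \<forall>x\<in>ball y e. \<tau> x - x = k"
    proof (rule has_vector_derivative_zero_constant)
      fix x assume "x \<in> ball y e"
      then have "\<bar>x - y\<bar> < e" by (simp add: dist_real_def abs_minus_commute)
      from DERIV_diff[OF d\<tau>[OF this] DERIV_ident]
      show "((\<lambda>x. \<tau> x - x) has_vector_derivative 0) (at x within ball y e)"
        by (simp add: has_real_derivative_iff_has_vector_derivative has_vector_derivative_at_within)
    qed (simp | blast)+
    then have "\<tau> u - u = \<tau> y - y" using u e(1) by (auto simp: dist_real_def abs_minus_commute)
    moreover have "\<tau> y = 0" by (simp add: \<tau>_def x0_def)
    ultimately show ?thesis by simp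
  qed
  have "\<eta> u = \<eta> y + (u - y) *\<^sub>R w" if "\<bar>u - y\<bar> < e" for u
    using \<tau>[OF that] unfolding \<tau>_eq[OF that] x0_def .
  then show ?thesis using e(1) w(1) by blast
qed

text \<open>The velocity is locally constant between the ends, hence constant there; continuity
  extends the affine formula to the ends, which may be corners.\<close>

lemma side_free:
  assumes ab: "a < b" and free: "\<And>y. a < y \<Longrightarrow> y < b \<Longrightarrow> \<not> corner y"
  shows "\<exists>w. norm w = 1 \<and> (\<forall>u\<in>{a..b}. \<eta> u = \<eta> a + (u - a) *\<^sub>R w)"
proof -
  let ?S = "{a<..<b}"
  have loc: "\<exists>e>0. \<forall>x. \<bar>x - y\<bar> < e \<longrightarrow> (\<eta> has_vector_derivative velocity \<eta> y) (at x) \<and> norm (velocity \<eta> y) = 1"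
    if y: "y \<in> ?S" for y
  proof -
    obtain w e where w: "norm w = 1" "e > 0" "\<And>u. \<bar>u - y\<bar> < e \<Longrightarrow> \<eta> u = \<eta> y + (u - y) *\<^sub>R w"
      using side_local[of y] free[of y] y by auto
    have b: "u \<in> ball y e \<longleftrightarrow> \<bar>u - y\<bar> < e" for u by (simp add: dist_real_def abs_minus_commute)
    have d: "(\<eta> has_vector_derivative w) (at x)" if "\<bar>x - y\<bar> < e" for x
    proof (rule affine_has_vector_derivative[of "ball y e"])
      show "\<eta> u = \<eta> y + (u - y) *\<^sub>R w" if "u \<in> ball y e" for u using w(3) that b by blast
    qed (use that b in auto)
    have "velocity \<eta> y = w" by (rule velocity_eq[OF d]) (use w in simp)
    then show ?thesis using d w by blast
  qed
  have "velocity \<eta> constant_on ?S"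
  proof (rule locally_constant_imp_constant)
    fix y assume y: "y \<in> ?S"
    obtain e where e: "e > 0" "\<And>x. \<bar>x - y\<bar> < e \<Longrightarrow> (\<eta> has_vector_derivative velocity \<eta> y) (at x)"
      using loc[OF y] by blast
    have "velocity \<eta> x = velocity \<eta> y" if "x \<in> ?S \<inter> ball y e" for x
      by (rule velocity_eq[OF e(2)]) (use that in \<open>auto simp: dist_real_def abs_minus_commute\<close>)
    then show "\<exists>T. openin (top_of_set ?S) T \<and> y \<in> T \<and> (\<forall>x\<in>T. velocity \<eta> x = velocity \<eta> y)"
    proof (intro exI[of _ "?S \<inter> ball y e"] conjI)
      show "openin (top_of_set ?S) (?S \<inter> ball y e)" by (rule openin_open_Int) simp
      show "y \<in> ?S \<inter> ball y e" using y e(1) by simp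
    qed blast
  qed simp
  then obtain w where w: "\<And>y. y \<in> ?S \<Longrightarrow> velocity \<eta> y = w" unfolding constant_on_def by blast
  have d: "(\<eta> has_vector_derivative w) (at y)" "norm w = 1" if y: "y \<in> ?S" for y
  proof -
    obtain e where "e > 0" "\<And>x. \<bar>x - y\<bar> < e \<Longrightarrow> (\<eta> has_vector_derivative velocity \<eta> y) (at x) \<and> norm (velocity \<eta> y) = 1"
      using loc[OF y] by blast
    from this(2)[of y] this(1) show "(\<eta> has_vector_derivative w) (at y)" "norm w = 1"
      unfolding w[OF y] by simp_all
  qed
  have "\<exists>k. \<forall>x\<in>?S. \<eta> x - x *\<^sub>R w = k"
  proof (rule has_vector_derivative_zero_constant)
    fix x assume x: "x \<in> ?S"
    have "((\<lambda>x. x *\<^sub>R w) has_vector_derivative w) (at x)" by (auto intro!: derivative_eq_intros)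
    from has_vector_derivative_diff[OF d(1)[OF x] this]
    show "((\<lambda>x. \<eta> x - x *\<^sub>R w) has_vector_derivative 0) (at x within ?S)"
      by (simp add: has_vector_derivative_at_within)
  qed (simp | blast)+
  then obtain k where k: "\<And>x. x \<in> ?S \<Longrightarrow> \<eta> x - x *\<^sub>R w = k" by blast
  have c: "\<eta> x = k + x *\<^sub>R w" if "x \<in> {a..b}" for x
  proof -
    have "\<eta> x - x *\<^sub>R w = k"
    proof (rule continuous_constant_on_closure[of ?S "\<lambda>x. \<eta> x - x *\<^sub>R w"])
      show "continuous_on (closure ?S) (\<lambda>x. \<eta> x - x *\<^sub>R w)"
        by (intro continuous_intros continuous_on_subset[OF K(5)]) auto
    qed (use k ab that in auto)
    then show ?thesis by (simp add: diff_eq_eq)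
  qed
  have "\<eta> u = \<eta> a + (u - a) *\<^sub>R w" if "u \<in> {a..b}" for u
    using c[OF that] c[of a] ab by (simp add: algebra_simps)
  moreover have "norm w = 1" using d(2)[of "(a + b) / 2"] ab by simp
  ultimately show ?thesis by blast
qed

text \<open>There are finitely many extreme points, and \<eta> is injective on an interval shorter
  than a period.\<close>

lemma corner_isolated:
  "\<exists>e>0. e < 1 / 4 \<and> (\<forall>u. u \<noteq> y \<longrightarrow> \<bar>u - y\<bar> < e \<longrightarrow> \<not> corner u)"
proof -
  define F where "F = {u. y - 1 / 4 \<le> u \<and> u \<le> y + 1 / 4 \<and> corner u}"
  have "inj_on \<eta> F"
  proof (rule inj_onI)
    fix u v assume uv: "u \<in> F" "v \<in> F" "\<eta> u = \<eta> v"
    then obtain k :: int where k: "u = v + k" using eq_imp_int_diff by blast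
    have "\<bar>u - v\<bar> \<le> 1 / 2" using uv unfolding F_def by (intro abs_leI) auto
    then have "\<bar>real_of_int k\<bar> \<le> 1 / 2" using k by simp
    then have "k = 0" by linarith
    then show "u = v" using k by simp
  qed
  moreover have "\<eta> ` F \<subseteq> {v. v extreme_point_of K}" unfolding F_def corner_def by auto
  ultimately have "finite F" using finite_extreme finite_imageD finite_subset by metis
  then obtain d where d: "d > 0" "\<And>x. x \<in> F \<Longrightarrow> x \<noteq> y \<Longrightarrow> d \<le> dist y x"
    using finite_set_avoid by metis
  define e where "e = min d (1 / 5)"
  have "\<not> corner u" if "u \<noteq> y" "\<bar>u - y\<bar> < e" for u
  proof
    assume "corner u"
    moreover have "\<bar>u - y\<bar> < 1 / 5" using that(2) by (simp add: e_def)
    then have "u - y < 1 / 5" "y - u < 1 / 5"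
      using abs_ge_self[of "u - y"] abs_ge_minus_self[of "u - y"] by linarith+
    ultimately have "u \<in> F" by (simp add: F_def)
    then have "d \<le> dist y u" using d(2) that by blast
    then show False using that by (simp add: e_def dist_real_def abs_minus_commute)
  qed
  moreover have "e > 0" "e < 1 / 4" using d by (auto simp: e_def)
  ultimately show ?thesis by blast
qed

lemma corner_directions:
  obtains wl wr where "\<And>y. norm (wl y) = 1" "\<And>y. norm (wr y) = 1"
    "\<And>y. \<exists>e>0. \<forall>u\<in>{y - e..y}. \<eta> u = \<eta> y + (u - y) *\<^sub>R wl y"
    "\<And>y. \<exists>e>0. \<forall>u\<in>{y..y + e}. \<eta> u = \<eta> y + (u - y) *\<^sub>R wr y"
proof -
  have 1: "\<exists>w. norm w = 1 \<and> (\<exists>e>0. \<forall>u\<in>{y - e..y}. \<eta> u = \<eta> y + (u - y) *\<^sub>R w)" for y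
  proof -
    obtain e where e: "e > 0" "\<And>u. u \<noteq> y \<Longrightarrow> \<bar>u - y\<bar> < e \<Longrightarrow> \<not> corner u" using corner_isolated[of y] by blast
    have "\<exists>w. norm w = 1 \<and> (\<forall>u\<in>{y - e / 2..y}. \<eta> u = \<eta> (y - e / 2) + (u - (y - e / 2)) *\<^sub>R w)"
      by (rule side_free) (use e in auto)
    then obtain w where w: "norm w = 1" "\<And>u. u \<in> {y - e / 2..y} \<Longrightarrow> \<eta> u = \<eta> (y - e / 2) + (u - (y - e / 2)) *\<^sub>R w"
      by blast
    have "\<eta> u = \<eta> y + (u - y) *\<^sub>R w" if "u \<in> {y - e / 2..y}" for u
      using w(2)[of y] w(2)[OF that] e(1) by (simp add: algebra_simps)
    moreover have "e / 2 > 0" using e(1) by simp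
    ultimately show ?thesis using w(1) by blast
  qed
  have 2: "\<exists>w. norm w = 1 \<and> (\<exists>e>0. \<forall>u\<in>{y..y + e}. \<eta> u = \<eta> y + (u - y) *\<^sub>R w)" for y
  proof -
    obtain e where e: "e > 0" "\<And>u. u \<noteq> y \<Longrightarrow> \<bar>u - y\<bar> < e \<Longrightarrow> \<not> corner u" using corner_isolated[of y] by blast
    have "\<exists>w. norm w = 1 \<and> (\<forall>u\<in>{y..y + e / 2}. \<eta> u = \<eta> y + (u - y) *\<^sub>R w)"
      by (rule side_free) (use e in auto)
    moreover have "e / 2 > 0" using e(1) by simp
    ultimately show ?thesis by blast
  qed
  from 1 2 that show ?thesis by metis
qed

text \<open>Carries the supporting property from the middle of a side to its end points, where
  \<eta> may have no derivative.\<close>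

lemma side_support:
  assumes uv: "u < v" and w: "norm w = 1" and line: "\<And>x. x \<in> {u..v} \<Longrightarrow> \<eta> x = p + (x - c) *\<^sub>R w"
  shows "x \<in> K \<Longrightarrow> y \<in> {u..v} \<Longrightarrow> 0 \<le> Im (cnj w * (x - \<eta> y))"
    and "z \<in> interior K \<Longrightarrow> y \<in> {u..v} \<Longrightarrow> 0 < Im (cnj (\<eta> y - z) * w)"
proof -
  define m where "m = (u + v) / 2"
  have m: "u < m" "m < v" using uv by (auto simp: m_def)
  have d: "(\<eta> has_vector_derivative w) (at m)"
    by (rule affine_has_vector_derivative[of "{u<..<v}" _ _ p c]) (use m line in auto)
  have w0: "w \<noteq> 0" using w by auto
  have eq: "\<eta> y = \<eta> m + (y - m) *\<^sub>R w" if "y \<in> {u..v}" for y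
  proof -
    have 1: "\<eta> y = p + (y - c) *\<^sub>R w" and 2: "\<eta> m = p + (m - c) *\<^sub>R w"
      using line[OF that] line[of m] m by auto
    show ?thesis unfolding 1 2 by (simp add: algebra_simps)
  qed
  have ww: "Im (cnj w * w) = 0" by simp
  show "0 \<le> Im (cnj w * (x - \<eta> y))" if "x \<in> K" "y \<in> {u..v}"
    using ccw_boundary_support(1)[OF ccw d w0 that(1)] unfolding eq[OF that(2)] by (simp add: algebra_simps)
  show "0 < Im (cnj (\<eta> y - z) * w)" if "z \<in> interior K" "y \<in> {u..v}"
    using ccw_boundary_support(2)[OF ccw d w0 that(1)] unfolding eq[OF that(2)] by (simp add: algebra_simps)
qed

end

section \<open>Marked polygons and their exterior angles\<close>

locale marked_polygon = polygon +
  assumes start: "\<not> \<eta> 0 extreme_point_of K"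
begin

text \<open>Corners are recorded as parameters, ordered from the marked point, so that the direction
  of a side is a sum over the earlier corners. The interval is open at 0 because the marked point is
  not a corner.\<close>

definition corners :: "real set" where
  "corners = {y \<in> {0<..<1}. corner y}"

lemma inj_on_corners: "inj_on \<eta> {0..<1}"
  using ccw unfolding ccw_boundary_param_def by auto

lemma corners_image: "\<eta> ` corners = {v. v extreme_point_of K}"
proof
  show "{v. v extreme_point_of K} \<subseteq> \<eta> ` corners"
  proof
    fix v assume v: "v \<in> {v. v extreme_point_of K}"
    then obtain q where q: "v = \<eta> q" using extreme_in_range by blast
    have fr: "\<eta> q = \<eta> (frac q)"
      using periodic_add_int[of \<eta> "frac q" "\<lfloor>q\<rfloor>"] K(6) by (simp add: frac_def)
    have "frac q \<noteq> 0"
    proof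
      assume "frac q = 0"
      then have "\<eta> q = \<eta> 0" using fr by metis
      then show False using v q start by simp
    qed
    then have "frac q \<in> corners" using v q fr frac_ge_0[of q] frac_lt_1[of q]
      by (auto simp: corners_def corner_def)
    then show "v \<in> \<eta> ` corners" using q fr by blast
  qed
qed (auto simp: corners_def corner_def)

lemma finite_corners: "finite corners"
proof (rule finite_imageD)
  show "finite (\<eta> ` corners)" unfolding corners_image by (rule finite_extreme)
  show "inj_on \<eta> corners" by (rule inj_on_subset[OF inj_on_corners]) (auto simp: corners_def)
qed

text \<open>Induction along the boundary, from \<open>y\<close> back to the last corner before
  it.\<close>

lemma corner_induct [consumes 1, case_names base step]:
  assumes "y \<in> {0<..1}"
    and base: "\<And>y. y \<in> {0<..1} \<Longrightarrow> corners \<inter> {0..<y} = {} \<Longrightarrow> P y"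
    and step: "\<And>y c. y \<in> {0<..1} \<Longrightarrow> c \<in> corners \<Longrightarrow> c < y \<Longrightarrow> corners \<inter> {c<..<y} = {} \<Longrightarrow> P c \<Longrightarrow> P y"
  shows "P y"
  using assms(1)
proof (induction "card (corners \<inter> {0..<y})" arbitrary: y rule: less_induct)
  case less
  have fin: "finite (corners \<inter> {0..<y})" using finite_corners by simp
  show ?case
  proof (cases "corners \<inter> {0..<y} = {}")
    case False
    define c where "c = Max (corners \<inter> {0..<y})"
    have c: "c \<in> corners \<inter> {0..<y}" unfolding c_def using False fin by (intro Max_in)
    have max: "x \<le> c" if "x \<in> corners \<inter> {0..<y}" for x unfolding c_def using that fin by simp
    have "corners \<inter> {c<..<y} = {}" using max by (force simp: corners_def)
    moreover have "corners \<inter> {0..<c} \<subset> corners \<inter> {0..<y}" using c by auto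
    then have "P c" using c by (intro less.hyps psubset_card_mono[OF fin]) (auto simp: corners_def)
    ultimately show ?thesis using step[OF less.prems, of c] c by auto
  qed (use base less.prems in blast)
qed

text \<open>The discrete theorem of turning tangents. Exterior angles are fixed only modulo 2 * pi;
  what pins down their sum is the invariant that the angle of the current side minus the polar angle
  around an interior point stays in (0, pi), along sides and across corners.\<close>

theorem tangent_angles:
  obtains \<tau> :: "real \<Rightarrow> real" and \<theta>0 :: real where "\<And>c. c \<in> corners \<Longrightarrow> 0 < \<tau> c" "\<And>c. c \<in> corners \<Longrightarrow> \<tau> c < pi"
    "(\<Sum>c\<in>corners. \<tau> c) = 2 * pi"
    "\<And>a b u. 0 \<le> a \<Longrightarrow> a < b \<Longrightarrow> b \<le> 1 \<Longrightarrow> corners \<inter> {a<..<b} = {} \<Longrightarrow> u \<in> {a..b} \<Longrightarrow>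
       \<eta> u = \<eta> a + (u - a) *\<^sub>R cis (\<theta>0 + (\<Sum>c\<in>corners \<inter> {..<b}. \<tau> c))"
proof -
  obtain wl wr where n: "\<And>y. norm (wl y) = 1" "\<And>y. norm (wr y) = 1"
    and wl: "\<And>y. \<exists>e>0. \<forall>u\<in>{y - e..y}. \<eta> u = \<eta> y + (u - y) *\<^sub>R wl y"
    and wr: "\<And>y. \<exists>e>0. \<forall>u\<in>{y..y + e}. \<eta> u = \<eta> y + (u - y) *\<^sub>R wr y"
    using corner_directions by metis
  obtain z where z: "z \<in> interior K" using K(4) by auto
  obtain a where a: "continuous_on UNIV a" "strict_mono a" "\<And>q. a (q + 1) = a q + 2 * pi"
    "\<And>q. \<eta> q - z = norm (\<eta> q - z) * cis (a q)" "\<And>q. \<eta> q \<noteq> z"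
    using ccw_boundary_angle[OF ccw z] by metis
  have sin_pos: "0 < sin (\<theta> - a y)" if "0 < Im (cnj (\<eta> y - z) * cis \<theta>)" for \<theta> y
  proof -
    have "Im (cnj (\<eta> y - z) * cis \<theta>) = norm (\<eta> y - z) * sin (\<theta> - a y)"
      by (subst a(4)) (simp add: sin_diff algebra_simps)
    then show ?thesis using that a(5)[of y] by (simp add: zero_less_mult_iff)
  qed
  have wl_unique: "wl y = w" if "u < y" "\<And>x. x \<in> {u..y} \<Longrightarrow> \<eta> x = \<eta> y + (x - y) *\<^sub>R w" for y u w
  proof -
    obtain e where e: "e > 0" "\<And>x. x \<in> {y - e..y} \<Longrightarrow> \<eta> x = \<eta> y + (x - y) *\<^sub>R wl y" using wl by blast
    define x where "x = max u (y - e)"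
    have "(x - y) *\<^sub>R w = (x - y) *\<^sub>R wl y" using e(1) that(2)[of x] e(2)[of x] that(1) by (auto simp: x_def)
    moreover have "x - y \<noteq> 0" using e(1) that(1) by (auto simp: x_def)
    ultimately show ?thesis by simp
  qed
  have wr_unique: "wr y = w" if "y < u" "\<And>x. x \<in> {y..u} \<Longrightarrow> \<eta> x = \<eta> y + (x - y) *\<^sub>R w" for y u w
  proof -
    obtain e where e: "e > 0" "\<And>x. x \<in> {y..y + e} \<Longrightarrow> \<eta> x = \<eta> y + (x - y) *\<^sub>R wr y" using wr by blast
    define x where "x = min u (y + e)"
    have "(x - y) *\<^sub>R w = (x - y) *\<^sub>R wr y" using e(1) that(2)[of x] e(2)[of x] that(1) by (auto simp: x_def)
    moreover have "x - y \<noteq> 0" using e(1) that(1) by (auto simp: x_def)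
    ultimately show ?thesis by simp
  qed
  have free: "\<eta> u = \<eta> x + (u - x) *\<^sub>R wl y \<and> wr x = wl y"
    if xy: "0 \<le> x" "x < y" "y \<le> 1" "corners \<inter> {x<..<y} = {}" and u: "u \<in> {x..y}" for x y u
  proof -
    have "\<exists>w. norm w = 1 \<and> (\<forall>u\<in>{x..y}. \<eta> u = \<eta> x + (u - x) *\<^sub>R w)"
    proof (rule side_free[OF xy(2)])
      fix u assume u: "x < u" "u < y"
      then have "u \<notin> corners" using xy(4) by auto
      then show "\<not> corner u" using u xy by (auto simp: corners_def)
    qed
    then obtain w where w: "norm w = 1" "\<And>u. u \<in> {x..y} \<Longrightarrow> \<eta> u = \<eta> x + (u - x) *\<^sub>R w" by blast
    have "wl y = w"
    proof (rule wl_unique[OF xy(2)])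
      show "\<eta> u = \<eta> y + (u - y) *\<^sub>R w" if "u \<in> {x..y}" for u
      proof -
        have 1: "\<eta> u = \<eta> x + (u - x) *\<^sub>R w" by (rule w(2)[OF that])
        have 2: "\<eta> y = \<eta> x + (y - x) *\<^sub>R w" by (rule w(2)) (use xy in simp)
        show ?thesis unfolding 1 2 by (simp add: algebra_simps)
      qed
    qed
    moreover have "wr x = w" by (rule wr_unique[OF xy(2) w(2)])
    ultimately show ?thesis using w(2)[OF u] by simp
  qed
  have supl: "0 < Im (cnj (\<eta> y - z) * wl y)" "v \<in> K \<Longrightarrow> 0 \<le> Im (cnj (wl y) * (v - \<eta> y))" for y v
  proof -
    obtain e where e: "e > 0" "\<And>x. x \<in> {y - e..y} \<Longrightarrow> \<eta> x = \<eta> y + (x - y) *\<^sub>R wl y" using wl by blast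
    show "0 < Im (cnj (\<eta> y - z) * wl y)"
      by (rule side_support(2)[OF _ n(1) e(2) z]) (use e(1) in auto)
    show "v \<in> K \<Longrightarrow> 0 \<le> Im (cnj (wl y) * (v - \<eta> y))"
      by (rule side_support(1)[OF _ n(1) e(2)]) (use e(1) in auto)
  qed
  have supr: "0 < Im (cnj (\<eta> y - z) * wr y)" for y
  proof -
    obtain e where e: "e > 0" "\<And>x. x \<in> {y..y + e} \<Longrightarrow> \<eta> x = \<eta> y + (x - y) *\<^sub>R wr y" using wr by blast
    show ?thesis by (rule side_support(2)[OF _ n(2) e(2) z]) (use e(1) in auto)
  qed
  \<comment> \<open>The supporting property of the incoming side gives the weak inequality. Equality
    would make the sides parallel: equal directions put the corner inside a segment, opposite ones
    make the boundary retrace itself.\<close>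
  have turn: "0 < Im (wr c / wl c)" if "corner c" for c
  proof -
    have q: "wr c / wl c = cnj (wl c) * wr c"
      using unit_cnj_mult[OF n(1)[of c]] n(1)[of c] by (metis mult.commute mult.assoc mult.right_neutral nonzero_eq_divide_eq norm_zero zero_neq_one)
    obtain e where e: "e > 0" "\<And>x. x \<in> {c..c + e} \<Longrightarrow> \<eta> x = \<eta> c + (x - c) *\<^sub>R wr c" using wr by blast
    obtain e' where e': "e' > 0" "\<And>x. x \<in> {c - e'..c} \<Longrightarrow> \<eta> x = \<eta> c + (x - c) *\<^sub>R wl c" using wl by blast
    \<comment> \<open>The bound 1/4 keeps 2 * h below a full period, so that \<eta> (c - h) and
      \<eta> (c + h) are different points.\<close>
    define h where "h = min (min e e') (1 / 4)"
    have h: "h > 0" "h \<le> e" "h \<le> e'" "h \<le> 1 / 4" using e(1) e'(1) by (auto simp: h_def)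
    have right: "\<eta> (c + h) = \<eta> c + h *\<^sub>R wr c" and left: "\<eta> (c - h) = \<eta> c - h *\<^sub>R wl c"
      using e(2)[of "c + h"] e'(2)[of "c - h"] h by auto
    have "0 \<le> Im (cnj (wl c) * (\<eta> (c + h) - \<eta> c))" by (rule supl(2)[OF K(9)])
    then have "0 \<le> h * Im (cnj (wl c) * wr c)" unfolding right by (simp add: algebra_simps)
    then have ge: "0 \<le> Im (cnj (wl c) * wr c)" using h(1) by (simp add: zero_le_mult_iff)
    moreover have "Im (cnj (wl c) * wr c) \<noteq> 0"
    proof
      assume "Im (cnj (wl c) * wr c) = 0"
      then have par: "wr c = Re (cnj (wl c) * wr c) *\<^sub>R wl c" by (rule Im_zero_parallel[OF n(1)])
      define d where "d = Re (cnj (wl c) * wr c)"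
      have "norm (wr c) = \<bar>d\<bar> * norm (wl c)" using par by (metis d_def norm_scaleR)
      then have "d = 1 \<or> d = - 1" using n by (auto simp: abs_if split: if_splits)
      then show False
      proof
        assume "d = 1"
        then have eq: "wr c = wl c" using par d_def by simp
        have "\<eta> c = midpoint (\<eta> (c - h)) (\<eta> (c + h))"
          unfolding left right eq by (simp add: midpoint_def algebra_simps scaleR_conv_of_real)
        moreover have "\<eta> (c - h) \<noteq> \<eta> (c + h)"
        proof
          assume "\<eta> (c - h) = \<eta> (c + h)"
          then have "(2 * h) *\<^sub>R wl c = 0" unfolding left right eq by (simp add: algebra_simps scaleR_conv_of_real)
          then show False using h(1) n(1)[of c] by auto
        qed
        ultimately have "\<eta> c \<in> open_segment (\<eta> (c - h)) (\<eta> (c + h))" by (metis midpoint_in_open_segment)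
        then show False using that K(9) unfolding corner_def extreme_point_of_def by blast
      next
        assume "d = - 1"
        then have "wr c = - wl c" using par d_def by simp
        then have "\<eta> (c + h) = \<eta> (c - h)" unfolding left right by simp
        then obtain k :: int where "c + h = c - h + k" using eq_imp_int_diff by blast
        then have "real_of_int k = 2 * h" by simp
        then have "0 < real_of_int k" "real_of_int k < 1" using h by auto
        then show False by simp
      qed
    qed
    ultimately show ?thesis unfolding q by simp
  qed
  define \<tau> where "\<tau> c = Arg (wr c / wl c)" for c
  have \<tau>: "0 < \<tau> c" "\<tau> c < pi" if "c \<in> corners" for c
    using turn[of c] that Arg_lt_pi[of "wr c / wl c"] unfolding \<tau>_def corners_def by auto
  have wr_\<tau>: "wr c = wl c * cis (\<tau> c)" for c
  proof -
    have "wl c \<noteq> 0" using n(1)[of c] by auto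
    moreover have "wr c / wl c = cis (\<tau> c)"
      using rcis_cmod_Arg[of "wr c / wl c"] n by (simp add: \<tau>_def rcis_def norm_divide)
    ultimately show ?thesis by (simp add: field_simps)
  qed
  \<comment> \<open>The initial angle is lifted relative to the polar angle at the marked point,
    which places the difference in (0, pi).\<close>
  define \<theta>0 where "\<theta>0 = a 0 + Arg (wr 0 / cis (a 0))"
  have cis\<theta>0: "cis \<theta>0 = wr 0"
  proof -
    have "cis (Arg (wr 0 / cis (a 0))) = wr 0 / cis (a 0)"
      using rcis_cmod_Arg[of "wr 0 / cis (a 0)"] n by (simp add: rcis_def norm_divide)
    then show ?thesis unfolding \<theta>0_def cis_mult[symmetric] by simp
  qed
  have \<theta>0: "0 < \<theta>0 - a 0" "\<theta>0 - a 0 < pi"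
  proof -
    have s: "sin (\<theta>0 - a 0) > 0" by (rule sin_pos) (use supr[of 0] cis\<theta>0 in simp)
    have r: "- pi < \<theta>0 - a 0" "\<theta>0 - a 0 \<le> pi" using Arg_bounded[of "wr 0 / cis (a 0)"] by (auto simp: \<theta>0_def)
    show "0 < \<theta>0 - a 0"
    proof (rule ccontr)
      assume "\<not> 0 < \<theta>0 - a 0"
      then have "0 \<le> sin (- (\<theta>0 - a 0))" using r by (intro sin_ge_zero) auto
      then show False using s unfolding sin_minus by linarith
    qed
    show "\<theta>0 - a 0 < pi" using r s by (cases "\<theta>0 - a 0 = pi") auto
  qed
  define \<Theta> where "\<Theta> y = \<theta>0 + (\<Sum>c\<in>corners \<inter> {..<y}. \<tau> c)" for y
  have stay: "0 < \<theta> - a y" "\<theta> - a y < pi"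
    if "x < y" "\<And>u. u \<in> {x..y} \<Longrightarrow> \<eta> u = \<eta> x + (u - x) *\<^sub>R cis \<theta>" "0 < \<theta> - a x" "\<theta> - a x < pi" for x y \<theta>
  proof -
    have c: "continuous_on {x..y} (\<lambda>u. \<theta> - a u)"
      by (intro continuous_intros continuous_on_subset[OF a(1)]) auto
    note xy = that
    have s: "sin (\<theta> - a u) > 0" if "u \<in> {x..y}" for u
      by (rule sin_pos, rule side_support(2)[OF xy(1) _ xy(2) z that]) simp_all
    show "0 < \<theta> - a y" "\<theta> - a y < pi"
      using stays_in_0_pi[OF c _ that(3,4) s] that(1) by auto
  qed
  have main: "wl y = cis (\<Theta> y) \<and> 0 < \<Theta> y - a y \<and> \<Theta> y - a y < pi" if "y \<in> {0<..1}" for y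
    using that
  proof (induction y rule: corner_induct)
    case (base y)
    have em: "corners \<inter> {..<y} = {}" "corners \<inter> {0<..<y} = {}" using base by (auto simp: corners_def)
    have f: "\<eta> u = \<eta> 0 + (u - 0) *\<^sub>R wl y \<and> wr 0 = wl y" if "u \<in> {0..y}" for u
      by (rule free) (use base em that in auto)
    have "wl y = cis \<theta>0" using f[of 0] base cis\<theta>0 by simp
    moreover have "\<eta> u = \<eta> 0 + (u - 0) *\<^sub>R cis \<theta>0" if "u \<in> {0..y}" for u
      using f[OF that] calculation by simp
    from stay[of 0 y \<theta>0, OF _ this \<theta>0] have "0 < \<theta>0 - a y" "\<theta>0 - a y < pi" using base by auto
    ultimately show ?case by (simp add: \<Theta>_def em)
  next
    case (step y c)
    have c: "0 < c" "c < y" using step by (auto simp: corners_def)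
    have f: "\<eta> u = \<eta> c + (u - c) *\<^sub>R wl y \<and> wr c = wl y" if "u \<in> {c..y}" for u
      by (rule free) (use step c that in auto)
    have "corners \<inter> {..<y} = insert c (corners \<inter> {..<c})" using step by (auto simp: not_less)
    then have \<Theta>y: "\<Theta> y = \<Theta> c + \<tau> c" unfolding \<Theta>_def using finite_corners by simp
    have wly: "wl y = cis (\<Theta> y)" using f[of y] c step wr_\<tau>[of c] by (simp add: \<Theta>y cis_mult)
    have "sin (\<Theta> y - a c) > 0"
      by (rule sin_pos) (use supr[of c] f[of y] c wly in simp)
    moreover have "0 < \<Theta> y - a c" "\<Theta> y - a c < 2 * pi"
      \<comment> \<open>Crossing a corner adds less than pi to a difference below pi. The result
        lies in (0, 2 * pi), and its positive sine forces it back below pi.\<close>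
      using step \<tau>[of c] by (auto simp: \<Theta>y)
    ultimately have "\<Theta> y - a c < pi"
      using sin_le_zero[of "\<Theta> y - a c"] by (cases "\<Theta> y - a c < pi") auto
    moreover have "\<eta> u = \<eta> c + (u - c) *\<^sub>R cis (\<Theta> y)" if "u \<in> {c..y}" for u
      using f[OF that] wly by simp
    ultimately have "0 < \<Theta> y - a y" "\<Theta> y - a y < pi"
      using stay[of c y "\<Theta> y", OF c(2) _ \<open>0 < \<Theta> y - a c\<close>] by blast+
    then show ?case using wly by simp
  qed
  have "(\<Sum>c\<in>corners. \<tau> c) = 2 * pi"
  proof -
    have "corners \<inter> {..<1} = corners" by (auto simp: corners_def)
    then have \<Theta>1: "\<Theta> 1 = \<theta>0 + (\<Sum>c\<in>corners. \<tau> c)" by (simp add: \<Theta>_def)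
    \<comment> \<open>The marked point is inside a side, so the directions at parameters 0 and 1
      agree and the total turn is 2 * pi * k; the invariant at both ends forces k = 1.\<close>
    obtain w e where w: "norm w = 1" "e > 0" "\<And>u. \<bar>u - 0\<bar> < e \<Longrightarrow> \<eta> u = \<eta> 0 + (u - 0) *\<^sub>R w"
      using side_local[of 0] start unfolding corner_def by blast
    have "wr 0 = w"
    proof (rule wr_unique[of 0 "e / 2"])
      show "\<eta> x = \<eta> 0 + (x - 0) *\<^sub>R w" if "x \<in> {0..e / 2}" for x
        using w(3)[of x] that w(2) by auto
    qed (use w(2) in simp)
    moreover have "wl 1 = w"
    proof (rule wl_unique[of "1 - e / 2"])
      fix x assume x: "x \<in> {1 - e / 2..1}"
      have "\<eta> x = \<eta> (x - 1)" using K(6)[of "x - 1"] by simp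
      also have "\<dots> = \<eta> 0 + (x - 1) *\<^sub>R w" using w(3)[of "x - 1"] x w(2) by auto
      finally show "\<eta> x = \<eta> 1 + (x - 1) *\<^sub>R w" using K(6)[of 0] by simp
    qed (use w(2) in simp)
    ultimately have "cis (\<Theta> 1) = cis \<theta>0" using main[of 1] cis\<theta>0 by simp
    then obtain k :: int where k: "\<Theta> 1 = \<theta>0 + 2 * pi * k" using cis_eq_cisD by blast
    have a1: "a 1 = a 0 + 2 * pi" using a(3)[of 0] by simp
    have "0 < \<Theta> 1 - a 1" "\<Theta> 1 - a 1 < pi" using main[of 1] by auto
    moreover have "2 * pi * (real_of_int k - 1) = 2 * pi * k - 2 * pi" by (simp add: algebra_simps)
    ultimately have lt: "2 * pi * (real_of_int k - 1) < pi" "- pi < 2 * pi * (real_of_int k - 1)"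
      using \<theta>0 unfolding k a1 by linarith+
    have "k = 1"
    proof (rule ccontr)
      assume "k \<noteq> 1"
      then consider "real_of_int k - 1 \<ge> 1" | "real_of_int k - 1 \<le> - 1" by linarith
      then show False
      proof cases
        case 1
        then have "2 * pi * 1 \<le> 2 * pi * (real_of_int k - 1)" by (intro mult_left_mono) auto
        then show False using lt pi_gt_zero by linarith
      next
        case 2
        then have "2 * pi * (real_of_int k - 1) \<le> 2 * pi * (- 1)" by (intro mult_left_mono) auto
        then show False using lt pi_gt_zero by linarith
      qed
    qed
    then show ?thesis using k \<Theta>1 by simp
  qed
  moreover have "\<eta> u = \<eta> x + (u - x) *\<^sub>R cis (\<theta>0 + (\<Sum>c\<in>corners \<inter> {..<b}. \<tau> c))"
    if "0 \<le> x" "x < b" "b \<le> 1" "corners \<inter> {x<..<b} = {}" "u \<in> {x..b}" for x b u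
    using free[OF that] main[of b] that unfolding \<Theta>_def by auto
  ultimately show ?thesis using that[of \<tau> \<theta>0] \<tau> by blast
qed

end

section \<open>Uniform convergence of smoothing families\<close>

text \<open>A monotonicity test without derivatives: over N equal pieces the errors telescope to (b
  - a) * (g b - g a) / N. It serves below for a function that involves the polygon parameter of a
  ray and a merely monotone angle.\<close>

lemma nonincreasing_of_small_increments:
  fixes f g :: "real \<Rightarrow> real"
  assumes ab: "a \<le> b"
    and inc: "\<And>x y. a \<le> x \<Longrightarrow> x \<le> y \<Longrightarrow> y \<le> b \<Longrightarrow> f y - f x \<le> (y - x) * (g y - g x)"
  shows "f b \<le> f a"
proof -
  have *: "f b - f a \<le> (b - a) * (g b - g a) / N" if N: "N > 0" for N :: nat
  proof -
    define x where "x i = a + (b - a) * (real i / N)" for i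
    have x: "a \<le> x i" "x i \<le> x (Suc i)" "x (Suc i) \<le> b" if "i < N" for i
    proof -
      have "0 \<le> real i / N" "real i / N \<le> real (Suc i) / N" "real (Suc i) / N \<le> 1"
        using that N by (auto simp: divide_simps)
      then show "a \<le> x i" "x i \<le> x (Suc i)" "x (Suc i) \<le> b"
        using ab mult_left_mono[of "real i / N" "real (Suc i) / N" "b - a"] mult_left_mono[of "real (Suc i) / N" 1 "b - a"]
        by (auto simp: x_def)
    qed
    have step: "x (Suc i) - x i = (b - a) / N" for i
      using N by (simp add: x_def field_simps)
    have ends: "x 0 = a" "x N = b" using N by (simp_all add: x_def)
    have "f b - f a = (\<Sum>i<N. f (x (Suc i)) - f (x i))"
      unfolding sum_lessThan_telescope[of "\<lambda>i. f (x i)" N] ends ..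
    also have "\<dots> \<le> (\<Sum>i<N. (b - a) / N * (g (x (Suc i)) - g (x i)))"
    proof (rule sum_mono)
      fix i assume "i \<in> {..<N}"
      then show "f (x (Suc i)) - f (x i) \<le> (b - a) / N * (g (x (Suc i)) - g (x i))"
        using inc[of "x i" "x (Suc i)"] x[of i] step[of i] by simp
    qed
    also have "\<dots> = (b - a) / N * (\<Sum>i<N. g (x (Suc i)) - g (x i))" by (rule sum_distrib_left[symmetric])
    also have "\<dots> = (b - a) / N * (g b - g a)"
      unfolding sum_lessThan_telescope[of "\<lambda>i. g (x i)" N] ends ..
    finally show ?thesis by simp
  qed
  have "(\<lambda>N. (b - a) * (g b - g a) / real (Suc N)) \<longlonglongrightarrow> 0"
    using LIMSEQ_Suc[OF lim_const_over_n[of "(b - a) * (g b - g a)"]] by simp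
  then have "f b - f a \<le> 0"
    by (rule LIMSEQ_le_const) (use *[OF zero_less_Suc] in blast)
  then show ?thesis by simp
qed

lemma one_minus_cos_le: "1 - cos x \<le> \<bar>x\<bar>" for x :: real
proof -
  have "1 - cos x = 2 * (sin (x / 2))\<^sup>2" using cos_double_sin[of "x / 2"] by simp
  also have "\<dots> = 2 * (\<bar>sin (x / 2)\<bar> * \<bar>sin (x / 2)\<bar>)" by (simp add: power2_eq_square)
  also have "\<dots> \<le> 2 * (1 * \<bar>x / 2\<bar>)"
    by (intro mult_left_mono mult_mono abs_sin_x_le_abs_x abs_sin_le_one) auto
  finally show ?thesis by simp
qed

lemma norm_cis_diff_le: "norm (cis x - cis y) \<le> \<bar>x - y\<bar>"
proof (rule power2_le_imp_le)
  have "(norm (cis x - cis y))\<^sup>2 = (cos x - cos y)\<^sup>2 + (sin x - sin y)\<^sup>2" by (simp add: cmod_power2)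
  also have "\<dots> = 2 - 2 * cos (x - y)"
    using sin_cos_squared_add3[of x] sin_cos_squared_add3[of y]
    by (simp add: cos_diff power2_eq_square algebra_simps)
  also have "\<dots> = 4 * (sin ((x - y) / 2))\<^sup>2"
  proof -
    define h where "h = (x - y) / 2"
    have "x - y = 2 * h" by (simp add: h_def)
    then show ?thesis using cos_double_sin[of h] by simp
  qed
  also have "\<dots> \<le> 4 * ((x - y) / 2)\<^sup>2"
    using abs_le_square_iff[THEN iffD1, OF abs_sin_x_le_abs_x[of "(x - y) / 2"]] by linarith
  finally show "(norm (cis x - cis y))\<^sup>2 \<le> \<bar>x - y\<bar>\<^sup>2" by (simp add: power_divide)
qed simp

text \<open>The new ball is the image of the old one under the homothety with centre
  \<open>p\<close> and ratio 1 - t.\<close>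

lemma convex_ball_shrink:
  fixes K :: "'a::real_normed_vector set"
  assumes K: "convex K" and b: "ball z r \<subseteq> K" and p: "p \<in> K" and t: "0 \<le> t" "t < 1"
  shows "ball (z + t *\<^sub>R (p - z)) ((1 - t) * r) \<subseteq> K"
proof
  fix y assume y: "y \<in> ball (z + t *\<^sub>R (p - z)) ((1 - t) * r)"
  define w where "w = (1 / (1 - t)) *\<^sub>R (y - (z + t *\<^sub>R (p - z)))"
  have "norm (y - (z + t *\<^sub>R (p - z))) < (1 - t) * r" using y by (simp add: dist_norm norm_minus_commute)
  then have "norm w < r" using t by (simp add: w_def pos_divide_less_eq mult.commute del: scaleR_diff_right)
  then have "z + w \<in> K" using b by (auto simp: dist_norm)
  then have "(1 - t) *\<^sub>R (z + w) + t *\<^sub>R p \<in> K" using convexD[OF K _ p, of "z + w" "1 - t" t] t by simp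
  moreover have "(1 - t) *\<^sub>R w = y - (z + t *\<^sub>R (p - z))" using t by (simp add: w_def)
  ultimately show "y \<in> K" by (simp add: algebra_simps)
qed

text \<open>If x lies on the ray inside w, then by shrinking the ball towards w it has depth (1 - c)
  * r in K, which bounds its distance to D from below. If it lies beyond w, the same argument with
  the segment from z to D bounds c - 1.\<close>

lemma ray_close:
  fixes K :: "complex set"
  assumes K: "convex K" "closed K" and r: "r > 0" "ball z r \<subseteq> K" and D: "D \<in> frontier K" and w: "w \<in> frontier K"
    and x: "x - z = c *\<^sub>R (w - z)" "c > 0"
  shows "norm (x - w) \<le> norm (w - z) / r * norm (x - D)"
proof -
  have inK: "D \<in> K" "w \<in> K" using frontier_subset_closed[OF K(2)] D w by auto
  have far: "(1 - t) * r \<le> norm (z + t *\<^sub>R (p - z) - q)"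
    if "p \<in> K" "0 \<le> t" "t < 1" "q \<in> frontier K" for p q t
  proof (rule ccontr)
    assume "\<not> ?thesis"
    then have "q \<in> ball (z + t *\<^sub>R (p - z)) ((1 - t) * r)" by (simp add: dist_norm)
    then have "q \<in> interior K"
      using interior_maximal[OF convex_ball_shrink[OF K(1) r(2) that(1-3)] open_ball] by blast
    then show False using that(4) by (simp add: frontier_def)
  qed
  consider "c < 1" | "c = 1" | "c > 1" by linarith
  then show ?thesis
  proof cases
    case 1
    have xz: "x = z + c *\<^sub>R (w - z)" using x(1) by (simp add: algebra_simps)
    have "(1 - c) * r \<le> norm (x - D)" using far[OF inK(2) _ 1 D] x(2) unfolding xz by simp
    then have le: "1 - c \<le> norm (x - D) / r" using r(1) by (simp add: pos_le_divide_eq)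
    have "x - w = (c - 1) *\<^sub>R (w - z)" unfolding xz by (simp add: algebra_simps)
    then have "norm (x - w) = (1 - c) * norm (w - z)" using 1 by simp
    also have "\<dots> \<le> norm (x - D) / r * norm (w - z)" by (rule mult_right_mono[OF le]) simp
    finally show ?thesis by (simp add: mult.commute)
  next
    case 2
    then show ?thesis using x r(1) by simp
  next
    case 3
    have "(1 - 1 / c) * r \<le> norm (z + (1 / c) *\<^sub>R (D - z) - w)"
      by (rule far[OF inK(1) _ _ w]) (use 3 in auto)
    also have "z + (1 / c) *\<^sub>R (D - z) - w = (1 / c) *\<^sub>R (D - x)"
    proof -
      have "w - z = (1 / c) *\<^sub>R (x - z)" using x by simp
      then have "w = z + (1 / c) *\<^sub>R (x - z)" by (simp add: algebra_simps)
      then show ?thesis by (simp add: algebra_simps)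
    qed
    also have "norm \<dots> = norm (x - D) / c" using x(2) by (simp add: norm_minus_commute)
    finally have "c * ((1 - 1 / c) * r) \<le> c * (norm (x - D) / c)" using x(2) by (intro mult_left_mono) auto
    moreover have "c * ((1 - 1 / c) * r) = (c - 1) * r" using x(2) by (simp add: field_simps)
    ultimately have "(c - 1) * r \<le> norm (x - D)" using x(2) by simp
    then have le: "c - 1 \<le> norm (x - D) / r" using r(1) by (simp add: pos_le_divide_eq)
    have "x - w = (c - 1) *\<^sub>R (w - z)" using x(1) by (simp add: algebra_simps)
    then have "norm (x - w) = (c - 1) * norm (w - z)" using 3 by simp
    also have "\<dots> \<le> norm (x - D) / r * norm (w - z)" by (rule mult_right_mono[OF le]) simp
    finally show ?thesis by (simp add: mult.commute)
  qed
qed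

context marked_polygon
begin

lemma side_length:
  assumes "0 \<le> a" "a \<le> b" "b \<le> 1" "corners \<inter> {a<..<b} = {}"
  shows "norm (\<eta> b - \<eta> a) = b - a"
proof (cases "a = b")
  case False
  show ?thesis
  proof (rule tangent_angles)
    fix \<tau> \<theta>0
    assume "\<And>a b u. 0 \<le> a \<Longrightarrow> a < b \<Longrightarrow> b \<le> 1 \<Longrightarrow> corners \<inter> {a<..<b} = {} \<Longrightarrow> u \<in> {a..b} \<Longrightarrow>
       \<eta> u = \<eta> a + (u - a) *\<^sub>R cis (\<theta>0 + (\<Sum>c\<in>corners \<inter> {..<b}. \<tau> c))"
    from this[OF assms(1) _ assms(3,4), of b]
    have "\<eta> b = \<eta> a + (b - a) *\<^sub>R cis (\<theta>0 + (\<Sum>c\<in>corners \<inter> {..<b}. \<tau> c))"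
      using assms(2) False by simp
    then have "\<eta> b - \<eta> a = (b - a) *\<^sub>R cis (\<theta>0 + (\<Sum>c\<in>corners \<inter> {..<b}. \<tau> c))" by (metis add_diff_cancel_left')
    then show ?thesis using assms(2) by simp
  qed
qed simp

lemma eta_lipschitz:
  assumes "u \<in> {0..1}" "v \<in> {0..1}"
  shows "norm (\<eta> u - \<eta> v) \<le> \<bar>u - v\<bar>"
proof -
  have *: "\<forall>x. 0 \<le> x \<longrightarrow> x \<le> y \<longrightarrow> norm (\<eta> y - \<eta> x) \<le> y - x" if "y \<in> {0<..1}" for y
    using that
  proof (induction y rule: corner_induct)
    case (base y)
    have "corners \<inter> {x<..<y} = {}" if "0 \<le> x" for x using base that by auto
    then show ?case using side_length[of _ y] base by auto
  next
    case (step y c)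
    show ?case
    proof (intro allI impI)
      fix x assume x: "0 \<le> x" "x \<le> y"
      show "norm (\<eta> y - \<eta> x) \<le> y - x"
      proof (cases "x \<ge> c")
        case True
        then have "corners \<inter> {x<..<y} = {}" using step by auto
        then show ?thesis using side_length[of x y] x step by auto
      next
        case False
        have "norm (\<eta> y - \<eta> c) = y - c" by (rule side_length) (use step in \<open>auto simp: corners_def\<close>)
        moreover have "norm (\<eta> c - \<eta> x) \<le> c - x" using step x False by auto
        ultimately show ?thesis using norm_triangle_ineq[of "\<eta> y - \<eta> c" "\<eta> c - \<eta> x"] by simp
      qed
    qed
  qed
  show ?thesis
  proof (cases "u \<le> v")
    case True
    show ?thesis
    proof (cases "v = 0")
      case False
      then show ?thesis using *[of v] assms True by (auto simp: norm_minus_commute)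
    qed (use assms True in auto)
  next
    case False
    then show ?thesis using *[of u] assms by auto
  qed
qed

text \<open>Points on the same ray from \<open>z\<close> are compared: \<open>Y q\<close> is the
  parameter of \<eta> on the ray of \<gamma> q, and the displacement \<open>W\<close> is at most
  \<open>d\<close>. The arc length of \<gamma> exceeds that of \<eta> by at most 10 * d because
  \<gamma> turns by 2 * pi; it falls short by at most 2 * d per side because sides are straight.
  From these, |Y q - l * q| and |l - 1| are at most (2 * n + 12) * d for n corners; doubling and
  adding the displacement gives (4 * n + 25) * d.\<close>

lemma ccw_param_compare:
  fixes \<theta> :: "real \<Rightarrow> real" and l d q :: real
  assumes z: "z \<in> interior K" and \<gamma>: "ccw_boundary_param L \<gamma>" and zL: "z \<in> interior L"
    and start\<gamma>: "\<gamma> 0 = \<eta> 0"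
    and d\<gamma>: "\<And>q. (\<gamma> has_vector_derivative l *\<^sub>R cis (\<theta> q)) (at q)" and l: "l > 0"
    and \<theta>: "mono \<theta>" "\<theta> 1 = \<theta> 0 + 2 * pi"
    and near: "\<And>q y c. \<gamma> q - z = c *\<^sub>R (\<eta> y - z) \<Longrightarrow> c > 0 \<Longrightarrow> norm (\<gamma> q - \<eta> y) \<le> d"
  shows "\<bar>l - 1\<bar> \<le> (2 * card corners + 12) * d"
    and "q \<in> {0..1} \<Longrightarrow> norm (\<gamma> q - \<eta> q) \<le> (4 * card corners + 25) * d"
proof -
  obtain a where a: "continuous_on UNIV a" "strict_mono a" "\<And>q. a (q + 1) = a q + 2 * pi"
    "\<And>q. \<eta> q - z = norm (\<eta> q - z) * cis (a q)" "\<And>q. \<eta> q \<noteq> z"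
    using ccw_boundary_angle[OF ccw z] by metis
  obtain b' where b': "continuous_on UNIV b'" "strict_mono b'" "\<And>q. b' (q + 1) = b' q + 2 * pi"
    "\<And>q. \<gamma> q - z = norm (\<gamma> q - z) * cis (b' q)" "\<And>q. \<gamma> q \<noteq> z"
    using ccw_boundary_angle[OF \<gamma> zL] by metis
  have "cis (b' 0) = cis (a 0)"
    using a(4)[of 0] b'(4)[of 0] a(5)[of 0] start\<gamma>
    by (metis mult_left_cancel norm_eq_zero of_real_eq_0_iff right_minus_eq)
  then obtain k :: int where k: "b' 0 = a 0 + 2 * pi * k" using cis_eq_cisD by blast
  \<comment> \<open>Both curves start at the same point, so the two polar angles can be normalized
    to agree there; then \<open>Y\<close> fixes 0 and 1.\<close>
  define b where "b q = b' q - 2 * pi * k" for q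
  have b: "strict_mono b" "b 0 = a 0" "b 1 = a 1"
    using b'(2) b'(3)[of 0] a(3)[of 0] k by (auto simp: b_def strict_mono_def)
  have cisb: "cis (b q) = cis (b' q)" for q
    using cis_multiple_2pi[of "of_int k"] by (simp add: b_def flip: cis_divide)
  have "\<exists>y. a y = x" for x by (rule quasiperiodic_surj[OF a(1,3)]) simp
  then obtain A where A: "\<And>x. a (A x) = x" by metis
  define Y where "Y q = A (b q)" for q
  have aY: "a (Y q) = b q" for q by (simp add: Y_def A)
  have Y01: "Y 0 = 0" "Y 1 = 1" using aY[of 0] aY[of 1] b strict_mono_eq[OF a(2)] by auto
  have Ymono: "Y p \<le> Y q" if "p \<le> q" for p q
    using strict_mono_less_eq[OF a(2), of "Y p" "Y q"] aY strict_mono_less_eq[OF b(1)] that by simp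
  have Yin: "Y q \<in> {0..1}" if "q \<in> {0..1}" for q using Ymono[of 0 q] Ymono[of q 1] Y01 that by auto
  define W where "W q = \<gamma> q - \<eta> (Y q)" for q
  have W: "norm (W q) \<le> d" for q
    unfolding W_def
  proof (rule near)
    have c: "cis (b' q) = (1 / norm (\<eta> (Y q) - z)) *\<^sub>R (\<eta> (Y q) - z)"
    proof -
      have "norm (\<eta> (Y q) - z) \<noteq> 0" using a(5) by simp
      then have "cis (a (Y q)) = (1 / norm (\<eta> (Y q) - z)) *\<^sub>R (norm (\<eta> (Y q) - z) * cis (a (Y q)))"
        by (simp add: scaleR_conv_of_real)
      then show ?thesis using a(4)[of "Y q"] aY[of q] cisb[of q] by simp
    qed
    show "\<gamma> q - z = (norm (\<gamma> q - z) / norm (\<eta> (Y q) - z)) *\<^sub>R (\<eta> (Y q) - z)"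
      using b'(4)[of q] c by (simp add: scaleR_conv_of_real)
    show "norm (\<gamma> q - z) / norm (\<eta> (Y q) - z) > 0" using a(5)[of "Y q"] b'(5)[of q] by simp
  qed
  have d0: "d \<ge> 0" using W[of 0] norm_ge_zero order_trans by blast
  have \<gamma>lip: "norm (\<gamma> q - \<gamma> p) \<le> l * \<bar>q - p\<bar>" for p q :: real
  proof -
    have "norm (\<gamma> q - \<gamma> p) \<le> l * norm (q - p)"
      by (rule differentiable_bound[of UNIV \<gamma> "\<lambda>q h. h *\<^sub>R (l *\<^sub>R cis (\<theta> q))"])
        (use d\<gamma> l in \<open>auto simp: has_vector_derivative_def abs_mult intro!: onorm_bound\<close>)
    then show ?thesis by simp
  qed
  text \<open>
    An Abel summation: the tangent of \<open>\<gamma>\<close> has total variation \<open>2 * pi\<close>, and \<open>\<eta>\<close> is 1-Lipschitz.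
  \<close>
  have main: "l * (v - u) - (Y v - Y u) \<le> 10 * d" if uv: "0 \<le> u" "u \<le> v" "v \<le> 1" for u v
  proof -
    \<comment> \<open>In an increment, l * q minus the projection of \<gamma> to the current tangent
      is of second order, the projection of \<eta> is at most the gain of \<open>Y\<close>, and the
      rotation of the tangent against \<open>W\<close> is paid for by d * \<theta>.\<close>
    define \<phi> where "\<phi> q = l * q - Y q - cis (\<theta> q) \<bullet> W q - d * \<theta> q" for q
    have "\<phi> v \<le> \<phi> u"
    proof (rule nonincreasing_of_small_increments[OF uv(2), of \<phi> "\<lambda>q. l * \<theta> q"])
      fix x y assume xy: "u \<le> x" "x \<le> y" "y \<le> v"
      define g where "g t = l * t - cis (\<theta> y) \<bullet> \<gamma> t" for t
      have dg: "(g has_real_derivative l - l * cos (\<theta> t - \<theta> y)) (at t)" for t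
      proof -
        have "((\<lambda>t. cis (\<theta> y) \<bullet> \<gamma> t) has_real_derivative l * cos (\<theta> t - \<theta> y)) (at t)"
          using bounded_linear.has_vector_derivative[OF bounded_linear_inner_right d\<gamma>[of t], of "cis (\<theta> y)"]
          by (simp add: has_real_derivative_iff_has_vector_derivative inner_complex_def cos_diff algebra_simps)
        then show ?thesis unfolding g_def by (auto intro!: derivative_eq_intros)
      qed
      have g: "g y - g x \<le> (y - x) * (l * \<theta> y - l * \<theta> x)"
      proof (cases "x = y")
        case False
        then obtain t where t: "x < t" "t < y" "g y - g x = (y - x) * (l - l * cos (\<theta> t - \<theta> y))"
          using MVT2[of x y g "\<lambda>t. l - l * cos (\<theta> t - \<theta> y)"] dg xy by auto
        have "\<bar>\<theta> t - \<theta> y\<bar> = \<theta> y - \<theta> t" "\<theta> x \<le> \<theta> t"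
          using monoD[OF \<theta>(1), of t y] monoD[OF \<theta>(1), of x t] t by auto
        then have "1 - cos (\<theta> t - \<theta> y) \<le> \<theta> y - \<theta> x" using one_minus_cos_le[of "\<theta> t - \<theta> y"] by simp
        then have "l * (1 - cos (\<theta> t - \<theta> y)) \<le> l * (\<theta> y - \<theta> x)" using l by (intro mult_left_mono) auto
        then show ?thesis unfolding t(3) using xy by (intro mult_left_mono) (auto simp: algebra_simps)
      qed simp
      have "\<phi> y - \<phi> x = (g y - g x) - (Y y - Y x) + cis (\<theta> y) \<bullet> (\<eta> (Y y) - \<eta> (Y x))
          - (cis (\<theta> y) - cis (\<theta> x)) \<bullet> W x - d * (\<theta> y - \<theta> x)"
        unfolding \<phi>_def g_def W_def by (simp add: inner_diff_left inner_diff_right algebra_simps)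
      moreover have "cis (\<theta> y) \<bullet> (\<eta> (Y y) - \<eta> (Y x)) \<le> Y y - Y x"
      proof -
        have "norm (\<eta> (Y y) - \<eta> (Y x)) \<le> \<bar>Y y - Y x\<bar>"
          by (rule eta_lipschitz) (use Yin xy uv in auto)
        then show ?thesis using abs_inner_unit_le[of "cis (\<theta> y)" "\<eta> (Y y) - \<eta> (Y x)"] Ymono[OF xy(2)] by simp
      qed
      moreover have "- ((cis (\<theta> y) - cis (\<theta> x)) \<bullet> W x) \<le> d * (\<theta> y - \<theta> x)"
      proof -
        have "norm (cis (\<theta> y) - cis (\<theta> x)) \<le> \<theta> y - \<theta> x"
          using norm_cis_diff_le[of "\<theta> y" "\<theta> x"] monoD[OF \<theta>(1) xy(2)] by simp
        then have "norm (cis (\<theta> y) - cis (\<theta> x)) * norm (W x) \<le> (\<theta> y - \<theta> x) * d"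
          using W[of x] monoD[OF \<theta>(1) xy(2)] by (intro mult_mono) auto
        then show ?thesis
          using Cauchy_Schwarz_ineq2[of "cis (\<theta> y) - cis (\<theta> x)" "W x"] by (simp add: mult.commute)
      qed
      ultimately show "\<phi> y - \<phi> x \<le> (y - x) * (l * \<theta> y - l * \<theta> x)" using g by linarith
    qed
    moreover have "\<bar>cis (\<theta> v) \<bullet> W v\<bar> \<le> d" "\<bar>cis (\<theta> u) \<bullet> W u\<bar> \<le> d"
      using abs_inner_unit_le[of "cis (\<theta> v)" "W v"] abs_inner_unit_le[of "cis (\<theta> u)" "W u"] W[of u] W[of v] by auto
    moreover have "d * (\<theta> v - \<theta> u) \<le> d * (2 * pi)"
      using monoD[OF \<theta>(1), of 0 u] monoD[OF \<theta>(1), of v 1] \<theta>(2) uv d0 by (intro mult_left_mono) auto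
    moreover have "d * (2 * pi) \<le> d * 8" using pi_less_4 d0 by (intro mult_left_mono) auto
    ultimately show ?thesis unfolding \<phi>_def by (simp add: algebra_simps)
  qed
  \<comment> \<open>Each side is a chord whose ends are displaced by at most \<open>d\<close>, and a
    chord is no longer than the arc of \<gamma>. At the marked point there is no
    displacement.\<close>
  have lower: "\<forall>q. q \<in> {0..1} \<longrightarrow> Y q = y \<longrightarrow> y - 2 * (card (corners \<inter> {..<y}) + 1) * d \<le> l * q"
    if "y \<in> {0<..1}" for y
    using that
  proof (induction y rule: corner_induct)
    case (base y)
    show ?case
    proof (intro allI impI)
      fix q assume q: "q \<in> {0..1}" "Y q = y"
      have "norm (\<eta> y - \<eta> 0) = y - 0" by (rule side_length) (use base in auto)
      moreover have "norm (\<eta> y - \<eta> 0) \<le> norm (\<gamma> q - \<gamma> 0) + norm (W q)"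
        using norm_triangle_ineq4[of "\<gamma> q - \<gamma> 0" "W q"] by (simp add: W_def q(2) start\<gamma>)
      ultimately have "y - d \<le> l * q" using \<gamma>lip[of q 0] W[of q] q(1) by simp
      moreover have "1 * d \<le> 2 * (card (corners \<inter> {..<y}) + 1) * d" using d0 by (intro mult_right_mono) auto
      ultimately show "y - 2 * (card (corners \<inter> {..<y}) + 1) * d \<le> l * q" by simp
    qed
  next
    case (step y c)
    show ?case
    proof (intro allI impI)
      fix q assume q: "q \<in> {0..1}" "Y q = y"
      have c: "0 < c" "c < y" using step by (auto simp: corners_def)
      obtain p where p: "Y p = c" "p \<in> {0..1}"
      proof -
        have "\<exists>p. b p = a c"
          by (rule quasiperiodic_surj[where c = "2 * pi"])
            (use b'(1,3) in \<open>auto simp: b_def intro!: continuous_intros\<close>)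
        then obtain p where "b p = a c" by blast
        then have Yp: "Y p = c" using aY[of p] strict_mono_eq[OF a(2)] by simp
        have "0 \<le> p" using Ymono[of p 0] Yp Y01 c by (cases "0 \<le> p") auto
        moreover have "p \<le> 1" using Ymono[of 1 p] Yp Y01 c step by (cases "p \<le> 1") auto
        ultimately show ?thesis using that Yp by auto
      qed
      have pq: "p \<le> q" using Ymono[of q p] p q c by (cases "p \<le> q") auto
      have "norm (\<eta> y - \<eta> c) = y - c" by (rule side_length) (use step c in auto)
      moreover have "norm (\<eta> y - \<eta> c) \<le> norm (\<gamma> q - \<gamma> p) + norm (W q) + norm (W p)"
        using norm_triangle_ineq4[of "\<gamma> q - \<gamma> p" "W q"] norm_triangle_ineq[of "\<gamma> q - \<gamma> p - W q" "W p"]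
        by (simp add: W_def q(2) p(1))
      ultimately have "y - c \<le> l * (q - p) + 2 * d" using \<gamma>lip[of q p] W[of q] W[of p] pq by simp
      moreover have "c - 2 * (card (corners \<inter> {..<c}) + 1) * d \<le> l * p" using step p by blast
      moreover have "card (corners \<inter> {..<y}) = card (corners \<inter> {..<c}) + 1"
      proof -
        have "corners \<inter> {..<y} = insert c (corners \<inter> {..<c})" using step by (auto simp: not_less)
        then show ?thesis using finite_corners by simp
      qed
      ultimately show "y - 2 * (card (corners \<inter> {..<y}) + 1) * d \<le> l * q" by (simp add: algebra_simps)
    qed
  qed
  have "corners \<inter> {..<1} = corners" by (auto simp: corners_def)
  then have lo: "1 - 2 * (card corners + 1) * d \<le> l" using lower[of 1, rule_format, of 1] Y01 by auto
  have up: "l \<le> 1 + 10 * d" using main[of 0 1] Y01 by simp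
  define m where "m = card corners * d"
  have m: "m \<ge> 0" "2 * (card corners + 1) * d = 2 * m + 2 * d"
    "(2 * card corners + 12) * d = 2 * m + 12 * d" "(4 * card corners + 25) * d = 4 * m + 25 * d"
    using d0 by (simp_all add: m_def algebra_simps)
  show L: "\<bar>l - 1\<bar> \<le> (2 * card corners + 12) * d"
    unfolding m using lo[unfolded m(2)] up m(1) d0 by linarith
  show "norm (\<gamma> q - \<eta> q) \<le> (4 * card corners + 25) * d" if q: "q \<in> {0..1}"
  proof -
    have 1: "l * q - Y q \<le> 10 * d" using main[of 0 q] Y01 q by simp
    have 2: "l - l * q - 1 + Y q \<le> 10 * d" using main[of q 1] Y01 q by (simp add: algebra_simps)
    \<comment> \<open>The upper estimate on [0, q] bounds one sign; applied on [q, 1] and combined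
      with the lower bound for the total length, it bounds the other.\<close>
    have 3: "\<bar>Y q - l * q\<bar> \<le> 2 * m + 12 * d"
      using 1 2 lo[unfolded m(2)] m(1) d0 by linarith
    have "\<bar>l * q - q\<bar> = \<bar>l - 1\<bar> * q" using q abs_mult[of "l - 1" q] by (simp add: left_diff_distrib)
    also have "\<dots> \<le> \<bar>l - 1\<bar> * 1" using q by (intro mult_left_mono) auto
    finally have "\<bar>Y q - q\<bar> \<le> 2 * (2 * m + 12 * d)"
      using 3 L[unfolded m(3)] abs_triangle_ineq[of "Y q - l * q" "l * q - q"] by simp
    then have "norm (\<eta> (Y q) - \<eta> q) \<le> 2 * (2 * m + 12 * d)"
      by (rule order_trans[OF eta_lipschitz[OF Yin[OF q] q]])
    with W[of q] have "norm (W q + (\<eta> (Y q) - \<eta> q)) \<le> d + 2 * (2 * m + 12 * d)"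
      by (rule norm_triangle_mono)
    then show ?thesis unfolding m by (simp add: W_def)
  qed
qed

end

section \<open>Smoothing families as curves near the polygon\<close>

lemma at_within_Ioc_nontrivial: "s \<in> {a<..b} \<Longrightarrow> at s within {a<..b} \<noteq> bot"
  for a b :: real
  by (cases "a < b") (auto simp: trivial_limit_within islimpt_Ioc)

lemma constant_speed_scaled:
  assumes g: "ccw_boundary_param L g" "smooth_fun g" "\<And>q. norm (velocity g q) = l"
  shows "l > 0" and "(\<lambda>q. c + (1 / l) *\<^sub>R (g q - c)) \<in> tables_C"
    and "\<exists>\<theta>. mono \<theta> \<and> \<theta> 1 = \<theta> 0 + 2 * pi \<and> (\<forall>q. (g has_vector_derivative l *\<^sub>R cis (\<theta> q)) (at q))"
proof -
  define \<Gamma> where "\<Gamma> q = c + (1 / l) *\<^sub>R (g q - c)" for q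
  show l: "l > 0"
  proof (rule ccontr)
    assume "\<not> l > 0"
    then have "velocity g q = 0" for q using g(3)[of q] norm_ge_zero[of "velocity g q"] by simp
    then have "(g has_vector_derivative 0) (at q)" for q
      using smooth_fun_has_velocity[OF g(2), of q] by metis
    then obtain k where "\<And>q. g q = k"
      using has_vector_derivative_zero_constant[of UNIV g] by auto
    then have "inj_on g {0..<1} \<Longrightarrow> (0::real) = 1 / 2" by (auto dest: inj_onD[of g _ 0 "1 / 2"])
    then show False using g(1) unfolding ccw_boundary_param_def by simp
  qed
  have \<Gamma>: "\<Gamma> = (\<lambda>q. of_real (1 / l) * g q + (c - of_real (1 / l) * c))"
    by (rule ext) (simp add: \<Gamma>_def scaleR_conv_of_real diff_divide_distrib)
  have "\<exists>L. ccw_boundary_param L \<Gamma>"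
    unfolding \<Gamma> using ccw_boundary_param_affine[OF g(1), of "of_real (1 / l)"] l by fastforce
  moreover have "smooth_fun \<Gamma>" unfolding \<Gamma> by (rule smooth_fun_affine[OF g(2)])
  moreover have "norm (velocity \<Gamma> q) = 1" for q
    unfolding \<Gamma> velocity_affine[OF smooth_fun_imp_velocity(1)[OF g(2)]] using g(3)[of q] l by (simp add: norm_mult norm_divide)
  ultimately have tC: "\<Gamma> \<in> tables_C" unfolding tables_C_def by blast
  then show "(\<lambda>q. c + (1 / l) *\<^sub>R (g q - c)) \<in> tables_C" by (simp add: \<Gamma>_def[abs_def])
  obtain \<theta> where \<theta>: "\<And>q. (\<Gamma> has_vector_derivative cis (\<theta> q)) (at q)"
    "\<And>q. (\<theta> has_real_derivative curvature \<Gamma> q) (at q)" "\<And>q. curvature \<Gamma> q \<ge> 0"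
    "\<And>q. \<theta> (q + 1) = \<theta> q + 2 * pi"
    using tables_C_angle[OF tC] by metis
  have "mono \<theta>"
    by (rule monoI, rule DERIV_nonneg_imp_nondecreasing) (use \<theta>(2,3) in auto)
  moreover have "(g has_vector_derivative l *\<^sub>R cis (\<theta> q)) (at q)" for q
  proof -
    have "g = (\<lambda>q. c + l *\<^sub>R (\<Gamma> q - c))" using l by (auto simp: \<Gamma>_def)
    moreover have "((\<lambda>q. c + l *\<^sub>R (\<Gamma> q - c)) has_vector_derivative l *\<^sub>R cis (\<theta> q)) (at q)"
      by (auto intro!: derivative_eq_intros \<theta>(1))
    ultimately show ?thesis by metis
  qed
  moreover have "\<theta> 1 = \<theta> 0 + 2 * pi" using \<theta>(4)[of 0] by simp
  ultimately show "\<exists>\<theta>. mono \<theta> \<and> \<theta> 1 = \<theta> 0 + 2 * pi \<and> (\<forall>q. (g has_vector_derivative l *\<^sub>R cis (\<theta> q)) (at q))"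
    by blast
qed

lemma smoothing_family_marked: "smoothing_family K \<eta> \<Gamma> \<Longrightarrow> marked_polygon K \<eta>"
  unfolding smoothing_family_def marked_polygon_def polygon_def marked_polygon_axioms_def by (elim conjE, intro conjI)

lemma smoothing_family_tables_C:
  assumes sf: "smoothing_family K \<eta> \<Gamma>" and s: "s \<in> {0<..1}"
  shows "\<Gamma> s \<in> tables_C"
proof -
  obtain \<gamma> centre where "smooth_family_on {0<..1} \<gamma>" and *: "\<forall>s\<in>{0<..1}. (\<exists>L. ccw_boundary_param L (\<gamma> s)) \<and>
      (\<forall>q. norm (velocity (\<gamma> s) q) = curve_length (\<gamma> s)) \<and>
      (\<forall>q. \<Gamma> s q = centre + (1 / curve_length (\<gamma> s)) *\<^sub>R (\<gamma> s q - centre))"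
    using sf unfolding smoothing_family_def
    apply (elim conjE exE)
    apply (rule that, assumption)
    apply (rule ballI, drule (1) bspec)
    apply (elim conjE)
    apply (intro conjI)
    apply assumption+
    done
  then have \<gamma>: "smooth_family_on {0<..1} \<gamma>" "\<exists>L. ccw_boundary_param L (\<gamma> s)"
    "\<And>q. norm (velocity (\<gamma> s) q) = curve_length (\<gamma> s)"
    "\<And>q. \<Gamma> s q = centre + (1 / curve_length (\<gamma> s)) *\<^sub>R (\<gamma> s q - centre)"
    using s by simp_all
  have "smooth_fun (\<gamma> s)"
    by (rule smooth_fun_of_smooth2[OF smooth2_of_smooth_family[OF \<gamma>(1)] s at_within_Ioc_nontrivial])
  moreover have "\<Gamma> s = (\<lambda>q. centre + (1 / curve_length (\<gamma> s)) *\<^sub>R (\<gamma> s q - centre))" using \<gamma>(4) by auto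
  ultimately show ?thesis using constant_speed_scaled(2) \<gamma>(2,3) by metis
qed

text \<open>If a hyperplane separated z from L, some extreme point of K would lie at least r farther
  on the side of z, and its neighbour in L would still be on that side.\<close>

lemma point_in_perturbed_hull:
  fixes K L :: "'a::euclidean_space set"
  assumes K: "convex K" "compact K" and r: "r > 0" "cball z r \<subseteq> K"
    and L: "convex L" "closed L" "L \<noteq> {}"
    and near: "\<And>D. D extreme_point_of K \<Longrightarrow> \<exists>p\<in>L. norm (p - D) \<le> r"
  shows "z \<in> L"
proof (rule ccontr)
  assume "z \<notin> L"
  then obtain a b where ab: "a \<bullet> z < b" "\<And>x. x \<in> L \<Longrightarrow> a \<bullet> x > b"
    using separating_hyperplane_closed_point[OF L(1,2)] by blast
  obtain x where x: "x \<in> L" using L(3) by blast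
  have a0: "a \<noteq> 0" using ab(1) ab(2)[OF x] by auto
  define w where "w = z - (r / norm a) *\<^sub>R a"
  have "w \<in> cball z r" using a0 r(1) by (simp add: w_def dist_norm)
  then have wK: "w \<in> K" using r(2) by blast
  have aw: "a \<bullet> w = a \<bullet> z - r * norm a"
    using a0 by (simp add: w_def inner_diff_right power2_norm_eq_inner[symmetric] power2_eq_square)
  have "\<exists>D. D extreme_point_of K \<and> a \<bullet> D \<le> a \<bullet> w"
  proof (rule ccontr)
    assume "\<not> ?thesis"
    then have "{D. D extreme_point_of K} \<subseteq> {x. a \<bullet> x > a \<bullet> w}" by force
    then have "convex hull {D. D extreme_point_of K} \<subseteq> {x. a \<bullet> x > a \<bullet> w}"
      by (intro hull_minimal convex_halfspace_gt)
    then show False using wK Krein_Milman_Minkowski[OF K(2,1)] by auto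
  qed
  then obtain D where D: "D extreme_point_of K" "a \<bullet> D \<le> a \<bullet> w" by blast
  obtain p where p: "p \<in> L" "norm (p - D) \<le> r" using near[OF D(1)] by blast
  have "a \<bullet> (p - D) \<le> norm a * norm (p - D)" by (rule norm_cauchy_schwarz)
  also have "\<dots> \<le> norm a * r" using p(2) by (intro mult_left_mono) auto
  finally have "a \<bullet> p \<le> a \<bullet> z" using D(2) aw by (simp add: inner_diff_right mult.commute)
  then show False using ab(1) ab(2)[OF p(1)] by simp
qed

text \<open>The graph of s * f (x / s) leaves the polygon only within O(s) of a corner. Along rays
  from an interior point this becomes a displacement O(s), and the comparison of arc lengths turns
  it into a uniform bound; the normalizing homothety has ratio 1 + O(s).\<close>

lemma smoothing_family_C0:
  assumes sf: "smoothing_family K \<eta> \<Gamma>" and e: "e > 0"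
  shows "\<exists>s0>0. \<forall>s\<in>{0<..1}. s < s0 \<longrightarrow> (\<forall>q. norm (\<Gamma> s q - \<eta> q) \<le> e)"
proof -
  interpret marked_polygon K \<eta> by (rule smoothing_family_marked[OF sf])
  define X where "X = {D. D extreme_point_of K}"
  obtain u v :: "complex \<Rightarrow> complex" and a l r f \<gamma> centre where
    corner: "\<forall>D. D extreme_point_of K \<longrightarrow>
           norm (u D) = 1 \<and> norm (v D) = 1 \<and> u D \<bullet> v D = 0 \<and>
           a D > 0 \<and> l D > 0 \<and> r D > 0 \<and>
           graph_in D (u D) (v D) (l D) (r D) (\<lambda>x. a D * \<bar>x\<bar>) \<subseteq> frontier K \<and>
           \<eta> 0 \<notin> graph_in D (u D) (v D) (l D) (r D) (\<lambda>x. a D * \<bar>x\<bar>) \<and>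
           smooth_fun (f D) \<and> convex_on UNIV (f D) \<and>
           (\<forall>x. x \<notin> {- l D..r D} \<longrightarrow> f D x = a D * \<bar>x\<bar>)"
    and \<gamma>: "smooth_family_on {0<..1} \<gamma>"
    and all: "\<forall>s\<in>{0<..1}. (\<exists>L. ccw_boundary_param L (\<gamma> s)) \<and>
           range (\<gamma> s) =
             (frontier K - (\<Union>D\<in>{D. D extreme_point_of K}.
                  graph_in D (u D) (v D) (l D) (r D) (\<lambda>x. a D * \<bar>x\<bar>))) \<union>
             (\<Union>D\<in>{D. D extreme_point_of K}.
                graph_in D (u D) (v D) (l D) (r D) (\<lambda>x. s * f D (x / s))) \<and>
           \<gamma> s 0 = \<eta> 0 \<and>
           (\<forall>q. norm (velocity (\<gamma> s) q) = curve_length (\<gamma> s)) \<and>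
           (\<forall>q. \<Gamma> s q = centre + (1 / curve_length (\<gamma> s)) *\<^sub>R (\<gamma> s q - centre))"
    using sf unfolding smoothing_family_def by (elim conjE exE) (rule that, assumption+)
  obtain z where z: "z \<in> interior K" using K(4) by blast
  obtain r0 where r0: "r0 > 0" "ball z r0 \<subseteq> K" using z mem_interior by blast
  have r0_int: "ball z r0 \<subseteq> interior K" by (rule interior_maximal[OF r0(2) open_ball])
  obtain R where R: "R > 0" "\<And>w. w \<in> K \<Longrightarrow> norm (w - z) \<le> R" "\<And>w. w \<in> K \<Longrightarrow> norm (w - centre) \<le> R"
  proof -
    have "bounded ((\<lambda>w. w - z) ` K \<union> (\<lambda>w. w - centre) ` K)"
      using compact_imp_bounded[OF K(2)] by (simp add: bounded_translation_minus)
    then show ?thesis using that unfolding bounded_pos by blast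
  qed
  have "\<exists>C. \<forall>D\<in>X. \<forall>x\<in>{- l D..r D}. \<bar>x\<bar> + \<bar>f D x\<bar> \<le> C"
  proof -
    have "\<exists>C. \<forall>x\<in>{- l D..r D}. \<bar>x\<bar> + \<bar>f D x\<bar> \<le> C" if "D \<in> X" for D
    proof -
      have "continuous_on {- l D..r D} (f D)" using corner that smooth_fun_continuous unfolding X_def by blast
      then have "continuous_on {- l D..r D} (\<lambda>x. \<bar>x\<bar> + \<bar>f D x\<bar>)" by (intro continuous_intros)
      then have "compact ((\<lambda>x. \<bar>x\<bar> + \<bar>f D x\<bar>) ` {- l D..r D})" by (rule compact_continuous_image) simp
      then have "bdd_above ((\<lambda>x. \<bar>x\<bar> + \<bar>f D x\<bar>) ` {- l D..r D})" by (simp add: compact_imp_bounded bounded_imp_bdd_above)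
      then show ?thesis unfolding bdd_above_def by blast
    qed
    then obtain C where C: "\<And>D x. D \<in> X \<Longrightarrow> x \<in> {- l D..r D} \<Longrightarrow> \<bar>x\<bar> + \<bar>f D x\<bar> \<le> C D" by metis
    have "C D \<le> Max (C ` X)" if "D \<in> X" for D using that finite_extreme by (auto simp: X_def)
    then show ?thesis using C by (intro exI[of _ "Max (C ` X)"]) force
  qed
  then obtain C' where C': "\<And>D x. D \<in> X \<Longrightarrow> x \<in> {- l D..r D} \<Longrightarrow> \<bar>x\<bar> + \<bar>f D x\<bar> \<le> C'" by blast
  define C where "C = max C' 1"
  have C: "\<And>D x. D \<in> X \<Longrightarrow> x \<in> {- l D..r D} \<Longrightarrow> \<bar>x\<bar> + \<bar>f D x\<bar> \<le> C" "C > 0"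
    using C' unfolding C_def by force+
  have graph_near: "norm (D + x *\<^sub>R u D + y *\<^sub>R v D - D) \<le> \<bar>x\<bar> + \<bar>y\<bar>" if "D \<in> X" for D x y
    using norm_triangle_ineq[of "x *\<^sub>R u D" "y *\<^sub>R v D"] corner that by (simp add: X_def)
  define N1 where "N1 = 2 * real (card corners) + 12"
  define N2 where "N2 = 4 * real (card corners) + 25"
  define M where "M = R / r0 * C"
  have pos: "N1 > 0" "N2 > 0" "M > 0" "N1 \<le> N2" using r0(1) R(1) C(2) by (auto simp: N1_def N2_def M_def)
  define B where "B = M * (N2 + 2 * N1 * (R + 1))"
  have B: "B > 0" using pos R(1) by (simp add: B_def add_pos_pos)
  \<comment> \<open>Three demands: the inner ball keeps \<open>z\<close> inside the smoothed curve,
    the length stays above 1/2, and the final error B * s is at most \<open>e\<close>.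
    \<open>B\<close> adds the parameter error N2 to the effect 2 * N1 * (R + 1) of
    rescaling.\<close>
  define s0 where "s0 = min (r0 / (2 * C)) (min (1 / (2 * N2 * M)) (e / B))"
  have s0: "s0 > 0" "s0 * C \<le> r0 / 2" "N2 * M * s0 \<le> 1 / 2" "B * s0 \<le> e"
  proof -
    show "s0 > 0" using r0(1) C(2) pos e B by (simp add: s0_def)
    have "s0 \<le> r0 / (2 * C)" "s0 \<le> 1 / (2 * N2 * M)" "s0 \<le> e / B" by (auto simp: s0_def)
    then show "s0 * C \<le> r0 / 2" "N2 * M * s0 \<le> 1 / 2" "B * s0 \<le> e"
      using C(2) pos B by (simp_all add: field_simps)
  qed
  show ?thesis
  proof (intro exI[of _ s0] conjI ballI impI allI s0(1))
    fix s q :: real assume s: "s \<in> {0<..1}" "s < s0"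
    have s': "s > 0" "s \<le> 1" using s by auto
    define g where "g = \<gamma> s"
    define len where "len = curve_length g"
    obtain L where L: "ccw_boundary_param L g" using all s(1) unfolding g_def by blast
    have speed: "\<And>q. norm (velocity g q) = len" and g0: "g 0 = \<eta> 0"
      and \<Gamma>: "\<And>q. \<Gamma> s q = centre + (1 / len) *\<^sub>R (g q - centre)"
      and ran: "range g = (frontier K - (\<Union>D\<in>{D. D extreme_point_of K}.
                  graph_in D (u D) (v D) (l D) (r D) (\<lambda>x. a D * \<bar>x\<bar>))) \<union>
             (\<Union>D\<in>{D. D extreme_point_of K}.
                graph_in D (u D) (v D) (l D) (r D) (\<lambda>x. s * f D (x / s)))"
      using all s(1) unfolding g_def len_def by auto
    have sm: "smooth_fun g" unfolding g_def
      by (rule smooth_fun_of_smooth2[OF smooth2_of_smooth_family[OF \<gamma>] s(1) at_within_Ioc_nontrivial])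
    note scaled = constant_speed_scaled[OF L sm speed]
    obtain \<theta> where \<theta>: "mono \<theta>" "\<theta> 1 = \<theta> 0 + 2 * pi" "\<And>q. (g has_vector_derivative len *\<^sub>R cis (\<theta> q)) (at q)"
      using scaled(3) by blast
    \<comment> \<open>If x / s is in the window, rescaling puts the point within s * C of the
      corner; otherwise the smoothed and the original graph agree there.\<close>
    have cases: "p \<in> frontier K \<or> (\<exists>D\<in>X. norm (p - D) \<le> s * C)" if pr: "p \<in> range g" for p
    proof -
      consider "p \<in> frontier K" | D where "D \<in> X" "p \<in> graph_in D (u D) (v D) (l D) (r D) (\<lambda>x. s * f D (x / s))"
        using pr unfolding ran X_def by blast
      then show ?thesis
      proof cases
        case 2
        then obtain x where x: "x \<in> {- l D..r D}" "p = D + x *\<^sub>R u D + (s * f D (x / s)) *\<^sub>R v D"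
          unfolding graph_in_def by blast
        show ?thesis
        proof (cases "x / s \<in> {- l D..r D}")
          case True
          have "norm (p - D) \<le> \<bar>x\<bar> + \<bar>s * f D (x / s)\<bar>" unfolding x(2) by (rule graph_near[OF 2(1)])
          also have "\<dots> = s * (\<bar>x / s\<bar> + \<bar>f D (x / s)\<bar>)" using s' by (simp add: abs_mult field_simps)
          also have "\<dots> \<le> s * C" using C(1)[OF 2(1) True] s' by (intro mult_left_mono) auto
          finally show ?thesis using 2(1) by blast
        next
          case False
          then have "f D (x / s) = a D * \<bar>x / s\<bar>" using corner 2(1) unfolding X_def by blast
          then have "s * f D (x / s) = a D * \<bar>x\<bar>" using s' by simp
          then have "p \<in> graph_in D (u D) (v D) (l D) (r D) (\<lambda>x. a D * \<bar>x\<bar>)"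
            unfolding graph_in_def x(2) using x(1) by auto
          then show ?thesis using corner 2(1) unfolding X_def by blast
        qed
      qed simp
    qed
    have Dfr: "D \<in> frontier K" if "D \<in> X" for D
      using extreme_in_range[of D] that K(7) unfolding X_def by auto
    have sC: "s * C \<le> r0 / 2" by (rule order_trans[OF mult_right_mono s0(2)]) (use s(2) C(2) in auto)
    have far: "r0 \<le> norm (p - z)" if "p \<in> frontier K" for p
    proof (rule ccontr)
      assume "\<not> ?thesis"
      then have "p \<in> ball z r0" by (simp add: dist_norm norm_minus_commute)
      then show False using that r0_int by (auto simp: frontier_def)
    qed
    have "z \<in> L"
    proof (rule point_in_perturbed_hull[OF K(1,2), where r = "r0 / 2"])
      show "r0 / 2 > 0" using r0(1) by simp
      show "cball z (r0 / 2) \<subseteq> K" using r0 by (intro order_trans[OF _ r0(2)]) (auto simp: subset_ball)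
      show "\<exists>p\<in>L. norm (p - D) \<le> r0 / 2" if "D extreme_point_of K" for D
      proof -
        define p where "p = D + 0 *\<^sub>R u D + (s * f D (0 / s)) *\<^sub>R v D"
        have 0: "0 \<in> {- l D..r D}" using corner that by force
        have "p \<in> graph_in D (u D) (v D) (l D) (r D) (\<lambda>x. s * f D (x / s))"
          unfolding graph_in_def p_def by (rule image_eqI[OF refl 0])
        then have "p \<in> range g" unfolding ran using that by blast
        then have "p \<in> L" using ccw_boundary_paramD(9)[OF L] by auto
        moreover have "norm (p - D) \<le> \<bar>0\<bar> + \<bar>s * f D (0 / s)\<bar>"
          unfolding p_def by (rule graph_near) (use that in \<open>simp add: X_def\<close>)
        moreover have "\<bar>s * f D (0 / s)\<bar> \<le> s * C"
          using C(1)[of D 0] that 0 s' by (simp add: abs_mult X_def)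
        ultimately show ?thesis using sC by (intro bexI[of _ p]) auto
      qed
      show "L \<noteq> {}" using ccw_boundary_paramD(9)[OF L] by auto
    qed (use ccw_boundary_paramD[OF L] in auto)
    \<comment> \<open>Points of the smoothed curve are on the frontier of \<open>K\<close> or within
      r0 / 2 of a corner, whereas \<open>z\<close> has distance at least \<open>r0\<close> from that
      frontier.\<close>
    moreover have "z \<notin> frontier L"
    proof
      assume "z \<in> frontier L"
      then have "z \<in> range g" using ccw_boundary_paramD(7)[OF L] by simp
      then consider "z \<in> frontier K" | D where "D \<in> X" "norm (z - D) \<le> s * C" using cases by blast
      then show False
      proof cases
        case 1
        then show False using z by (simp add: frontier_def)
      next
        case 2
        then show False using far[OF Dfr[OF 2(1)]] sC r0(1) by (simp add: norm_minus_commute)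
      qed
    qed
    ultimately have zL: "z \<in> interior L" using ccw_boundary_paramD(3)[OF L] by (simp add: frontier_def)
    define d where "d = M * s"
    have d: "d > 0" "N2 * d \<le> 1 / 2" "N1 * d \<le> 1 / 2"
    proof -
      show "d > 0" using pos s' by (simp add: d_def)
      have "N2 * M * s \<le> N2 * M * s0" using s(2) pos by (intro mult_left_mono) auto
      then show *: "N2 * d \<le> 1 / 2" using s0(3) by (simp add: d_def)
      have "N1 * d \<le> N2 * d" using pos \<open>d > 0\<close> by (intro mult_right_mono) auto
      then show "N1 * d \<le> 1 / 2" using * by simp
    qed
    have near: "norm (g q - \<eta> y) \<le> d" if c: "g q - z = c *\<^sub>R (\<eta> y - z)" "c > 0" for q y c
    proof -
      consider "g q \<in> frontier K" | D where "D \<in> X" "norm (g q - D) \<le> s * C" using cases[of "g q"] by blast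
      then show ?thesis
      proof cases
        case 1
        then show ?thesis using frontier_ray_unique[OF K(1) z 1 K(8)[of y] c] d(1) by simp
      next
        case 2
        have "norm (g q - \<eta> y) \<le> norm (\<eta> y - z) / r0 * norm (g q - D)"
          by (rule ray_close[OF K(1,3) r0 Dfr[OF 2(1)] K(8) c])
        also have "\<dots> \<le> R / r0 * (s * C)"
          using R(2)[OF K(9)] 2(2) r0(1) R(1) by (intro mult_mono divide_right_mono) auto
        also have "\<dots> = d" by (simp add: d_def M_def)
        finally show ?thesis .
      qed
    qed
    have len: "\<bar>len - 1\<bar> \<le> N1 * d" 
      by (rule order_trans[OF ccw_param_compare(1)[OF z L zL g0 \<theta>(3) scaled(1) \<theta>(1,2), where d = d]])
        (erule (1) near, simp add: N1_def)
    have lpos: "len \<ge> 1 / 2" using len d(3) by simp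
    define t where "t = frac q"
    have t: "t \<in> {0..1}" by (auto simp: t_def frac_lt_1 less_imp_le)
    have gt: "norm (g t - \<eta> t) \<le> N2 * d" 
      by (rule order_trans[OF ccw_param_compare(2)[OF z L zL g0 \<theta>(3) scaled(1) \<theta>(1,2) _ t, where d = d]])
        (erule (1) near, simp add: N2_def)
    have "q = t + of_int \<lfloor>q\<rfloor>" by (simp add: t_def frac_def)
    then have per: "\<Gamma> s q = \<Gamma> s t" "\<eta> q = \<eta> t"
      using periodic_add_int[of "\<Gamma> s" t "\<lfloor>q\<rfloor>"] tables_C_periodic[OF smoothing_family_tables_C[OF sf s(1)]]
        periodic_add_int[of \<eta> t "\<lfloor>q\<rfloor>"] K(6) by auto
    have "\<Gamma> s t - \<eta> t = (g t - \<eta> t) + (1 / len - 1) *\<^sub>R (g t - centre)"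
      unfolding \<Gamma> by (simp add: algebra_simps)
    then have "norm (\<Gamma> s t - \<eta> t) \<le> norm (g t - \<eta> t) + \<bar>1 / len - 1\<bar> * norm (g t - centre)"
      by (metis norm_scaleR norm_triangle_ineq real_norm_def)
    also have "\<dots> \<le> N2 * d + (2 * (N1 * d)) * (R + 1)"
    proof (rule add_mono[OF gt mult_mono])
      have "\<bar>1 / len - 1\<bar> = \<bar>len - 1\<bar> / len" using lpos by (simp add: abs_minus_commute diff_divide_distrib[symmetric] divide_simps)
      also have "\<dots> \<le> \<bar>len - 1\<bar> / (1 / 2)" using lpos by (intro divide_left_mono) auto
      finally show "\<bar>1 / len - 1\<bar> \<le> 2 * (N1 * d)" using len by simp
      have "norm (g t - centre) \<le> norm (g t - \<eta> t) + norm (\<eta> t - centre)"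
        using norm_triangle_ineq[of "g t - \<eta> t" "\<eta> t - centre"] by simp
      also have "\<dots> \<le> N2 * d + R" by (rule add_mono[OF gt R(3)[OF K(9)]])
      finally show "norm (g t - centre) \<le> R + 1" using d(2) by simp
    qed (use pos d in auto)
    also have "\<dots> = B * s" by (simp add: B_def d_def algebra_simps)
    also have "\<dots> \<le> e" by (rule order_trans[OF mult_left_mono s0(4)]) (use B s(2) in auto)
    finally show "norm (\<Gamma> s q - \<eta> q) \<le> e" unfolding per .
  qed
qed

section \<open>Existence of smoothing families\<close>

definition soft_sign :: "real \<Rightarrow> real" where
  "soft_sign y = 2 * smooth_step ((y + 1) / 2) - 1"

text \<open>The primitive of \<open>soft_sign\<close> with value 1 at 1. It equals the absolute
  value outside (-1, 1), on the left because \<open>soft_sign\<close> is odd, and it is convex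
  because \<open>soft_sign\<close> is monotone.\<close>

definition soft_abs :: "real \<Rightarrow> real" where
  "soft_abs y = 1 + (integral {0..y} soft_sign - integral {y..0} soft_sign)
                  - (integral {0..1} soft_sign - integral {1..0} soft_sign)"

lemma soft_sign_simps:
  "y \<le> -1 \<Longrightarrow> soft_sign y = -1" "y \<ge> 1 \<Longrightarrow> soft_sign y = 1" "soft_sign (- y) = - soft_sign y"
proof -
  show "y \<le> -1 \<Longrightarrow> soft_sign y = -1" "y \<ge> 1 \<Longrightarrow> soft_sign y = 1"
    by (simp_all add: soft_sign_def smooth_step_simps)
  have "(- y + 1) / 2 = 1 - (y + 1) / 2" by (simp add: field_simps)
  then have "smooth_step ((- y + 1) / 2) = 1 - smooth_step ((y + 1) / 2)"
    using smooth_step_simps(5)[of "(y + 1) / 2"] by metis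
  then show "soft_sign (- y) = - soft_sign y" unfolding soft_sign_def by linarith
qed

lemma soft_sign_mono: "x \<le> y \<Longrightarrow> soft_sign x \<le> soft_sign y"
  unfolding soft_sign_def using smooth_step_mono[of "(x + 1) / 2" "(y + 1) / 2"] by simp

lemma smooth_fun_soft_sign: "smooth_fun soft_sign"
  unfolding soft_sign_def
  by (intro smooth_funI smooth2_intros smooth2_compose1[OF smooth_fun_smooth_step]) auto

lemma soft_abs_smooth: "smooth_fun soft_abs"
  and soft_abs_deriv: "(soft_abs has_real_derivative soft_sign y) (at y)"
proof -
  have nt: "at s within UNIV \<noteq> bot" for s :: real by simp
  note P = smooth2_primitive[of UNIV, OF nt convex_UNIV smooth2_of_smooth_fun[OF smooth_fun_soft_sign]]
  define J where "J q = integral {0..q} soft_sign - integral {q..0} soft_sign" for q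
  have J: "soft_abs = (\<lambda>y. 1 + J y - J 1)" unfolding J_def soft_abs_def[abs_def] ..
  have "smooth2 UNIV UNIV (\<lambda>s. J)" unfolding J_def[abs_def] by (rule P(1))
  then show "smooth_fun soft_abs"
    unfolding J by (intro smooth_funI smooth2_diff smooth2_add smooth2_const)
  have dJ: "(J has_real_derivative soft_sign y) (at y)"
    unfolding J_def[abs_def] has_real_derivative_iff_has_vector_derivative by (rule P(2)) simp
  show "(soft_abs has_real_derivative soft_sign y) (at y)"
    using DERIV_diff[OF DERIV_add[OF DERIV_const dJ] DERIV_const, of 1 "J 1"] unfolding J by simp
qed

lemma soft_abs_outside: "\<bar>y\<bar> \<ge> 1 \<Longrightarrow> soft_abs y = \<bar>y\<bar>"
proof -
  have pos: "soft_abs y = y" if "y \<ge> 1" for y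
  proof -
    have "((\<lambda>y. soft_abs y - y) has_real_derivative 0) (at x within {1..y})" if "x \<in> {1..y}" for x
      by (rule has_field_derivative_at_within)
        (use DERIV_diff[OF soft_abs_deriv[of x] DERIV_ident] that soft_sign_simps(2)[of x] in simp)
    then obtain c where "\<And>x. x \<in> {1..y} \<Longrightarrow> soft_abs x - x = c"
      using has_field_derivative_zero_constant[of "{1..y}" "\<lambda>y. soft_abs y - y"] by (meson convex_real_interval(5))
    from this[of y] this[of 1] have "soft_abs y - y = soft_abs 1 - 1" using that by simp
    then show ?thesis by (simp add: soft_abs_def)
  qed
  have even: "soft_abs (- y) = soft_abs y" for y
  proof -
    have "((\<lambda>y. soft_abs (- y) - soft_abs y) has_real_derivative 0) (at x)" for x
      using DERIV_diff[OF DERIV_chain2[OF soft_abs_deriv DERIV_minus[OF DERIV_ident]] soft_abs_deriv, of x]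
        soft_sign_simps(3)[of x] by simp
    then have "soft_abs (- y) - soft_abs y = soft_abs (- 0) - soft_abs 0"
      using DERIV_isconst_all[of "\<lambda>y. soft_abs (- y) - soft_abs y" y 0] by blast
    then show ?thesis by simp
  qed
  assume "\<bar>y\<bar> \<ge> 1"
  then show ?thesis using pos[of y] pos[of "- y"] even[of y] by (cases "y \<ge> 0") auto
qed

text \<open>\<open>B\<close> is constant near both ends of the unit interval, at the values 0 and T,
  so the translated pieces join continuously across the integers.\<close>

lemma quasiperiodic_extension:
  fixes B :: "real \<Rightarrow> real"
  assumes B: "continuous_on UNIV B" "mono B" "\<And>x. x \<le> \<delta> \<Longrightarrow> B x = 0" "\<And>x. x \<ge> 1 - \<delta> \<Longrightarrow> B x = T" and \<delta>: "\<delta> > 0"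
  defines "H \<equiv> \<lambda>q. T * \<lfloor>q\<rfloor> + B (frac q)"
  shows "continuous_on UNIV H" "mono H" "H (q + 1) = H q + T"
proof -
  have loc: "H y = T * k + B (y - k)" if "k - \<delta> < y" "y < k + 1" for y :: real and k :: int
  proof (cases "y \<ge> k")
    case True
    then have "\<lfloor>y\<rfloor> = k" using that by linarith
    then show ?thesis by (simp add: H_def frac_def)
  next
    case False
    show ?thesis
    proof (cases "\<delta> \<le> 1")
      case True
      then have fl: "\<lfloor>y\<rfloor> = k - 1" using False that by linarith
      have "B (frac y) = T" using that fl by (intro B(4)) (simp add: frac_def)
      moreover have "B (y - k) = 0" using False \<delta> by (intro B(3)) simp
      moreover have "T * \<lfloor>y\<rfloor> = T * k - T" unfolding fl by (simp add: algebra_simps)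
      ultimately show ?thesis unfolding H_def by simp
    next
      case F: False
      \<comment> \<open>For \<delta> > 1 the two regions where \<open>B\<close> is prescribed
        overlap, which forces T = 0 and B = 0.\<close>
      have "B 0 = 0" "B 0 = T" using F \<delta> by (auto intro: B(3,4))
      then have T: "T = 0" by simp
      have "B x = 0" for x using B(3)[of x] B(4)[of x] F T by (cases "x \<le> \<delta>") auto
      then show ?thesis by (simp add: H_def T)
    qed
  qed
  show "continuous_on UNIV H"
    unfolding continuous_on_eq_continuous_at[OF open_UNIV]
  proof
    fix q :: real
    define k where "k = \<lfloor>q\<rfloor>"
    have k: "of_int k \<le> q" "q < of_int k + 1" unfolding k_def by linarith+
    have "isCont B (q - of_int k)" using B(1) by (simp add: continuous_on_eq_continuous_at)
    then have "isCont (\<lambda>y. B (y - of_int k)) q"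
      by (rule isCont_o2[of q "\<lambda>y. y - of_int k" B, rotated]) (auto intro!: continuous_intros)
    then have "isCont (\<lambda>y::real. T * of_int k + B (y - of_int k)) q"
      by (intro continuous_add continuous_const)
    moreover have "\<forall>\<^sub>F y in nhds q. y \<in> {of_int k - \<delta><..<of_int k + 1}"
      by (rule eventually_nhds_in_open) (use \<delta> k in auto)
    then have "\<forall>\<^sub>F y in nhds q. H y = T * of_int k + B (y - of_int k)"
      by (rule eventually_mono) (use loc in auto)
    ultimately show "isCont H q" by (simp add: isCont_cong)
  qed
  have range: "0 \<le> B x" "B x \<le> T" for x
  proof -
    show "0 \<le> B x" using monoD[OF B(2), of \<delta> x] B(3)[of \<delta>] B(3)[of x] by (cases "x \<le> \<delta>") auto
    show "B x \<le> T" using monoD[OF B(2), of x "1 - \<delta>"] B(4)[of "1 - \<delta>"] B(4)[of x] by (cases "x \<ge> 1 - \<delta>") auto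
  qed
  have T: "T \<ge> 0" using range[of 0] by linarith
  show "mono H"
  proof (rule monoI)
    fix x y :: real assume xy: "x \<le> y"
    show "H x \<le> H y"
    proof (cases "\<lfloor>x\<rfloor> = \<lfloor>y\<rfloor>")
      case True
      then show ?thesis using monoD[OF B(2), of "frac x" "frac y"] xy by (simp add: H_def frac_def)
    next
      case False
      then have "\<lfloor>x\<rfloor> + 1 \<le> \<lfloor>y\<rfloor>" using floor_mono[OF xy] by linarith
      then have "T * (\<lfloor>x\<rfloor> + 1) \<le> T * \<lfloor>y\<rfloor>" using T by (intro mult_left_mono) linarith+
      then show ?thesis using range[of "frac x"] range[of "frac y"] by (simp add: H_def algebra_simps)
    qed
  qed
  show "H (q + 1) = H q + T" by (simp add: H_def frac_def algebra_simps)
qed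

text \<open>The speed is recovered as the norm of \<open>dq \<beta>\<close>, smooth because it never
  vanishes; dividing its primitive by the length and inverting gives constant speed without changing
  the range. The angle is only continuous and monotone, which is enough to recognize a convex
  boundary.\<close>

lemma constant_speed_family:
  fixes \<beta> :: "real \<Rightarrow> real \<Rightarrow> complex" and \<theta> :: "real \<Rightarrow> real \<Rightarrow> real"
  assumes nt: "\<And>s. s \<in> A \<Longrightarrow> at s within A \<noteq> bot" and A: "convex A"
    and \<beta>: "smooth2 A UNIV \<beta>" and per: "\<And>s q. s \<in> A \<Longrightarrow> \<beta> s (q + 1) = \<beta> s q"
    and d: "\<And>s q. s \<in> A \<Longrightarrow> \<exists>r>0. (\<beta> s has_vector_derivative r *\<^sub>R cis (\<theta> s q)) (at q)"
    and \<theta>: "\<And>s. s \<in> A \<Longrightarrow> continuous_on UNIV (\<theta> s)" "\<And>s. s \<in> A \<Longrightarrow> mono (\<theta> s)"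
      "\<And>s q. s \<in> A \<Longrightarrow> \<theta> s (q + 1) = \<theta> s q + 2 * pi"
  obtains \<gamma> where "smooth2 A UNIV \<gamma>"
    "\<And>s. s \<in> A \<Longrightarrow> range (\<gamma> s) = range (\<beta> s)" "\<And>s. s \<in> A \<Longrightarrow> \<gamma> s 0 = \<beta> s 0"
    "\<And>s. s \<in> A \<Longrightarrow> \<exists>L. ccw_boundary_param L (\<gamma> s)"
    "\<And>s q. s \<in> A \<Longrightarrow> norm (velocity (\<gamma> s) q) = curve_length (\<gamma> s)"
proof -
  note D = smooth2D[OF nt open_UNIV \<beta>, simplified]
  define v where "v s q = sqrt (dq \<beta> s q \<bullet> dq \<beta> s q)" for s q
  have dv: "v s q > 0 \<and> dq \<beta> s q = v s q *\<^sub>R cis (\<theta> s q)" if s: "s \<in> A" for s q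
  proof -
    obtain r where r: "r > 0" "(\<beta> s has_vector_derivative r *\<^sub>R cis (\<theta> s q)) (at q)" using d[OF s] by blast
    have "dq \<beta> s q = r *\<^sub>R cis (\<theta> s q)" by (rule vector_derivative_unique_at[OF D(4)[OF s] r(2)])
    moreover have "v s q = norm (dq \<beta> s q)" unfolding v_def norm_eq_sqrt_inner ..
    moreover from calculation have "v s q = r" using r(1) by simp
    ultimately show ?thesis using r(1) by simp
  qed
  have sv: "smooth2 A UNIV v"
    unfolding v_def
  proof (intro smooth2_intros D(2))
    fix s q :: real assume "s \<in> A"
    then show "dq \<beta> s q \<bullet> dq \<beta> s q > 0" using dv[of s q] by (simp add: v_def)
  qed
  define P where "P s q = integral {0..q} (v s) - integral {q..0} (v s)" for s q
  have P: "smooth2 A UNIV P" "\<And>s q. s \<in> A \<Longrightarrow> (P s has_vector_derivative v s q) (at q)" "\<And>s. P s 0 = 0"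
    unfolding P_def using smooth2_primitive[OF nt A sv] by auto
  have P': "(P s has_real_derivative v s q) (at q)" if "s \<in> A" for s q
    using P(2)[OF that] by (simp add: has_real_derivative_iff_has_vector_derivative)
  have len: "P s 1 > 0" if "s \<in> A" for s
    using DERIV_pos_imp_increasing[of 0 1 "P s"] P' dv that P(3) by force
  define \<sigma> where "\<sigma> s q = P s q / P s 1" for s q
  have s\<sigma>: "smooth2 A UNIV \<sigma>"
    unfolding \<sigma>_def by (intro smooth2_intros P(1) smooth2_compose[OF P(1)]) (use len in force)
  have d\<sigma>: "(\<sigma> s has_vector_derivative v s q / P s 1) (at q)" if "s \<in> A" for s q
    unfolding \<sigma>_def using P(2)[OF that] len[OF that] by (auto intro!: derivative_eq_intros)
  have dq\<sigma>: "dq \<sigma> s q = v s q / P s 1" if "s \<in> A" for s q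
    by (rule vector_derivative_unique_at[OF smooth2D(4)[OF nt open_UNIV s\<sigma> that UNIV_I] d\<sigma>[OF that]])
  have v_per: "v s (q + 1) = v s q" if s: "s \<in> A" for s q
  proof -
    have "((\<lambda>q. \<beta> s (q + 1)) has_vector_derivative dq \<beta> s (q + 1)) (at q)"
    proof -
      have "((\<lambda>q::real. q + 1) has_vector_derivative 1) (at q)" by (auto intro!: derivative_eq_intros)
      from vector_diff_chain_at[OF this D(4)[OF s]] show ?thesis by (simp add: o_def)
    qed
    then have "(\<beta> s has_vector_derivative dq \<beta> s (q + 1)) (at q)" unfolding per[OF s] .
    then have "dq \<beta> s (q + 1) = dq \<beta> s q" by (rule vector_derivative_unique_at[OF _ D(4)[OF s]])
    then show ?thesis by (simp add: v_def)
  qed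
  have \<sigma>_per: "\<sigma> s (q + 1) = \<sigma> s q + 1" if s: "s \<in> A" for s q
  proof -
    have "((\<lambda>q. P s (q + 1) - P s q) has_real_derivative 0) (at x)" for x
    proof -
      have "((\<lambda>q::real. q + 1) has_real_derivative 1) (at x)" by (auto intro!: derivative_eq_intros)
      from DERIV_diff[OF DERIV_chain2[OF P'[OF s] this] P'[OF s]] show ?thesis using v_per[OF s, of x] by simp
    qed
    then have "P s (q + 1) - P s q = P s (0 + 1) - P s 0"
      using DERIV_isconst_all[of "\<lambda>q. P s (q + 1) - P s q" q 0] by blast
    then have "P s (q + 1) = P s q + P s 1" using P(3) by simp
    then show ?thesis using len[OF s] by (simp add: \<sigma>_def add_divide_distrib)
  qed
  have "\<exists>x. \<sigma> s x = q" if s: "s \<in> A" for s q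
    by (rule quasiperiodic_surj[where f = "\<sigma> s" and c = 1])
      (use d\<sigma>[OF s] \<sigma>_per[OF s] in \<open>auto intro!: continuous_at_imp_continuous_on has_vector_derivative_continuous\<close>)
  then obtain U where U: "\<And>s q. s \<in> A \<Longrightarrow> \<sigma> s (U s q) = q" by metis
  have pos: "dq \<sigma> s q > 0" if "s \<in> A" for s q using dq\<sigma>[OF that] dv[OF that] len[OF that] by simp
  have I: "smooth2 A UNIV U"
    by (rule smooth2_inverse_family(1)[OF nt A s\<sigma> pos U]; assumption)
  have I2: "U s (\<sigma> s q) = q" if "s \<in> A" for s q
    by (rule smooth2_inverse_family(2)[OF nt A s\<sigma> pos U]; (assumption | rule that))
  have I3: "(U s has_real_derivative inverse (dq \<sigma> s (U s q))) (at q)" if "s \<in> A" for s q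
    by (rule smooth2_inverse_family(3)[OF nt A s\<sigma> pos U]; (assumption | rule that))
  have U1: "U s (q + 1) = U s q + 1" if "s \<in> A" for s q
    using I2[OF that, of "U s q + 1"] \<sigma>_per[OF that] U[OF that] by simp
  have U0: "U s 0 = 0" if "s \<in> A" for s
    using I2[OF that, of 0] P(3) by (simp add: \<sigma>_def)
  define \<gamma> where "\<gamma> s q = \<beta> s (U s q)" for s q
  have d\<gamma>: "(\<gamma> s has_vector_derivative of_real (P s 1) * cis (\<theta> s (U s q))) (at q)" if s: "s \<in> A" for s q
  proof -
    have "(U s has_vector_derivative P s 1 / v s (U s q)) (at q)"
      using I3[OF s, of q] dq\<sigma>[OF s] by (simp add: has_real_derivative_iff_has_vector_derivative)
    from vector_diff_chain_at[OF this D(4)[OF s]]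
    have "(\<gamma> s has_vector_derivative (P s 1 / v s (U s q)) *\<^sub>R dq \<beta> s (U s q)) (at q)"
      by (simp add: o_def \<gamma>_def[abs_def])
    moreover have "(P s 1 / v s (U s q)) *\<^sub>R dq \<beta> s (U s q) = of_real (P s 1) * cis (\<theta> s (U s q))"
      using dv[OF s, of "U s q"] by (simp add: scaleR_conv_of_real)
    ultimately show ?thesis by simp
  qed
  show ?thesis
  proof (rule that[of \<gamma>])
    show "smooth2 A UNIV \<gamma>" unfolding \<gamma>_def by (rule smooth2_compose[OF \<beta> I])
    fix s assume s: "s \<in> A"
    show "\<gamma> s 0 = \<beta> s 0" by (simp add: \<gamma>_def U0[OF s])
    show "range (\<gamma> s) = range (\<beta> s)"
    proof
      show "range (\<beta> s) \<subseteq> range (\<gamma> s)"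
        using I2[OF s] unfolding \<gamma>_def by (metis image_subsetI rangeI)
    qed (auto simp: \<gamma>_def)
    have speed: "norm (velocity (\<gamma> s) q) = P s 1" for q
      using velocity_eq[OF d\<gamma>[OF s, of q]] len[OF s] by (simp add: norm_mult)
    then show "norm (velocity (\<gamma> s) q) = curve_length (\<gamma> s)" for q by (simp add: curve_length_def)
    have mU: "mono (U s)"
      by (rule monoI, erule DERIV_nonneg_imp_nondecreasing)
        (intro exI conjI, rule I3[OF s], simp add: pos[OF s] less_imp_le)
    have cU: "continuous_on UNIV (U s)"
      using I3[OF s] by (intro continuous_at_imp_continuous_on ballI) (rule DERIV_isCont)
    have "ccw_boundary_param (convex hull range (\<gamma> s)) (\<gamma> s)"
    proof (rule ccw_boundary_param_hull[OF d\<gamma>[OF s] len[OF s]])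
      show "continuous_on UNIV (\<lambda>q. \<theta> s (U s q))"
        by (rule continuous_on_compose2[OF \<theta>(1)[OF s] cU]) simp
      show "mono (\<lambda>q. \<theta> s (U s q))" using \<theta>(2)[OF s] mU by (auto simp: mono_def)
    qed (use \<theta>(3)[OF s] U1[OF s] per[OF s] in \<open>auto simp: \<gamma>_def\<close>)
    then show "\<exists>L. ccw_boundary_param L (\<gamma> s)" by blast
  qed
qed

lemma graph_in_eq_image:
  assumes C: "C > 0" and F: "\<And>x. \<bar>x\<bar> \<le> m \<Longrightarrow> F (c + x) = D + (x * C) *\<^sub>R u + h (x * C) *\<^sub>R v"
  shows "graph_in D u v (m * C) (m * C) h = F ` {c - m..c + m}"
proof
  show "graph_in D u v (m * C) (m * C) h \<subseteq> F ` {c - m..c + m}"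
    unfolding graph_in_def
  proof (rule image_subsetI)
    fix y assume y: "y \<in> {- (m * C)..m * C}"
    have "\<bar>y\<bar> \<le> m * C" using y by (intro abs_leI) auto
    then have x: "\<bar>y / C\<bar> \<le> m" using C by (simp add: pos_divide_le_eq)
    have "D + y *\<^sub>R u + h y *\<^sub>R v = F (c + y / C)" using F[OF x] C by simp
    moreover have "c + y / C \<in> {c - m..c + m}" using x abs_le_D1[OF x] abs_le_D2[OF x] by simp
    ultimately show "D + y *\<^sub>R u + h y *\<^sub>R v \<in> F ` {c - m..c + m}" by (rule image_eqI)
  qed
  show "F ` {c - m..c + m} \<subseteq> graph_in D u v (m * C) (m * C) h"
    unfolding graph_in_def
  proof (rule image_subsetI)
    fix q assume q: "q \<in> {c - m..c + m}"
    have x: "\<bar>q - c\<bar> \<le> m" using q by (intro abs_leI) auto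
    have "F q = D + ((q - c) * C) *\<^sub>R u + h ((q - c) * C) *\<^sub>R v" using F[OF x] by simp
    moreover have "(q - c) * C \<le> m * C" "(- m) * C \<le> (q - c) * C"
      using q C by (intro mult_right_mono; simp)+
    then have "(q - c) * C \<in> {- (m * C)..m * C}" by simp
    ultimately show "F q \<in> (\<lambda>y. D + y *\<^sub>R u + h y *\<^sub>R v) ` {- (m * C)..m * C}" by (rule image_eqI)
  qed
qed

lemma range_periodic:
  fixes f :: "real \<Rightarrow> 'a"
  assumes "\<And>q. f (q + 1) = f q"
  shows "range f = f ` {0..<1}"
proof
  show "range f \<subseteq> f ` {0..<1}"
  proof (rule image_subsetI)
    fix q
    have "f q = f (frac q)" using periodic_add_int[of f "frac q" "\<lfloor>q\<rfloor>"] assms by (simp add: frac_def)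
    then show "f q \<in> f ` {0..<1}" by (rule image_eqI) (simp add: frac_lt_1)
  qed
qed auto

lemma cis_split:
  "cis (x - y) = cos y *\<^sub>R cis x - sin y *\<^sub>R (\<i> * cis x)"
  "cis (x + y) = cos y *\<^sub>R cis x + sin y *\<^sub>R (\<i> * cis x)"
  by (simp_all add: complex_eq_iff cos_diff sin_diff cos_add sin_add algebra_simps)

text \<open>Here \<open>d\<close> is a radius for which corners are at least 3 * d apart and at
  least 3 * d from both ends of the period; changes within d / 2 of the corners therefore cannot
  interact.\<close>

locale corner_rounding = marked_polygon +
  fixes \<tau> :: "real \<Rightarrow> real" and \<theta>0 d :: real
  assumes \<tau>: "\<And>c. c \<in> corners \<Longrightarrow> 0 < \<tau> c" "\<And>c. c \<in> corners \<Longrightarrow> \<tau> c < pi" "(\<Sum>c\<in>corners. \<tau> c) = 2 * pi"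
    and side: "\<And>a b u. 0 \<le> a \<Longrightarrow> a < b \<Longrightarrow> b \<le> 1 \<Longrightarrow> corners \<inter> {a<..<b} = {} \<Longrightarrow> u \<in> {a..b} \<Longrightarrow>
       \<eta> u = \<eta> a + (u - a) *\<^sub>R cis (\<theta>0 + (\<Sum>c\<in>corners \<inter> {..<b}. \<tau> c))"
    and d: "d > 0" "\<And>c. c \<in> corners \<Longrightarrow> 3 * d \<le> c" "\<And>c. c \<in> corners \<Longrightarrow> c \<le> 1 - 3 * d"
      "\<And>c c'. c \<in> corners \<Longrightarrow> c' \<in> corners \<Longrightarrow> c \<noteq> c' \<Longrightarrow> 3 * d \<le> \<bar>c - c'\<bar>"
begin

definition half_turn :: "real \<Rightarrow> real" where "half_turn c = \<tau> c / 2"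

text \<open>The direction halfway between the incoming and the outgoing side. With this axis both
  sides have slopes of absolute value tan (half_turn c), as a graph of a multiple of |x|
  requires.\<close>

definition axis :: "real \<Rightarrow> complex" where
  "axis c = cis (\<theta>0 + (\<Sum>c'\<in>corners \<inter> {..<c}. \<tau> c') + half_turn c)"

definition width :: "real \<Rightarrow> real" where "width s = s * (d / 2)"

text \<open>At each corner the normal component, a multiple of |x|, is exchanged for its smoothed
  version. Each correction vanishes at distance at least \<open>width s\<close> from its
  corner.\<close>

definition rounded :: "real \<Rightarrow> real \<Rightarrow> complex" where
  "rounded s q = \<eta> q + (\<Sum>c\<in>corners. (sin (half_turn c) *
     (width s * soft_abs ((frac q - c) / width s) - \<bar>frac q - c\<bar>)) *\<^sub>R (\<i> * axis c))"

text \<open>The part of the exterior angle at \<open>c\<close> already completed at signed parameter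
  distance x: relative to the axis, the rounded graph has slope tan (half_turn c) * soft_sign (x /
  width s), whose angle runs from - half_turn c to half_turn c.\<close>

definition turn :: "real \<Rightarrow> real \<Rightarrow> real \<Rightarrow> real" where
  "turn s c x = half_turn c + arctan (tan (half_turn c) * soft_sign (x / width s))"

definition tangent_angle :: "real \<Rightarrow> real \<Rightarrow> real" where
  "tangent_angle s q = \<theta>0 + (2 * pi * \<lfloor>q\<rfloor> + (\<Sum>c\<in>corners. turn s c (frac q - c)))"

section \<open>The rounded curve near the corners and along the sides\<close>

lemma half_turn:
  assumes "c \<in> corners"
  shows "0 < half_turn c" "half_turn c < pi / 2" "cos (half_turn c) > 0" "sin (half_turn c) > 0" "tan (half_turn c) > 0"
proof -
  show *: "0 < half_turn c" "half_turn c < pi / 2" using \<tau>(1,2)[OF assms] by (simp_all add: half_turn_def)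
  show "cos (half_turn c) > 0" by (rule cos_gt_zero_pi) (use * in auto)
  show "sin (half_turn c) > 0" by (rule sin_gt_zero) (use * in auto)
  show "tan (half_turn c) > 0" by (rule tan_gt_zero) (use * in auto)
qed

lemma width: "s \<in> {0<..1} \<Longrightarrow> width s > 0" "s \<in> {0<..1} \<Longrightarrow> width s \<le> d / 2"
  using d(1) mult_right_mono[of s 1 "d / 2"] by (auto simp: width_def)

lemma eta_near:
  assumes c: "c \<in> corners" and x: "\<bar>x\<bar> \<le> d"
  shows "\<eta> (c + x) = \<eta> c + (x * cos (half_turn c)) *\<^sub>R axis c + (sin (half_turn c) * \<bar>x\<bar>) *\<^sub>R (\<i> * axis c)"
proof (cases "x \<le> 0")
  case True
  define L where "L = cis (\<theta>0 + (\<Sum>c'\<in>corners \<inter> {..<c}. \<tau> c'))"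
  have free: "corners \<inter> {c - d<..<c} = {}"
  proof (rule ccontr)
    assume "\<not> ?thesis"
    then obtain c' where c': "c' \<in> corners" "c - d < c'" "c' < c" by auto
    have "3 * d \<le> \<bar>c - c'\<bar>" by (rule d(4)[OF c c'(1)]) (use c' in simp)
    then show False using c' d(1) by simp
  qed
  have b: "0 \<le> c - d" "c - d < c" "c \<le> 1" using d(1) d(2)[OF c] d(3)[OF c] by auto
  have xd: "- d \<le> x" using abs_le_D2[OF x] by simp
  have 1: "\<eta> (c + x) = \<eta> (c - d) + (c + x - (c - d)) *\<^sub>R L"
    unfolding L_def by (rule side[OF b free]) (use True xd in auto)
  have 2: "\<eta> c = \<eta> (c - d) + (c - (c - d)) *\<^sub>R L"
    unfolding L_def by (rule side[OF b free]) (use d(1) in auto)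
  have L: "L = cos (half_turn c) *\<^sub>R axis c - sin (half_turn c) *\<^sub>R (\<i> * axis c)"
    unfolding L_def axis_def cis_split(1)[symmetric] by simp
  have "\<eta> (c + x) = \<eta> c + x *\<^sub>R L" unfolding 1 2 by (simp add: algebra_simps)
  then show ?thesis unfolding L using True by (simp add: algebra_simps)
next
  case False
  define L where "L = cis (\<theta>0 + (\<Sum>c'\<in>corners \<inter> {..<c + d}. \<tau> c'))"
  have free: "c' \<notin> corners" if "c < c'" "c' < c + d" for c'
  proof
    assume c': "c' \<in> corners"
    have "3 * d \<le> \<bar>c - c'\<bar>" by (rule d(4)[OF c c']) (use that in simp)
    then show False using that d(1) by simp
  qed
  have b: "0 \<le> c" "c < c + d" "c + d \<le> 1" using d(1) d(2)[OF c] d(3)[OF c] by auto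
  have xd: "x \<le> d" using abs_le_D1[OF x] by simp
  have "\<eta> (c + x) = \<eta> c + (c + x - c) *\<^sub>R L"
    unfolding L_def by (rule side[OF b]) (use free False xd in auto)
  moreover have "corners \<inter> {..<c + d} = insert c (corners \<inter> {..<c})"
  proof (rule set_eqI)
    show "y \<in> corners \<inter> {..<c + d} \<longleftrightarrow> y \<in> insert c (corners \<inter> {..<c})" for y
      using c d(1) free[of y] by (cases y c rule: linorder_cases) auto
  qed
  then have "(\<Sum>c'\<in>corners \<inter> {..<c + d}. \<tau> c') = \<tau> c + (\<Sum>c'\<in>corners \<inter> {..<c}. \<tau> c')"
    using finite_corners by simp
  then have "L = cis (\<theta>0 + (\<Sum>c'\<in>corners \<inter> {..<c}. \<tau> c') + half_turn c + half_turn c)"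
    unfolding L_def half_turn_def by (simp add: algebra_simps)
  then have "L = cos (half_turn c) *\<^sub>R axis c + sin (half_turn c) *\<^sub>R (\<i> * axis c)"
    unfolding axis_def cis_split(2)[symmetric] .
  ultimately show ?thesis using False by (simp add: algebra_simps)
qed

lemma soft_abs_scaled:
  assumes "w > 0" "\<bar>x\<bar> \<ge> w" shows "w * soft_abs (x / w) = \<bar>x\<bar>"
proof -
  have "\<bar>x / w\<bar> \<ge> 1" using assms by (simp add: abs_div_pos[symmetric])
  then show ?thesis using soft_abs_outside[of "x / w"] assms by simp
qed

lemma turn_left:
  assumes c: "c \<in> corners" and s: "s \<in> {0<..1}" and x: "x \<le> - width s" shows "turn s c x = 0"
proof -
  have "x / width s \<le> -1" using x width(1)[OF s] by (simp add: pos_divide_le_eq)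
  then show ?thesis
    using half_turn[OF c] arctan_tan[of "half_turn c"] by (simp add: turn_def soft_sign_simps arctan_minus)
qed

lemma turn_right:
  assumes c: "c \<in> corners" and s: "s \<in> {0<..1}" and x: "x \<ge> width s" shows "turn s c x = \<tau> c"
proof -
  have "x / width s \<ge> 1" using x width(1)[OF s] by (simp add: pos_le_divide_eq)
  then show ?thesis
    using half_turn[OF c] arctan_tan[of "half_turn c"] by (simp add: turn_def soft_sign_simps half_turn_def)
qed

lemma turn_mono:
  assumes c: "c \<in> corners" and s: "s \<in> {0<..1}" and x: "x \<le> y" shows "turn s c x \<le> turn s c y"
proof -
  have "x / width s \<le> y / width s" using x width(1)[OF s] by (simp add: divide_right_mono)
  then have "tan (half_turn c) * soft_sign (x / width s) \<le> tan (half_turn c) * soft_sign (y / width s)"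
    using half_turn(5)[OF c] by (intro mult_left_mono soft_sign_mono) auto
  then show ?thesis unfolding turn_def using arctan_monotone' by (intro add_left_mono)
qed

lemma rounded_near:
  assumes s: "s \<in> {0<..1}" and c: "c \<in> corners" and x: "\<bar>x\<bar> \<le> d" and q: "q = c + x + real_of_int k"
  shows "rounded s q = \<eta> c + (x * cos (half_turn c)) *\<^sub>R axis c
           + (sin (half_turn c) * (width s * soft_abs (x / width s))) *\<^sub>R (\<i> * axis c)"
    and "cis (tangent_angle s q) = axis c * cis (arctan (tan (half_turn c) * soft_sign (x / width s)))"
proof -
  have x': "- d \<le> x" "x \<le> d" using abs_le_D1[OF x] abs_le_D2[OF x] by auto
  have fl: "\<lfloor>q\<rfloor> = k" unfolding q using x' d(1) d(2)[OF c] d(3)[OF c] by (intro floor_unique) auto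
  then have fr: "frac q = c + x" by (simp add: frac_def q)
  have w: "width s > 0" "width s \<le> d / 2" using width s by auto
  \<comment> \<open>Every other corner is at least 3 * d away, so near \<open>c\<close> its
    correction vanishes and its turn is either complete or has not begun.\<close>
  have far: "(c' < c \<longrightarrow> c + x - c' \<ge> width s) \<and> (c < c' \<longrightarrow> c + x - c' \<le> - width s)"
    if "c' \<in> corners" for c'
  proof (intro conjI impI)
    assume "c' < c"
    then have "3 * d \<le> c - c'" using d(4)[OF c that] by simp
    then show "c + x - c' \<ge> width s" using x' w d(1) by linarith
  next
    assume "c < c'"
    then have "3 * d \<le> c' - c" using d(4)[OF c that] by simp
    then show "c + x - c' \<le> - width s" using x' w d(1) by linarith
  qed
  have far': "\<bar>c + x - c'\<bar> \<ge> width s" if "c' \<in> corners - {c}" for c'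
    using far[of c'] that w(1) by (cases "c' < c") auto
  have "(\<Sum>c'\<in>corners. (sin (half_turn c') * (width s * soft_abs ((frac q - c') / width s) - \<bar>frac q - c'\<bar>)) *\<^sub>R (\<i> * axis c'))
      = (sin (half_turn c) * (width s * soft_abs (x / width s) - \<bar>x\<bar>)) *\<^sub>R (\<i> * axis c)
        + (\<Sum>c'\<in>corners - {c}. (sin (half_turn c') * (width s * soft_abs ((c + x - c') / width s) - \<bar>c + x - c'\<bar>)) *\<^sub>R (\<i> * axis c'))"
    unfolding fr by (subst sum.remove[OF finite_corners c]) simp
  also have "(\<Sum>c'\<in>corners - {c}. (sin (half_turn c') * (width s * soft_abs ((c + x - c') / width s) - \<bar>c + x - c'\<bar>)) *\<^sub>R (\<i> * axis c')) = 0"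
    by (rule sum.neutral) (use soft_abs_scaled[OF w(1) far'] in simp)
  finally have sum: "(\<Sum>c'\<in>corners. (sin (half_turn c') * (width s * soft_abs ((frac q - c') / width s) - \<bar>frac q - c'\<bar>)) *\<^sub>R (\<i> * axis c'))
      = (sin (half_turn c) * (width s * soft_abs (x / width s) - \<bar>x\<bar>)) *\<^sub>R (\<i> * axis c)" by simp
  have "\<eta> q = \<eta> (c + x)" unfolding q by (rule periodic_add_int[of \<eta>, OF K(6)])
  then show "rounded s q = \<eta> c + (x * cos (half_turn c)) *\<^sub>R axis c
           + (sin (half_turn c) * (width s * soft_abs (x / width s))) *\<^sub>R (\<i> * axis c)"
    unfolding rounded_def sum eta_near[OF c x] by (simp add: algebra_simps)
  have "(\<Sum>c'\<in>corners. turn s c' (frac q - c')) = turn s c x + (\<Sum>c'\<in>corners - {c}. turn s c' (c + x - c'))"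
    unfolding fr by (subst sum.remove[OF finite_corners c]) simp
  also have "(\<Sum>c'\<in>corners - {c}. turn s c' (c + x - c')) = (\<Sum>c'\<in>corners - {c}. if c' < c then \<tau> c' else 0)"
    by (rule sum.cong[OF refl]) (use far turn_left[OF _ s] turn_right[OF _ s] in auto)
  also have "\<dots> = (\<Sum>c'\<in>corners \<inter> {..<c}. \<tau> c')"
    using finite_corners by (intro sum.mono_neutral_cong_right) auto
  finally have "tangent_angle s q = \<theta>0 + (\<Sum>c'\<in>corners \<inter> {..<c}. \<tau> c') + half_turn c
      + arctan (tan (half_turn c) * soft_sign (x / width s)) + 2 * pi * k"
    by (simp add: tangent_angle_def fl turn_def)
  then show "cis (tangent_angle s q) = axis c * cis (arctan (tan (half_turn c) * soft_sign (x / width s)))"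
    by (simp add: axis_def cis_mult[symmetric])
qed

lemma rounded_far:
  assumes s: "s \<in> {0<..1}" and far: "\<And>c. c \<in> corners \<Longrightarrow> d / 2 \<le> \<bar>frac q - c\<bar>"
  shows "rounded s q = \<eta> q"
    and "cis (tangent_angle s q) = cis (\<theta>0 + (\<Sum>c\<in>corners \<inter> {..<frac q}. \<tau> c))"
proof -
  have w: "width s > 0" "width s \<le> d / 2" using width s by auto
  have far': "width s \<le> \<bar>frac q - c\<bar>" if "c \<in> corners" for c using far[OF that] w(2) by simp
  have "(\<Sum>c\<in>corners. (sin (half_turn c) * (width s * soft_abs ((frac q - c) / width s) - \<bar>frac q - c\<bar>)) *\<^sub>R (\<i> * axis c)) = 0"
    by (rule sum.neutral) (use soft_abs_scaled[OF w(1) far'] in simp)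
  then show "rounded s q = \<eta> q" by (simp add: rounded_def)
  have "turn s c (frac q - c) = (if c < frac q then \<tau> c else 0)" if "c \<in> corners" for c
    using turn_left[OF that s, of "frac q - c"] turn_right[OF that s, of "frac q - c"] far'[OF that] by auto
  then have "(\<Sum>c\<in>corners. turn s c (frac q - c)) = (\<Sum>c\<in>corners. if c < frac q then \<tau> c else 0)"
    by (rule sum.cong[OF refl])
  also have "\<dots> = (\<Sum>c\<in>corners \<inter> {..<frac q}. \<tau> c)"
    using finite_corners by (intro sum.mono_neutral_cong_right) auto
  finally have "tangent_angle s q = \<theta>0 + (\<Sum>c\<in>corners \<inter> {..<frac q}. \<tau> c) + 2 * pi * of_int \<lfloor>q\<rfloor>"
    by (simp add: tangent_angle_def)
  then show "cis (tangent_angle s q) = cis (\<theta>0 + (\<Sum>c\<in>corners \<inter> {..<frac q}. \<tau> c))"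
    by (simp add: cis_mult[symmetric])
qed

text \<open>Distances to corners are taken modulo the period, so that the statement also covers
  parameters near the marked point, where \<open>frac\<close> jumps.\<close>

lemma far_line:
  assumes far: "\<And>c k. c \<in> corners \<Longrightarrow> d \<le> \<bar>q - c - real_of_int k\<bar>"
  obtains e where "e > 0"
    "\<And>x. \<bar>x - q\<bar> < e \<Longrightarrow> \<eta> x = \<eta> q + (x - q) *\<^sub>R cis (\<theta>0 + (\<Sum>c\<in>corners \<inter> {..<frac q}. \<tau> c))"
    "\<And>x c. \<bar>x - q\<bar> < e \<Longrightarrow> c \<in> corners \<Longrightarrow> d / 2 \<le> \<bar>frac x - c\<bar>"
proof -
  define p where "p = frac q"
  have p: "0 \<le> p" "p < 1" "q = p + of_int \<lfloor>q\<rfloor>"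
    unfolding p_def using frac_ge_0[of q] frac_lt_1[of q] by (simp_all add: frac_def)
  have pc: "d \<le> \<bar>p - c\<bar>" if "c \<in> corners" for c
    using far[OF that, of "\<lfloor>q\<rfloor>"] by (simp add: p_def frac_def algebra_simps)
  have "\<not> corner q"
  proof
    assume "corner q"
    then have "\<eta> q \<in> \<eta> ` corners" unfolding corners_image corner_def by simp
    then obtain c where c: "c \<in> corners" "\<eta> q = \<eta> c" by blast
    then obtain k :: int where "q = c + k" using eq_imp_int_diff by blast
    then show False using far[OF c(1), of k] d(1) by simp
  qed
  then obtain w0 e0 where e0: "e0 > 0" and w0: "\<And>u. \<bar>u - q\<bar> < e0 \<Longrightarrow> \<eta> u = \<eta> q + (u - q) *\<^sub>R w0"
    using side_local by blast
  define b where "b = min 1 (p + d)"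
  have b: "p < b" "b \<le> 1" "b \<le> p + d" using p d(1) by (auto simp: b_def)
  have nb: "c \<notin> corners" if "p \<le> c" "c < b" for c
  proof
    assume "c \<in> corners"
    from pc[OF this] show False using that b d(1) by auto
  qed
  have cb: "corners \<inter> {..<b} = corners \<inter> {..<p}"
  proof (rule set_eqI)
    show "y \<in> corners \<inter> {..<b} \<longleftrightarrow> y \<in> corners \<inter> {..<p}" for y
      using nb[of y] b(1) by (cases "y < p") auto
  qed
  \<comment> \<open>Within this step to the right both affine descriptions of \<eta> are valid;
    comparing them identifies the local direction \<open>w0\<close> with the angle sum.\<close>
  define \<delta> where "\<delta> = min (b - p) (e0 / 2)"
  have \<delta>: "\<delta> > 0" "\<delta> \<le> b - p" "\<delta> < e0" using b e0 by (auto simp: \<delta>_def)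
  have "\<eta> (p + \<delta>) = \<eta> p + (p + \<delta> - p) *\<^sub>R cis (\<theta>0 + (\<Sum>c\<in>corners \<inter> {..<p}. \<tau> c))"
    unfolding cb[symmetric] by (rule side[OF p(1) b(1,2)]) (use nb \<delta> in auto)
  moreover have "\<eta> (q + \<delta>) = \<eta> q + (q + \<delta> - q) *\<^sub>R w0" by (rule w0) (use \<delta> in simp)
  moreover have "\<eta> (p + \<delta>) = \<eta> (q + \<delta>)"
    using periodic_add_int[of \<eta> "p + \<delta>" "\<lfloor>q\<rfloor>", OF K(6)] p(3) by (metis add.commute add.left_commute)
  moreover have "\<eta> p = \<eta> q" using periodic_add_int[of \<eta> p "\<lfloor>q\<rfloor>", OF K(6)] p(3) by metis
  ultimately have "\<delta> *\<^sub>R w0 = \<delta> *\<^sub>R cis (\<theta>0 + (\<Sum>c\<in>corners \<inter> {..<p}. \<tau> c))" by simp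
  then have w0': "w0 = cis (\<theta>0 + (\<Sum>c\<in>corners \<inter> {..<p}. \<tau> c))" using \<delta>(1) by simp
  show ?thesis
  proof (rule that[of "min e0 (d / 2)"])
    show "min e0 (d / 2) > 0" using e0 d(1) by simp
    show "\<eta> x = \<eta> q + (x - q) *\<^sub>R cis (\<theta>0 + (\<Sum>c\<in>corners \<inter> {..<frac q}. \<tau> c))" if "\<bar>x - q\<bar> < min e0 (d / 2)" for x
      using w0[of x] that unfolding w0' p_def by simp
    show "d / 2 \<le> \<bar>frac x - c\<bar>" if x: "\<bar>x - q\<bar> < min e0 (d / 2)" "c \<in> corners" for x c
    proof -
      have "d \<le> \<bar>q - c - of_int \<lfloor>x\<rfloor>\<bar>" by (rule far[OF x(2)])
      also have "\<dots> \<le> \<bar>x - q\<bar> + \<bar>frac x - c\<bar>"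
        using abs_triangle_ineq4[of "frac x - c" "x - q"] by (simp add: frac_def algebra_simps)
      finally show ?thesis using x(1) by simp
    qed
  qed
qed

text \<open>Near a corner the absolute value in the correction cancels that of \<eta>, leaving a
  formula in \<open>soft_abs\<close>; elsewhere \<eta> is affine and there is no correction. These
  local formulas are glued.\<close>

lemma rounded_smooth: "smooth2 {0<..1} UNIV rounded"
proof (rule smooth2_local[OF at_within_Ioc_nontrivial open_UNIV])
  fix s q :: real assume s: "s \<in> {0<..1}"
  show "\<exists>U V. open U \<and> open V \<and> s \<in> U \<and> q \<in> V \<and> smooth2 ({0<..1} \<inter> U) V rounded"
  proof (cases "\<exists>c\<in>corners. \<exists>k::int. \<bar>q - c - k\<bar> < d")
    case True
    then obtain c and k :: int where c: "c \<in> corners" and k: "\<bar>q - c - k\<bar> < d" by blast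
    define V where "V = {c + k - d<..<c + k + d}"
    define G where "G s q = \<eta> c + ((q - c - of_int k) * cos (half_turn c)) *\<^sub>R axis c
           + (sin (half_turn c) * (width s * soft_abs ((q - c - of_int k) / width s))) *\<^sub>R (\<i> * axis c)" for s q
    have "smooth2 {0<..1} V G"
      unfolding G_def width_def
      by (intro smooth2_intros smooth2_compose1[OF soft_abs_smooth]) (use d(1) in auto)
    moreover have "G s q = rounded s q" if "s \<in> {0<..1}" "q \<in> V" for s q
      unfolding G_def
      by (rule rounded_near(1)[OF that(1) c, where k = k, symmetric]) (use that(2) in \<open>auto simp: V_def abs_le_iff\<close>)
    ultimately have "smooth2 {0<..1} V rounded" by (intro smooth2_cong[of V "{0<..1}" G rounded]) (auto simp: V_def)
    moreover have "q \<in> V" using k by (auto simp: V_def)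
    ultimately show ?thesis by (intro exI[of _ UNIV] exI[of _ V]) (auto simp: V_def)
  next
    case False
    then have "d \<le> \<bar>q - c - of_int k\<bar>" if "c \<in> corners" for c k using that not_less by blast
    then obtain e where e: "e > 0"
      "\<And>x. \<bar>x - q\<bar> < e \<Longrightarrow> \<eta> x = \<eta> q + (x - q) *\<^sub>R cis (\<theta>0 + (\<Sum>c\<in>corners \<inter> {..<frac q}. \<tau> c))"
      "\<And>x c. \<bar>x - q\<bar> < e \<Longrightarrow> c \<in> corners \<Longrightarrow> d / 2 \<le> \<bar>frac x - c\<bar>"
      by (rule far_line) (assumption, (rule that; blast))
    define V where "V = {q - e<..<q + e}"
    define G where "G s x = \<eta> q + (x - q) *\<^sub>R cis (\<theta>0 + (\<Sum>c\<in>corners \<inter> {..<frac q}. \<tau> c))" for s x :: real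
    have "smooth2 {0<..1} V G" unfolding G_def by (intro smooth2_intros)
    moreover have "G s x = rounded s x" if "s \<in> {0<..1}" "x \<in> V" for s x
    proof -
      have x: "\<bar>x - q\<bar> < e" using that(2) by (auto simp: V_def abs_less_iff)
      show ?thesis using e(2)[OF x] rounded_far(1)[OF that(1) e(3)[OF x]] by (simp add: G_def)
    qed
    ultimately have "smooth2 {0<..1} V rounded" by (intro smooth2_cong[of V "{0<..1}" G rounded]) (auto simp: V_def)
    moreover have "q \<in> V" using e(1) by (auto simp: V_def)
    ultimately show ?thesis by (intro exI[of _ UNIV] exI[of _ V]) (auto simp: V_def)
  qed
qed

lemma rounded_derivative:
  assumes s: "s \<in> {0<..1}"
  shows "\<exists>r>0. (rounded s has_vector_derivative r *\<^sub>R cis (tangent_angle s q)) (at q)"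
proof (cases "\<exists>c\<in>corners. \<exists>k::int. \<bar>q - c - k\<bar> < d")
  case True
  then obtain c and k :: int where c: "c \<in> corners" and k: "\<bar>q - c - k\<bar> < d" by blast
  define V where "V = {c + k - d<..<c + k + d}"
  define w where "w = width s"
  have w: "w > 0" using width(1)[OF s] by (simp add: w_def)
  define x where "x = q - c - of_int k"
  define t where "t = tan (half_turn c) * soft_sign (x / w)"
  define g where "g y = \<eta> c + ((y - c - of_int k) * cos (half_turn c)) *\<^sub>R axis c
         + (sin (half_turn c) * (w * soft_abs ((y - c - of_int k) / w))) *\<^sub>R (\<i> * axis c)" for y :: real
  have lin: "((\<lambda>y. y - c - of_int k) has_real_derivative 1) (at q)" by (auto intro!: derivative_eq_intros)
  have "((\<lambda>y. (y - c - of_int k) / w) has_real_derivative 1 / w) (at q)" by (rule DERIV_cdivide[OF lin])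
  from DERIV_cmult[OF DERIV_cmult[OF DERIV_chain2[OF soft_abs_deriv this]], of "sin (half_turn c)" w]
  have 1: "((\<lambda>y. sin (half_turn c) * (w * soft_abs ((y - c - of_int k) / w))) has_vector_derivative
      sin (half_turn c) * soft_sign (x / w)) (at q)"
    using w by (simp add: x_def has_real_derivative_iff_has_vector_derivative)
  have 2: "((\<lambda>y. (y - c - of_int k) * cos (half_turn c)) has_vector_derivative cos (half_turn c)) (at q)"
    using DERIV_cmult_right[OF lin, of "cos (half_turn c)"] by (simp add: has_real_derivative_iff_has_vector_derivative)
  have A: "((\<lambda>y. ((y - c - of_int k) * cos (half_turn c)) *\<^sub>R axis c) has_vector_derivative
      cos (half_turn c) *\<^sub>R axis c) (at q)"
    by (rule bounded_linear.has_vector_derivative[OF bounded_linear_scaleR_left 2])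
  have B: "((\<lambda>y. (sin (half_turn c) * (w * soft_abs ((y - c - of_int k) / w))) *\<^sub>R (\<i> * axis c)) has_vector_derivative
      (sin (half_turn c) * soft_sign (x / w)) *\<^sub>R (\<i> * axis c)) (at q)"
    by (rule bounded_linear.has_vector_derivative[OF bounded_linear_scaleR_left 1])
  have "(g has_vector_derivative 0 + cos (half_turn c) *\<^sub>R axis c + (sin (half_turn c) * soft_sign (x / w)) *\<^sub>R (\<i> * axis c)) (at q)"
    unfolding g_def[abs_def] by (rule has_vector_derivative_add[OF has_vector_derivative_add[OF has_vector_derivative_const A] B])
  then have "(g has_vector_derivative cos (half_turn c) *\<^sub>R axis c + (sin (half_turn c) * soft_sign (x / w)) *\<^sub>R (\<i> * axis c)) (at q)"
    by simp
  moreover have "g y = rounded s y" if "y \<in> V" for y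
    unfolding g_def w_def
    by (rule rounded_near(1)[OF s c, where k = k, symmetric]) (use that in \<open>auto simp: V_def abs_le_iff\<close>)
  moreover have "q \<in> V" using k by (auto simp: V_def)
  ultimately have der: "(rounded s has_vector_derivative
      cos (half_turn c) *\<^sub>R axis c + (sin (half_turn c) * soft_sign (x / w)) *\<^sub>R (\<i> * axis c)) (at q)"
    by (intro has_vector_derivative_transform_within_open[of g _ q V "rounded s"]) (auto simp: V_def)
  have r: "sqrt (1 + t\<^sup>2) > 0" by (simp add: add_pos_nonneg)
  \<comment> \<open>Polar form of the velocity relative to the axis: a slope t corresponds to the
    angle arctan t, which is how \<open>tangent_angle\<close> was built.\<close>
  have "sqrt (1 + t\<^sup>2) *\<^sub>R cis (arctan t) = 1 + \<i> * t"
    using r by (simp add: complex_eq_iff cos_arctan sin_arctan)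
  moreover have "cis (tangent_angle s q) = axis c * cis (arctan t)"
    unfolding t_def w_def by (rule rounded_near(2)[OF s c, where k = k]) (use k in \<open>auto simp: x_def\<close>)
  ultimately have S: "sqrt (1 + t\<^sup>2) *\<^sub>R cis (tangent_angle s q) = axis c * (1 + \<i> * t)"
    by (metis mult_scaleR_right)
  have "(cos (half_turn c) * sqrt (1 + t\<^sup>2)) *\<^sub>R cis (tangent_angle s q)
      = cos (half_turn c) *\<^sub>R (sqrt (1 + t\<^sup>2) *\<^sub>R cis (tangent_angle s q))" by (rule scaleR_scaleR[symmetric])
  also have "\<dots> = cos (half_turn c) *\<^sub>R axis c + (cos (half_turn c) * t) *\<^sub>R (\<i> * axis c)"
    unfolding S by (simp add: scaleR_conv_of_real algebra_simps)
  also have "cos (half_turn c) * t = sin (half_turn c) * soft_sign (x / w)"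
    using half_turn(3)[OF c] by (simp add: t_def tan_def)
  finally have R: "cos (half_turn c) *\<^sub>R axis c + (sin (half_turn c) * soft_sign (x / w)) *\<^sub>R (\<i> * axis c)
      = (cos (half_turn c) * sqrt (1 + t\<^sup>2)) *\<^sub>R cis (tangent_angle s q)" ..
  show ?thesis
    by (rule exI[of _ "cos (half_turn c) * sqrt (1 + t\<^sup>2)"], rule conjI)
      (use half_turn(3)[OF c] r der in \<open>simp_all add: R\<close>)
next
  case False
  then have "d \<le> \<bar>q - c - of_int k\<bar>" if "c \<in> corners" for c k using that not_less by blast
  then obtain e where e: "e > 0"
    "\<And>x. \<bar>x - q\<bar> < e \<Longrightarrow> \<eta> x = \<eta> q + (x - q) *\<^sub>R cis (\<theta>0 + (\<Sum>c\<in>corners \<inter> {..<frac q}. \<tau> c))"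
    "\<And>x c. \<bar>x - q\<bar> < e \<Longrightarrow> c \<in> corners \<Longrightarrow> d / 2 \<le> \<bar>frac x - c\<bar>"
    by (rule far_line) (assumption, (rule that; blast))
  have "(rounded s has_vector_derivative cis (\<theta>0 + (\<Sum>c\<in>corners \<inter> {..<frac q}. \<tau> c))) (at q)"
  proof (rule affine_has_vector_derivative[of "{q - e<..<q + e}"])
    show "rounded s x = \<eta> q + (x - q) *\<^sub>R cis (\<theta>0 + (\<Sum>c\<in>corners \<inter> {..<frac q}. \<tau> c))" if "x \<in> {q - e<..<q + e}" for x
    proof -
      have x: "\<bar>x - q\<bar> < e" using that by (auto simp: abs_less_iff)
      have "rounded s x = \<eta> x" by (rule rounded_far(1)[OF s], rule e(3)[OF x])
      then show ?thesis unfolding e(2)[OF x] .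
    qed
  qed (use e(1) in auto)
  moreover have "cis (tangent_angle s q) = cis (\<theta>0 + (\<Sum>c\<in>corners \<inter> {..<frac q}. \<tau> c))"
    by (rule rounded_far(2)[OF s], rule e(3)) (use e(1) in auto)
  ultimately show ?thesis by (intro exI[of _ 1]) simp
qed

text \<open>All corners are at least 3 * d away from 0 and 1, so the sum of the turns is constant
  near both ends of a period and continues quasi-periodically.\<close>

lemma tangent_angle_props:
  assumes s: "s \<in> {0<..1}"
  shows "continuous_on UNIV (tangent_angle s)" "mono (tangent_angle s)"
    "tangent_angle s (q + 1) = tangent_angle s q + 2 * pi"
proof -
  define B where "B x = (\<Sum>c\<in>corners. turn s c (x - c))" for x
  have w: "width s > 0" "width s \<le> d / 2" using width s by auto
  have cont: "continuous_on UNIV B"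
    unfolding B_def turn_def
    by (intro continuous_intros continuous_on_compose2[OF smooth_fun_continuous[OF smooth_fun_soft_sign, of UNIV]]) (use w in auto)
  have mono: "mono B"
    unfolding B_def by (intro monoI sum_mono turn_mono s) auto
  have 0: "B x = 0" if "x \<le> d" for x
    unfolding B_def
  proof (rule sum.neutral, rule ballI, rule turn_left[OF _ s])
    fix c assume "c \<in> corners"
    then show "x - c \<le> - width s" using d(2) w(2) that d(1) by force
  qed
  have 1: "B x = 2 * pi" if "x \<ge> 1 - d" for x
    unfolding B_def \<tau>(3)[symmetric]
  proof (rule sum.cong[OF refl], rule turn_right[OF _ s])
    fix c assume "c \<in> corners"
    then show "width s \<le> x - c" using d(3) w(2) that d(1) by force
  qed
  have eq: "tangent_angle s = (\<lambda>q. \<theta>0 + (2 * pi * \<lfloor>q\<rfloor> + B (frac q)))"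
    by (rule ext) (simp add: tangent_angle_def B_def)
  note H = quasiperiodic_extension[OF cont mono 0 1 d(1)]
  show "continuous_on UNIV (tangent_angle s)" unfolding eq by (intro continuous_on_add continuous_on_const H(1))
  show "mono (tangent_angle s)" unfolding eq using H(2) by (simp add: mono_def)
  show "tangent_angle s (q + 1) = tangent_angle s q + 2 * pi" unfolding eq using H(3)[of q] by simp
qed

lemma rounded_periodic: "rounded s (q + 1) = rounded s q"
  by (simp add: rounded_def K(6) frac_def)

section \<open>The rounded curve as a smoothing family\<close>

definition corner_window :: "real \<Rightarrow> real set" where
  "corner_window c = {c - d / 2..c + d / 2}"

lemma corner_windows:
  "c \<in> corners \<Longrightarrow> corner_window c \<subseteq> {0<..<1}"
  "c \<in> corners \<Longrightarrow> c' \<in> corners \<Longrightarrow> c \<noteq> c' \<Longrightarrow> corner_window c \<inter> corner_window c' = {}"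
proof -
  show "c \<in> corners \<Longrightarrow> corner_window c \<subseteq> {0<..<1}"
    using d(1) d(2)[of c] d(3)[of c] by (auto simp: corner_window_def)
  assume c: "c \<in> corners" "c' \<in> corners" "c \<noteq> c'"
  show "corner_window c \<inter> corner_window c' = {}"
  proof (rule ccontr)
    assume "\<not> ?thesis"
    then obtain x where "x \<in> corner_window c" "x \<in> corner_window c'" by blast
    then have "\<bar>c - c'\<bar> \<le> d" unfolding corner_window_def by (intro abs_leI) auto
    then show False using d(4)[OF c] d(1) by simp
  qed
qed

lemma eta_graph:
  assumes c: "c \<in> corners"
  shows "graph_in (\<eta> c) (axis c) (\<i> * axis c) (d / 2 * cos (half_turn c)) (d / 2 * cos (half_turn c))
           (\<lambda>x. tan (half_turn c) * \<bar>x\<bar>) = \<eta> ` corner_window c"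
  unfolding corner_window_def
proof (rule graph_in_eq_image[OF half_turn(3)[OF c]])
  fix x :: real assume x: "\<bar>x\<bar> \<le> d / 2"
  have "tan (half_turn c) * \<bar>x * cos (half_turn c)\<bar> = sin (half_turn c) * \<bar>x\<bar>"
    using half_turn(3)[OF c] by (simp add: abs_mult tan_def)
  then show "\<eta> (c + x) = \<eta> c + (x * cos (half_turn c)) *\<^sub>R axis c + (tan (half_turn c) * \<bar>x * cos (half_turn c)\<bar>) *\<^sub>R (\<i> * axis c)"
    using eta_near[OF c, of x] x d(1) by simp
qed

text \<open>The normal component at s = 1 in terms of the coordinate along the axis, which is the
  parameter distance times cos (half_turn c). As \<open>width\<close> is linear in s, the rescaled
  profile describes the curve at every s.\<close>

definition profile :: "real \<Rightarrow> real \<Rightarrow> real" where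
  "profile c x = sin (half_turn c) * (d / 2) * soft_abs (x / (d / 2 * cos (half_turn c)))"

lemma rounded_graph:
  assumes c: "c \<in> corners" and s: "s \<in> {0<..1}"
  shows "graph_in (\<eta> c) (axis c) (\<i> * axis c) (d / 2 * cos (half_turn c)) (d / 2 * cos (half_turn c))
           (\<lambda>x. s * profile c (x / s)) = rounded s ` corner_window c"
  unfolding corner_window_def
proof (rule graph_in_eq_image[OF half_turn(3)[OF c]])
  fix x :: real assume x: "\<bar>x\<bar> \<le> d / 2"
  have "s * profile c (x * cos (half_turn c) / s) = sin (half_turn c) * (width s * soft_abs (x / width s))"
    using half_turn(3)[OF c] by (simp add: profile_def width_def mult_ac)
  then show "rounded s (c + x) = \<eta> c + (x * cos (half_turn c)) *\<^sub>R axis c + (s * profile c (x * cos (half_turn c) / s)) *\<^sub>R (\<i> * axis c)"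
    using rounded_near(1)[OF s c, of x "c + x" 0] x d(1) by simp
qed

lemma profile_props:
  assumes c: "c \<in> corners"
  shows "smooth_fun (profile c)" "convex_on UNIV (profile c)"
    "x \<notin> {- (d / 2 * cos (half_turn c))..d / 2 * cos (half_turn c)} \<Longrightarrow> profile c x = tan (half_turn c) * \<bar>x\<bar>"
proof -
  define m where "m = d / 2 * cos (half_turn c)"
  define n where "n = sin (half_turn c) * (d / 2)"
  have m: "m > 0" "n > 0" using half_turn[OF c] d(1) by (auto simp: m_def n_def)
  have eq: "profile c = (\<lambda>x. n * soft_abs (x / m))" by (rule ext) (simp add: profile_def m_def n_def)
  show "smooth_fun (profile c)"
    unfolding eq by (intro smooth_funI smooth2_intros smooth2_compose1[OF soft_abs_smooth]) (use m in auto)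
  show "convex_on UNIV (profile c)"
    unfolding eq
  proof (rule convex_on_realI[where f' = "\<lambda>x. n * (soft_sign (x / m) * (1 / m))"])
    show "((\<lambda>x. n * soft_abs (x / m)) has_real_derivative n * (soft_sign (x / m) * (1 / m))) (at x)" for x
      by (intro DERIV_cmult DERIV_chain2[OF soft_abs_deriv] DERIV_cdivide DERIV_ident)
    show "n * (soft_sign (x / m) * (1 / m)) \<le> n * (soft_sign (y / m) * (1 / m))" if "x \<le> y" for x y
      using that m by (intro mult_left_mono mult_right_mono soft_sign_mono divide_right_mono) auto
  qed auto
  assume x: "x \<notin> {- (d / 2 * cos (half_turn c))..d / 2 * cos (half_turn c)}"
  have "m \<le> \<bar>x\<bar>" using x by (auto simp: m_def)
  from soft_abs_scaled[OF m(1) this] have "n * soft_abs (x / m) = n / m * \<bar>x\<bar>" using m(1) by (simp add: field_simps)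
  moreover have "n / m = tan (half_turn c)" using d(1) by (simp add: n_def m_def tan_def)
  ultimately show "profile c x = tan (half_turn c) * \<bar>x\<bar>" unfolding eq by simp
qed

lemma smoothing_family_exists: "\<exists>\<Gamma>. smoothing_family K \<eta> \<Gamma>"
proof -
  obtain \<gamma> where \<gamma>: "smooth2 {0<..1} UNIV \<gamma>" "\<And>s. s \<in> {0<..1} \<Longrightarrow> range (\<gamma> s) = range (rounded s)"
    "\<And>s. s \<in> {0<..1} \<Longrightarrow> \<gamma> s 0 = rounded s 0" "\<And>s. s \<in> {0<..1} \<Longrightarrow> \<exists>L. ccw_boundary_param L (\<gamma> s)"
    "\<And>s q. s \<in> {0<..1} \<Longrightarrow> norm (velocity (\<gamma> s) q) = curve_length (\<gamma> s)"
    by (rule constant_speed_family[where A = "{0<..1}" and \<beta> = rounded and \<theta> = tangent_angle,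
          OF at_within_Ioc_nontrivial convex_real_interval(6) rounded_smooth rounded_periodic
          rounded_derivative tangent_angle_props]) (assumption+, (rule that; blast))
  define X where "X = {D. D extreme_point_of K}"
  have X: "X = \<eta> ` corners" using corners_image by (simp add: X_def)
  have inj: "inj_on \<eta> {0..<1}" by (rule inj_on_corners)
  have c01: "corners \<subseteq> {0..<1}" by (auto simp: corners_def)
  \<comment> \<open>A smoothing family indexes its data by corner points, while the rounding indexes
    them by parameters; \<open>pos\<close> translates.\<close>
  define pos where "pos = the_inv_into corners \<eta>"
  have pos: "pos (\<eta> c) = c" if "c \<in> corners" for c
    unfolding pos_def by (rule the_inv_into_f_f[OF inj_on_subset[OF inj c01] that])
  define l where "l D = d / 2 * cos (half_turn (pos D))" for D
  define G where "G D = graph_in D (axis (pos D)) (\<i> * axis (pos D)) (l D) (l D) (\<lambda>x. tan (half_turn (pos D)) * \<bar>x\<bar>)" for D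
  define G' where "G' s D = graph_in D (axis (pos D)) (\<i> * axis (pos D)) (l D) (l D) (\<lambda>x. s * profile (pos D) (x / s))" for s D
  have G: "G (\<eta> c) = \<eta> ` corner_window c" if "c \<in> corners" for c
    unfolding G_def l_def pos[OF that] by (rule eta_graph[OF that])
  have G': "G' s (\<eta> c) = rounded s ` corner_window c" if "c \<in> corners" "s \<in> {0<..1}" for c s
    unfolding G'_def l_def pos[OF that(1)] by (rule rounded_graph[OF that])
  define W where "W = (\<Union>c\<in>corners. corner_window c)"
  have W: "W \<subseteq> {0<..<1}" using corner_windows(1) unfolding W_def by blast
  have W': "W \<subseteq> {0..<1}" by (rule order_trans[OF W]) auto
  have GW: "(\<Union>D\<in>X. G D) = \<eta> ` W" unfolding X W_def using G by (simp add: image_UN)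
  have GW': "(\<Union>D\<in>X. G' s D) = rounded s ` W" if "s \<in> {0<..1}" for s
    unfolding X W_def using G'[OF _ that] by (simp add: image_UN)
  have off: "rounded s q = \<eta> q" if s: "s \<in> {0<..1}" and q: "q \<in> {0..<1} - W" for s q
  proof (rule rounded_far(1)[OF s])
    fix c assume c: "c \<in> corners"
    have "frac q = q" using q by (simp add: frac_eq)
    moreover have "q \<notin> corner_window c" using q c by (auto simp: W_def)
    ultimately show "d / 2 \<le> \<bar>frac q - c\<bar>"
      using abs_ge_self[of "q - c"] abs_ge_minus_self[of "q - c"] by (auto simp: corner_window_def)
  qed
  have range: "range (\<gamma> s) = (frontier K - (\<Union>D\<in>X. G D)) \<union> (\<Union>D\<in>X. G' s D)" if s: "s \<in> {0<..1}" for s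
  proof -
    have "frontier K = \<eta> ` {0..<1}" using K(7) range_periodic[of \<eta>, OF K(6)] by simp
    then have "frontier K - (\<Union>D\<in>X. G D) = \<eta> ` ({0..<1} - W)"
      unfolding GW using inj_on_image_set_diff[OF inj _ W', of "{0..<1}"] by simp
    also have "\<dots> = rounded s ` ({0..<1} - W)" using off[OF s] by (intro image_cong) auto
    finally have "(frontier K - (\<Union>D\<in>X. G D)) \<union> (\<Union>D\<in>X. G' s D) = rounded s ` (({0..<1} - W) \<union> W)"
      unfolding GW'[OF s] by (simp only: image_Un)
    also have "({0..<1} - W) \<union> W = {0..<1}" using W' by blast
    also have "rounded s ` {0..<1} = range (\<gamma> s)" unfolding \<gamma>(2)[OF s] by (rule range_periodic[of "rounded s", OF rounded_periodic, symmetric])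
    finally show ?thesis ..
  qed
  have start0: "\<gamma> s 0 = \<eta> 0" if "s \<in> {0<..1}" for s
  proof -
    have "0 \<in> {0..<1} - W" using W by force
    from off[OF that this] show ?thesis using \<gamma>(3)[OF that] by simp
  qed
  have sm: "smooth_family_on {0<..1} \<gamma>"
    by (rule smooth_family_onI[OF at_within_Ioc_nontrivial convex_real_interval(6) \<gamma>(1)])
  have corner: "norm (axis (pos D)) = 1 \<and> norm (\<i> * axis (pos D)) = 1 \<and> axis (pos D) \<bullet> (\<i> * axis (pos D)) = 0 \<and>
      tan (half_turn (pos D)) > 0 \<and> l D > 0 \<and> l D > 0 \<and> G D \<subseteq> frontier K \<and> \<eta> 0 \<notin> G D \<and>
      smooth_fun (profile (pos D)) \<and> convex_on UNIV (profile (pos D)) \<and>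
      (\<forall>x. x \<notin> {- l D..l D} \<longrightarrow> profile (pos D) x = tan (half_turn (pos D)) * \<bar>x\<bar>)" if D: "D \<in> X" for D
  proof -
    obtain c where c: "c \<in> corners" "D = \<eta> c" using D X by blast
    have pD: "pos D = c" using pos[OF c(1)] c(2) by simp
    have "\<eta> 0 \<notin> \<eta> ` corner_window c"
    proof
      assume "\<eta> 0 \<in> \<eta> ` corner_window c"
      then obtain q where q: "q \<in> corner_window c" "\<eta> 0 = \<eta> q" by blast
      have "q \<in> {0<..<1}" using q(1) corner_windows(1)[OF c(1)] by blast
      then show False using inj_onD[OF inj q(2)] by auto
    qed
    moreover have "\<eta> ` corner_window c \<subseteq> frontier K" using K(8) by blast
    moreover have "axis c \<bullet> (\<i> * axis c) = 0" by (simp add: inner_complex_def)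
    moreover have "l D > 0" using half_turn(3)[OF c(1)] d(1) by (simp add: l_def pD)
    moreover have "norm (axis c) = 1" by (simp add: axis_def)
    ultimately show ?thesis
      using G[OF c(1)] half_turn(5)[OF c(1)] profile_props[OF c(1)] unfolding pD c(2)[symmetric]
      by (simp add: norm_mult l_def pD)
  qed
  have disj: "disjoint_family_on G X"
    unfolding disjoint_family_on_def
  proof (intro ballI impI)
    fix D D' assume "D \<in> X" "D' \<in> X" "D \<noteq> D'"
    then obtain c c' where c: "c \<in> corners" "D = \<eta> c" "c' \<in> corners" "D' = \<eta> c'" "c \<noteq> c'" using X by blast
    have "\<eta> ` corner_window c \<inter> \<eta> ` corner_window c' = \<eta> ` (corner_window c \<inter> corner_window c')"
      by (rule inj_on_image_Int[OF inj, symmetric]) (use corner_windows(1) c in force)+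
    then show "G D \<inter> G D' = {}" using G c corner_windows(2)[OF c(1,3,5)] by simp
  qed
  have corner': "\<forall>D. D extreme_point_of K \<longrightarrow>
      norm (axis (pos D)) = 1 \<and> norm (\<i> * axis (pos D)) = 1 \<and> axis (pos D) \<bullet> (\<i> * axis (pos D)) = 0 \<and>
      tan (half_turn (pos D)) > 0 \<and> l D > 0 \<and> l D > 0 \<and>
      graph_in D (axis (pos D)) (\<i> * axis (pos D)) (l D) (l D) (\<lambda>x. tan (half_turn (pos D)) * \<bar>x\<bar>) \<subseteq> frontier K \<and>
      \<eta> 0 \<notin> graph_in D (axis (pos D)) (\<i> * axis (pos D)) (l D) (l D) (\<lambda>x. tan (half_turn (pos D)) * \<bar>x\<bar>) \<and>
      smooth_fun (profile (pos D)) \<and> convex_on UNIV (profile (pos D)) \<and>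
      (\<forall>x. x \<notin> {- l D..l D} \<longrightarrow> profile (pos D) x = tan (half_turn (pos D)) * \<bar>x\<bar>)"
    by (intro allI impI) (rule corner[unfolded X_def G_def mem_Collect_eq])
  \<comment> \<open>The homothety may have any centre; the origin is chosen.\<close>
  define \<Gamma> where "\<Gamma> s q = 0 + (1 / curve_length (\<gamma> s)) *\<^sub>R (\<gamma> s q - 0)" for s q
  have curves: "\<forall>s\<in>{0<..1}. (\<exists>L. ccw_boundary_param L (\<gamma> s)) \<and>
      range (\<gamma> s) = (frontier K - (\<Union>D\<in>{D. D extreme_point_of K}.
          graph_in D (axis (pos D)) (\<i> * axis (pos D)) (l D) (l D) (\<lambda>x. tan (half_turn (pos D)) * \<bar>x\<bar>))) \<union>
        (\<Union>D\<in>{D. D extreme_point_of K}.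
          graph_in D (axis (pos D)) (\<i> * axis (pos D)) (l D) (l D) (\<lambda>x. s * profile (pos D) (x / s))) \<and>
      \<gamma> s 0 = \<eta> 0 \<and> (\<forall>q. norm (velocity (\<gamma> s) q) = curve_length (\<gamma> s)) \<and>
      (\<forall>q. \<Gamma> s q = 0 + (1 / curve_length (\<gamma> s)) *\<^sub>R (\<gamma> s q - 0))"
  proof (intro ballI conjI allI)
    fix s :: real and q assume s: "s \<in> {0<..1}"
    show "\<exists>L. ccw_boundary_param L (\<gamma> s)" by (rule \<gamma>(4)[OF s])
    show "range (\<gamma> s) = (frontier K - (\<Union>D\<in>{D. D extreme_point_of K}.
          graph_in D (axis (pos D)) (\<i> * axis (pos D)) (l D) (l D) (\<lambda>x. tan (half_turn (pos D)) * \<bar>x\<bar>))) \<union>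
        (\<Union>D\<in>{D. D extreme_point_of K}.
          graph_in D (axis (pos D)) (\<i> * axis (pos D)) (l D) (l D) (\<lambda>x. s * profile (pos D) (x / s)))"
      by (rule range[OF s, unfolded G_def G'_def X_def])
    show "\<gamma> s 0 = \<eta> 0" by (rule start0[OF s])
    show "norm (velocity (\<gamma> s) q) = curve_length (\<gamma> s)" by (rule \<gamma>(5)[OF s])
    show "\<Gamma> s q = 0 + (1 / curve_length (\<gamma> s)) *\<^sub>R (\<gamma> s q - 0)" by (rule \<Gamma>_def)
  qed
  have "smoothing_family K \<eta> \<Gamma>"
    unfolding smoothing_family_def
    apply (intro conjI, rule poly, rule start)
    apply (rule exI[of _ "\<lambda>D. axis (pos D)"], rule exI[of _ "\<lambda>D. \<i> * axis (pos D)"],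
        rule exI[of _ "\<lambda>D. tan (half_turn (pos D))"], rule exI[of _ l], rule exI[of _ l],
        rule exI[of _ "\<lambda>D. profile (pos D)"], rule exI[of _ \<gamma>], rule exI[of _ "0::complex"])
    apply (intro conjI, rule corner', rule disj[unfolded G_def[abs_def] X_def], rule sm, rule curves)
    done
  then show ?thesis by blast
qed

end

lemma finite_positive_lower_bound:
  fixes P :: "real set"
  assumes "finite P" "\<And>x. x \<in> P \<Longrightarrow> x > 0" shows "\<exists>m>0. \<forall>x\<in>P. m \<le> x"
  using assms by (intro exI[of _ "Min (insert 1 P)"]) auto

lemma (in marked_polygon) smoothing_family_exists: "\<exists>\<Gamma>. smoothing_family K \<eta> \<Gamma>"
proof (rule tangent_angles)
  fix \<tau> :: "real \<Rightarrow> real" and \<theta>0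
  assume *: "\<And>c. c \<in> corners \<Longrightarrow> 0 < \<tau> c" "\<And>c. c \<in> corners \<Longrightarrow> \<tau> c < pi" "(\<Sum>c\<in>corners. \<tau> c) = 2 * pi"
    "\<And>a b u. 0 \<le> a \<Longrightarrow> a < b \<Longrightarrow> b \<le> 1 \<Longrightarrow> corners \<inter> {a<..<b} = {} \<Longrightarrow> u \<in> {a..b} \<Longrightarrow>
       \<eta> u = \<eta> a + (u - a) *\<^sub>R cis (\<theta>0 + (\<Sum>c\<in>corners \<inter> {..<b}. \<tau> c))"
  \<comment> \<open>The distances of the corners to 0, to 1 and to each other; a third of a positive
    lower bound for them serves as the radius \<open>d\<close>.\<close>
  define P where "P = corners \<union> (\<lambda>c. 1 - c) ` corners \<union> (\<lambda>(c, c'). \<bar>c - c'\<bar>) ` {(c, c'). c \<in> corners \<and> c' \<in> corners \<and> c \<noteq> c'}"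
  have "finite {(c, c'). c \<in> corners \<and> c' \<in> corners \<and> c \<noteq> c'}"
    by (rule finite_subset[of _ "corners \<times> corners"]) (use finite_corners in auto)
  then have fin: "finite P" using finite_corners by (simp add: P_def)
  have pos: "x > 0" if "x \<in> P" for x using that by (auto simp: P_def corners_def)
  have "\<exists>m>0. \<forall>x\<in>P. m \<le> x" by (rule finite_positive_lower_bound[OF fin pos])
  then obtain m where m: "m > 0" "\<And>x. x \<in> P \<Longrightarrow> m \<le> x" by blast
  have "corner_rounding K \<eta> \<tau> \<theta>0 (m / 3)"
  proof
    show "3 * (m / 3) \<le> c" if "c \<in> corners" for c using m(2)[of c] that by (simp add: P_def)
    show "c \<le> 1 - 3 * (m / 3)" if "c \<in> corners" for c using m(2)[of "1 - c"] that by (auto simp: P_def)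
    show "3 * (m / 3) \<le> \<bar>c - c'\<bar>" if "c \<in> corners" "c' \<in> corners" "c \<noteq> c'" for c c'
      using m(2)[of "\<bar>c - c'\<bar>"] that by (force simp: P_def)
    show "0 < \<tau> c" "\<tau> c < pi" if "c \<in> corners" for c by (rule *(1)[OF that], rule *(2)[OF that])
    show "(\<Sum>c\<in>corners. \<tau> c) = 2 * pi" by (rule *(3))
    show "m / 3 > 0" using m(1) by simp
    show "\<eta> u = \<eta> a + (u - a) *\<^sub>R cis (\<theta>0 + (\<Sum>c\<in>corners \<inter> {..<b}. \<tau> c))"
      if "0 \<le> a" "a < b" "b \<le> 1" "corners \<inter> {a<..<b} = {}" "u \<in> {a..b}" for a b u
      by (rule *(4)[OF that])
  qed
  then show ?thesis by (rule corner_rounding.smoothing_family_exists)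
qed

section \<open>Sequences obtained by the smoothing construction\<close>

lemma ennreal_tendsto_0I:
  fixes f :: "nat \<Rightarrow> ennreal"
  assumes "\<And>e::real. e > 0 \<Longrightarrow> \<exists>N. \<forall>n\<ge>N. f n \<le> ennreal e"
  shows "f \<longlonglongrightarrow> 0"
proof (rule order_tendstoI)
  fix a :: ennreal assume "a > 0"
  then obtain e where e: "0 < e" "e < a" using dense by blast
  then obtain r where r: "e = ennreal r" "r > 0"
    by (cases e) (auto simp: top_unique ennreal_less_zero_iff)
  obtain N where "\<And>n. n \<ge> N \<Longrightarrow> f n \<le> ennreal r" using assms[OF r(2)] by blast
  then have "\<And>n. n \<ge> N \<Longrightarrow> f n < a" using e(2) unfolding r(1) by (meson le_less_trans)
  then show "\<forall>\<^sub>F n in sequentially. f n < a" unfolding eventually_sequentially by blast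
qed simp

lemma orbit_dist_le: "\<alpha> \<in> X \<Longrightarrow> \<beta> \<in> Y \<Longrightarrow> orbit_dist M X Y \<le> table_dist M \<alpha> \<beta>"
  unfolding orbit_dist_def by (rule INF_lower2, assumption, rule INF_lower)

lemma d_AB_le:
  assumes "\<alpha> \<in> X" "\<beta> \<in> Y" "\<alpha> \<in> tables_B" "\<beta> \<in> tables_B" "\<And>q. norm (\<alpha> q - \<beta> q) \<le> e"
  shows "d_AB X Y \<le> ennreal (18 * e)"
  by (rule order_trans[OF orbit_dist_le[OF assms(1,2)] table_dist_le[OF bounded_homotopy_tables_B[OF assms(3-5)]]])

lemma self_in_orbit: "\<gamma> \<in> SE2_orbit \<gamma>"
  unfolding SE2_orbit_def using id_in_SE2 by (auto intro!: exI[of _ id])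

lemma uniformly_continuous_shift:
  fixes \<eta> :: "real \<Rightarrow> complex"
  assumes \<eta>: "continuous_on UNIV \<eta>" "\<And>q. \<eta> (q + 1) = \<eta> q" and e: "e > 0"
  shows "\<exists>d>0. \<forall>t q. \<bar>t\<bar> < d \<longrightarrow> norm (\<eta> (q + t) - \<eta> q) \<le> e"
proof -
  have "uniformly_continuous_on {-1..2} \<eta>"
    by (rule compact_uniformly_continuous[OF continuous_on_subset[OF \<eta>(1)]]) auto
  then obtain d where d: "d > 0" "\<And>x y. x \<in> {-1..2} \<Longrightarrow> y \<in> {-1..2} \<Longrightarrow> dist y x < d \<Longrightarrow> dist (\<eta> y) (\<eta> x) < e"
    using e unfolding uniformly_continuous_on_def by meson
  have "norm (\<eta> (q + t) - \<eta> q) \<le> e" if t: "\<bar>t\<bar> < min d 1" for t q :: real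
  proof -
    define p where "p = frac q"
    have p: "0 \<le> p" "p < 1" by (auto simp: p_def frac_lt_1)
    have q: "q = p + of_int \<lfloor>q\<rfloor>" "q + t = (p + t) + of_int \<lfloor>q\<rfloor>" by (auto simp: p_def frac_def)
    have "\<eta> q = \<eta> p" "\<eta> (q + t) = \<eta> (p + t)"
      using periodic_add_int[of \<eta> p "\<lfloor>q\<rfloor>", OF \<eta>(2)] periodic_add_int[of \<eta> "p + t" "\<lfloor>q\<rfloor>", OF \<eta>(2)] q by metis+
    moreover have "-1 < t" "t < 1" using t by (auto simp: abs_less_iff)
    then have "dist (\<eta> (p + t)) (\<eta> p) < e" by (intro d(2)) (use p t in \<open>auto simp: dist_real_def\<close>)
    ultimately show ?thesis by (simp add: dist_norm)
  qed
  then show ?thesis using d(1) by (intro exI[of _ "min d 1"]) auto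
qed

text \<open>Moving the marked point. The winding number is read off from a polar angle, whose gain
  over any interval of length 1 is 2 * pi.\<close>

lemma polygon_param_shift:
  assumes \<eta>: "polygon_param K \<eta>"
  shows "polygon_param K (\<lambda>q. \<eta> (q + t))"
proof -
  interpret polygon K \<eta> by (rule polygon.intro[OF \<eta>])
  have body: "convex_body K" and wn: "\<And>z. z \<in> interior K \<Longrightarrow> winding_number \<eta> z = 1"
    using ccw unfolding ccw_boundary_param_def by auto
  have shift: "\<And>q. \<eta> (q + 1 + t) = \<eta> (q + t)" using K(6)[of "q + t" for q] by (simp add: add.commute add.left_commute)
  have cont: "continuous_on UNIV (\<lambda>q. \<eta> (q + t))"
    by (rule continuous_on_compose2[OF K(5)]) (auto intro!: continuous_intros)
  have "ccw_boundary_param K (\<lambda>q. \<eta> (q + t))"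
    unfolding ccw_boundary_param_def
  proof (intro conjI allI ballI body cont shift)
    show "inj_on (\<lambda>q. \<eta> (q + t)) {0..<1}"
    proof (rule inj_onI)
      fix x y :: real assume xy: "x \<in> {0..<1}" "y \<in> {0..<1}" "\<eta> (x + t) = \<eta> (y + t)"
      then obtain k :: int where "x + t = y + t + k" using eq_imp_int_diff by blast
      then have k: "x = y + k" by simp
      then have "\<bar>real_of_int k\<bar> < 1" using xy(1,2) by (auto simp: abs_less_iff)
      then have "k = 0" by linarith
      then show "x = y" using k by simp
    qed
    have "surj (\<lambda>q. q + t)" by (rule surjI[of _ "\<lambda>q. q - t"]) simp
    then have "range (\<lambda>q. \<eta> (q + t)) = range \<eta>" by (metis image_image)
    then show "range (\<lambda>q. \<eta> (q + t)) = frontier K" using K(7) by simp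
    fix z assume z: "z \<in> interior K"
    obtain a where a: "continuous_on UNIV a" "\<And>q. a (q + 1) = a q + 2 * pi"
      "\<And>q. \<eta> q - z = norm (\<eta> q - z) * cis (a q)" "\<And>q. \<eta> q \<noteq> z"
      using ccw_boundary_angle[OF ccw z] by metis
    have ca: "continuous_on UNIV (\<lambda>q. a (q + t))"
      by (rule continuous_on_compose2[OF a(1)]) (auto intro!: continuous_intros)
    have "winding_number (\<lambda>q. \<eta> (q + t)) z = of_real ((a (1 + t) - a (0 + t)) / (2 * pi))"
      by (rule winding_number_angle_lift[OF cont ca a(4) a(3)]) (use K(6)[of t] in \<open>simp add: add.commute\<close>)
    also have "a (1 + t) - a (0 + t) = 2 * pi" using a(2)[of t] by (simp add: add.commute)
    finally show "winding_number (\<lambda>q. \<eta> (q + t)) z = 1" by simp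
  qed
  moreover have "\<exists>w. norm w = 1 \<and> ((\<lambda>q. \<eta> (q + t)) has_vector_derivative w) (at q)"
    if ne: "\<not> \<eta> (q + t) extreme_point_of K" for q
  proof -
    obtain w where w: "norm w = 1" "(\<eta> has_vector_derivative w) (at (q + t))"
      using deriv[of "q + t"] ne unfolding corner_def by blast
    have "((\<lambda>q. q + t) has_vector_derivative 1) (at q)" by (auto intro!: derivative_eq_intros)
    from vector_diff_chain_at[OF this w(2)] have "((\<lambda>q. \<eta> (q + t)) has_vector_derivative w) (at q)" by (simp add: o_def)
    then show ?thesis using w(1) by blast
  qed
  ultimately show ?thesis using polytope unfolding polygon_param_def by blast
qed

text \<open>All that is kept of the construction is uniform closeness of some representatives to the
  polygon. At a marked corner there are three errors of e / 3: from the table to the family, from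
  the family to the shifted polygon, and from the shifted polygon to \<eta>.\<close>

lemma obtained_by_smoothing_near:
  assumes X: "\<And>n. X n \<in> AB" and ob: "obtained_by_smoothing E X"
  shows "\<exists>\<eta>\<in>E. \<forall>e>0. \<exists>N. \<forall>n\<ge>N. \<exists>\<alpha>\<in>X n. \<alpha> \<in> tables_B \<and> (\<forall>q. norm (\<alpha> q - \<eta> q) \<le> e)"
proof -
  obtain \<eta> K where \<eta>: "\<eta> \<in> E" "polygon_param K \<eta>" and
    cases: "if \<not> \<eta> 0 extreme_point_of K
      then \<exists>\<Gamma> s. smoothing_family K \<eta> \<Gamma> \<and> (\<forall>n. s n \<in> {0<..1}) \<and> s \<longlonglongrightarrow> 0 \<and>
             (\<lambda>n. d_AC (X n) (SE2_orbit (\<Gamma> (s n)))) \<longlonglongrightarrow> 0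
      else \<exists>\<tau> \<Gamma>. \<tau> \<longlonglongrightarrow> 0 \<and>
             (\<forall>n. \<not> \<eta> (\<tau> n) extreme_point_of K \<and>
                  smoothing_family K (\<lambda>q. \<eta> (q + \<tau> n)) (\<Gamma> n)) \<and>
             (\<lambda>n. Limsup (at_right 0) (\<lambda>s. d_AC (X n) (SE2_orbit (\<Gamma> n s)))) \<longlonglongrightarrow> 0"
    using ob unfolding obtained_by_smoothing_def by blast
  interpret polygon K \<eta> by (rule polygon.intro[OF \<eta>(2)])
  have "\<exists>N. \<forall>n\<ge>N. \<exists>\<alpha>\<in>X n. \<alpha> \<in> tables_B \<and> (\<forall>q. norm (\<alpha> q - \<eta> q) \<le> e)" if e: "e > 0" for e :: real
  proof (cases "\<eta> 0 extreme_point_of K")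
    case False
    then obtain \<Gamma> s where \<Gamma>: "smoothing_family K \<eta> \<Gamma>" and s: "\<And>n. s n \<in> {0<..1}" "s \<longlonglongrightarrow> 0"
      and lim: "(\<lambda>n. d_AC (X n) (SE2_orbit (\<Gamma> (s n)))) \<longlonglongrightarrow> 0" using cases by auto
    obtain s0 where s0: "s0 > 0" "\<And>s q. s \<in> {0<..1} \<Longrightarrow> s < s0 \<Longrightarrow> norm (\<Gamma> s q - \<eta> q) \<le> e / 2"
      using smoothing_family_C0[OF \<Gamma>, of "e / 2"] e by auto
    have "\<forall>\<^sub>F n in sequentially. s n < s0" by (rule order_tendstoD(2)[OF s(2) s0(1)])
    moreover have "\<forall>\<^sub>F n in sequentially. d_AC (X n) (SE2_orbit (\<Gamma> (s n))) < ennreal (e / 2)"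
      by (rule order_tendstoD(2)[OF lim]) (use e in simp)
    ultimately have "\<forall>\<^sub>F n in sequentially. \<exists>\<alpha>\<in>X n. \<alpha> \<in> tables_B \<and> (\<forall>q. norm (\<alpha> q - \<eta> q) \<le> e)"
    proof eventually_elim
      case (elim n)
      obtain \<alpha> where \<alpha>: "\<alpha> \<in> X n" "\<alpha> \<in> tables_B" "\<And>q. norm (\<alpha> q - \<Gamma> (s n) q) \<le> e / 2"
        using d_AC_dominates[OF X elim(2)] by blast
      have "norm (\<alpha> q - \<eta> q) \<le> e" for q
        using norm_triangle_mono[OF \<alpha>(3)[of q] s0(2)[OF s(1) elim(1), of q]] by simp
      then show ?case using \<alpha>(1,2) by blast
    qed
    then show ?thesis unfolding eventually_sequentially .
  next
    case True
    then obtain \<tau> \<Gamma> where \<tau>: "\<tau> \<longlonglongrightarrow> 0" and \<Gamma>: "\<And>n. smoothing_family K (\<lambda>q. \<eta> (q + \<tau> n)) (\<Gamma> n)"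
      and lim: "(\<lambda>n. Limsup (at_right 0) (\<lambda>s. d_AC (X n) (SE2_orbit (\<Gamma> n s)))) \<longlonglongrightarrow> 0" using cases by auto
    obtain d where d: "d > 0" "\<And>t q. \<bar>t\<bar> < d \<Longrightarrow> norm (\<eta> (q + t) - \<eta> q) \<le> e / 3"
      using uniformly_continuous_shift[OF K(5,6), of "e / 3"] e by auto
    have "\<forall>\<^sub>F n in sequentially. \<bar>\<tau> n\<bar> < d"
      by (rule order_tendstoD(2)[OF tendsto_rabs_zero[OF \<tau>] d(1)])
    moreover have "\<forall>\<^sub>F n in sequentially. Limsup (at_right 0) (\<lambda>s. d_AC (X n) (SE2_orbit (\<Gamma> n s))) < ennreal (e / 3)"
      by (rule order_tendstoD(2)[OF lim]) (use e in simp)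
    ultimately have "\<forall>\<^sub>F n in sequentially. \<exists>\<alpha>\<in>X n. \<alpha> \<in> tables_B \<and> (\<forall>q. norm (\<alpha> q - \<eta> q) \<le> e)"
    proof eventually_elim
      case (elim n)
      obtain s0 where s0: "s0 > 0" "\<And>s q. s \<in> {0<..1} \<Longrightarrow> s < s0 \<Longrightarrow> norm (\<Gamma> n s q - \<eta> (q + \<tau> n)) \<le> e / 3"
        using smoothing_family_C0[OF \<Gamma>[of n], of "e / 3"] e by auto
      have "\<forall>\<^sub>F s in at_right 0. s \<in> {0<..<min 1 s0}" by (rule eventually_at_right_real) (use s0 in simp)
      with Limsup_lessD[OF elim(2)]
      have "\<forall>\<^sub>F s in at_right 0. d_AC (X n) (SE2_orbit (\<Gamma> n s)) < ennreal (e / 3) \<and> s \<in> {0<..<min 1 s0}"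
        by (rule eventually_conj)
      \<comment> \<open>A single small \<open>s\<close> is enough; the bound on the upper limit and
        the uniform convergence hold together for all \<open>s\<close> near 0.\<close>
      then obtain s where s: "d_AC (X n) (SE2_orbit (\<Gamma> n s)) < ennreal (e / 3)" "s \<in> {0<..<min 1 s0}"
        using eventually_happens'[OF trivial_limit_at_right_real] by blast
      obtain \<alpha> where \<alpha>: "\<alpha> \<in> X n" "\<alpha> \<in> tables_B" "\<And>q. norm (\<alpha> q - \<Gamma> n s q) \<le> e / 3"
        using d_AC_dominates[OF X s(1)] by blast
      have "norm (\<alpha> q - \<eta> q) \<le> e" for q
      proof -
        have 2: "norm (\<Gamma> n s q - \<eta> (q + \<tau> n)) \<le> e / 3" by (rule s0(2)) (use s(2) in auto)
        show ?thesis
          using norm_triangle_mono[OF norm_triangle_mono[OF \<alpha>(3)[of q] 2] d(2)[OF elim(1), of q]] by simp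
      qed
      then show ?case using \<alpha>(1,2) by blast
    qed
    then show ?thesis unfolding eventually_sequentially .
  qed
  then show ?thesis using \<eta>(1) by blast
qed

text \<open>The two sequences may be close to different representatives of the polygon; the rigid
  motion between these aligns the tables. Each table is within e / 36 of the aligned polygon, so
  they are e / 18 apart, and the factor 18 returns \<open>e\<close>.\<close>

lemma smoothing_sequences_equivalent:
  assumes E: "E = SE2_orbit \<zeta>"
    and X: "\<And>n. X n \<in> AB" "obtained_by_smoothing E X" and Y: "\<And>n. Y n \<in> AB" "obtained_by_smoothing E Y"
  shows "(\<lambda>n. d_AB (X n) (Y n)) \<longlonglongrightarrow> 0"
proof (rule ennreal_tendsto_0I)
  fix e :: real assume e: "e > 0"
  obtain \<eta> where \<eta>: "\<eta> \<in> E"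
    "\<And>e. e > 0 \<Longrightarrow> \<exists>N. \<forall>n\<ge>N. \<exists>\<alpha>\<in>X n. \<alpha> \<in> tables_B \<and> (\<forall>q. norm (\<alpha> q - \<eta> q) \<le> e)"
    using obtained_by_smoothing_near[OF X] by blast
  obtain \<xi> where \<xi>: "\<xi> \<in> E"
    "\<And>e. e > 0 \<Longrightarrow> \<exists>N. \<forall>n\<ge>N. \<exists>\<alpha>\<in>Y n. \<alpha> \<in> tables_B \<and> (\<forall>q. norm (\<alpha> q - \<xi> q) \<le> e)"
    using obtained_by_smoothing_near[OF Y] by blast
  obtain g h where g: "g \<in> SE2" "\<eta> = g \<circ> \<zeta>" and h: "h \<in> SE2" "\<xi> = h \<circ> \<zeta>"
    using \<eta>(1) \<xi>(1) unfolding E SE2_orbit_def by blast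
  obtain g' where g': "g' \<in> SE2" "g' \<circ> g = id" using SE2_inverse[OF g(1)] by blast
  define k where "k = h \<circ> g'"
  have k: "k \<in> SE2" unfolding k_def by (rule SE2_comp[OF h(1) g'(1)])
  have k\<eta>: "k (\<eta> q) = \<xi> q" for q
    using fun_cong[OF g'(2), of "\<zeta> q"] by (simp add: k_def g(2) h(2))
  have e36: "e / 36 > 0" using e by simp
  obtain N where N: "\<And>n. n \<ge> N \<Longrightarrow> \<exists>\<alpha>\<in>X n. \<alpha> \<in> tables_B \<and> (\<forall>q. norm (\<alpha> q - \<eta> q) \<le> e / 36)"
    using \<eta>(2)[OF e36] by blast
  obtain N' where N': "\<And>n. n \<ge> N' \<Longrightarrow> \<exists>\<alpha>\<in>Y n. \<alpha> \<in> tables_B \<and> (\<forall>q. norm (\<alpha> q - \<xi> q) \<le> e / 36)"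
    using \<xi>(2)[OF e36] by blast
  have "d_AB (X n) (Y n) \<le> ennreal e" if n: "n \<ge> max N N'" for n
  proof -
    have nn: "n \<ge> N" "n \<ge> N'" using n by auto
    obtain \<alpha> where \<alpha>: "\<alpha> \<in> X n" "\<alpha> \<in> tables_B" "\<And>q. norm (\<alpha> q - \<eta> q) \<le> e / 36" using N[OF nn(1)] by blast
    obtain \<beta> where \<beta>: "\<beta> \<in> Y n" "\<beta> \<in> tables_B" "\<And>q. norm (\<beta> q - \<xi> q) \<le> e / 36" using N'[OF nn(2)] by blast
    obtain \<xi>' where X': "X n = SE2_orbit \<xi>'" using X(1)[of n] unfolding AB_def by blast
    have k\<alpha>: "k \<circ> \<alpha> \<in> X n" using \<alpha>(1) unfolding X' by (rule SE2_orbit_comp[OF k])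
    have close: "norm ((k \<circ> \<alpha>) q - \<beta> q) \<le> e / 18" for q
    proof -
      have 1: "norm ((k \<circ> \<alpha>) q - \<xi> q) \<le> e / 36"
        using SE2_isometry[OF k, of "\<alpha> q" "\<eta> q"] \<alpha>(3)[of q] k\<eta>[of q] by simp
      have 2: "norm (\<xi> q - \<beta> q) \<le> e / 36" using \<beta>(3)[of q] by (simp add: norm_minus_commute)
      show ?thesis using norm_triangle_mono[OF 1 2] by simp
    qed
    have "d_AB (X n) (Y n) \<le> ennreal (18 * (e / 18))"
      by (rule d_AB_le[OF k\<alpha> \<beta>(1) tables_B_SE2[OF \<alpha>(2) k] \<beta>(2) close])
    then show ?thesis by simp
  qed
  then show "\<exists>N. \<forall>n\<ge>N. d_AB (X n) (Y n) \<le> ennreal e" by blast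
qed

lemma Cauchy_and_C0:
  assumes \<beta>: "\<And>n. \<beta> n \<in> tables_B" and \<eta>: "\<eta> \<in> E"
    and lim: "\<And>e. e > 0 \<Longrightarrow> \<exists>N. \<forall>n\<ge>N. \<forall>q. norm (\<beta> n q - \<eta> q) \<le> e"
  shows "d_AB_Cauchy (\<lambda>n. SE2_orbit (\<beta> n))" "C0_tendsto (\<lambda>n. SE2_orbit (\<beta> n)) E"
proof -
  show "d_AB_Cauchy (\<lambda>n. SE2_orbit (\<beta> n))"
    unfolding d_AB_Cauchy_def
  proof (intro allI impI)
    fix e :: ennreal assume "e > 0"
    then obtain e' where e': "0 < e'" "e' < e" using dense by blast
    then obtain r where r: "e' = ennreal r" "r > 0"
      by (cases e') (auto simp: top_unique ennreal_less_zero_iff)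
    obtain N where N: "\<And>n q. n \<ge> N \<Longrightarrow> norm (\<beta> n q - \<eta> q) \<le> r / 36" using lim[of "r / 36"] r(2) by auto
    have "d_AB (SE2_orbit (\<beta> m)) (SE2_orbit (\<beta> n)) < e" if mn: "m \<ge> N" "n \<ge> N" for m n
    proof -
      have "norm (\<beta> m q - \<beta> n q) \<le> r / 18" for q
      proof -
        have "norm (\<eta> q - \<beta> n q) \<le> r / 36" using N[OF mn(2), of q] by (simp add: norm_minus_commute)
        from norm_triangle_mono[OF N[OF mn(1), of q] this] show ?thesis by simp
      qed
      then have "d_AB (SE2_orbit (\<beta> m)) (SE2_orbit (\<beta> n)) \<le> ennreal (18 * (r / 18))"
        by (intro d_AB_le[OF self_in_orbit self_in_orbit \<beta> \<beta>])
      also have "\<dots> < e" using e'(2) r(1) by simp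
      finally show ?thesis .
    qed
    then show "\<exists>N. \<forall>m\<ge>N. \<forall>n\<ge>N. d_AB (SE2_orbit (\<beta> m)) (SE2_orbit (\<beta> n)) < e" by blast
  qed
  have "(\<lambda>n. SUP q. norm (\<beta> n q - \<eta> q)) \<longlonglongrightarrow> 0"
  proof (rule LIMSEQ_I)
    fix e :: real assume e: "e > 0"
    obtain N where N: "\<And>n q. n \<ge> N \<Longrightarrow> norm (\<beta> n q - \<eta> q) \<le> e / 2" using lim[of "e / 2"] e by auto
    have "norm ((SUP q. norm (\<beta> n q - \<eta> q)) - 0) < e" if n: "n \<ge> N" for n
    proof -
      have le: "(SUP q. norm (\<beta> n q - \<eta> q)) \<le> e / 2" by (rule cSUP_least) (use N[OF n] in auto)
      have "bdd_above (range (\<lambda>q. norm (\<beta> n q - \<eta> q)))" using N[OF n] by (auto intro!: bdd_aboveI[of _ "e / 2"])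
      then have "norm (\<beta> n 0 - \<eta> 0) \<le> (SUP q. norm (\<beta> n q - \<eta> q))" by (intro cSUP_upper) auto
      then have "0 \<le> (SUP q. norm (\<beta> n q - \<eta> q))" using norm_ge_zero order_trans by blast
      then show ?thesis using le e by simp
    qed
    then show "\<exists>N. \<forall>n\<ge>N. norm ((SUP q. norm (\<beta> n q - \<eta> q)) - 0) < e" by blast
  qed
  then show "C0_tendsto (\<lambda>n. SE2_orbit (\<beta> n)) E"
    unfolding C0_tendsto_def using \<eta> \<beta> self_in_orbit by blast
qed

lemma inverse_Suc_small:
  assumes "e > 0" "c \<ge> 0" shows "\<exists>N. \<forall>n\<ge>N. c / real (Suc n) \<le> e"
proof -
  have "(\<lambda>n. c / real (Suc n)) \<longlonglongrightarrow> 0" using LIMSEQ_Suc[OF lim_const_over_n[of c]] by simp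
  from order_tendstoD(2)[OF this assms(1)] show ?thesis
    unfolding eventually_sequentially using less_imp_le by blast
qed

text \<open>Away from a corner, members of one smoothing family are bent slightly into
  \<open>tables_B\<close>. At a corner the marked point is moved by \<tau> n and a member is picked
  from the n-th family; that all later members of this family are \<open>d_AC\<close>-close to it
  follows from uniform closeness.\<close>

lemma smoothing_sequence_exists:
  assumes \<eta>: "polygon_param K \<eta>" "\<eta> \<in> E"
  shows "\<exists>X. (\<forall>n. X n \<in> AB) \<and> obtained_by_smoothing E X \<and> d_AB_Cauchy X \<and> C0_tendsto X E"
proof (cases "\<eta> 0 extreme_point_of K")
  case False
  interpret marked_polygon K \<eta>
    by (intro marked_polygon.intro polygon.intro marked_polygon_axioms.intro \<eta>(1) False)
  obtain \<Gamma> where \<Gamma>: "smoothing_family K \<eta> \<Gamma>" using smoothing_family_exists by blast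
  define s where "s n = 1 / real (Suc n)" for n
  have s: "s n \<in> {0<..1}" for n by (auto simp: s_def divide_simps)
  have s0: "s \<longlonglongrightarrow> 0" unfolding s_def using LIMSEQ_Suc[OF lim_const_over_n[of 1]] by simp
  have "\<exists>\<beta>. \<beta> \<in> tables_B \<and> bounded_homotopy tables_C (\<Gamma> (s n)) \<beta> (s n)" for n
    using tables_B_approx[OF smoothing_family_tables_C[OF \<Gamma> s], of "s n"] s[of n] by auto
  then obtain \<beta> where \<beta>: "\<And>n. \<beta> n \<in> tables_B" "\<And>n. bounded_homotopy tables_C (\<Gamma> (s n)) (\<beta> n) (s n)" by metis
  have "(\<lambda>n. d_AC (SE2_orbit (\<beta> n)) (SE2_orbit (\<Gamma> (s n)))) \<longlonglongrightarrow> 0"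
  proof (rule ennreal_tendsto_0I)
    fix e :: real assume "e > 0"
    then obtain N where N: "\<And>n. n \<ge> N \<Longrightarrow> s n \<le> e" using inverse_Suc_small[of e 1] by (auto simp: s_def)
    have "d_AC (SE2_orbit (\<beta> n)) (SE2_orbit (\<Gamma> (s n))) \<le> ennreal e" if "n \<ge> N" for n
      by (rule order_trans[OF orbit_dist_le[OF self_in_orbit self_in_orbit]
            order_trans[OF table_dist_le[OF bounded_homotopy_sym[OF \<beta>(2)]] ennreal_leI[OF N[OF that]]]])
    then show "\<exists>N. \<forall>n\<ge>N. d_AC (SE2_orbit (\<beta> n)) (SE2_orbit (\<Gamma> (s n))) \<le> ennreal e" by blast
  qed
  then have ob: "obtained_by_smoothing E (\<lambda>n. SE2_orbit (\<beta> n))"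
    unfolding obtained_by_smoothing_def using \<eta> False \<Gamma> s s0 by auto
  have lim: "\<exists>N. \<forall>n\<ge>N. \<forall>q. norm (\<beta> n q - \<eta> q) \<le> e" if e: "e > 0" for e
  proof -
    obtain s1 where s1: "s1 > 0" "\<And>s q. s \<in> {0<..1} \<Longrightarrow> s < s1 \<Longrightarrow> norm (\<Gamma> s q - \<eta> q) \<le> e / 2"
      using smoothing_family_C0[OF \<Gamma>, of "e / 2"] e by auto
    have m: "min (e / 2) (s1 / 2) > 0" using e s1 by simp
    obtain N where N: "\<And>n. n \<ge> N \<Longrightarrow> s n \<le> min (e / 2) (s1 / 2)"
      using inverse_Suc_small[OF m, of 1] by (auto simp: s_def)
    have "norm (\<beta> n q - \<eta> q) \<le> e" if "n \<ge> N" for n q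
    proof -
      have 1: "norm (\<beta> n q - \<Gamma> (s n) q) \<le> e / 2"
        using bounded_homotopy_dominates[OF \<beta>(2), of n q] N[OF that] by (simp add: norm_minus_commute)
      have 2: "norm (\<Gamma> (s n) q - \<eta> q) \<le> e / 2" by (rule s1(2)[OF s]) (use N[OF that] s1(1) in simp)
      show ?thesis using norm_triangle_mono[OF 1 2] by simp
    qed
    then show ?thesis by blast
  qed
  have cauchy: "d_AB_Cauchy (\<lambda>n. SE2_orbit (\<beta> n))" by (rule Cauchy_and_C0(1)[OF \<beta>(1) \<eta>(2)]) (rule lim)
  have c0: "C0_tendsto (\<lambda>n. SE2_orbit (\<beta> n)) E" by (rule Cauchy_and_C0(2)[OF \<beta>(1) \<eta>(2)]) (rule lim)
  have ab: "\<forall>n. SE2_orbit (\<beta> n) \<in> AB" using \<beta>(1) unfolding AB_def by blast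
  show ?thesis using ab ob cauchy c0 by (intro exI[of _ "\<lambda>n. SE2_orbit (\<beta> n)"] conjI)
next
  case True
  interpret polygon K \<eta> by (rule polygon.intro[OF \<eta>(1)])
  obtain r where r: "r > 0" "\<And>u. u \<noteq> 0 \<Longrightarrow> \<bar>u\<bar> < r \<Longrightarrow> \<not> \<eta> u extreme_point_of K"
    using corner_isolated[of 0] unfolding corner_def by auto
  \<comment> \<open>Positive and below the isolation radius of the corner at 0, so the shifted
    marked point is never a corner.\<close>
  define \<tau> where "\<tau> n = (r / 2) / real (Suc n)" for n
  have \<tau>_pos: "\<tau> n > 0" "\<tau> n < r" for n
  proof -
    show "\<tau> n > 0" using r(1) by (simp add: \<tau>_def)
    have "\<tau> n \<le> r / 2" using r(1) by (simp add: \<tau>_def divide_le_eq mult_le_cancel_left1)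
    then show "\<tau> n < r" using r(1) by simp
  qed
  have \<tau>: "\<not> \<eta> (\<tau> n) extreme_point_of K" for n by (rule r(2)) (use \<tau>_pos[of n] in auto)
  have \<tau>0: "\<tau> \<longlonglongrightarrow> 0" unfolding \<tau>_def using LIMSEQ_Suc[OF lim_const_over_n[of "r / 2"]] by simp
  have "\<exists>\<Gamma>. smoothing_family K (\<lambda>q. \<eta> (q + \<tau> n)) \<Gamma>" for n
  proof -
    interpret m: marked_polygon K "\<lambda>q. \<eta> (q + \<tau> n)"
      by (intro marked_polygon.intro polygon.intro marked_polygon_axioms.intro polygon_param_shift[OF \<eta>(1)])
        (use \<tau>[of n] in simp)
    show ?thesis by (rule m.smoothing_family_exists)
  qed
  then obtain \<Gamma> where \<Gamma>: "\<And>n. smoothing_family K (\<lambda>q. \<eta> (q + \<tau> n)) (\<Gamma> n)" by metis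
  define e where "e n = 1 / real (Suc n)" for n
  have e: "e n > 0" for n by (simp add: e_def)
  have "\<exists>s0>0. \<forall>s\<in>{0<..1}. s < s0 \<longrightarrow> (\<forall>q. norm (\<Gamma> n s q - \<eta> (q + \<tau> n)) \<le> e n)" for n
    by (rule smoothing_family_C0[OF \<Gamma> e])
  then obtain s0 where s0: "\<And>n. s0 n > 0"
    "\<And>n s q. s \<in> {0<..1} \<Longrightarrow> s < s0 n \<Longrightarrow> norm (\<Gamma> n s q - \<eta> (q + \<tau> n)) \<le> e n" by metis
  define s where "s n = min 1 (s0 n / 2)" for n
  have s: "s n \<in> {0<..1}" "s n < s0 n" for n using s0(1)[of n] by (auto simp: s_def)
  have "\<exists>\<beta>. \<beta> \<in> tables_B \<and> bounded_homotopy tables_C (\<Gamma> n (s n)) \<beta> (e n)" for n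
    using tables_B_approx[OF smoothing_family_tables_C[OF \<Gamma> s(1)] e] by metis
  then obtain \<beta> where \<beta>: "\<And>n. \<beta> n \<in> tables_B" "\<And>n. bounded_homotopy tables_C (\<Gamma> n (s n)) (\<beta> n) (e n)" by metis
  have \<beta>\<eta>: "norm (\<beta> n q - \<eta> (q + \<tau> n)) \<le> 2 * e n" for n q
  proof -
    have 1: "norm (\<beta> n q - \<Gamma> n (s n) q) \<le> e n"
      using bounded_homotopy_dominates[OF \<beta>(2), of n q] by (simp add: norm_minus_commute)
    show ?thesis using norm_triangle_mono[OF 1 s0(2)[OF s, of n q]] by simp
  qed
  obtain c where c: "c > 0" "\<And>\<alpha> \<gamma> d. \<alpha> \<in> tables_B \<Longrightarrow> \<gamma> \<in> tables_C \<Longrightarrow> d > 0 \<Longrightarrow>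
    (\<And>q. norm (\<alpha> q - \<gamma> q) \<le> d) \<Longrightarrow> bounded_homotopy tables_C \<alpha> \<gamma> (c * d)"
    by (rule bounded_homotopy_tables_C) (rule that; blast)
  \<comment> \<open>The chosen table is within 2 * e n of the shifted polygon and every member with
    t < s0 n within e n, hence the factor 3. The bound is uniform in t, as the upper limit
    requires.\<close>
  have dC: "d_AC (SE2_orbit (\<beta> n)) (SE2_orbit (\<Gamma> n t)) \<le> ennreal (c * (3 * e n))" if t: "t \<in> {0<..<min 1 (s0 n)}" for n t
  proof -
    have t': "t \<in> {0<..1}" "t < s0 n" using t by auto
    have "norm (\<beta> n q - \<Gamma> n t q) \<le> 3 * e n" for q
    proof -
      have 2: "norm (\<eta> (q + \<tau> n) - \<Gamma> n t q) \<le> e n" using s0(2)[OF t', of q] by (simp add: norm_minus_commute)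
      show ?thesis using norm_triangle_mono[OF \<beta>\<eta>[of n q] 2] by simp
    qed
    then have "bounded_homotopy tables_C (\<beta> n) (\<Gamma> n t) (c * (3 * e n))"
      using e[of n] by (intro c(2)[OF \<beta>(1) smoothing_family_tables_C[OF \<Gamma> t'(1)]]) auto
    from order_trans[OF orbit_dist_le[OF self_in_orbit self_in_orbit] table_dist_le[OF this]] show ?thesis .
  qed
  have "(\<lambda>n. Limsup (at_right 0) (\<lambda>t. d_AC (SE2_orbit (\<beta> n)) (SE2_orbit (\<Gamma> n t)))) \<longlonglongrightarrow> 0"
  proof (rule ennreal_tendsto_0I)
    fix \<epsilon> :: real assume "\<epsilon> > 0"
    then obtain N where N: "\<And>n. n \<ge> N \<Longrightarrow> c * 3 / real (Suc n) \<le> \<epsilon>" using inverse_Suc_small[of \<epsilon> "c * 3"] c(1) by auto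
    have "Limsup (at_right 0) (\<lambda>t. d_AC (SE2_orbit (\<beta> n)) (SE2_orbit (\<Gamma> n t))) \<le> ennreal \<epsilon>" if "n \<ge> N" for n
    proof (rule Limsup_bounded)
      have "\<forall>\<^sub>F t in at_right 0. t \<in> {0<..<min 1 (s0 n)}" by (rule eventually_at_right_real) (use s0 in simp)
      then show "\<forall>\<^sub>F t in at_right 0. d_AC (SE2_orbit (\<beta> n)) (SE2_orbit (\<Gamma> n t)) \<le> ennreal \<epsilon>"
      proof eventually_elim
        case (elim t)
        have "c * (3 * e n) \<le> \<epsilon>" using N[OF that] by (simp add: e_def)
        from order_trans[OF dC[OF elim] ennreal_leI[OF this]] show ?case .
      qed
    qed
    then show "\<exists>N. \<forall>n\<ge>N. Limsup (at_right 0) (\<lambda>t. d_AC (SE2_orbit (\<beta> n)) (SE2_orbit (\<Gamma> n t))) \<le> ennreal \<epsilon>" by blast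
  qed
  then have "\<exists>\<tau> \<Gamma>. \<tau> \<longlonglongrightarrow> 0 \<and> (\<forall>n. \<not> \<eta> (\<tau> n) extreme_point_of K \<and> smoothing_family K (\<lambda>q. \<eta> (q + \<tau> n)) (\<Gamma> n)) \<and>
      (\<lambda>n. Limsup (at_right 0) (\<lambda>s. d_AC (SE2_orbit (\<beta> n)) (SE2_orbit (\<Gamma> n s)))) \<longlonglongrightarrow> 0"
    using \<tau>0 \<tau> \<Gamma> by (intro exI[of _ \<tau>] exI[of _ \<Gamma>]) simp
  then have ob: "obtained_by_smoothing E (\<lambda>n. SE2_orbit (\<beta> n))"
    unfolding obtained_by_smoothing_def using \<eta> True by (intro bexI[of _ \<eta>] exI[of _ K]) simp_all
  have lim: "\<exists>N. \<forall>n\<ge>N. \<forall>q. norm (\<beta> n q - \<eta> q) \<le> \<epsilon>" if \<epsilon>: "\<epsilon> > 0" for \<epsilon>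
  proof -
    obtain d where d: "d > 0" "\<And>t q. \<bar>t\<bar> < d \<Longrightarrow> norm (\<eta> (q + t) - \<eta> q) \<le> \<epsilon> / 2"
      using uniformly_continuous_shift[OF K(5,6), of "\<epsilon> / 2"] \<epsilon> by auto
    obtain N where N: "\<And>n. n \<ge> N \<Longrightarrow> \<bar>\<tau> n\<bar> < d"
      using order_tendstoD(2)[OF tendsto_rabs_zero[OF \<tau>0] d(1)] unfolding eventually_sequentially by blast
    obtain N' where N': "\<And>n. n \<ge> N' \<Longrightarrow> 2 / real (Suc n) \<le> \<epsilon> / 2" using inverse_Suc_small[of "\<epsilon> / 2" 2] \<epsilon> by auto
    have "norm (\<beta> n q - \<eta> q) \<le> \<epsilon>" if n: "n \<ge> max N N'" for n q
    proof -
      have 1: "norm (\<beta> n q - \<eta> (q + \<tau> n)) \<le> \<epsilon> / 2"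
        by (rule order_trans[OF \<beta>\<eta>]) (use N'[of n] n in \<open>simp add: e_def\<close>)
      have 2: "norm (\<eta> (q + \<tau> n) - \<eta> q) \<le> \<epsilon> / 2" by (rule d(2), rule N) (use n in simp)
      show ?thesis using norm_triangle_mono[OF 1 2] by simp
    qed
    then show ?thesis by blast
  qed
  have cauchy: "d_AB_Cauchy (\<lambda>n. SE2_orbit (\<beta> n))" by (rule Cauchy_and_C0(1)[OF \<beta>(1) \<eta>(2)]) (rule lim)
  have c0: "C0_tendsto (\<lambda>n. SE2_orbit (\<beta> n)) E" by (rule Cauchy_and_C0(2)[OF \<beta>(1) \<eta>(2)]) (rule lim)
  have ab: "\<forall>n. SE2_orbit (\<beta> n) \<in> AB" using \<beta>(1) unfolding AB_def by blast
  show ?thesis using ab ob cauchy c0 by (intro exI[of _ "\<lambda>n. SE2_orbit (\<beta> n)"] conjI)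
qed

theorem theorem4p2:
  fixes E :: "(real \<Rightarrow> complex) set"
  assumes "E \<in> AP"
  shows "(\<exists>X. (\<forall>n. X n \<in> AB) \<and> obtained_by_smoothing E X \<and> d_AB_Cauchy X \<and> C0_tendsto X E) \<and>
         (\<forall>X Y. (\<forall>n. X n \<in> AB) \<and> obtained_by_smoothing E X \<and>
                (\<forall>n. Y n \<in> AB) \<and> obtained_by_smoothing E Y \<longrightarrow>
                (\<lambda>n. d_AB (X n) (Y n)) \<longlonglongrightarrow> 0)"
proof -
  obtain \<eta> K where \<eta>: "E = SE2_orbit \<eta>" "polygon_param K \<eta>"
    using assms unfolding AP_def tables_P_def by blast
  have "\<exists>X. (\<forall>n. X n \<in> AB) \<and> obtained_by_smoothing E X \<and> d_AB_Cauchy X \<and> C0_tendsto X E"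
    by (rule smoothing_sequence_exists[OF \<eta>(2)]) (simp add: \<eta>(1) self_in_orbit)
  then show ?thesis using smoothing_sequences_equivalent[OF \<eta>(1)] by blast
qed

end
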